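(* Let $\mathbb F$ be the completed natural filtration of a Poisson process $N$ with intensity $\lambda>0$, let $\tau$ be a random time that avoids all $\mathbb F$-stopping times, i.e. $\mathbb P(\tau=\sigma<\infty)=0$ for every $\mathbb F$-stopping time $\sigma$, and let $\mathbb G$ be the progressive enlargement of $\mathbb F$ with $\tau$. Then for every bounded $\mathbb F$-predictable process $h$ having a limit at $+\infty$, the $\mathbb G$-martingale $Y^h_t=\mathbb E(h_\tau\mid\mathcal G_t)$ satisfies $$dY^h_t=\Big(h_t-\frac{X^h_{t-}}{Z_{t-}}\Big)dM^{(\tau)}_t+\frac{1-A_{t-}}{Z_{t-}+\phi_t}\Big(\phi^h_t-\phi_t\frac{X^h_{t-}}{Z_{t-}}\Big)d\widehat M_t ,$$ where $A,Z,X^h,\phi,\phi^h,M^{(\tau)},\widehat M$ are as defined in the context.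
   Context: Setting. $(\Omega,\mathcal G,\mathbb P)$ is a probability space carrying a Poisson process $N$ with intensity $\lambda>0$; $\mathbb F=(\mathcal F_t)_{t\ge0}$ is the completed filtration generated by $N$; $M_t:=N_t-\lambda t$. A random time $\tau$ is a $[0,\infty]$-valued random variable; $A_t:=\mathbf 1_{\{\tau\le t\}}$ (with $A_{0-}:=0$). $\mathbb G=(\mathcal G_t)_{t\ge 0}$, the progressive enlargement of $\mathbb F$ with $\tau$, is the smallest right-continuous $\mathbb P$-complete filtration containing $\mathbb F$ for which $\tau$ is a stopping time. $Z_t:=\mathbb P(\tau>t\mid\mathcal F_t)$ (càdlàg version), $Z_{0-}:=1$, $Z_\infty:=\lim_{t\to\infty}Z_t$. $A^p$ (resp. $A^o$) is the dual $\mathbb F$-predictable (resp. dual $\mathbb F$-optional) projection of $A$. $\mu_t:=\mathbb E(A^p_\infty+\mathbf 1_{\{\tau=\infty\}}\mid\mathcal F_t)$ and $m_t:=\mathbb E(A^o_\infty+\mathbf 1_{\{\tau=\infty\}}\mid\mathcal F_t)$, so that $Z=\mu-A^p=m-A^o$. It is known that $Z_->0$ on $[\![0,\tau]\!]$. For a bounded $\mathbb F$-predictable process $h$ with limit $h_\infty$ at $+\infty$ (so $h_\tau=h_\infty$ on $\{\tau=\infty\}$), set $$X^h_t:=\mathbb E\Big(\int_t^\infty h_s\,dA^p_s+h_\infty Z_\infty\,\Big|\,\mathcal F_t\Big)=\mu^h_t-\int_0^th_s\,dA^p_s,\qquad \mu^h_t:=\mathbb E\Big(\int_0^\infty h_s\,dA^p_s+h_\infty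 Z_\infty\,\Big|\,\mathcal F_t\Big).$$ By the predictable representation property of $M$ in $\mathbb F$, there are $\mathbb F$-predictable processes $\phi,\phi^h,\gamma$ with $$\mu_t=1+\int_0^t\phi_s\,dM_s,\quad \mu^h_t=\mu^h_0+\int_0^t\phi^h_s\,dM_s,\quad m_t=1+\int_0^t\gamma_s\,dM_s .$$ Define the $\mathbb G$-(local) martingales stopped at $\tau$ $$M^{(\tau)}_t:=A_t-\int_0^{t\wedge\tau}\frac{dA^p_s}{Z_{s-}},\qquad \widehat M_t:=M_{t\wedge\tau}-\lambda\int_0^{t\wedge\tau}\frac{\gamma_s}{Z_{s-}}\,ds.$$ Conventions: $\int_t^s=\int_{(t,s]}$; all integrals are implicitly assumed to be well defined; integrands only matter on $[\![0,\tau]\!]$. The quotient with denominator $Z_{t-}+\phi_t$ is set to $0$ where this denominator vanishes (this set is not charged by $\widehat M$). *)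

theory Defs
  imports "HOL-Probability.Probability"
begin

text \<open>
  Processes are functions of a real time, of which only the times \<open>t \<ge> 0\<close> matter. Filtrations are
  indexed by \<open>[0, \<infinity>]\<close> (type \<^typ>\<open>ennreal\<close>), so that the library's \<^const>\<open>filtration\<close> and
  \<^const>\<open>stopping_time\<close> apply to \<open>[0, \<infinity>]\<close>-valued random times. The probability space is not assumed
  to be complete: null sets, conditional expectations and expectations refer to
  \<^term>\<open>completion M\<close>, whose \<sigma>-algebra contains all filtrations below.
\<close>

section \<open>Paths and Stieltjes integrals\<close>

definition cadlag :: "(real \<Rightarrow> real) \<Rightarrow> bool" where
  "cadlag f \<longleftrightarrow>
     (\<forall>t\<ge>0. continuous (at_right t) f) \<and> (\<forall>t>0. \<exists>l. (f \<longlongrightarrow> l) (at_left t))"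

definition left_limit :: "(real \<Rightarrow> real) \<Rightarrow> real \<Rightarrow> real" where
  "left_limit f t = Lim (at_left t) f"

definition increasing_path :: "(real \<Rightarrow> real) \<Rightarrow> bool" where
  "increasing_path f \<longleftrightarrow>
     0 \<le> f 0 \<and> mono_on {0..} f \<and> (\<forall>t\<ge>0. continuous (at_right t) f)"

text \<open>
  The measure \<open>df\<close> of an increasing path. Setting \<open>f\<close> to \<open>0\<close> before time \<open>0\<close> is the convention
  \<open>f(0-) = 0\<close>; the point \<open>0\<close> carries the mass \<open>f 0\<close>.
\<close>

definition path_measure :: "(real \<Rightarrow> real) \<Rightarrow> real measure" where
  "path_measure f = interval_measure (\<lambda>s. if s < 0 then 0 else f s)"

text \<open>
  Lebesgue-Stieltjes integral over \<open>(0, t]\<close> against a right-continuous integrator \<open>v\<close> of finite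
  variation. The value does not depend on the decomposition \<open>v = v1 - v2\<close>, and a decomposition for
  which \<open>f\<close> is integrable against both parts exists iff \<open>f\<close> is integrable against the total
  variation of \<open>v\<close>. The predicate thus also says that the integral is well defined.
\<close>

definition has_stieltjes_integral ::
    "(real \<Rightarrow> real) \<Rightarrow> (real \<Rightarrow> real) \<Rightarrow> real \<Rightarrow> real \<Rightarrow> bool" where
  "has_stieltjes_integral f v t I \<longleftrightarrow>
     (\<exists>v1 v2. mono v1 \<and> mono v2 \<and>
        (\<forall>s. continuous (at_right s) v1) \<and> (\<forall>s. continuous (at_right s) v2) \<and>
        (\<forall>s\<in>{0..t}. v s = v1 s - v2 s) \<and>
        set_integrable (interval_measure v1) {0<..t} f \<and>
        set_integrable (interval_measure v2) {0<..t} f \<and>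
        I = (LINT s:{0<..t}|interval_measure v1. f s) - (LINT s:{0<..t}|interval_measure v2. f s))"

section \<open>Poisson process and filtrations\<close>

definition poisson_process :: "'a measure \<Rightarrow> real \<Rightarrow> (real \<Rightarrow> 'a \<Rightarrow> nat) \<Rightarrow> bool" where
  "poisson_process M lam N \<longleftrightarrow>
     (\<forall>t\<ge>0. N t \<in> M \<rightarrow>\<^sub>M count_space UNIV) \<and>
     (\<forall>\<omega>\<in>space M. N 0 \<omega> = 0 \<and> mono_on {0..} (\<lambda>t. N t \<omega>) \<and> cadlag (\<lambda>t. real (N t \<omega>))) \<and>
     (\<forall>s t. 0 \<le> s \<and> s < t \<longrightarrow>
        distr M (count_space UNIV) (\<lambda>\<omega>. N t \<omega> - N s \<omega>) = measure_pmf (poisson_pmf (lam * (t - s)))) \<and>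
     (\<forall>(ts :: nat \<Rightarrow> real) n. 0 \<le> ts 0 \<and> (\<forall>i<n. ts i < ts (Suc i)) \<longrightarrow>
        prob_space.indep_vars M (\<lambda>_. count_space UNIV)
          (\<lambda>i \<omega>. N (ts (Suc i)) \<omega> - N (ts i) \<omega>) {..<n})"

definition compensated :: "real \<Rightarrow> (real \<Rightarrow> 'a \<Rightarrow> nat) \<Rightarrow> real \<Rightarrow> 'a \<Rightarrow> real" where
  "compensated lam N t \<omega> = real (N t \<omega>) - lam * t"

definition completed_filtration :: "'a measure \<Rightarrow> (real \<Rightarrow> 'a \<Rightarrow> nat) \<Rightarrow> ennreal \<Rightarrow> 'a measure" where
  "completed_filtration M N t =
     sigma (space M)
       ({N s -` B \<inter> space M |s B. 0 \<le> s \<and> ennreal s \<le> t} \<union> null_sets (completion M))"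

definition usual_filtration :: "'a measure \<Rightarrow> (ennreal \<Rightarrow> 'a measure) \<Rightarrow> bool" where
  "usual_filtration M H \<longleftrightarrow>
     filtration (space M) H \<and>
     (\<forall>t. null_sets (completion M) \<subseteq> sets (H t)) \<and>
     (\<forall>t<\<infinity>. sets (H t) = (\<Inter>s\<in>{t<..}. sets (H s)))"

text \<open>The smallest filtration is the pointwise intersection of all the candidates.\<close>

definition progressive_enlargement ::
    "'a measure \<Rightarrow> (ennreal \<Rightarrow> 'a measure) \<Rightarrow> ('a \<Rightarrow> ennreal) \<Rightarrow> ennreal \<Rightarrow> 'a measure" where
  "progressive_enlargement M F \<tau> t =
     sigma (space M)
       (\<Inter>H \<in> {H. usual_filtration M H \<and> (\<forall>s. sets (F s) \<subseteq> sets (H s)) \<and> stopping_time H \<tau>}.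
          sets (H t))"

definition avoids_stopping_times ::
    "'a measure \<Rightarrow> (ennreal \<Rightarrow> 'a measure) \<Rightarrow> ('a \<Rightarrow> ennreal) \<Rightarrow> bool" where
  "avoids_stopping_times M F \<tau> \<longleftrightarrow>
     (\<forall>\<sigma>. stopping_time F \<sigma> \<longrightarrow>
        measure (completion M) {\<omega> \<in> space M. \<tau> \<omega> = \<sigma> \<omega> \<and> \<sigma> \<omega> < \<infinity>} = 0)"

section \<open>Predictable and optional processes, dual projections\<close>

definition adapted :: "(ennreal \<Rightarrow> 'a measure) \<Rightarrow> (real \<Rightarrow> 'a \<Rightarrow> real) \<Rightarrow> bool" where
  "adapted F X \<longleftrightarrow> (\<forall>t\<ge>0. X t \<in> borel_measurable (F (ennreal t)))"

definition predictable_algebra ::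
    "'a measure \<Rightarrow> (ennreal \<Rightarrow> 'a measure) \<Rightarrow> (real \<times> 'a) measure" where
  "predictable_algebra M F =
     sigma ({0..} \<times> space M)
       ({{0} \<times> B |B. B \<in> sets (F 0)} \<union>
        {{s<..t} \<times> B |s t B. 0 \<le> s \<and> s < t \<and> B \<in> sets (F (ennreal s))})"

definition optional_algebra ::
    "'a measure \<Rightarrow> (ennreal \<Rightarrow> 'a measure) \<Rightarrow> (real \<times> 'a) measure" where
  "optional_algebra M F =
     sigma ({0..} \<times> space M)
       {{(t, \<omega>) \<in> {0..} \<times> space M. X t \<omega> \<in> B} |X B.
          adapted F X \<and> (\<forall>\<omega>\<in>space M. cadlag (\<lambda>t. X t \<omega>)) \<and> B \<in> sets borel}"

definition predictable ::
    "'a measure \<Rightarrow> (ennreal \<Rightarrow> 'a measure) \<Rightarrow> (real \<Rightarrow> 'a \<Rightarrow> real) \<Rightarrow> bool" where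
  "predictable M F X \<longleftrightarrow> (\<lambda>(t, \<omega>). X t \<omega>) \<in> borel_measurable (predictable_algebra M F)"

text \<open>
  \<open>B\<close> is the dual projection of the increasing process \<open>A\<close> on the \<sigma>-algebra \<open>S\<close> over
  \<open>[0, \<infinity>) \<times> \<Omega>\<close>: an \<open>S\<close>-measurable increasing process such that the expectations of
  \<open>\<integral>\<^bsub>[0,\<infinity>)\<^esub> H dA\<close> and \<open>\<integral>\<^bsub>[0,\<infinity>)\<^esub> H dB\<close> agree for all nonnegative \<open>S\<close>-measurable \<open>H\<close>.
\<close>

definition dual_projection ::
    "'a measure \<Rightarrow> (real \<times> 'a) measure \<Rightarrow> (real \<Rightarrow> 'a \<Rightarrow> real) \<Rightarrow> (real \<Rightarrow> 'a \<Rightarrow> real) \<Rightarrow> bool" where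
  "dual_projection M S A B \<longleftrightarrow>
     (\<lambda>(t, \<omega>). B t \<omega>) \<in> borel_measurable S \<and>
     (\<forall>\<omega>\<in>space M. increasing_path (\<lambda>t. B t \<omega>)) \<and>
     (\<forall>H :: real \<times> 'a \<Rightarrow> ennreal. H \<in> borel_measurable S \<longrightarrow>
        (\<integral>\<^sup>+\<omega>. (\<integral>\<^sup>+s\<in>{0..}. H (s, \<omega>) \<partial>path_measure (\<lambda>t. A t \<omega>)) \<partial>completion M) =
        (\<integral>\<^sup>+\<omega>. (\<integral>\<^sup>+s\<in>{0..}. H (s, \<omega>) \<partial>path_measure (\<lambda>t. B t \<omega>)) \<partial>completion M))"

abbreviation "dual_predictable_projection M F \<equiv> dual_projection M (predictable_algebra M F)"
abbreviation "dual_optional_projection M F \<equiv> dual_projection M (optional_algebra M F)"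

text \<open>\<open>X\<close> is a version with right-continuous paths and left limits of the process \<open>t \<mapsto> E(\<xi>\<^sub>t | F\<^sub>t)\<close>.\<close>

definition cadlag_cond_exp ::
    "'a measure \<Rightarrow> (ennreal \<Rightarrow> 'a measure) \<Rightarrow> (real \<Rightarrow> 'a \<Rightarrow> real) \<Rightarrow> (real \<Rightarrow> 'a \<Rightarrow> real) \<Rightarrow> bool" where
  "cadlag_cond_exp M F \<xi> X \<longleftrightarrow>
     adapted F X \<and> (\<forall>\<omega>\<in>space M. cadlag (\<lambda>t. X t \<omega>)) \<and>
     (\<forall>t\<ge>0. AE \<omega> in completion M. X t \<omega> = real_cond_exp (completion M) (F (ennreal t)) (\<xi> t) \<omega>)"

section \<open>Processes attached to a random time\<close>

definition at_infinity_value :: "(real \<Rightarrow> 'a \<Rightarrow> real) \<Rightarrow> 'a \<Rightarrow> real" where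
  "at_infinity_value X \<omega> = Lim at_top (\<lambda>t. X t \<omega>)"

definition at_random_time :: "('a \<Rightarrow> ennreal) \<Rightarrow> (real \<Rightarrow> 'a \<Rightarrow> real) \<Rightarrow> 'a \<Rightarrow> real" where
  "at_random_time \<tau> X \<omega> =
     (if \<tau> \<omega> = \<infinity> then at_infinity_value X \<omega> else X (enn2real (\<tau> \<omega>)) \<omega>)"

text \<open>The guard \<open>0 \<le> t\<close> gives \<open>A(0-) = 0\<close>, since \<^term>\<open>ennreal t = 0\<close> for negative \<open>t\<close>.\<close>

definition occurrence :: "('a \<Rightarrow> ennreal) \<Rightarrow> real \<Rightarrow> 'a \<Rightarrow> real" where
  "occurrence \<tau> t \<omega> = of_bool (0 \<le> t \<and> \<tau> \<omega> \<le> ennreal t)"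

definition stop :: "('a \<Rightarrow> ennreal) \<Rightarrow> real \<Rightarrow> 'a \<Rightarrow> real" where
  "stop \<tau> t \<omega> = enn2real (min (ennreal t) (\<tau> \<omega>))"

definition M_tau ::
    "('a \<Rightarrow> ennreal) \<Rightarrow> (real \<Rightarrow> 'a \<Rightarrow> real) \<Rightarrow> (real \<Rightarrow> 'a \<Rightarrow> real) \<Rightarrow> real \<Rightarrow> 'a \<Rightarrow> real" where
  "M_tau \<tau> Z Ap t \<omega> =
     occurrence \<tau> t \<omega> -
     (LINT s:{0<..stop \<tau> t \<omega>}|path_measure (\<lambda>u. Ap u \<omega>). 1 / left_limit (\<lambda>u. Z u \<omega>) s)"

definition M_hat ::
    "real \<Rightarrow> (real \<Rightarrow> 'a \<Rightarrow> nat) \<Rightarrow> ('a \<Rightarrow> ennreal) \<Rightarrow> (real \<Rightarrow> 'a \<Rightarrow> real) \<Rightarrow> (real \<Rightarrow> 'a \<Rightarrow> real) \<Rightarrow>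
     real \<Rightarrow> 'a \<Rightarrow> real" where
  "M_hat lam N \<tau> Z \<gamma> t \<omega> =
     compensated lam N (stop \<tau> t \<omega>) \<omega> -
     lam * (LINT s:{0<..stop \<tau> t \<omega>}|lborel. \<gamma> s \<omega> / left_limit (\<lambda>u. Z u \<omega>) s)"

end

theory Submission imports Defs begin

text \<open>
  On \<open>{t < \<tau>}\<close> the traces of the \<sigma>-algebras of \<open>G\<close> and \<open>F\<close> agree, so that \<open>Y = X / Z\<close> before \<open>\<tau>\<close>
  and \<open>Y = h\<^sub>\<tau>\<close> from \<open>\<tau>\<close> on. The theorem thus follows from the quotient rule for \<open>X / Z\<close> up to \<open>\<tau>\<close>,
  applied path by path: \<open>X\<close> and \<open>Z\<close> have finite variation, since both are driven by \<open>dN\<close>, \<open>dt\<close> and \<open>dA\<^sup>p\<close>.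

  Because \<open>\<tau>\<close> avoids stopping times, \<open>A\<^sup>p\<close> and \<open>A\<^sup>o\<close> have no atoms and \<open>N\<close> does not jump at \<open>\<tau>\<close>. Hence \<open>Z\<close> jumps
  by \<open>\<phi>\<close> as well as by \<open>\<gamma>\<close> at the jump times of \<open>N\<close>, and the compensator of \<open>N\<close> carries the identity
  \<open>\<phi> = \<gamma>\<close>, and likewise \<open>\<bar>X\<^sub>- + \<phi>h\<bar> \<le> C (Z\<^sub>- + \<phi>)\<close>, over from the jump times to almost all times. The
  second fact takes care of the zeros of the denominator \<open>Z\<^sub>- + \<phi>\<close>.
\<close>

section \<open>Stieltjes measures\<close>

text \<open>The quotient rule needs \<open>Z\<close> bounded away from 0 along a whole path up to
  \<tau>, and \<open>X\<close> contains \<open>Z\<close> at infinity, which has to be a true limit.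
  Both come from elementary maximal inequalities over finite sets of rational times, split by the
  first time at which an event occurs.

  The enlargement is an intersection over all candidate filtrations, so only an explicit candidate
  bounds it from above. Candidates are right-continuous while F is not known to be, so that
  candidate is built from F_{t+}; right-continuous paths lead back to F_t.

  The dN part of X / Z has denominator Z_- + \<phi> and the dt part Z_-, because Z = Z_- + \<phi> at
  a jump and Z = Z_- elsewhere. Once \<gamma> = \<phi>, the drift removed from N in
  \<open>M_hat\<close> has density lam (Z_- + \<phi>) / Z_-, and this factor merges both parts into
  one integral against \<open>M_hat\<close>. Where Z_- + \<phi> = 0, the bound forces X_- + \<phi>h
  = 0, so the numerator \<phi>h - \<phi> X_- / Z_- vanishes too and the value of the quotient there
  is immaterial.\<close>

definition rcmono :: "(real \<Rightarrow> real) \<Rightarrow> bool" where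
  "rcmono F \<longleftrightarrow> mono F \<and> (\<forall>s. continuous (at_right s) F)"

lemma rcmonoD: "rcmono F \<Longrightarrow> x \<le> y \<Longrightarrow> F x \<le> F y" "rcmono F \<Longrightarrow> continuous (at_right s) F"
  by (auto simp: rcmono_def mono_def)

lemma emeasure_rcmono_Ioc: "rcmono F \<Longrightarrow> a \<le> b \<Longrightarrow> emeasure (interval_measure F) {a<..b} = ennreal (F b - F a)"
  by (intro emeasure_interval_measure_Ioc) (auto dest: rcmonoD)

text \<open>The intervals (a,b] form a generating pi-system, exhausted by bounded ones, so the
  increments determine the measure. Restrictions, sums, densities and Dirac masses are all
  recognised as Stieltjes measures through this rule.\<close>

lemma interval_measure_unique:
  assumes sets: "sets \<kappa> = sets borel" and F: "rcmono F"
    and eq: "\<And>a b. a \<le> b \<Longrightarrow> emeasure \<kappa> {a<..b} = ennreal (F b - F a)"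
  shows "\<kappa> = interval_measure F"
proof (rule measure_eqI_generator_eq)
  let ?E = "range (\<lambda>(a, b). {a<..b::real})"
  let ?A = "\<lambda>i::nat. {- real i<..real i}"
  show "Int_stable ?E"
  proof (rule Int_stableI)
    fix a b assume "a \<in> ?E" "b \<in> ?E"
    then obtain p q r s where "a = {p<..q}" "b = {r<..s}" by auto
    then have "a \<inter> b = {max p r<..min q s}" by auto
    then show "a \<inter> b \<in> ?E" by (auto intro!: rev_image_eqI[where x = "(max p r, min q s)"])
  qed
  show "?E \<subseteq> Pow UNIV" by auto
  show "sets \<kappa> = sigma_sets UNIV ?E" "sets (interval_measure F) = sigma_sets UNIV ?E"
    by (simp_all add: sets borel_sigma_sets_Ioc)
  show "range ?A \<subseteq> ?E" by (auto intro!: rev_image_eqI)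
  show "(\<Union>i. ?A i) = UNIV"
  proof (safe, simp_all)
    fix x :: real
    obtain n where "\<bar>x\<bar> < real n" using reals_Archimedean2 by blast
    then show "\<exists>i. - real i < x \<and> x \<le> real i" by (intro exI[of _ n]) auto
  qed
  show "emeasure \<kappa> (?A i) \<noteq> \<infinity>" for i by (subst eq) auto
  show "emeasure \<kappa> X = emeasure (interval_measure F) X" if X: "X \<in> ?E" for X
  proof -
    obtain a b where "X = {a<..b}" using X by auto
    then show ?thesis using eq[of a b] emeasure_rcmono_Ioc[OF F, of a b] by (cases "a \<le> b") auto
  qed
qed

lemma rcmono_add: "rcmono F \<Longrightarrow> rcmono G \<Longrightarrow> rcmono (\<lambda>s. F s + G s)"
  unfolding rcmono_def mono_def by (auto intro!: add_mono continuous_intros)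

lemma rcmono_scale: "0 \<le> c \<Longrightarrow> rcmono (\<lambda>s. c * s)"
  unfolding rcmono_def mono_def by (auto intro!: mult_left_mono continuous_intros)

text \<open>\<open>F\<close> frozen outside [0,t]: the distribution function of the restriction of
  dF to (0,t].\<close>

definition clamp_path :: "real \<Rightarrow> (real \<Rightarrow> real) \<Rightarrow> real \<Rightarrow> real" where
  "clamp_path t F s = F (max 0 (min s t))"

lemma continuous_at_right_comp_min:
  fixes F :: "real \<Rightarrow> real"
  assumes "\<And>s. continuous (at_right s) F" shows "continuous (at_right s) (\<lambda>s. F (min s t))"
proof (cases "s < t")
  case True
  have "eventually (\<lambda>x. x < t) (at_right s)" using True by (rule eventually_at_rightI[of _ t, rotated]) simp_all
  then have "eventually (\<lambda>x. F (min x t) = F x) (at_right s)" by eventually_elim auto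
  then show ?thesis using assms[of s] True unfolding continuous_within
    by (subst filterlim_cong[OF refl refl]) auto
next
  case False
  have "eventually (\<lambda>x. x > s) (at_right s)" by (simp add: eventually_at_right_less)
  then have "eventually (\<lambda>x. F (min x t) = F t) (at_right s)" by eventually_elim (use False in auto)
  then show ?thesis using False unfolding continuous_within
    by (subst filterlim_cong[OF refl refl]) auto
qed

lemma continuous_at_right_comp_max:
  fixes F :: "real \<Rightarrow> real"
  assumes "\<And>s. c \<le> s \<Longrightarrow> continuous (at_right s) F" shows "continuous (at_right s) (\<lambda>s. F (max c s))"
proof (cases "c \<le> s")
  case True
  have "eventually (\<lambda>x. x > s) (at_right s)" by (simp add: eventually_at_right_less)
  then have "eventually (\<lambda>x. F (max c x) = F x) (at_right s)" by eventually_elim (use True in auto)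
  then show ?thesis using assms[of s] True unfolding continuous_within
    by (subst filterlim_cong[OF refl refl]) auto
next
  case False
  have "eventually (\<lambda>x. x < c) (at_right s)" using False by (intro eventually_at_rightI[of _ c]) simp_all
  then have "eventually (\<lambda>x. F (max c x) = F c) (at_right s)" by eventually_elim auto
  then show ?thesis using False unfolding continuous_within
    by (subst filterlim_cong[OF refl refl]) auto
qed

lemma rcmono_clamp:
  assumes "rcmono F" shows "rcmono (clamp_path t F)"
proof -
  have "continuous (at_right s) (\<lambda>s. (\<lambda>r. F (max 0 r)) (min s t))" for s
    using assms by (intro continuous_at_right_comp_min continuous_at_right_comp_max) (auto dest: rcmonoD)
  then show ?thesis
    using assms unfolding rcmono_def clamp_path_def mono_def by auto
qed

lemma interval_measure_clamp:
  assumes F: "rcmono F"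
  shows "density (interval_measure F) (indicator {0<..t}) = interval_measure (clamp_path t F)"
proof (rule interval_measure_unique[OF _ rcmono_clamp[OF F]])
  fix a b :: real assume "a \<le> b"
  have "emeasure (density (interval_measure F) (indicator {0<..t})) {a<..b}
      = emeasure (interval_measure F) ({0<..t} \<inter> {a<..b})"
    by (subst emeasure_density) (auto simp: nn_integral_indicator[symmetric] indicator_inter_arith[symmetric]
        simp del: nn_integral_indicator Int_greaterThanAtMost intro!: nn_integral_cong)
  also have "{0<..t} \<inter> {a<..b} = {max 0 a <.. min t b}" by auto
  also have "emeasure (interval_measure F) \<dots> = ennreal (clamp_path t F b - clamp_path t F a)"
  proof (cases "max 0 a \<le> min t b")
    case True
    then show ?thesis using emeasure_rcmono_Ioc[OF F True] unfolding clamp_path_def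
      by (smt (verit) max_def min_def)
  next
    case False
    then have "clamp_path t F b = clamp_path t F a"
      using \<open>a \<le> b\<close> unfolding clamp_path_def by (smt (verit) max_def min_def)
    moreover have "{max 0 a <.. min t b} = {}" using False by (intro greaterThanAtMost_empty) auto
    ultimately show ?thesis by (simp only:) simp
  qed
  finally show "emeasure (density (interval_measure F) (indicator {0<..t})) {a<..b} =
    ennreal (clamp_path t F b - clamp_path t F a)" .
qed simp

text \<open>A sum of measures as a relation, so that it can be asserted of three given Stieltjes
  measures; the equation on sets is all that integration uses.\<close>

definition sum_of_measures :: "'a measure \<Rightarrow> 'a measure \<Rightarrow> 'a measure \<Rightarrow> bool" where
  "sum_of_measures C A B \<longleftrightarrow> sets A = sets C \<and> sets B = sets C \<and>
     (\<forall>E\<in>sets C. emeasure C E = emeasure A E + emeasure B E)"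

lemma sum_of_measures_nn_integral:
  assumes "sum_of_measures C A B" "f \<in> borel_measurable C"
  shows "(\<integral>\<^sup>+x. f x \<partial>C) = (\<integral>\<^sup>+x. f x \<partial>A) + (\<integral>\<^sup>+x. f x \<partial>B)"
proof -
  have s[measurable_cong]: "sets A = sets C" "sets B = sets C"
    and sum: "\<And>E. E \<in> sets C \<Longrightarrow> emeasure C E = emeasure A E + emeasure B E"
    using assms by (auto simp: sum_of_measures_def)
  have sp: "space A = space C" "space B = space C" using s by (auto dest: sets_eq_imp_space_eq)
  show ?thesis using assms(2)
  proof (induction rule: borel_measurable_induct)
    case (cong f g)
    moreover have "nn_integral A f = nn_integral A g" "nn_integral B f = nn_integral B g" "nn_integral C f = nn_integral C g"
      using cong(3) by (auto simp: sp intro!: nn_integral_cong)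
    ultimately show ?case by simp
  next
    case (set E) then show ?case by (simp add: sum s)
  next
    case (mult u c)
    then have m: "u \<in> borel_measurable C" "u \<in> borel_measurable A" "u \<in> borel_measurable B" by (auto cong: measurable_cong_sets simp: s)
    then show ?case using mult(4) by (simp add: nn_integral_cmult distrib_left)
  next
    case (add u v)
    then have m: "u \<in> borel_measurable A" "u \<in> borel_measurable B" "v \<in> borel_measurable A" "v \<in> borel_measurable B"
      by (auto cong: measurable_cong_sets simp: s)
    then show ?case using add by (simp add: nn_integral_add ac_simps)
  next
    case (seq U)
    then have m: "U i \<in> borel_measurable A" "U i \<in> borel_measurable B" for i
      by (auto cong: measurable_cong_sets simp: s)
    have "(\<integral>\<^sup>+x. (SUP i. U i) x \<partial>C) = (SUP i. \<integral>\<^sup>+x. U i x \<partial>C)"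
      using seq by (simp add: SUP_apply nn_integral_monotone_convergence_SUP image_comp)
    also have "\<dots> = (SUP i. (\<integral>\<^sup>+x. U i x \<partial>A) + (\<integral>\<^sup>+x. U i x \<partial>B))" using seq by simp
    also have "\<dots> = (SUP i. (\<integral>\<^sup>+x. U i x \<partial>A)) + (SUP i. (\<integral>\<^sup>+x. U i x \<partial>B))"
      using seq(3) by (intro ennreal_SUP_add) (auto simp: incseq_def le_fun_def intro!: nn_integral_mono)
    also have "\<dots> = (\<integral>\<^sup>+x. (SUP i. U i) x \<partial>A) + (\<integral>\<^sup>+x. (SUP i. U i) x \<partial>B)"
      using m seq(3) by (simp add: SUP_apply nn_integral_monotone_convergence_SUP image_comp)
    finally show ?case .
  qed
qed

lemma sum_of_measures_integrable:
  fixes f :: "'a \<Rightarrow> real"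
  assumes "sum_of_measures C A B"
  shows "integrable C f \<longleftrightarrow> integrable A f \<and> integrable B f"
proof -
  have s: "sets A = sets C" "sets B = sets C" using assms by (auto simp: sum_of_measures_def)
  have m: "borel_measurable A = borel_measurable C" "borel_measurable B = borel_measurable C"
    using s by (auto cong: measurable_cong_sets)
  show ?thesis
  proof (cases "f \<in> borel_measurable C")
    case True
    then have "(\<lambda>x. ennreal (norm (f x))) \<in> borel_measurable C" by measurable
    from sum_of_measures_nn_integral[OF assms this] show ?thesis
      using True by (simp add: integrable_iff_bounded m)
  qed (auto simp: integrable_iff_bounded m)
qed

lemma sum_of_measures_integral:
  fixes f :: "'a \<Rightarrow> real"
  assumes sm: "sum_of_measures C A B" and f: "integrable C f"
  shows "(\<integral>x. f x \<partial>C) = (\<integral>x. f x \<partial>A) + (\<integral>x. f x \<partial>B)"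
proof -
  have f': "integrable A f" "integrable B f" using f sum_of_measures_integrable[OF sm] by auto
  have [measurable]: "f \<in> borel_measurable C" using f by auto
  have 1: "(\<integral>\<^sup>+x. ennreal (f x) \<partial>C) = (\<integral>\<^sup>+x. ennreal (f x) \<partial>A) + (\<integral>\<^sup>+x. ennreal (f x) \<partial>B)"
   and 2: "(\<integral>\<^sup>+x. ennreal (- f x) \<partial>C) = (\<integral>\<^sup>+x. ennreal (- f x) \<partial>A) + (\<integral>\<^sup>+x. ennreal (- f x) \<partial>B)"
    by (auto intro!: sum_of_measures_nn_integral[OF sm])
  have fin: "(\<integral>\<^sup>+x. ennreal (f x) \<partial>A) < \<infinity>" "(\<integral>\<^sup>+x. ennreal (f x) \<partial>B) < \<infinity>"
     "(\<integral>\<^sup>+x. ennreal (- f x) \<partial>A) < \<infinity>" "(\<integral>\<^sup>+x. ennreal (- f x) \<partial>B) < \<infinity>"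
    using f' by (auto simp: real_integrable_def less_top)
  show ?thesis
    using fin unfolding real_lebesgue_integral_def[OF f] real_lebesgue_integral_def[OF f'(1)] real_lebesgue_integral_def[OF f'(2)] 1 2
    by (simp add: enn2real_plus)
qed

text \<open>The sum of the two set functions is countably additive, hence a measure, and its values
  on (a,b] identify it.\<close>

lemma sum_of_interval_measures:
  assumes F: "rcmono F" and G: "rcmono G"
  shows "sum_of_measures (interval_measure (\<lambda>s. F s + G s)) (interval_measure F) (interval_measure G)"
proof -
  let ?m = "\<lambda>E. emeasure (interval_measure F) E + emeasure (interval_measure G) E"
  define C where "C = measure_of UNIV (sets borel) ?m"
  have sC: "sets C = sets borel" unfolding C_def
    by (metis sets.sets_measure_of_eq space_borel)
  have eC: "emeasure C E = ?m E" if "E \<in> sets borel" for E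
  proof -
    have "emeasure C E = ?m E"
    proof (rule emeasure_measure_of[OF C_def])
      show "sets borel \<subseteq> Pow UNIV" by auto
      show "positive (sets C) ?m" by (simp add: positive_def)
      show "countably_additive (sets C) ?m"
      proof (rule countably_additiveI)
        fix A :: "nat \<Rightarrow> real set" assume A: "range A \<subseteq> sets C" "disjoint_family A" "\<Union> (range A) \<in> sets C"
        show "(\<Sum>i. ?m (A i)) = ?m (\<Union> (range A))"
          using A by (subst suminf_add[symmetric]) (auto simp: suminf_emeasure sC)
      qed
      show "E \<in> sets C" using that sC by simp
    qed
    then show ?thesis .
  qed
  have "C = interval_measure (\<lambda>s. F s + G s)"
  proof (rule interval_measure_unique[OF sC rcmono_add[OF F G]])
    fix a b :: real assume "a \<le> b"
    then show "emeasure C {a<..b} = ennreal (F b + G b - (F a + G a))"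
      using rcmonoD(1)[OF F, of a b] rcmonoD(1)[OF G, of a b]
      by (simp add: eC emeasure_rcmono_Ioc F G flip: ennreal_plus)
  qed
  then show ?thesis using eC sC by (auto simp: sum_of_measures_def)
qed

lemma interval_measure_scale: "0 \<le> c \<Longrightarrow> interval_measure (\<lambda>s. c * s) = density lborel (\<lambda>_. ennreal c)"
  by (rule interval_measure_unique[symmetric])
     (auto simp: rcmono_scale emeasure_density_const right_diff_distrib simp flip: ennreal_mult)

lemma density_indicator_integrable:
  fixes g :: "real \<Rightarrow> real"
  assumes "sets \<kappa> = sets borel" "\<And>s. s \<notin> {0<..t} \<Longrightarrow> g s = 0"
  shows "integrable (density \<kappa> (indicator {0<..t})) g \<longleftrightarrow> integrable \<kappa> g"
    and "(\<integral>s. g s \<partial>density \<kappa> (indicator {0<..t})) = (\<integral>s. g s \<partial>\<kappa>)"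
proof -
  have g: "g = (\<lambda>s. indicator {0<..t} s *\<^sub>R g s)" using assms(2) by (auto simp: fun_eq_iff indicator_def)
  have m: "borel_measurable (density \<kappa> (indicator {0<..t})) = borel_measurable \<kappa>"
    by (auto cong: measurable_cong_sets)
  have e: "(indicator {0<..t}::real \<Rightarrow> ennreal) = (\<lambda>s. ennreal (indicator {0<..t} s))" by (simp add: ennreal_indicator)
  have [measurable]: "{0<..t} \<in> sets \<kappa>" by (simp add: assms)
  show i: "integrable (density \<kappa> (indicator {0<..t})) g \<longleftrightarrow> integrable \<kappa> g"
  proof (cases "g \<in> borel_measurable \<kappa>")
    case True then show ?thesis unfolding e by (subst integrable_density) (auto simp del: real_scaleR_def simp flip: g)
  qed (auto simp: m)
  show "(\<integral>s. g s \<partial>density \<kappa> (indicator {0<..t})) = (\<integral>s. g s \<partial>\<kappa>)"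
  proof (cases "g \<in> borel_measurable \<kappa>")
    case True then show ?thesis unfolding e by (subst integral_density) (auto simp del: real_scaleR_def simp flip: g)
  next
    case False then have "\<not> integrable \<kappa> g" by auto
    then show ?thesis using i by (simp add: not_integrable_integral_eq)
  qed
qed

text \<open>This makes the Stieltjes integral independent of the decomposition of its integrator. An
  equality of differences is written as F + G = F' + G', so that both sides are distribution
  functions of measures. Agreement on [0,t] gives equal restrictions to (0,t], and integrability
  against a sum is integrability against both summands.\<close>

lemma sum_of_measures_clamp:
  fixes g :: "real \<Rightarrow> real"
  assumes F: "rcmono F" and G: "rcmono G" "rcmono F'" "rcmono G'"
    and eq: "\<And>s. s \<in> {0..t} \<Longrightarrow> F s + G s = F' s + G' s" and t: "0 \<le> t"
    and g: "\<And>s. s \<notin> {0<..t} \<Longrightarrow> g s = 0"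
    and i: "integrable (interval_measure F) g" "integrable (interval_measure G) g"
  shows "integrable (interval_measure F') g \<and> integrable (interval_measure G') g \<and>
    (\<integral>s. g s \<partial>interval_measure F) + (\<integral>s. g s \<partial>interval_measure G) =
    (\<integral>s. g s \<partial>interval_measure F') + (\<integral>s. g s \<partial>interval_measure G')"
proof -
  note sm = sum_of_interval_measures[OF F G(1)] sum_of_interval_measures[OF G(2,3)]
  let ?C = "interval_measure (\<lambda>s. F s + G s)" and ?C' = "interval_measure (\<lambda>s. F' s + G' s)"
  have "clamp_path t (\<lambda>s. F s + G s) = clamp_path t (\<lambda>s. F' s + G' s)"
    using eq t by (auto simp: clamp_path_def fun_eq_iff)
  then have d: "density ?C (indicator {0<..t}) = density ?C' (indicator {0<..t})"
    by (simp add: interval_measure_clamp rcmono_add assms)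
  have "integrable ?C g" using i sum_of_measures_integrable[OF sm(1)] by simp
  then have C': "integrable ?C' g"
    using density_indicator_integrable(1)[of ?C t g] density_indicator_integrable(1)[of ?C' t g] g d by auto
  have "(\<integral>s. g s \<partial>?C) = (\<integral>s. g s \<partial>?C')"
    using density_indicator_integrable(2)[of ?C t g] density_indicator_integrable(2)[of ?C' t g] g d by auto
  then show ?thesis
    using sum_of_measures_integrable[OF sm(2)] C' sum_of_measures_integral[OF sm(1) \<open>integrable ?C g\<close>]
      sum_of_measures_integral[OF sm(2) C'] by simp
qed

lemma rcmono_path: "increasing_path f \<Longrightarrow> rcmono (\<lambda>s. if s < 0 then 0 else f s)"
proof -
  assume f: "increasing_path f"
  have "mono (\<lambda>s. if s < 0 then 0 else f s)"
    using \<open>increasing_path f\<close> unfolding increasing_path_def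
    by (intro monoI) (auto intro: order_trans[OF _ mono_onD[of "{0..}" f 0]] mono_onD[of "{0..}" f])
  moreover have "continuous (at_right s) (\<lambda>s. if s < 0 then 0 else f s)" for s
  proof (cases "s < 0")
    case True
    have "eventually (\<lambda>x. x < 0) (at_right s)" using True by (intro eventually_at_rightI[of _ 0]) simp_all
    then have "eventually (\<lambda>x. (if x < 0 then 0 else f x) = 0) (at_right s)" by eventually_elim auto
    then show ?thesis using True unfolding continuous_within by (subst filterlim_cong[OF refl refl]) auto
  next
    case False
    have "eventually (\<lambda>x. x > s) (at_right s)" by (simp add: eventually_at_right_less)
    then have "eventually (\<lambda>x. (if x < 0 then 0 else f x) = f x) (at_right s)" by eventually_elim (use False in auto)
    then show ?thesis using False f unfolding continuous_within increasing_path_def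
      by (subst filterlim_cong[OF refl refl]) auto
  qed
  ultimately show ?thesis by (simp add: rcmono_def)
qed

lemma sets_path_measure[simp, measurable_cong]: "sets (path_measure f) = sets borel"
  and space_path_measure[simp]: "space (path_measure f) = UNIV"
  by (simp_all add: path_measure_def)

lemma emeasure_path_measure_Ioc:
  "increasing_path f \<Longrightarrow> 0 \<le> a \<Longrightarrow> a \<le> b \<Longrightarrow> emeasure (path_measure f) {a<..b} = ennreal (f b - f a)"
  unfolding path_measure_def by (subst emeasure_rcmono_Ioc[OF rcmono_path]) auto

text \<open>[0,b] is the decreasing limit of (-1/(n+1), b], and the path is 0 before time 0; so the
  point 0 carries the mass \<open>f 0\<close>.\<close>

lemma emeasure_path_measure_Icc:
  assumes f: "increasing_path f" and b: "0 \<le> b" shows "emeasure (path_measure f) {0..b} = ennreal (f b)"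
proof -
  let ?F = "\<lambda>s. if s < 0 then 0 else f s"
  have F: "rcmono ?F" by (rule rcmono_path[OF f])
  have "(\<lambda>n. emeasure (interval_measure ?F) {- inverse (real (Suc n))<..b}) \<longlonglongrightarrow> emeasure (interval_measure ?F) (\<Inter>n. {- inverse (real (Suc n))<..b})"
  proof (rule Lim_emeasure_decseq)
    show "decseq (\<lambda>n. {- inverse (real (Suc n))<..b})"
    proof (rule decseq_SucI)
      fix n
      have "inverse (real (Suc (Suc n))) \<le> inverse (real (Suc n))" by (intro le_imp_inverse_le) auto
      then show "{- inverse (real (Suc (Suc n)))<..b} \<subseteq> {- inverse (real (Suc n))<..b}"
        by (intro subsetI) (metis greaterThanAtMost_iff le_less_trans neg_le_iff_le)
    qed
    show "emeasure (interval_measure ?F) {- inverse (real (Suc i))<..b} \<noteq> \<infinity>" for i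
      using b by (subst emeasure_rcmono_Ioc[OF F]) (auto intro: order_trans[of _ 0])
  qed auto
  also have "(\<Inter>n. {- inverse (real (Suc n))<..b}) = {0..b}"
  proof -
    have "0 \<le> x \<longleftrightarrow> (\<forall>n. - inverse (real (Suc n)) < x)" for x :: real
    proof
      assume "0 \<le> x"
      moreover have "0 < inverse (real (Suc n))" for n by simp
      ultimately show "\<forall>n. - inverse (real (Suc n)) < x" by (smt (verit))
    next
      assume x: "\<forall>n. - inverse (real (Suc n)) < x"
      show "0 \<le> x"
      proof (rule ccontr)
        assume "\<not> 0 \<le> x" then obtain n where "inverse (real (Suc n)) < - x" using reals_Archimedean[of "- x"] by auto
        with x[rule_format, of n] show False by linarith
      qed
    qed
    then show ?thesis by (auto simp del: of_nat_Suc)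
  qed
  also have "(\<lambda>n. emeasure (interval_measure ?F) {- inverse (real (Suc n))<..b}) = (\<lambda>n. ennreal (f b))"
  proof
    fix n
    have "- inverse (real (Suc n)) < 0" by simp
    then show "emeasure (interval_measure ?F) {- inverse (real (Suc n))<..b} = ennreal (f b)"
      using b by (subst emeasure_rcmono_Ioc[OF F]) (auto simp del: of_nat_Suc intro: order_trans[of _ 0])
  qed
  finally show ?thesis unfolding path_measure_def by (simp add: LIMSEQ_const_iff)
qed

lemma sigma_finite_path_measure: "increasing_path f \<Longrightarrow> sigma_finite_measure (path_measure f)"
  unfolding path_measure_def by (intro sigma_finite_interval_measure rcmonoD[OF rcmono_path])

section \<open>Counting paths\<close>

text \<open>For a right-continuous increasing path with values in the natural numbers these are the
  jump times. Strict increase from every earlier time takes the place of a left limit.\<close>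

definition jump_times :: "(real \<Rightarrow> nat) \<Rightarrow> real set" where
  "jump_times P = {s. 0 < s \<and> (\<forall>r. 0 \<le> r \<and> r < s \<longrightarrow> P r < P s)}"

lemma counting_mono: "increasing_path (\<lambda>t. real (P t)) \<Longrightarrow> 0 \<le> r \<Longrightarrow> r \<le> s \<Longrightarrow> P r \<le> P s"
  unfolding increasing_path_def by (auto dest: mono_onD[of "{0..}" _ r s])

lemma counting_right_locally_const:
  assumes P: "increasing_path (\<lambda>t. real (P t))" and s: "0 \<le> s"
  shows "\<exists>u>s. P u = P s"
proof -
  have "((\<lambda>t. real (P t)) \<longlongrightarrow> real (P s)) (at_right s)"
    using P s by (auto simp: increasing_path_def continuous_within)
  then have "eventually (\<lambda>t. dist (real (P t)) (real (P s)) < 1) (at_right s)"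
    by (auto simp: tendsto_iff)
  moreover have "eventually (\<lambda>x. x > s) (at_right s)" by (simp add: eventually_at_right_less)
  ultimately have "eventually (\<lambda>t. s < t \<and> P t = P s) (at_right s)"
    by eventually_elim (auto simp: dist_real_def)
  then show ?thesis using eventually_happens'[of "at_right s"] by (auto simp: trivial_limit_at_right_real)
qed

text \<open>Values are integers, so each interval (r,s] with 0 \<le> r < s has mass P s - P r of at
  least 1; these intervals shrink to {s}.\<close>

lemma emeasure_jump_ge_1:
  assumes P: "increasing_path (\<lambda>t. real (P t))" and s: "s \<in> jump_times P"
  shows "1 \<le> emeasure (path_measure (\<lambda>t. real (P t))) {s}"
proof -
  let ?\<kappa> = "path_measure (\<lambda>t. real (P t))"
  have s0: "0 < s" and lt: "\<And>r. 0 \<le> r \<Longrightarrow> r < s \<Longrightarrow> P r < P s" using s by (auto simp: jump_times_def)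
  let ?r = "\<lambda>n. s - s / real (Suc n)"
  have r: "0 \<le> ?r n" "?r n < s" for n using s0 by (auto simp: field_simps)
  have "(\<lambda>n. emeasure ?\<kappa> {?r n<..s}) \<longlonglongrightarrow> emeasure ?\<kappa> (\<Inter>n. {?r n<..s})"
  proof (rule Lim_emeasure_decseq)
    show "decseq (\<lambda>n. {?r n<..s})"
    proof (rule decseq_SucI)
      fix n have "s / real (Suc (Suc n)) \<le> s / real (Suc n)" using s0 by (intro divide_left_mono) auto
      then show "{?r (Suc n)<..s} \<subseteq> {?r n<..s}" by (auto simp del: of_nat_Suc)
    qed
    show "emeasure ?\<kappa> {?r n<..s} \<noteq> \<infinity>" for n
      using r[of n] by (subst emeasure_path_measure_Ioc[OF P]) auto
  qed auto
  also have "(\<Inter>n. {?r n<..s}) = {s}"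
  proof -
    have "x = s" if x: "\<And>n. ?r n < x" "x \<le> s" for x
    proof -
      have "(\<lambda>n. s - s / real (Suc n)) \<longlonglongrightarrow> s - 0"
        by (intro tendsto_diff tendsto_const LIMSEQ_Suc[OF lim_const_over_n])
      then have "s - 0 \<le> x" using x(1) by (intro LIMSEQ_le_const2[of _ _ x]) (auto intro: less_imp_le)
      then show ?thesis using x by simp
    qed
    moreover have "?r n < s" for n using r by auto
    ultimately show ?thesis by auto
  qed
  finally show ?thesis
  proof (rule LIMSEQ_le_const, intro exI allI impI)
    fix n :: nat
    have "real (P (?r n)) + 1 \<le> real (P s)" using lt[of "?r n"] r[of n] by linarith
    then have "ennreal 1 \<le> ennreal (real (P s) - real (P (?r n)))" by (intro ennreal_leI) linarith
    then show "1 \<le> emeasure ?\<kappa> {?r n<..s}"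
      using r[of n] by (subst emeasure_path_measure_Ioc[OF P]) auto
  qed
qed

text \<open>Every jump carries mass at least 1, so a finite set of jumps in (0,t] has at most P t
  elements.\<close>

lemma finite_jump_times:
  assumes P: "increasing_path (\<lambda>t. real (P t))"
  shows "finite (jump_times P \<inter> {0<..t})"
proof (cases "0 \<le> t")
  case True
  let ?\<kappa> = "path_measure (\<lambda>t. real (P t))"
  show ?thesis
  proof (rule finite_if_finite_subsets_card_bdd[THEN conjunct1])
    fix K assume K: "K \<subseteq> jump_times P \<inter> {0<..t}" "finite K"
    have "ennreal (real (card K)) = (\<Sum>s\<in>K. 1)" by (simp add: ennreal_of_nat_eq_real_of_nat)
    also have "\<dots> \<le> (\<Sum>s\<in>K. emeasure ?\<kappa> {s})" using K by (intro sum_mono emeasure_jump_ge_1[OF P]) auto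
    also have "\<dots> = emeasure ?\<kappa> K" using K by (intro emeasure_eq_sum_singleton[symmetric]) auto
    also have "\<dots> \<le> emeasure ?\<kappa> {0<..t}" using K by (intro emeasure_mono) auto
    also have "\<dots> = ennreal (real (P t) - real (P 0))" using True by (intro emeasure_path_measure_Ioc[OF P]) auto
    finally show "card K \<le> P t" by (subst (asm) ennreal_le_iff) (use counting_mono[OF P, of 0 t] True in auto)
  qed
qed auto

lemma countable_jump_times:
  assumes P: "increasing_path (\<lambda>t. real (P t))" shows "countable (jump_times P)"
proof -
  have "jump_times P = (\<Union>n. jump_times P \<inter> {0<..real n})"
  proof safe
    fix x assume "x \<in> jump_times P"
    moreover obtain n where "x < real n" using reals_Archimedean2 by blast
    ultimately show "x \<in> (\<Union>n. jump_times P \<inter> {0<..real n})" by (auto simp: jump_times_def intro!: exI[of _ n])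
  qed
  also have "countable \<dots>"
    using countable_finite[OF finite_jump_times[OF P]] by (intro countable_UN) auto
  finally show ?thesis .
qed

lemma jump_times_borel[measurable]: "increasing_path (\<lambda>t. real (P t)) \<Longrightarrow> jump_times P \<in> sets borel"
  by (rule sets.countable[OF _ countable_jump_times]) simp_all

text \<open>Around a time that is not a jump time the path is constant: to the left by the
  definition, to the right by right-continuity and integer values. Hence countably many intervals
  with rational end points and zero mass cover these times.\<close>

lemma emeasure_off_jump_times:
  assumes P: "increasing_path (\<lambda>t. real (P t))"
  shows "{0<..} - jump_times P \<in> null_sets (path_measure (\<lambda>t. real (P t)))"
proof -
  let ?I = "{(p, q). p \<in> \<rat> \<and> q \<in> \<rat> \<and> 0 \<le> p \<and> p \<le> q \<and> P p = P q}"
  let ?U = "\<Union>(p, q)\<in>?I. {p<..q}"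
  have "countable ?I" by (rule countable_subset[of _ "\<rat> \<times> \<rat>"]) (auto simp: countable_rat)
  then have "?U \<in> null_sets (path_measure (\<lambda>t. real (P t)))"
    by (intro null_sets_UN') (auto intro!: null_setsI simp: emeasure_path_measure_Ioc[OF P])
  moreover have "{0<..} - jump_times P \<subseteq> ?U"
  proof
    fix s assume s: "s \<in> {0<..} - jump_times P"
    then obtain r where r: "0 \<le> r" "r < s" "\<not> P r < P s" by (auto simp: jump_times_def)
    then have "P r = P s" using counting_mono[OF P, of r s] by auto
    obtain u where u: "s < u" "P u = P s" using counting_right_locally_const[OF P, of s] s by auto
    obtain p where p: "p \<in> \<rat>" "r < p" "p < s" using Rats_dense_in_real[OF r(2)] by auto
    obtain q where q: "q \<in> \<rat>" "s < q" "q < u" using Rats_dense_in_real[OF u(1)] by auto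
    have "P p = P s" using counting_mono[OF P, of r p] counting_mono[OF P, of p s] r p \<open>P r = P s\<close> by auto
    moreover have "P q = P s" using counting_mono[OF P, of s q] counting_mono[OF P, of q u] u s q by auto
    ultimately show "s \<in> ?U" using p q r by (intro UN_I[of "(p, q)"]) auto
  qed
  ultimately show ?thesis using jump_times_borel[OF P] by (auto intro: null_sets_subset)
qed

lemma AE_jump_times:
  assumes P: "increasing_path (\<lambda>t. real (P t))"
  shows "AE s in path_measure (\<lambda>t. real (P t)). 0 < s \<longrightarrow> s \<in> jump_times P"
  by (rule AE_I'[OF emeasure_off_jump_times[OF P]]) auto

lemma emeasure_path_singleton_finite:
  "increasing_path f \<Longrightarrow> 0 \<le> s \<Longrightarrow> emeasure (path_measure f) {s} < \<infinity>"
  by (rule le_less_trans[OF emeasure_mono[of "{s}" "{0..s}"]]) (auto simp: emeasure_path_measure_Icc)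

text \<open>On (0,t] the measure is concentrated on finitely many points of finite mass.\<close>

lemma set_integrable_counting:
  fixes f :: "real \<Rightarrow> real"
  assumes P: "increasing_path (\<lambda>t. real (P t))" and f: "set_borel_measurable borel {0<..t} f"
  shows "set_integrable (path_measure (\<lambda>t. real (P t))) {0<..t} f"
proof -
  let ?\<kappa> = "path_measure (\<lambda>t. real (P t))" and ?J = "jump_times P \<inter> {0<..t}"
  let ?g = "\<lambda>s. indicator {0<..t} s *\<^sub>R f s"
  have fin: "finite ?J" by (rule finite_jump_times[OF P])
  have g[measurable]: "?g \<in> borel_measurable borel" using f by (simp add: set_borel_measurable_def)
  have "(\<integral>\<^sup>+s. norm (?g s) \<partial>?\<kappa>) = (\<integral>\<^sup>+s. ennreal (norm (?g s)) * indicator ?J s \<partial>?\<kappa>)"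
    using AE_jump_times[OF P] by (intro nn_integral_cong_AE) (auto elim!: eventually_mono simp: indicator_def)
  also have "\<dots> = (\<Sum>s\<in>?J. ennreal (norm (?g s)) * emeasure ?\<kappa> {s})"
    using fin by (intro nn_integral_indicator_finite) auto
  also have "\<dots> < \<infinity>"
  proof -
    have "ennreal (norm (?g s)) * emeasure ?\<kappa> {s} < top" if "s \<in> ?J" for s
      using emeasure_path_singleton_finite[OF P, of s] that by (intro ennreal_mult_less_top[THEN iffD2]) auto
    then have "(\<Sum>s\<in>?J. ennreal (norm (?g s)) * emeasure ?\<kappa> {s}) \<noteq> top"
      using fin by (metis (no_types, lifting) ennreal_sum_eq_top less_irrefl)
    then show ?thesis by (simp add: less_top)
  qed
  finally show ?thesis unfolding set_integrable_def
    by (intro integrableI_bounded) (use g in \<open>simp_all cong: measurable_cong_sets\<close>)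
qed

text \<open>The definition supplies some decomposition v1 - v2 of P - lam s. Rearranged, v2 + P = v1
  + lam s. The left side integrates f, by assumption for v2 and because P is a counting path; so the
  right side does as well, which gives integrability against ds and the value of the
  integral.\<close>

lemma has_stieltjes_integral_compensated:
  assumes P: "increasing_path (\<lambda>t. real (P t))" and lam: "0 < lam" and t: "0 \<le> t"
    and I: "has_stieltjes_integral f (\<lambda>s. real (P s) - lam * s) t I"
  shows "set_integrable lborel {0<..t} f"
    and "set_integrable (path_measure (\<lambda>t. real (P t))) {0<..t} f"
    and "I = (LINT s:{0<..t}|path_measure (\<lambda>t. real (P t)). f s) - lam * (LINT s:{0<..t}|lborel. f s)"
proof -
  obtain v1 v2 where v: "rcmono v1" "rcmono v2"
     "\<And>s. s \<in> {0..t} \<Longrightarrow> real (P s) - lam * s = v1 s - v2 s"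
     "set_integrable (interval_measure v1) {0<..t} f" "set_integrable (interval_measure v2) {0<..t} f"
     "I = (LINT s:{0<..t}|interval_measure v1. f s) - (LINT s:{0<..t}|interval_measure v2. f s)"
    using I unfolding has_stieltjes_integral_def rcmono_def by auto
  let ?g = "\<lambda>s. indicator {0<..t} s *\<^sub>R f s"
  let ?P = "\<lambda>s. if s < 0 then 0 else real (P s)"
  have g: "?g s = 0" if "s \<notin> {0<..t}" for s using that by auto
  have i: "integrable (interval_measure v1) ?g" "integrable (interval_measure v2) ?g"
    using v by (auto simp: set_integrable_def)
  have gb: "?g \<in> borel_measurable borel"
    using i(1) by (auto dest!: borel_measurable_integrable cong: measurable_cong_sets)
  show N: "set_integrable (path_measure (\<lambda>t. real (P t))) {0<..t} f"
    using gb by (intro set_integrable_counting[OF P]) (simp add: set_borel_measurable_def)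
  then have iP: "integrable (interval_measure ?P) ?g" by (simp add: set_integrable_def path_measure_def)
  have eq: "v2 s + ?P s = v1 s + lam * s" if "s \<in> {0..t}" for s using v(3)[OF that] that by auto
  have L: "rcmono (\<lambda>s. lam * s)" using lam by (intro rcmono_scale) auto
  note * = sum_of_measures_clamp[OF v(2) rcmono_path[OF P] v(1) L eq t g i(2) iP]
  have l: "integrable (density lborel (\<lambda>_. ennreal lam)) ?g"
    using * lam by (simp add: interval_measure_scale)
  then have "integrable lborel (\<lambda>s. lam *\<^sub>R ?g s)"
    using gb lam by (subst (asm) integrable_density) auto
  then have "integrable lborel (\<lambda>s. inverse lam *\<^sub>R (lam *\<^sub>R ?g s))"
    by (rule integrable_scaleR_right)
  moreover have "(\<lambda>s. inverse lam *\<^sub>R (lam *\<^sub>R ?g s)) = ?g" using lam by (auto simp: fun_eq_iff)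
  ultimately show l': "set_integrable lborel {0<..t} f" unfolding set_integrable_def by (simp only:)
  have "(\<integral>s. ?g s \<partial>density lborel (\<lambda>_. ennreal lam)) = lam * (\<integral>s. ?g s \<partial>lborel)"
    using gb lam by (subst integral_density) auto
  then show "I = (LINT s:{0<..t}|path_measure (\<lambda>t. real (P t)). f s) - lam * (LINT s:{0<..t}|lborel. f s)"
    using * lam unfolding v(6) set_lebesgue_integral_def path_measure_def by (simp add: interval_measure_scale)
qed

section \<open>Pathwise calculus\<close>

lemma set_integrable_Ioc_subset:
  fixes f :: "real \<Rightarrow> real"
  assumes "set_integrable \<nu> {a<..b} f" "sets \<nu> = sets borel" "a \<le> c" "d \<le> b"
  shows "set_integrable \<nu> {c<..d} f"
proof (rule set_integrable_subset[OF assms(1)])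
  show "{c<..d} \<subseteq> {a<..b}" using assms(3,4) by (intro subsetI) simp
qed (simp add: assms(2))

lemma set_integral_cong_AE_on:
  fixes f g :: "'a \<Rightarrow> real"
  assumes f: "set_integrable \<nu> S f" and g: "(\<lambda>s. indicator S s *\<^sub>R g s) \<in> borel_measurable \<nu>"
    and eq: "AE s in \<nu>. s \<in> S \<longrightarrow> f s = g s"
  shows "set_integrable \<nu> S g" and "(LINT s:S|\<nu>. f s) = (LINT s:S|\<nu>. g s)"
proof -
  have ae: "AE s in \<nu>. indicator S s *\<^sub>R f s = indicator S s *\<^sub>R g s"
    using eq by eventually_elim (auto simp: indicator_def)
  show "set_integrable \<nu> S g" using f g ae unfolding set_integrable_def by (rule integrable_cong_AE_imp)
  show "(LINT s:S|\<nu>. f s) = (LINT s:S|\<nu>. g s)" unfolding set_lebesgue_integral_def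
    using f g ae by (intro integral_cong_AE) (auto simp: set_integrable_def)
qed

text \<open>Dominated convergence with bound |f| on A: every point is eventually treated by
  \<open>B n\<close> as it is by \<open>C\<close>.\<close>

lemma tendsto_set_integral_shrink:
  fixes f :: "real \<Rightarrow> real" and B :: "nat \<Rightarrow> real set"
  assumes \<kappa>: "sets \<kappa> = sets borel" and f: "set_integrable \<kappa> A f"
    and B: "\<And>n. B n \<in> sets borel" "\<And>n. B n \<subseteq> A" "C \<in> sets borel" "C \<subseteq> A"
    and lim: "\<And>s. eventually (\<lambda>n. s \<in> B n \<longleftrightarrow> s \<in> C) sequentially"
  shows "(\<lambda>n. LINT s:B n|\<kappa>. f s) \<longlonglongrightarrow> (LINT s:C|\<kappa>. f s)"
  unfolding set_lebesgue_integral_def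
proof (rule integral_dominated_convergence)
  have i: "set_integrable \<kappa> (B n) f" "set_integrable \<kappa> C f" for n
    using set_integrable_subset[OF f, of "B n"] set_integrable_subset[OF f, of C] B \<kappa> by simp_all
  then show "(\<lambda>s. indicator C s *\<^sub>R f s) \<in> borel_measurable \<kappa>"
    "\<And>n. (\<lambda>s. indicator (B n) s *\<^sub>R f s) \<in> borel_measurable \<kappa>"
    by (auto simp: set_integrable_def)
  show "integrable \<kappa> (\<lambda>s. norm (indicator A s *\<^sub>R f s))" using f by (auto simp: set_integrable_def)
  show "AE s in \<kappa>. (\<lambda>n. indicator (B n) s *\<^sub>R f s) \<longlonglongrightarrow> indicator C s *\<^sub>R f s"
  proof (intro AE_I2 tendsto_eventually)
    fix s show "\<forall>\<^sub>F n in sequentially. indicator (B n) s *\<^sub>R f s = indicator C s *\<^sub>R f s"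
      using lim[of s] by eventually_elim (auto simp: indicator_def)
  qed
  show "AE s in \<kappa>. norm (indicator (B n) s *\<^sub>R f s) \<le> norm (indicator A s *\<^sub>R f s)" for n
    using B by (auto simp: indicator_def)
qed

text \<open>As r increases to s, the intervals (0,r] fill the open interval (0,s), so an atom at s
  is left out.\<close>

lemma integral_left_limit:
  fixes f :: "real \<Rightarrow> real"
  assumes \<kappa>: "sets \<kappa> = sets borel" and f: "set_integrable \<kappa> {0<..T} f" and s: "0 < s" "s \<le> T"
  shows "((\<lambda>r. LINT u:{0<..r}|\<kappa>. f u) \<longlongrightarrow> (LINT u:{0<..<s}|\<kappa>. f u)) (at_left s)"
proof (rule tendsto_at_left_sequentially[OF s(1)])
  fix S :: "nat \<Rightarrow> real" assume S: "\<And>n. S n < s" "\<And>n. 0 < S n" "incseq S" "S \<longlonglongrightarrow> s"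
  have S': "\<And>n. S n \<le> T" using S(1) s(2) by (meson less_imp_le order_trans)
  show "(\<lambda>n. LINT u:{0<..S n}|\<kappa>. f u) \<longlonglongrightarrow> (LINT u:{0<..<s}|\<kappa>. f u)"
  proof (rule tendsto_set_integral_shrink[OF \<kappa> f])
    fix u
    show "\<forall>\<^sub>F n in sequentially. (u \<in> {0<..S n}) = (u \<in> {0<..<s})"
    proof (cases "u < s")
      case True
      then have "\<forall>\<^sub>F n in sequentially. u < S n" using S(4) by (rule order_tendstoD(1)[rotated])
      then show ?thesis by eventually_elim (use True in auto)
    next
      case False
      then show ?thesis using S(1) by (intro always_eventually) (meson greaterThanAtMost_iff greaterThanLessThan_iff leD le_less_trans less_imp_le linorder_not_less order_trans)
    qed
    show "{0<..S n} \<subseteq> {0<..T}" for n using S'[of n] s by auto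
  qed (use S S' s in auto)
qed

text \<open>Yields the short interval on which the Volterra equation below is a contraction.\<close>

lemma integral_right_shrink:
  fixes f :: "real \<Rightarrow> real"
  assumes \<kappa>: "sets \<kappa> = sets borel" and f: "set_integrable \<kappa> {0<..T} f" and s: "0 \<le> s" "s < T" and e: "0 < e"
  shows "\<exists>u>s. u \<le> T \<and> (LINT r:{s<..u}|\<kappa>. \<bar>f r\<bar>) < e"
proof -
  let ?S = "\<lambda>n. s + (T - s) / real (Suc n)"
  have lim: "?S \<longlonglongrightarrow> s + 0" by (intro tendsto_intros LIMSEQ_Suc[OF lim_const_over_n])
  have S: "s < ?S n" "?S n \<le> T" for n
  proof -
    have "(T - s) / real (Suc n) \<le> (T - s) / 1" using s by (intro divide_left_mono) auto
    then show "?S n \<le> T" by simp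
  qed (use s in simp)
  have a: "set_integrable \<kappa> {0<..T} (\<lambda>r. \<bar>f r\<bar>)" using set_integrable_abs[OF f] .
  have "(\<lambda>n. LINT r:{s<..?S n}|\<kappa>. \<bar>f r\<bar>) \<longlonglongrightarrow> (LINT r:{}|\<kappa>. \<bar>f r\<bar>)"
  proof (rule tendsto_set_integral_shrink[OF \<kappa> a])
    fix u
    show "\<forall>\<^sub>F n in sequentially. (u \<in> {s<..?S n}) = (u \<in> {})"
    proof (cases "s < u")
      case True
      then have "\<forall>\<^sub>F n in sequentially. ?S n < u" using lim by (intro order_tendstoD(2)[of _ s]) auto
      then show ?thesis by eventually_elim auto
    qed auto
    show "{s<..?S n} \<subseteq> {0<..T}" for n using S(2)[of n] s by auto
  qed (use S s in auto)
  then have "\<forall>\<^sub>F n in sequentially. (LINT r:{s<..?S n}|\<kappa>. \<bar>f r\<bar>) < e"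
    using e by (intro order_tendstoD(2)[of _ 0]) (auto simp: set_lebesgue_integral_def)
  then obtain n where "(LINT r:{s<..?S n}|\<kappa>. \<bar>f r\<bar>) < e" by (auto simp: eventually_sequentially)
  then show ?thesis using S by blast
qed

lemma set_integral_jump:
  fixes f :: "real \<Rightarrow> real"
  assumes \<kappa>: "sets \<kappa> = sets borel" and f: "set_integrable \<kappa> {0<..T} f" and s: "0 < s" "s \<le> T"
    and fin: "emeasure \<kappa> {s} < \<infinity>"
  shows "(LINT u:{0<..s}|\<kappa>. f u) = (LINT u:{0<..<s}|\<kappa>. f u) + f s * measure \<kappa> {s}"
proof -
  have e: "{0<..s} = {0<..<s} \<union> {s}" using s by auto
  have "(LINT u:{0<..<s} \<union> {s}|\<kappa>. f u) = (LINT u:{0<..<s}|\<kappa>. f u) + (LINT u:{s}|\<kappa>. f u)"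
    using s \<kappa> by (intro set_integral_Un set_integrable_subset[OF f]) auto
  moreover have "(LINT u:{s}|\<kappa>. f u) = (LINT u:{s}|\<kappa>. f s)"
    using \<kappa> by (intro set_lebesgue_integral_cong) auto
  moreover have "\<dots> = f s * measure \<kappa> {s}"
    using \<kappa> fin by (simp add: set_lebesgue_integral_def less_top)
  ultimately show ?thesis using e by simp
qed

text \<open>Fubini on the square (0,t] x (0,t], cut into r < s and s \<le> r. The diagonal goes to
  one side only, which is why \<open>P\<close> integrates over the open interval and
  \<open>Q\<close> over the closed one; common jumps of the two factors are thereby counted exactly
  once.\<close>

lemma by_parts:
  fixes x w :: "real \<Rightarrow> real" and p q :: real
  assumes \<nu>: "sigma_finite_measure \<nu>" "sets \<nu> = sets borel"
    and x: "set_integrable \<nu> {0<..t} x" and w: "set_integrable \<nu> {0<..t} w"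
  defines "P \<equiv> \<lambda>s. p + (LINT u:{0<..<s}|\<nu>. x u)" and "Q \<equiv> \<lambda>s. q + (LINT u:{0<..s}|\<nu>. w u)"
  shows "set_integrable \<nu> {0<..t} (\<lambda>s. P s * w s)" "set_integrable \<nu> {0<..t} (\<lambda>s. Q s * x s)"
    and "(p + (LINT u:{0<..t}|\<nu>. x u)) * Q t = p * q + (LINT s:{0<..t}|\<nu>. P s * w s + Q s * x s)"
proof -
  interpret sigma_finite_measure \<nu> by fact
  interpret PP: pair_sigma_finite \<nu> \<nu> by standard
  note [measurable_cong] = \<nu>(2)
  define a b where "a = (\<lambda>s. indicator {0<..t} s *\<^sub>R x s)" and "b = (\<lambda>s. indicator {0<..t} s *\<^sub>R w s)"
  have a: "integrable \<nu> a" and b: "integrable \<nu> b" using x w by (auto simp: set_integrable_def a_def b_def)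
  have [measurable]: "a \<in> borel_measurable borel" "b \<in> borel_measurable borel"
    using a b \<nu>(2) by (auto dest!: borel_measurable_integrable cong: measurable_cong_sets)
  have ab: "integrable (\<nu> \<Otimes>\<^sub>M \<nu>) (\<lambda>(r, s). a r * b s)"
  proof (rule PP.Fubini_integrable)
    show "integrable \<nu> (\<lambda>r. \<integral>s. norm (case (r, s) of (r, s) \<Rightarrow> a r * b s) \<partial>\<nu>)"
      using a b by (auto simp: abs_mult)
  qed (use b in auto)
  have lt: "integrable (\<nu> \<Otimes>\<^sub>M \<nu>) (\<lambda>(r, s). if r < s then a r * b s else 0)"
    by (rule Bochner_Integration.integrable_bound[OF ab]) (auto split: if_splits)
  have ge: "integrable (\<nu> \<Otimes>\<^sub>M \<nu>) (\<lambda>(r, s). if s \<le> r then a r * b s else 0)"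
    by (rule Bochner_Integration.integrable_bound[OF ab]) (auto split: if_splits)
  have ea: "(LINT u:{0<..<s}|\<nu>. x u) * b s = (\<integral>r. (if r < s then a r * b s else 0) \<partial>\<nu>)" for s
  proof (cases "s \<in> {0<..t}")
    case True
    have "(\<integral>r. (if r < s then a r * b s else 0) \<partial>\<nu>) = (\<integral>r. (indicator {0<..<s} r *\<^sub>R x r) * b s \<partial>\<nu>)"
      using True by (intro Bochner_Integration.integral_cong) (auto simp: a_def indicator_def)
    then show ?thesis by (simp add: set_lebesgue_integral_def)
  next
    case False then have *: "b s = 0" by (auto simp: b_def)
    show ?thesis unfolding * by (simp cong: if_cong)
  qed
  have eb: "(LINT u:{0<..s}|\<nu>. w u) * a s = (\<integral>r. (if r \<le> s then a s * b r else 0) \<partial>\<nu>)" for s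
  proof (cases "s \<in> {0<..t}")
    case True
    have "(\<integral>r. (if r \<le> s then a s * b r else 0) \<partial>\<nu>) = (\<integral>r. a s * (indicator {0<..s} r *\<^sub>R w r) \<partial>\<nu>)"
      using True by (intro Bochner_Integration.integral_cong) (auto simp: b_def indicator_def)
    then show ?thesis by (simp add: set_lebesgue_integral_def)
  next
    case False then have *: "a s = 0" by (auto simp: a_def)
    show ?thesis unfolding * by (simp cong: if_cong)
  qed
  have i1: "integrable \<nu> (\<lambda>s. (LINT u:{0<..<s}|\<nu>. x u) * b s)" unfolding ea by (rule PP.integrable_snd[OF lt])
  have i2: "integrable \<nu> (\<lambda>s. (LINT u:{0<..s}|\<nu>. w u) * a s)" unfolding eb using PP.integrable_fst[OF ge] by simp
  have j1: "integrable \<nu> (\<lambda>s. P s * b s)" unfolding P_def distrib_right using i1 b by auto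
  have j2: "integrable \<nu> (\<lambda>s. Q s * a s)" unfolding Q_def distrib_right using i2 a by auto
  show "set_integrable \<nu> {0<..t} (\<lambda>s. P s * w s)" using j1 by (simp add: set_integrable_def b_def ac_simps)
  show "set_integrable \<nu> {0<..t} (\<lambda>s. Q s * x s)" using j2 by (simp add: set_integrable_def a_def ac_simps)
  have "(\<integral>r. a r \<partial>\<nu>) * (\<integral>s. b s \<partial>\<nu>) = (\<integral>r. (\<integral>s. a r * b s \<partial>\<nu>) \<partial>\<nu>)" by simp
  also have "\<dots> = (\<integral>z. (case z of (r, s) \<Rightarrow> a r * b s) \<partial>(\<nu> \<Otimes>\<^sub>M \<nu>))" using PP.integral_fst[OF ab] by simp
  also have "\<dots> = (\<integral>z. (case z of (r, s) \<Rightarrow> if r < s then a r * b s else 0) + (case z of (r, s) \<Rightarrow> if s \<le> r then a r * b s else 0) \<partial>(\<nu> \<Otimes>\<^sub>M \<nu>))"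
    by (intro Bochner_Integration.integral_cong) auto
  also have "\<dots> = (\<integral>z. (case z of (r, s) \<Rightarrow> if r < s then a r * b s else 0) \<partial>(\<nu> \<Otimes>\<^sub>M \<nu>)) + (\<integral>z. (case z of (r, s) \<Rightarrow> if s \<le> r then a r * b s else 0) \<partial>(\<nu> \<Otimes>\<^sub>M \<nu>))"
    by (rule Bochner_Integration.integral_add[OF lt ge])
  also have "\<dots> = (\<integral>s. (LINT u:{0<..<s}|\<nu>. x u) * b s \<partial>\<nu>) + (\<integral>s. (LINT u:{0<..s}|\<nu>. w u) * a s \<partial>\<nu>)"
    unfolding ea eb using PP.integral_snd[OF lt] PP.integral_fst[OF ge] by simp
  finally have *: "(\<integral>r. a r \<partial>\<nu>) * (\<integral>s. b s \<partial>\<nu>) = (\<integral>s. (LINT u:{0<..<s}|\<nu>. x u) * b s \<partial>\<nu>) + (\<integral>s. (LINT u:{0<..s}|\<nu>. w u) * a s \<partial>\<nu>)" .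
  have "(LINT s:{0<..t}|\<nu>. P s * w s + Q s * x s) = (\<integral>s. P s * b s + Q s * a s \<partial>\<nu>)"
    unfolding set_lebesgue_integral_def a_def b_def by (intro Bochner_Integration.integral_cong) (auto simp: algebra_simps)
  also have "\<dots> = (\<integral>s. P s * b s \<partial>\<nu>) + (\<integral>s. Q s * a s \<partial>\<nu>)" using j1 j2 by simp
  also have "\<dots> = p * (\<integral>s. b s \<partial>\<nu>) + q * (\<integral>s. a s \<partial>\<nu>) + (\<integral>r. a r \<partial>\<nu>) * (\<integral>s. b s \<partial>\<nu>)"
    unfolding * P_def Q_def distrib_right using a b i1 i2 by simp
  finally show "(p + (LINT u:{0<..t}|\<nu>. x u)) * Q t = p * q + (LINT s:{0<..t}|\<nu>. P s * w s + Q s * x s)"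
    unfolding Q_def set_lebesgue_integral_def a_def b_def by (simp add: algebra_simps)
qed

text \<open>The function is an integral depending on a parameter, hence measurable by Fubini. The
  cut-off at \<open>t\<close> is there because measurability of \<open>x\<close> is known only on
  (0,t].\<close>

lemma borel_measurable_open_integral:
  fixes x :: "real \<Rightarrow> real"
  assumes \<nu>: "sigma_finite_measure \<nu>" "sets \<nu> = sets borel" and x: "set_integrable \<nu> {0<..t} x"
  shows "(\<lambda>s. if s \<le> t then (LINT u:{0<..<s}|\<nu>. x u) else 0) \<in> borel_measurable borel"
proof -
  interpret sigma_finite_measure \<nu> by fact
  note [measurable_cong] = \<nu>(2)
  define a where "a = (\<lambda>s. indicator {0<..t} s *\<^sub>R x s)"
  have [measurable]: "a \<in> borel_measurable borel"
    using x \<nu>(2) by (auto simp: set_integrable_def a_def dest!: borel_measurable_integrable cong: measurable_cong_sets)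
  have "(\<lambda>s. if s \<le> t then (LINT u:{0<..<s}|\<nu>. x u) else 0) = (\<lambda>s. if s \<le> t then (\<integral>u. (if u < s then a u else 0) \<partial>\<nu>) else 0)"
    unfolding set_lebesgue_integral_def a_def
    by (intro ext if_cong refl Bochner_Integration.integral_cong) (auto simp: indicator_def)
  also have "\<dots> \<in> borel_measurable borel" by measurable
  finally show ?thesis .
qed

text \<open>Uniqueness for a homogeneous Volterra equation. \<open>Vm\<close> stands for the left
  limit of \<open>V\<close>, through the bounds that it inherits from earlier values. Let
  \<open>c\<close> be the supremum of the times up to which V vanishes; then Vm vanishes on (0,c],
  so V c = 0 even if c is an atom. If c < T, then on a short interval after c on which |k| has
  integral below 1/2 the supremum of |V| is at most half of itself.\<close>

lemma volterra_zero:
  fixes k V Vm :: "real \<Rightarrow> real"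
  assumes \<nu>: "sets \<nu> = sets borel"
    and k: "set_integrable \<nu> {0<..T} k" and Vk: "set_integrable \<nu> {0<..T} (\<lambda>s. Vm s * k s)"
    and V: "\<And>t. 0 \<le> t \<Longrightarrow> t \<le> T \<Longrightarrow> V t = (LINT s:{0<..t}|\<nu>. Vm s * k s)"
    and Vm: "\<And>s b. 0 < s \<Longrightarrow> s \<le> T \<Longrightarrow> (\<And>r. 0 \<le> r \<Longrightarrow> r < s \<Longrightarrow> \<bar>V r\<bar> \<le> b) \<Longrightarrow> \<bar>Vm s\<bar> \<le> b"
    and bd: "\<And>s. 0 \<le> s \<Longrightarrow> s \<le> T \<Longrightarrow> \<bar>V s\<bar> \<le> B" and T: "0 \<le> T"
  shows "V T = 0"
proof -
  let ?S = "{t\<in>{0..T}. \<forall>r\<in>{0..t}. V r = 0}"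
  define c where "c = Sup ?S"
  have V0: "V 0 = 0" using V[of 0] T by (simp add: set_lebesgue_integral_def)
  then have S0: "0 \<in> ?S" using T by auto
  have bdd: "bdd_above ?S" by (rule bdd_aboveI[of _ T]) auto
  have c: "0 \<le> c" "c \<le> T" using S0 bdd unfolding c_def by (auto intro!: cSup_upper cSup_least)
  have below: "V r = 0" if r: "0 \<le> r" "r < c" for r
  proof -
    obtain t where "t \<in> ?S" "r < t" using r(2) S0 bdd unfolding c_def by (subst (asm) less_cSup_iff) auto
    then show ?thesis using r by auto
  qed
  have Vmz: "Vm s = 0" if "0 < s" "s \<le> c" for s
    using Vm[of s 0] below that c by fastforce
  have "V c = (LINT s:{0<..c}|\<nu>. 0)" unfolding V[OF c] using Vmz \<nu>
    by (intro set_lebesgue_integral_cong) auto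
  then have Vc: "V c = 0" by simp
  have upto: "V r = 0" if "0 \<le> r" "r \<le> c" for r using below[of r] Vc that by (cases "r = c") auto
  have "c = T"
  proof (rule ccontr)
    assume "c \<noteq> T" then have cT: "c < T" using c by simp
    obtain u where u: "c < u" "u \<le> T" "(LINT r:{c<..u}|\<nu>. \<bar>k r\<bar>) < 1/2"
      using integral_right_shrink[OF \<nu> k c(1) cT, of "1/2"] by auto
    define m where "m = (SUP r\<in>{0..u}. \<bar>V r\<bar>)"
    have bu: "bdd_above ((\<lambda>r. \<bar>V r\<bar>) ` {0..u})" using bd u by (intro bdd_aboveI[of _ B]) auto
    have m: "\<bar>V r\<bar> \<le> m" if "0 \<le> r" "r \<le> u" for r unfolding m_def using that bu by (intro cSUP_upper) auto
    have m0: "0 \<le> m" using m[of 0] u c by auto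
    have half: "\<bar>V r\<bar> \<le> m / 2" if r: "0 \<le> r" "r \<le> u" for r
    proof (cases "r \<le> c")
      case True then show ?thesis using upto r m0 by simp
    next
      case False
      have "V r = (LINT s:{c<..r}|\<nu>. Vm s * k s)"
      proof -
        have "{0<..r} = {0<..c} \<union> {c<..r}" using c False by auto
        then have "V r = (LINT s:{0<..c} \<union> {c<..r}|\<nu>. Vm s * k s)" using V[of r] r u by simp
        also have "\<dots> = (LINT s:{0<..c}|\<nu>. Vm s * k s) + (LINT s:{c<..r}|\<nu>. Vm s * k s)"
          using \<nu> c r u by (intro set_integral_Un set_integrable_subset[OF Vk]) auto
        also have "(LINT s:{0<..c}|\<nu>. Vm s * k s) = 0" using V[OF c] Vc by simp
        finally show ?thesis by simp
      qed
      also have "\<bar>\<dots>\<bar> \<le> (LINT s:{c<..u}|\<nu>. m * \<bar>k s\<bar>)" unfolding set_lebesgue_integral_def real_norm_def[symmetric]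
      proof (rule Bochner_Integration.integral_norm_bound_integral)
        show "integrable \<nu> (\<lambda>s. indicator {c<..r} s *\<^sub>R (Vm s * k s))"
          using set_integrable_Ioc_subset[OF Vk \<nu> c(1), of r] r u by (simp add: set_integrable_def)
        have "set_integrable \<nu> {c<..u} (\<lambda>s. m * \<bar>k s\<bar>)"
          using set_integrable_Ioc_subset[OF set_integrable_abs[OF k] \<nu> c(1) u(2)] by simp
        then show "integrable \<nu> (\<lambda>s. indicator {c<..u} s *\<^sub>R (m * norm (k s)))" by (simp add: set_integrable_def)
        fix s
        have "\<bar>Vm s\<bar> \<le> m" if "c < s" "s \<le> r" using that c r u by (intro Vm m) auto
        then show "norm (indicator {c<..r} s *\<^sub>R (Vm s * k s)) \<le> indicator {c<..u} s *\<^sub>R (m * norm (k s))"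
          using r m0 by (auto simp: indicator_def abs_mult intro!: mult_right_mono)
      qed
      also have "\<dots> = m * (LINT s:{c<..u}|\<nu>. \<bar>k s\<bar>)" by simp
      also have "\<dots> \<le> m * (1/2)" using u m0 by (intro mult_left_mono) auto
      finally show ?thesis by simp
    qed
    have "m \<le> m / 2" unfolding m_def[of] using u c half by (intro cSUP_least) (auto simp: m_def)
    then have "m = 0" using m0 by simp
    then have "u \<in> ?S" using m u c by force
    then have "u \<le> c" unfolding c_def using bdd by (rule cSup_upper)
    then show False using u by simp
  qed
  then show ?thesis using Vc by simp
qed

lemma open_integral_ge:
  fixes z :: "real \<Rightarrow> real"
  assumes \<nu>: "sets \<nu> = sets borel" and z: "set_integrable \<nu> {0<..T} z"
    and ge: "\<And>r. 0 \<le> r \<Longrightarrow> r < s \<Longrightarrow> \<epsilon> \<le> c + (LINT u:{0<..r}|\<nu>. z u)" and s: "0 < s" "s \<le> T"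
  shows "\<epsilon> \<le> c + (LINT u:{0<..<s}|\<nu>. z u)"
proof (rule tendsto_lowerbound)
  show "((\<lambda>r. c + (LINT u:{0<..r}|\<nu>. z u)) \<longlongrightarrow> c + (LINT u:{0<..<s}|\<nu>. z u)) (at_left s)"
    by (intro tendsto_intros integral_left_limit[OF \<nu> z s])
  show "\<forall>\<^sub>F r in at_left s. \<epsilon> \<le> c + (LINT u:{0<..r}|\<nu>. z u)"
    using s ge by (intro eventually_at_leftI[of 0]) auto
qed simp

lemma set_integral_abs_le:
  fixes x :: "real \<Rightarrow> real"
  assumes "sets \<nu> = sets borel" "set_integrable \<nu> {0<..T} x" "s \<le> T"
  shows "\<bar>LINT u:{0<..s}|\<nu>. x u\<bar> \<le> (LINT u:{0<..T}|\<nu>. \<bar>x u\<bar>)"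
  unfolding set_lebesgue_integral_def real_norm_def[symmetric]
proof (rule Bochner_Integration.integral_norm_bound_integral)
  show "integrable \<nu> (\<lambda>u. indicator {0<..s} u *\<^sub>R x u)"
    using set_integrable_Ioc_subset[OF assms(2,1), of 0 s] assms(3) by (simp add: set_integrable_def)
  show "integrable \<nu> (\<lambda>u. indicator {0<..T} u *\<^sub>R norm (x u))"
    using set_integrable_abs[OF assms(2)] by (auto simp: set_integrable_def)
qed (use assms(3) in \<open>auto simp: indicator_def\<close>)

text \<open>
  \<open>W = X\<^sub>0 / Z\<^sub>0 + \<integral> w d\<nu>\<close> is compared with \<open>X / Z\<close> through \<open>V = W Z - X\<close>, which satisfies the homogeneous
  linear equation \<open>dV = V\<^sub>- (z / Z\<^sub>-) d\<nu>\<close>.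
\<close>

lemma quotient_rule:
  fixes x z w :: "real \<Rightarrow> real" and X0 Z0 :: real
  assumes \<nu>: "sigma_finite_measure \<nu>" "sets \<nu> = sets borel" and T: "0 \<le> T"
    and x: "set_integrable \<nu> {0<..T} x" and z: "set_integrable \<nu> {0<..T} z" and w: "set_integrable \<nu> {0<..T} w"
  defines "X \<equiv> \<lambda>s. X0 + (LINT u:{0<..s}|\<nu>. x u)" and "Z \<equiv> \<lambda>s. Z0 + (LINT u:{0<..s}|\<nu>. z u)"
    and "Xm \<equiv> \<lambda>s. X0 + (LINT u:{0<..<s}|\<nu>. x u)" and "Zm \<equiv> \<lambda>s. Z0 + (LINT u:{0<..<s}|\<nu>. z u)"
  assumes \<epsilon>: "0 < \<epsilon>" "\<And>s. 0 \<le> s \<Longrightarrow> s \<le> T \<Longrightarrow> \<epsilon> \<le> Z s"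
    and eq: "AE s in \<nu>. s \<in> {0<..T} \<longrightarrow> Z s * w s = x s - Xm s / Zm s * z s"
  shows "X T / Z T = X0 / Z0 + (LINT s:{0<..T}|\<nu>. w s)"
proof -
  note sub = set_integrable_subset[of \<nu> "{0<..T}"]
  have le: "set_integrable \<nu> {0<..t} x" "set_integrable \<nu> {0<..t} z" "set_integrable \<nu> {0<..t} w" if "t \<le> T" for t
    using that \<nu>(2) by (auto intro!: set_integrable_Ioc_subset[OF x] set_integrable_Ioc_subset[OF z] set_integrable_Ioc_subset[OF w])
  have Zm: "\<epsilon> \<le> Zm s" if "0 < s" "s \<le> T" for s
    using open_integral_ge[OF \<nu>(2) z, of s \<epsilon> Z0] that \<epsilon>(2) unfolding Zm_def Z_def by auto
  define W where "W = (\<lambda>s. X0 / Z0 + (LINT u:{0<..s}|\<nu>. w u))"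
  define Wm where "Wm = (\<lambda>s. X0 / Z0 + (LINT u:{0<..<s}|\<nu>. w u))"
  define V where "V = (\<lambda>s. W s * Z s - X s)"
  define Vm where "Vm = (\<lambda>s. Wm s * Zm s - Xm s)"
  define k where "k = (\<lambda>s. z s / Zm s)"
  have Z0: "Z0 \<noteq> 0" using \<epsilon>(2)[of 0] \<epsilon>(1) T by (auto simp: Z_def set_lebesgue_integral_def)
  \<comment> \<open>The density of d(WZ) - dX. Inserting Z w = x - (Xm / Zm) z leaves (Wm - Xm / Zm)
    z = Vm z / Zm.\<close>
  have eq2: "AE s in \<nu>. s \<in> {0<..t} \<longrightarrow> Wm s * z s + Z s * w s - x s = Vm s * k s" if "t \<le> T" for t
    using eq
  proof eventually_elim
    case (elim s)
    show ?case
    proof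
      assume s: "s \<in> {0<..t}"
      then have "Zm s \<noteq> 0" using Zm[of s] \<epsilon>(1) that by auto
      then show "Wm s * z s + Z s * w s - x s = Vm s * k s"
        using elim s that by (auto simp: Vm_def k_def field_simps)
    qed
  qed
  have bp: "set_integrable \<nu> {0<..t} (\<lambda>s. Wm s * z s)" "set_integrable \<nu> {0<..t} (\<lambda>s. Z s * w s)"
       "W t * Z t = X0 / Z0 * Z0 + (LINT s:{0<..t}|\<nu>. Wm s * z s + Z s * w s)" if "t \<le> T" for t
    using by_parts(1)[OF \<nu> le(3)[OF that] le(2)[OF that], of "X0 / Z0"]
      by_parts(2)[OF \<nu> le(3)[OF that] le(2)[OF that], of Z0]
      by_parts(3)[OF \<nu> le(3)[OF that] le(2)[OF that], of "X0 / Z0" Z0] unfolding W_def Wm_def Z_def by auto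
  have kb: "set_integrable \<nu> {0<..T} k"
  proof -
    have mz: "(\<lambda>s. indicator {0<..T} s *\<^sub>R z s) \<in> borel_measurable borel"
      using z \<nu>(2) by (auto simp: set_integrable_def dest!: borel_measurable_integrable cong: measurable_cong_sets)
    have "(\<lambda>s. indicator {0<..T} s *\<^sub>R k s) = (\<lambda>s. (indicator {0<..T} s *\<^sub>R z s) / (Z0 + (if s \<le> T then (LINT u:{0<..<s}|\<nu>. z u) else 0)))"
      by (auto simp: fun_eq_iff indicator_def k_def Zm_def)
    also have "\<dots> \<in> borel_measurable borel"
      using mz borel_measurable_open_integral[OF \<nu> z] by measurable
    finally have mk: "(\<lambda>s. indicator {0<..T} s *\<^sub>R k s) \<in> borel_measurable borel" .
    have iz: "integrable \<nu> (\<lambda>s. (1 / \<epsilon>) * (indicator {0<..T} s *\<^sub>R z s))" using z by (auto simp: set_integrable_def)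
    show ?thesis unfolding set_integrable_def
    proof (rule Bochner_Integration.integrable_bound[OF iz])
      show "(\<lambda>s. indicator {0<..T} s *\<^sub>R k s) \<in> borel_measurable \<nu>" using mk \<nu>(2) by (simp cong: measurable_cong_sets)
      have "\<bar>k s\<bar> \<le> \<bar>z s\<bar> / \<epsilon>" if "0 < s" "s \<le> T" for s
        using Zm[OF that] \<epsilon>(1) unfolding k_def by (auto simp: abs_divide intro!: frac_le)
      then show "AE s in \<nu>. norm (indicator {0<..T} s *\<^sub>R k s) \<le> norm (1 / \<epsilon> * (indicator {0<..T} s *\<^sub>R z s))"
        using \<epsilon>(1) by (auto simp: indicator_def abs_mult)
    qed
  qed
  have mk: "(\<lambda>s. indicator {0<..T} s *\<^sub>R (Vm s * k s)) \<in> borel_measurable borel"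
  proof -
    have "(\<lambda>s. indicator {0<..T} s *\<^sub>R (Vm s * k s)) = (\<lambda>s. ((X0 / Z0 + (if s \<le> T then (LINT u:{0<..<s}|\<nu>. w u) else 0)) * (Z0 + (if s \<le> T then (LINT u:{0<..<s}|\<nu>. z u) else 0))
       - (X0 + (if s \<le> T then (LINT u:{0<..<s}|\<nu>. x u) else 0))) * (indicator {0<..T} s *\<^sub>R k s))"
      by (auto simp: fun_eq_iff indicator_def Vm_def Zm_def Wm_def Xm_def)
    also have "\<dots> \<in> borel_measurable borel"
      using borel_measurable_open_integral[OF \<nu> z] borel_measurable_open_integral[OF \<nu> x] borel_measurable_open_integral[OF \<nu> w]
        kb \<nu>(2) by (auto intro!: borel_measurable_times borel_measurable_diff borel_measurable_add simp: set_integrable_def dest!: borel_measurable_integrable cong: measurable_cong_sets)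
    finally show ?thesis .
  qed
  have Vk: "set_integrable \<nu> {0<..T} (\<lambda>s. Vm s * k s)"
  proof -
    have 1: "set_integrable \<nu> {0<..T} (\<lambda>s. Wm s * z s + Z s * w s - x s)"
      using bp(1,2)[of T] x by (auto intro!: set_integral_add set_integral_diff)
    show ?thesis
      by (rule set_integral_cong_AE_on(1)[OF 1 _ eq2]) (use mk \<nu>(2) in \<open>simp_all cong: measurable_cong_sets\<close>)
  qed
  have VV: "V t = (LINT s:{0<..t}|\<nu>. Vm s * k s)" if "0 \<le> t" "t \<le> T" for t
  proof -
    have "V t = (LINT s:{0<..t}|\<nu>. Wm s * z s + Z s * w s) - (LINT s:{0<..t}|\<nu>. x s)"
      unfolding V_def bp(3)[OF that(2)] using Z0 by (simp add: X_def)
    also have "\<dots> = (LINT s:{0<..t}|\<nu>. Wm s * z s + Z s * w s - x s)"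
      using bp(1,2)[OF that(2)] le[OF that(2)] by (subst set_integral_diff) (auto intro!: set_integral_add)
    also have "\<dots> = (LINT s:{0<..t}|\<nu>. Vm s * k s)"
    proof (rule set_integral_cong_AE_on(2))
      show "set_integrable \<nu> {0<..t} (\<lambda>s. Wm s * z s + Z s * w s - x s)"
        using bp(1,2)[OF that(2)] le[OF that(2)] by (auto intro!: set_integral_add set_integral_diff)
      show "(\<lambda>s. indicator {0<..t} s *\<^sub>R (Vm s * k s)) \<in> borel_measurable \<nu>"
        using set_integrable_Ioc_subset[OF Vk \<nu>(2) order_refl that(2)] by (auto simp: set_integrable_def)
    qed (rule eq2[OF that(2)])
    finally show ?thesis .
  qed
  have "V T = 0"
  proof (rule volterra_zero[OF \<nu>(2) kb Vk VV _ _ T])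
    fix s b assume s: "0 < s" "s \<le> T" and b: "\<And>r. 0 \<le> r \<Longrightarrow> r < s \<Longrightarrow> \<bar>V r\<bar> \<le> b"
    have "(V \<longlongrightarrow> Vm s) (at_left s)"
      unfolding V_def Vm_def W_def Wm_def X_def Xm_def Z_def Zm_def
      by (intro tendsto_intros integral_left_limit[OF \<nu>(2) _ s] x z w)
    then have lim: "((\<lambda>r. \<bar>V r\<bar>) \<longlongrightarrow> \<bar>Vm s\<bar>) (at_left s)" by (rule tendsto_rabs)
    have "\<forall>\<^sub>F r in at_left s. \<bar>V r\<bar> \<le> b" using s b by (intro eventually_at_leftI[of 0]) auto
    then show "\<bar>Vm s\<bar> \<le> b" by (rule tendsto_upperbound[OF lim]) simp
  next
    fix s assume s: "0 \<le> s" "s \<le> T"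
    let ?I = "\<lambda>x. LINT u:{0<..T}|\<nu>. \<bar>x u\<bar>"
    have "\<bar>V s\<bar> \<le> \<bar>W s\<bar> * \<bar>Z s\<bar> + \<bar>X s\<bar>" unfolding V_def by (metis abs_mult abs_triangle_ineq4)
    also have "\<dots> \<le> (\<bar>X0 / Z0\<bar> + ?I w) * (\<bar>Z0\<bar> + ?I z) + (\<bar>X0\<bar> + ?I x)"
    proof -
      have "\<bar>W s\<bar> \<le> \<bar>X0 / Z0\<bar> + ?I w" "\<bar>Z s\<bar> \<le> \<bar>Z0\<bar> + ?I z" "\<bar>X s\<bar> \<le> \<bar>X0\<bar> + ?I x"
        using set_integral_abs_le[OF \<nu>(2) w s(2)] set_integral_abs_le[OF \<nu>(2) z s(2)]
          set_integral_abs_le[OF \<nu>(2) x s(2)] unfolding W_def Z_def X_def by linarith+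
      then show ?thesis by (intro add_mono mult_mono) auto
    qed
    finally show "\<bar>V s\<bar> \<le> (\<bar>X0 / Z0\<bar> + ?I w) * (\<bar>Z0\<bar> + ?I z) + (\<bar>X0\<bar> + ?I x)" .
  qed auto
  moreover have "Z T \<noteq> 0" using \<epsilon>(2)[of T] \<epsilon>(1) T by auto
  ultimately show ?thesis by (simp add: V_def W_def field_simps)
qed

text \<open>A Radon-Nikodym derivative in a real-valued version: domination gives absolute
  continuity, and sigma-finiteness of \<kappa> gives finite values almost everywhere.\<close>

lemma dominated_real_density:
  assumes \<nu>: "sigma_finite_measure \<nu>" "sets \<nu> = sets borel" and \<kappa>: "sigma_finite_measure \<kappa>" "sets \<kappa> = sets borel"
    and le: "\<And>E. E \<in> sets borel \<Longrightarrow> emeasure \<kappa> E \<le> emeasure \<nu> E"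
  obtains d :: "real \<Rightarrow> real" where "d \<in> borel_measurable borel" "\<And>s. 0 \<le> d s" "\<kappa> = density \<nu> (\<lambda>s. ennreal (d s))"
proof -
  interpret sigma_finite_measure \<nu> by fact
  have ac: "absolutely_continuous \<nu> \<kappa>"
    unfolding absolutely_continuous_def
  proof
    fix E assume "E \<in> null_sets \<nu>"
    then show "E \<in> null_sets \<kappa>" using le[of E] \<nu> \<kappa> by (auto simp: null_sets_def)
  qed
  have d: "density \<nu> (RN_deriv \<nu> \<kappa>) = \<kappa>" using ac \<nu> \<kappa> by (intro density_RN_deriv) auto
  have fin: "AE s in \<nu>. RN_deriv \<nu> \<kappa> s \<noteq> \<infinity>" using ac \<nu> \<kappa> by (intro RN_deriv_finite) auto
  have m: "RN_deriv \<nu> \<kappa> \<in> borel_measurable borel" using \<nu>(2) borel_measurable_RN_deriv[of \<nu> \<kappa>] by (simp cong: measurable_cong_sets)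
  show ?thesis
  proof (rule that[of "\<lambda>s. enn2real (RN_deriv \<nu> \<kappa> s)"])
    show "\<kappa> = density \<nu> (\<lambda>s. ennreal (enn2real (RN_deriv \<nu> \<kappa> s)))"
    proof (subst d[symmetric], rule density_cong)
      show "AE s in \<nu>. RN_deriv \<nu> \<kappa> s = ennreal (enn2real (RN_deriv \<nu> \<kappa> s))"
        using fin by eventually_elim (simp add: less_top)
    qed (use m \<nu>(2) in \<open>simp_all cong: measurable_cong_sets\<close>)
  qed (use m in auto)
qed

lemma density_set_integral:
  fixes f d :: "real \<Rightarrow> real"
  assumes \<nu>: "sets \<nu> = sets borel" and d: "d \<in> borel_measurable borel" "\<And>s. 0 \<le> d s"
    and f: "set_integrable (density \<nu> (\<lambda>s. ennreal (d s))) S f"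
  shows "set_integrable \<nu> S (\<lambda>s. d s * f s)"
    and "(LINT s:S|density \<nu> (\<lambda>s. ennreal (d s)). f s) = (LINT s:S|\<nu>. d s * f s)"
proof -
  let ?g = "\<lambda>s. indicator S s *\<^sub>R f s"
  have m: "?g \<in> borel_measurable \<nu>" "d \<in> borel_measurable \<nu>"
    using f d \<nu> by (auto simp: set_integrable_def dest!: borel_measurable_integrable cong: measurable_cong_sets)
  have e: "(\<lambda>s. d s *\<^sub>R ?g s) = (\<lambda>s. indicator S s *\<^sub>R (d s * f s))" by (auto simp: fun_eq_iff)
  show "set_integrable \<nu> S (\<lambda>s. d s * f s)"
    using f m d unfolding set_integrable_def e[symmetric] by (subst (asm) integrable_density) auto
  show "(LINT s:S|density \<nu> (\<lambda>s. ennreal (d s)). f s) = (LINT s:S|\<nu>. d s * f s)"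
    unfolding set_lebesgue_integral_def e[symmetric] using m d by (subst integral_density) auto
qed

lemma left_limit_eqI: "(f \<longlongrightarrow> l) (at_left t) \<Longrightarrow> left_limit f t = l"
  unfolding left_limit_def by (intro tendsto_Lim) auto

lemma left_limit_cong_on:
  assumes "(g \<longlongrightarrow> l) (at_left s)" "0 < s" "\<And>r. 0 \<le> r \<Longrightarrow> r < s \<Longrightarrow> f r = g r"
  shows "(f \<longlongrightarrow> l) (at_left s)"
proof -
  have "eventually (\<lambda>r. f r = g r) (at_left s)" using assms by (intro eventually_at_leftI[of 0]) auto
  then show ?thesis using assms(1) by (simp cong: filterlim_cong)
qed

section \<open>The quotient rule along a path\<close>

text \<open>The dynamics dV = \<phi> d(P - lam t) - a dA along one path. Z has this form with a = 1,
  once for each of the two dual projections, and X has it with a = h.\<close>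

definition drift_path where
  "drift_path P lam A \<phi> a V \<longleftrightarrow> (\<forall>t\<ge>0::real. set_integrable lborel {0<..t} \<phi> \<and>
     set_integrable (path_measure (\<lambda>t. real (P t))) {0<..t} \<phi> \<and> set_integrable (path_measure A) {0<..t} a \<and>
     V t = V 0 + ((LINT s:{0<..t}|path_measure (\<lambda>t. real (P t)). \<phi> s) - lam * (LINT s:{0<..t}|lborel. \<phi> s))
       - (LINT s:{0<..t}|path_measure A. (a s :: real)))"

lemma drift_pathD:
  assumes "drift_path P lam A \<phi> a V" "0 \<le> t"
  shows "set_integrable lborel {0<..t} \<phi>" "set_integrable (path_measure (\<lambda>t. real (P t))) {0<..t} \<phi>"
    "set_integrable (path_measure A) {0<..t} a"
    "V t = V 0 + ((LINT s:{0<..t}|path_measure (\<lambda>t. real (P t)). \<phi> s) - lam * (LINT s:{0<..t}|lborel. \<phi> s))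
       - (LINT s:{0<..t}|path_measure A. a s)"
  using assms unfolding drift_path_def by blast+

text \<open>Neither dt nor dA charges {s}, so only the counting part can make V jump.\<close>

lemma drift_left_limit:
  assumes d: "drift_path P lam A \<phi> a V" and P: "increasing_path (\<lambda>t. real (P t))"
    and s: "0 < s" and atomless: "emeasure (path_measure A) {s} = 0"
  shows "(V \<longlongrightarrow> V s - \<phi> s * measure (path_measure (\<lambda>t. real (P t))) {s}) (at_left s)"
proof -
  let ?\<kappa> = "path_measure (\<lambda>t. real (P t))"
  have s0: "0 \<le> s" using s by simp
  note D = drift_pathD[OF d s0]
  let ?W = "\<lambda>r. V 0 + ((LINT u:{0<..r}|?\<kappa>. \<phi> u) - lam * (LINT u:{0<..r}|lborel. \<phi> u)) - (LINT u:{0<..r}|path_measure A. a u)"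
  let ?l = "V 0 + ((LINT u:{0<..<s}|?\<kappa>. \<phi> u) - lam * (LINT u:{0<..<s}|lborel. \<phi> u)) - (LINT u:{0<..<s}|path_measure A. a u)"
  have "(?W \<longlongrightarrow> ?l) (at_left s)"
    by (intro tendsto_intros integral_left_limit[OF _ D(1) s order_refl] integral_left_limit[OF _ D(2) s order_refl]
        integral_left_limit[OF _ D(3) s order_refl]) simp_all
  then have "(V \<longlongrightarrow> ?l) (at_left s)" using s by (rule left_limit_cong_on) (rule drift_pathD(4)[OF d])
  moreover have "?l = V s - \<phi> s * measure ?\<kappa> {s}"
    unfolding D(4) set_integral_jump[OF sets_path_measure D(2) s order_refl emeasure_path_singleton_finite[OF P s0]]
      set_integral_jump[OF sets_lborel D(1) s order_refl, simplified]
      set_integral_jump[OF sets_path_measure D(3) s order_refl, unfolded atomless, simplified]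
    using atomless by (simp add: measure_def algebra_simps)
  ultimately show ?thesis by simp
qed

text \<open>The integrators dA, dt and dP are dominated by their sum \<nu>, so
  \<open>quotient_rule\<close> applies with one density for all three. The density of dP lives on
  the jump times and the other two live off them, so the required identity Z w = x - U z splits into
  two cases: at a jump Z = Zm + \<phi>, elsewhere Z = Zm. This is the origin of the two
  denominators.\<close>

lemma pathwise_quotient:
  fixes A h \<phi> \<phi>h X Z :: "real \<Rightarrow> real" and P :: "real \<Rightarrow> nat" and lam T \<epsilon> :: real
  assumes A: "increasing_path A" and P: "increasing_path (\<lambda>t. real (P t))" and lam: "0 < lam" and T: "0 \<le> T"
    and dX: "drift_path P lam A \<phi>h h X" and dZ: "drift_path P lam A \<phi> (\<lambda>_. 1) Z"
    and \<epsilon>: "0 < \<epsilon>" "\<And>s. 0 \<le> s \<Longrightarrow> s \<le> T \<Longrightarrow> \<epsilon> \<le> Z s"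
    and atomless: "\<And>s. 0 \<le> s \<Longrightarrow> emeasure (path_measure A) {s} = 0"
    and unit: "\<And>s. s \<in> jump_times P \<Longrightarrow> emeasure (path_measure (\<lambda>t. real (P t))) {s} = 1"
  defines "Zm \<equiv> left_limit Z" and "U \<equiv> \<lambda>s. left_limit X s / left_limit Z s"
  shows "set_integrable (path_measure A) {0<..T} (\<lambda>s. (h s - U s) / Zm s)"
    and "set_integrable lborel {0<..T} (\<lambda>s. (\<phi>h s - \<phi> s * U s) / Zm s)"
    and "set_integrable (path_measure (\<lambda>t. real (P t))) {0<..T} (\<lambda>s. (\<phi>h s - \<phi> s * U s) / (Zm s + \<phi> s))"
    and "X T / Z T = X 0 / Z 0
      + (LINT s:{0<..T}|path_measure (\<lambda>t. real (P t)). (\<phi>h s - \<phi> s * U s) / (Zm s + \<phi> s))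
      - lam * (LINT s:{0<..T}|lborel. (\<phi>h s - \<phi> s * U s) / Zm s)
      - (LINT s:{0<..T}|path_measure A. (h s - U s) / Zm s)"
    and "(\<lambda>s. indicator {0<..T} s * Zm s) \<in> borel_measurable borel"
    and "\<And>s. s \<in> {0<..T} \<Longrightarrow> \<epsilon> \<le> Zm s"
proof -
  note \<phi> = drift_pathD(1)[OF dZ T] and \<phi>h = drift_pathD(1)[OF dX T] and h = drift_pathD(3)[OF dX T]
  define \<kappa>A \<kappa>P where "\<kappa>A = path_measure A" and "\<kappa>P = path_measure (\<lambda>t. real (P t))"
  let ?A = "\<lambda>s. if s < 0 then 0 else A s" and ?P = "\<lambda>s. if s < 0 then 0 else real (P s)"
  have rc: "rcmono ?A" "rcmono ?P" "rcmono (\<lambda>s. s)" using rcmono_path A P rcmono_scale[of 1] by auto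
  define \<nu> where "\<nu> = interval_measure (\<lambda>s. (?A s + s) + ?P s)"
  have rc': "rcmono (\<lambda>s. ?A s + s)" "rcmono (\<lambda>s. (?A s + s) + ?P s)" using rc by (auto intro!: rcmono_add)
  have \<nu>: "sigma_finite_measure \<nu>" "sets \<nu> = sets borel"
    unfolding \<nu>_def using rc' by (auto intro!: sigma_finite_interval_measure dest: rcmonoD)
  have sf: "sigma_finite_measure \<kappa>A" "sigma_finite_measure \<kappa>P" "sigma_finite_measure (lborel :: real measure)"
    unfolding \<kappa>A_def \<kappa>P_def using sigma_finite_path_measure A P by (auto intro: lborel.sigma_finite_measure_axioms)
  have sets: "sets \<kappa>A = sets borel" "sets \<kappa>P = sets borel" "sets lborel = sets borel" by (auto simp: \<kappa>A_def \<kappa>P_def)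
  have sm: "sum_of_measures \<nu> (interval_measure (\<lambda>s. ?A s + s)) \<kappa>P"
      "sum_of_measures (interval_measure (\<lambda>s. ?A s + s)) \<kappa>A lborel"
    unfolding \<nu>_def \<kappa>A_def \<kappa>P_def path_measure_def lborel_eq_real using rc rc' by (auto intro!: sum_of_interval_measures)
  have le: "emeasure \<kappa>A E \<le> emeasure \<nu> E" "emeasure \<kappa>P E \<le> emeasure \<nu> E" "emeasure lborel E \<le> emeasure \<nu> E"
    if "E \<in> sets borel" for E
  proof -
    have "emeasure \<nu> E = (emeasure \<kappa>A E + emeasure lborel E) + emeasure \<kappa>P E"
      using sm that \<nu>(2) by (auto simp: sum_of_measures_def)
    then show "emeasure \<kappa>A E \<le> emeasure \<nu> E" "emeasure \<kappa>P E \<le> emeasure \<nu> E" "emeasure lborel E \<le> emeasure \<nu> E"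
      by (auto intro: order_trans[OF _ add_increasing2] simp: add_increasing2 add_increasing)
  qed
  obtain a where a: "a \<in> borel_measurable borel" "\<And>s. 0 \<le> a s" "\<kappa>A = density \<nu> (\<lambda>s. ennreal (a s))"
    using dominated_real_density[OF \<nu> sf(1) sets(1) le(1)] by blast
  obtain n where n: "n \<in> borel_measurable borel" "\<And>s. 0 \<le> n s" "\<kappa>P = density \<nu> (\<lambda>s. ennreal (n s))"
    using dominated_real_density[OF \<nu> sf(2) sets(2) le(2)] by blast
  obtain l where l: "l \<in> borel_measurable borel" "\<And>s. 0 \<le> l s" "lborel = density \<nu> (\<lambda>s. ennreal (l s))"
    using dominated_real_density[OF \<nu> sf(3) sets(3) le(3)] by blast
  note dA = density_set_integral[OF \<nu>(2) a(1,2), folded a(3)]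
  note dP = density_set_integral[OF \<nu>(2) n(1,2), folded n(3)]
  note dL = density_set_integral[OF \<nu>(2) l(1,2), folded l(3)]
  have bor: "set_borel_measurable borel {0<..T} f" if "set_integrable \<kappa> {0<..T} f" "sets \<kappa> = sets borel"
    for f :: "real \<Rightarrow> real" and \<kappa>
    using that by (auto simp: set_borel_measurable_def set_integrable_def dest!: borel_measurable_integrable cong: measurable_cong_sets)
  have iP: "set_integrable \<kappa>P {0<..T} \<phi>" "set_integrable \<kappa>P {0<..T} \<phi>h" and one: "set_integrable \<kappa>A {0<..T} (\<lambda>_. 1::real)"
    unfolding \<kappa>P_def \<kappa>A_def by (rule drift_pathD[OF dZ T] drift_pathD[OF dX T])+
  have sub: "set_integrable \<kappa> S f" if "set_integrable \<kappa> {0<..T} f" "sets \<kappa> = sets borel" "S \<in> sets borel" "S \<subseteq> {0<..T}"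
    for S and f :: "real \<Rightarrow> real" and \<kappa>
    using set_integrable_subset[OF that(1) _ that(4)] that(2,3) by simp

  text \<open>Every integrator has a density with respect to \<open>\<nu>\<close>; this merges three integrals into one.\<close>
  have merge: "set_integrable \<nu> S (\<lambda>s. n s * f s - lam * (l s * g s) - a s * k s)"
     "(LINT s:S|\<nu>. n s * f s - lam * (l s * g s) - a s * k s)
       = ((LINT s:S|\<kappa>P. f s) - lam * (LINT s:S|lborel. g s)) - (LINT s:S|\<kappa>A. k s)"
    if "set_integrable \<kappa>P {0<..T} f" "set_integrable lborel {0<..T} g" "set_integrable \<kappa>A {0<..T} k"
       "S \<in> sets borel" "S \<subseteq> {0<..T}" for S f g k
  proof -
    have s: "set_integrable \<kappa>P S f" "set_integrable lborel S g" "set_integrable \<kappa>A S k"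
      using that sets by (auto intro!: sub)
    have i: "set_integrable \<nu> S (\<lambda>s. n s * f s)" "set_integrable \<nu> S (\<lambda>s. lam * (l s * g s))" "set_integrable \<nu> S (\<lambda>s. a s * k s)"
      using dP(1)[OF s(1)] dL(1)[OF s(2)] dA(1)[OF s(3)] by auto
    then show "set_integrable \<nu> S (\<lambda>s. n s * f s - lam * (l s * g s) - a s * k s)" by (intro set_integral_diff)
    show "(LINT s:S|\<nu>. n s * f s - lam * (l s * g s) - a s * k s)
       = ((LINT s:S|\<kappa>P. f s) - lam * (LINT s:S|lborel. g s)) - (LINT s:S|\<kappa>A. k s)"
      using i by (simp add: set_integral_diff dP(2)[OF s(1)] dL(2)[OF s(2)] dA(2)[OF s(3)])
  qed
  define x where "x = (\<lambda>s. n s * \<phi>h s - lam * (l s * \<phi>h s) - a s * h s)"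
  define z where "z = (\<lambda>s. n s * \<phi> s - lam * (l s * \<phi> s) - a s * 1)"
  note mx = merge[OF iP(2) \<phi>h h[folded \<kappa>A_def], folded x_def]
  note mz = merge[OF iP(1) \<phi> one, folded z_def]
  have xi: "set_integrable \<nu> {0<..T} x" and zi: "set_integrable \<nu> {0<..T} z" using mx(1) mz(1) by auto
  have X\<nu>: "X t = X 0 + (LINT s:{0<..t}|\<nu>. x s)" and Z\<nu>: "Z t = Z 0 + (LINT s:{0<..t}|\<nu>. z s)"
    if t: "0 \<le> t" "t \<le> T" for t
  proof -
    have S: "{0<..t} \<in> sets borel" "{0<..t} \<subseteq> {0<..T}" using t by auto
    show "X t = X 0 + (LINT s:{0<..t}|\<nu>. x s)" using drift_pathD(4)[OF dX t(1)] mx(2)[OF S] by (simp add: \<kappa>P_def \<kappa>A_def)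
    show "Z t = Z 0 + (LINT s:{0<..t}|\<nu>. z s)" using drift_pathD(4)[OF dZ t(1)] mz(2)[OF S] by (simp add: \<kappa>P_def \<kappa>A_def)
  qed
  define Xo where "Xo = (\<lambda>s. X 0 + (LINT u:{0<..<s}|\<nu>. x u))"
  define Zo where "Zo = (\<lambda>s. Z 0 + (LINT u:{0<..<s}|\<nu>. z u))"
  have lim: "(X \<longlongrightarrow> Xo s) (at_left s)" "(Z \<longlongrightarrow> Zo s) (at_left s)" if s: "0 < s" "s \<le> T" for s
  proof -
    have "((\<lambda>t. X 0 + (LINT s:{0<..t}|\<nu>. x s)) \<longlongrightarrow> Xo s) (at_left s)"
      unfolding Xo_def by (intro tendsto_add tendsto_const integral_left_limit[OF \<nu>(2) xi s])
    then show "(X \<longlongrightarrow> Xo s) (at_left s)"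
    proof (rule left_limit_cong_on[OF _ s(1)])
      show "X r = X 0 + (LINT s:{0<..r}|\<nu>. x s)" if "0 \<le> r" "r < s" for r
        by (rule X\<nu>) (use that s in linarith)+
    qed
    have "((\<lambda>t. Z 0 + (LINT s:{0<..t}|\<nu>. z s)) \<longlongrightarrow> Zo s) (at_left s)"
      unfolding Zo_def by (intro tendsto_add tendsto_const integral_left_limit[OF \<nu>(2) zi s])
    then show "(Z \<longlongrightarrow> Zo s) (at_left s)"
    proof (rule left_limit_cong_on[OF _ s(1)])
      show "Z r = Z 0 + (LINT s:{0<..r}|\<nu>. z s)" if "0 \<le> r" "r < s" for r
        by (rule Z\<nu>) (use that s in linarith)+
    qed
  qed
  then have ll: "left_limit X s = Xo s" "Zm s = Zo s" if s: "0 < s" "s \<le> T" for s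
    unfolding Zm_def using left_limit_eqI s by auto
  have Zo: "\<epsilon> \<le> Zo s" if s: "0 < s" "s \<le> T" for s
    unfolding Zo_def
  proof (rule open_integral_ge[OF \<nu>(2) zi _ s])
    fix r assume "0 \<le> r" "r < s"
    then have r: "0 \<le> r" "r \<le> T" using s by linarith+
    show "\<epsilon> \<le> Z 0 + (LINT u:{0<..r}|\<nu>. z u)" using \<epsilon>(2)[OF r] unfolding Z\<nu>[OF r] .
  qed
  show "\<And>s. s \<in> {0<..T} \<Longrightarrow> \<epsilon> \<le> Zm s" using Zo ll by auto
  have jump: "Z s = Zo s + \<phi> s * measure \<kappa>P {s}" if s: "0 < s" "s \<le> T" for s
    using tendsto_unique[OF _ lim(2)[OF s] drift_left_limit[OF dZ P s(1) atomless]] s by (simp add: \<kappa>P_def)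
  let ?J = "jump_times P"
  have mJ: "measure \<kappa>P {s} = 1" if "s \<in> ?J" for s using unit[OF that] by (simp add: measure_def \<kappa>P_def)
  have mnJ: "measure \<kappa>P {s} = 0" if "0 < s" "s \<notin> ?J" for s
  proof -
    have "{s} \<subseteq> {0<..} - ?J" using that by auto
    then have "{s} \<in> null_sets \<kappa>P" using emeasure_off_jump_times[OF P] by (auto intro: null_sets_subset simp: \<kappa>P_def)
    then show ?thesis by (simp add: measure_def null_sets_def)
  qed
  have jZ: "s \<in> ?J \<Longrightarrow> Z s = Zm s + \<phi> s" and njZ: "s \<notin> ?J \<Longrightarrow> Z s = Zm s" if "s \<in> {0<..T}" for s
    using jump[of s] mJ[of s] mnJ[of s] ll[of s] that by auto

  \<comment> \<open>Globally measurable functions that agree with the left limits on (0,T].\<close>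
  define Xb Zb where "Xb = (\<lambda>s. X 0 + (if s \<le> T then LINT u:{0<..<s}|\<nu>. x u else 0))"
    and "Zb = (\<lambda>s. Z 0 + (if s \<le> T then LINT u:{0<..<s}|\<nu>. z u else 0))"
  have [measurable]: "Xb \<in> borel_measurable borel" "Zb \<in> borel_measurable borel"
    unfolding Xb_def Zb_def
    using borel_measurable_open_integral[OF \<nu> xi] borel_measurable_open_integral[OF \<nu> zi] by auto
  have Ub: "U s = Xb s / Zb s" "Zm s = Zb s" if "s \<in> {0<..T}" for s
    using that ll[of s] by (auto simp: U_def Xb_def Zb_def Xo_def Zo_def Zm_def)
  have mZ: "(\<lambda>s. indicator {0<..T} s * Zm s) = (\<lambda>s. indicator {0<..T} s * Zb s)"
    using Ub by (auto simp: fun_eq_iff indicator_def)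
  show m1: "(\<lambda>s. indicator {0<..T} s * Zm s) \<in> borel_measurable borel" unfolding mZ by measurable
  \<comment> \<open>|X| is at most |X 0| plus the integral of |x| over (0,T], and Zm is at least
    \<epsilon>, so B bounds the ratio U.\<close>
  define B where "B = (\<bar>X 0\<bar> + (LINT u:{0<..T}|\<nu>. \<bar>x u\<bar>)) / \<epsilon>"
  have UB: "\<bar>U s\<bar> \<le> B" if s: "s \<in> {0<..T}" for s
  proof -
    have "\<bar>X r\<bar> \<le> \<bar>X 0\<bar> + (LINT u:{0<..T}|\<nu>. \<bar>x u\<bar>)" if "0 \<le> r" "r \<le> T" for r
      using set_integral_abs_le[OF \<nu>(2) xi that(2)] X\<nu>[OF that] by linarith
    then have "\<forall>\<^sub>F r in at_left s. \<bar>X r\<bar> \<le> \<bar>X 0\<bar> + (LINT u:{0<..T}|\<nu>. \<bar>x u\<bar>)"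
      using s by (intro eventually_at_leftI[of 0]) auto
    then have "\<bar>Xo s\<bar> \<le> \<bar>X 0\<bar> + (LINT u:{0<..T}|\<nu>. \<bar>x u\<bar>)"
      using s lim(1)[of s] by (intro tendsto_upperbound[OF tendsto_rabs]) auto
    then show ?thesis using Zo[of s] \<epsilon>(1) s unfolding U_def B_def using ll[of s]
      by (auto simp: abs_divide Zm_def intro!: frac_le)
  qed
  have intR: "set_integrable \<kappa> {0<..T} (\<lambda>s. (f s - g s * U s) / Zm s)"
    if f: "set_integrable \<kappa> {0<..T} f" and g: "set_integrable \<kappa> {0<..T} g" and \<kappa>: "sets \<kappa> = sets borel" for f g and \<kappa> :: "real measure"
    unfolding set_integrable_def
  proof (rule Bochner_Integration.integrable_bound)
    show "integrable \<kappa> (\<lambda>s. (\<bar>indicator {0<..T} s *\<^sub>R f s\<bar> + \<bar>B\<bar> * \<bar>indicator {0<..T} s *\<^sub>R g s\<bar>) / \<epsilon>)"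
      using f g by (auto simp: set_integrable_def intro!: Bochner_Integration.integrable_add integrable_abs integrable_mult_right)
    have "(\<lambda>s. indicator {0<..T} s *\<^sub>R ((f s - g s * U s) / Zm s)) =
      (\<lambda>s. (indicator {0<..T} s *\<^sub>R f s - (indicator {0<..T} s *\<^sub>R g s) * (Xb s / Zb s)) / Zb s)"
      using Ub by (auto simp: fun_eq_iff indicator_def)
    also have "\<dots> \<in> borel_measurable borel"
      using bor[OF f \<kappa>] bor[OF g \<kappa>] unfolding set_borel_measurable_def by measurable
    finally show "(\<lambda>s. indicator {0<..T} s *\<^sub>R ((f s - g s * U s) / Zm s)) \<in> borel_measurable \<kappa>"
      using \<kappa> by (simp cong: measurable_cong_sets)
    have "\<bar>(f s - g s * U s) / Zm s\<bar> \<le> (\<bar>f s\<bar> + \<bar>B\<bar> * \<bar>g s\<bar>) / \<epsilon>" if s: "s \<in> {0<..T}" for s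
    proof -
      have "\<bar>f s - g s * U s\<bar> \<le> \<bar>f s\<bar> + \<bar>g s\<bar> * \<bar>U s\<bar>" by (metis abs_mult abs_triangle_ineq4)
      also have "\<dots> \<le> \<bar>f s\<bar> + \<bar>g s\<bar> * \<bar>B\<bar>" using UB[OF s] by (intro add_left_mono mult_left_mono) auto
      finally show ?thesis using Zo[of s] ll(2)[of s] s \<epsilon>(1) by (auto simp: abs_divide mult.commute intro!: frac_le)
    qed
    then show "AE s in \<kappa>. norm (indicator {0<..T} s *\<^sub>R ((f s - g s * U s) / Zm s))
       \<le> norm ((\<bar>indicator {0<..T} s *\<^sub>R f s\<bar> + \<bar>B\<bar> * \<bar>indicator {0<..T} s *\<^sub>R g s\<bar>) / \<epsilon>)"
      using \<epsilon>(1) by (auto simp: indicator_def)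
  qed
  show iA: "set_integrable (path_measure A) {0<..T} (\<lambda>s. (h s - U s) / Zm s)"
    using intR[OF h one[unfolded \<kappa>A_def]] by simp
  show iL: "set_integrable lborel {0<..T} (\<lambda>s. (\<phi>h s - \<phi> s * U s) / Zm s)"
    using intR[OF \<phi>h \<phi>] by simp
  show iK: "set_integrable (path_measure (\<lambda>t. real (P t))) {0<..T} (\<lambda>s. (\<phi>h s - \<phi> s * U s) / (Zm s + \<phi> s))"
  proof (rule set_integrable_counting[OF P])
    have "(\<lambda>s. indicator {0<..T} s *\<^sub>R ((\<phi>h s - \<phi> s * U s) / (Zm s + \<phi> s))) =
      (\<lambda>s. (indicator {0<..T} s *\<^sub>R \<phi>h s - (indicator {0<..T} s *\<^sub>R \<phi> s) * (Xb s / Zb s)) / (Zb s + indicator {0<..T} s *\<^sub>R \<phi> s))"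
      using Ub by (auto simp: fun_eq_iff indicator_def)
    also have "\<dots> \<in> borel_measurable borel"
      using bor[OF \<phi>] bor[OF \<phi>h] unfolding set_borel_measurable_def by measurable
    finally show "set_borel_measurable borel {0<..T} (\<lambda>s. (\<phi>h s - \<phi> s * U s) / (Zm s + \<phi> s))"
      by (simp add: set_borel_measurable_def)
  qed
  \<comment> \<open>The candidate for the density of X / Z with respect to \<nu>.\<close>
  define w where "w = (\<lambda>s. n s * ((\<phi>h s - \<phi> s * U s) / (Zm s + \<phi> s)) - lam * (l s * ((\<phi>h s - \<phi> s * U s) / Zm s)) - a s * ((h s - U s) / Zm s))"
  note mw = merge[OF iK[folded \<kappa>P_def] iL iA[folded \<kappa>A_def], folded w_def]
  have wi: "set_integrable \<nu> {0<..T} w" using mw(1) by auto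
  \<comment> \<open>A density with respect to \<nu> vanishes \<nu>-almost everywhere off a set that
    carries its measure. The next facts apply this to the other two densities, for which the
    countable set of jump times is null.\<close>
  have aen: "AE s in \<nu>. 0 < s \<longrightarrow> n s \<noteq> 0 \<longrightarrow> s \<in> ?J"
  proof -
    have "AE s in \<kappa>P. 0 < s \<longrightarrow> s \<in> ?J" using AE_jump_times[OF P] unfolding \<kappa>P_def[symmetric] .
    then show ?thesis unfolding n(3) using n(1,2) \<nu>(2)
      by (subst (asm) AE_density) (auto cong: measurable_cong_sets elim!: eventually_mono simp: less_le)
  qed
  have nullJ: "?J \<in> null_sets \<kappa>A" "?J \<in> null_sets lborel"
  proof -
    have "?J = (\<Union>s\<in>?J. {s})" by auto
    moreover have "(\<Union>s\<in>?J. {s}) \<in> null_sets \<kappa>A"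
      using countable_jump_times[OF P] atomless
      by (intro null_sets_UN') (auto intro!: null_setsI simp: \<kappa>A_def jump_times_def)
    ultimately show "?J \<in> null_sets \<kappa>A" by simp
    show "?J \<in> null_sets lborel" using countable_jump_times[OF P] by (rule countable_imp_null_set_lborel)
  qed
  have aea: "AE s in \<nu>. a s \<noteq> 0 \<longrightarrow> s \<notin> ?J"
    using AE_not_in[OF nullJ(1)] unfolding a(3) using a(1,2) \<nu>(2)
    by (subst (asm) AE_density) (auto cong: measurable_cong_sets elim!: eventually_mono simp: less_le)
  have ael: "AE s in \<nu>. l s \<noteq> 0 \<longrightarrow> s \<notin> ?J"
    using AE_not_in[OF nullJ(2)] unfolding l(3) using l(1,2) \<nu>(2)
    by (subst (asm) AE_density) (auto cong: measurable_cong_sets elim!: eventually_mono simp: less_le)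
  have "AE s in \<nu>. s \<in> {0<..T} \<longrightarrow> Z s * w s = x s - Xo s / Zo s * z s"
    using aen aea ael
  proof eventually_elim
    case (elim s)
    show ?case
    proof
      assume s: "s \<in> {0<..T}"
      have U: "Xo s / Zo s = U s" and Zmo: "Zm s = Zo s" using ll[of s] s by (auto simp: U_def Zm_def)
      have Zs: "Z s \<noteq> 0" "Zm s \<noteq> 0" using \<epsilon>(2)[of s] \<epsilon>(1) Zo[of s] s Zmo by auto
      show "Z s * w s = x s - Xo s / Zo s * z s"
      proof (cases "s \<in> ?J")
        case True
        then have "a s = 0" "l s = 0" "Z s = Zm s + \<phi> s" using elim jZ s by auto
        then have "w s = n s * ((\<phi>h s - \<phi> s * U s) / Z s)" by (simp add: w_def)
        then have "Z s * w s = n s * (\<phi>h s - \<phi> s * U s)" using Zs by simp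
        then show ?thesis unfolding U using \<open>a s = 0\<close> \<open>l s = 0\<close> by (simp add: x_def z_def algebra_simps)
      next
        case False
        then have "n s = 0" "Z s = Zm s" using elim njZ s by auto
        then have "w s = - (lam * l s * (\<phi>h s - \<phi> s * U s) + a s * (h s - U s)) / Z s"
        proof -
          have alg: "- (lam * (l' * (p / c))) - a' * (q / c) = - (lam * l' * p + a' * q) / c" for l' p a' q c :: real
            by (simp add: diff_divide_distrib)
          show ?thesis
            unfolding w_def \<open>n s = 0\<close> \<open>Z s = Zm s\<close> mult_zero_left diff_0 by (rule alg)
        qed
        then have "Z s * w s = - (lam * l s * (\<phi>h s - \<phi> s * U s) + a s * (h s - U s))" using Zs by simp
        then show ?thesis unfolding U using \<open>n s = 0\<close> by (simp add: x_def z_def algebra_simps)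
      qed
    qed
  qed
  then have "AE s in \<nu>. s \<in> {0<..T} \<longrightarrow> (Z 0 + (LINT u:{0<..s}|\<nu>. z u)) * w s = x s - Xo s / Zo s * z s"
  proof eventually_elim
    case (elim s)
    show ?case
    proof
      assume s: "s \<in> {0<..T}"
      then have s': "0 \<le> s" "s \<le> T" by auto
      show "(Z 0 + (LINT u:{0<..s}|\<nu>. z u)) * w s = x s - Xo s / Zo s * z s"
        using elim s unfolding Z\<nu>[OF s'] by blast
    qed
  qed
  moreover have "\<epsilon> \<le> Z 0 + (LINT u:{0<..s}|\<nu>. z u)" if "0 \<le> s" "s \<le> T" for s
    using \<epsilon>(2)[OF that] unfolding Z\<nu>[OF that] .
  ultimately have "X T / Z T = X 0 / Z 0 + (LINT s:{0<..T}|\<nu>. w s)"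
    unfolding X\<nu>[OF T order_refl] Z\<nu>[OF T order_refl] Xo_def Zo_def
    by (intro quotient_rule[OF \<nu> T xi zi wi \<epsilon>(1)])
  then show "X T / Z T = X 0 / Z 0
      + (LINT s:{0<..T}|path_measure (\<lambda>t. real (P t)). (\<phi>h s - \<phi> s * U s) / (Zm s + \<phi> s))
      - lam * (LINT s:{0<..T}|lborel. (\<phi>h s - \<phi> s * U s) / Zm s)
      - (LINT s:{0<..T}|path_measure A. (h s - U s) / Zm s)"
    using mw(2)[of "{0<..T}"] by (simp add: \<kappa>P_def \<kappa>A_def)
qed

section \<open>Random measures\<close>

lemma emeasure_path_measure_atMost:
  assumes f: "increasing_path f" and T: "0 \<le> T"
  shows "emeasure (path_measure f) ({..x} \<inter> {0..T}) = (if 0 \<le> x then ennreal (f (min x T)) else 0)"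
proof (cases "0 \<le> x")
  case True
  have "{..x} \<inter> {0..T} = {0..min x T}" by auto
  then show ?thesis using True T by (simp add: emeasure_path_measure_Icc[OF f])
next
  case False
  then have "{..x} \<inter> {0..T} = {}" by auto
  then show ?thesis using False by (simp only:) simp
qed

text \<open>Restriction to [0,T] makes all masses finite, so that the complement step may subtract.
  Only V t with t \<le> T enters; integrals up to T are therefore measurable with respect to what is
  known at T.\<close>

lemma path_kernel_measurable_set:
  assumes inc: "\<And>w. w \<in> space S \<Longrightarrow> increasing_path (\<lambda>t. V t w)"
    and V: "\<And>t. 0 \<le> t \<Longrightarrow> t \<le> T \<Longrightarrow> V t \<in> borel_measurable S" and T: "0 \<le> T"
    and E: "E \<in> sets borel"
  shows "(\<lambda>w. emeasure (path_measure (\<lambda>t. V t w)) (E \<inter> {0..T})) \<in> borel_measurable S"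
proof -
  have E': "E \<in> sigma_sets UNIV (range (\<lambda>a::real. {..a}))"
    using E unfolding borel_eq_atMost by simp
  have int: "Int_stable (range (\<lambda>a::real. {..a}))"
    by (auto simp: Int_stable_def)
  have "range (\<lambda>a::real. {..a}) \<subseteq> Pow UNIV" by auto
  from int this E' show ?thesis
  proof (induction rule: sigma_sets_induct_disjoint)
    case (basic A)
    then obtain x where A: "A = {..x}" by auto
    have "(\<lambda>w. if 0 \<le> x then ennreal (V (min x T) w) else 0) \<in> borel_measurable S"
      using V[of "min x T"] T by (cases "0 \<le> x") auto
    then show ?case
      by (subst measurable_cong[OF emeasure_path_measure_atMost[OF inc T, of _ x, folded A]]) auto
  next
    case empty
    show ?case by simp
  next
    case (compl A)
    have A: "A \<in> sets borel" using compl(1) unfolding borel_eq_atMost by simp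
    have "emeasure (path_measure (\<lambda>t. V t w)) ((UNIV - A) \<inter> {0..T}) =
        ennreal (V T w) - emeasure (path_measure (\<lambda>t. V t w)) (A \<inter> {0..T})" if w: "w \<in> space S" for w
    proof -
      have "(UNIV - A) \<inter> {0..T} = {0..T} - A \<inter> {0..T}" by auto
      moreover have "emeasure (path_measure (\<lambda>t. V t w)) (A \<inter> {0..T}) \<noteq> \<infinity>"
        using emeasure_mono[of "A \<inter> {0..T}" "{0..T}" "path_measure (\<lambda>t. V t w)"]
          emeasure_path_measure_Icc[OF inc[OF w] T] by (auto simp: top_unique)
      ultimately show ?thesis using A emeasure_path_measure_Icc[OF inc[OF w] T]
        by (simp only:, subst emeasure_Diff) auto
    qed
    then show ?case using compl(2) V[of T] T by (simp cong: measurable_cong)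
  next
    case (union A)
    have A: "A i \<in> sets borel" for i using union(2) unfolding borel_eq_atMost by auto
    have "emeasure (path_measure (\<lambda>t. V t w)) (\<Union> (range A) \<inter> {0..T}) =
        (\<Sum>i. emeasure (path_measure (\<lambda>t. V t w)) (A i \<inter> {0..T}))" for w
    proof -
      have "\<Union> (range A) \<inter> {0..T} = (\<Union>i. A i \<inter> {0..T})" by auto
      then show ?thesis using A union(1)
        by (subst suminf_emeasure) (auto simp: disjoint_family_on_def)
    qed
    then show ?case using union(3) by simp
  qed
qed

text \<open>The same induction over measurable rectangles, so that the measured set may depend on
  the path.\<close>

lemma path_kernel_measurable_pair_set:
  assumes inc: "\<And>w. w \<in> space S \<Longrightarrow> increasing_path (\<lambda>t. V t w)"
    and V: "\<And>t. 0 \<le> t \<Longrightarrow> t \<le> T \<Longrightarrow> V t \<in> borel_measurable S" and T: "0 \<le> T"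
    and E: "E \<in> sets (borel \<Otimes>\<^sub>M S)"
  shows "(\<lambda>w. emeasure (path_measure (\<lambda>t. V t w)) ({s. (s, w) \<in> E} \<inter> {0..T})) \<in> borel_measurable S"
proof -
  have sec: "{s. (s, w) \<in> A} \<in> sets borel" if "A \<in> sets (borel \<Otimes>\<^sub>M S)" for A w
    using sets_Pair2[OF that, of w] by (simp add: vimage_def)
  have E': "E \<in> sigma_sets (space borel \<times> space S) {a \<times> b |a b. a \<in> sets borel \<and> b \<in> sets S}"
    using E unfolding sets_pair_measure .
  have int: "Int_stable {a \<times> b |a b. a \<in> sets borel \<and> b \<in> sets S}" by (rule Int_stable_pair_measure_generator)
  have "{a \<times> b |a b. a \<in> sets borel \<and> b \<in> sets S} \<subseteq> Pow (space borel \<times> space S)"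
    using sets.space_closed[of S] by auto
  from int this E' show ?thesis
  proof (induction rule: sigma_sets_induct_disjoint)
    case (basic A)
    then obtain a b where A: "A = a \<times> b" "a \<in> sets borel" "b \<in> sets S" by auto
    have "emeasure (path_measure (\<lambda>t. V t w)) ({s. (s, w) \<in> A} \<inter> {0..T}) =
      indicator b w * emeasure (path_measure (\<lambda>t. V t w)) (a \<inter> {0..T})" for w
      unfolding A by (cases "w \<in> b") auto
    then show ?case using path_kernel_measurable_set[OF inc V T A(2)] A(3) by simp
  next
    case empty
    show ?case by simp
  next
    case (compl A)
    have A: "A \<in> sets (borel \<Otimes>\<^sub>M S)" using compl(1) unfolding sets_pair_measure .
    have "emeasure (path_measure (\<lambda>t. V t w)) ({s. (s, w) \<in> space borel \<times> space S - A} \<inter> {0..T}) =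
        ennreal (V T w) - emeasure (path_measure (\<lambda>t. V t w)) ({s. (s, w) \<in> A} \<inter> {0..T})" if w: "w \<in> space S" for w
    proof -
      have "{s. (s, w) \<in> space borel \<times> space S - A} \<inter> {0..T} = {0..T} - {s. (s, w) \<in> A} \<inter> {0..T}" using w by auto
      moreover have "emeasure (path_measure (\<lambda>t. V t w)) ({s. (s, w) \<in> A} \<inter> {0..T}) \<noteq> \<infinity>"
        using emeasure_mono[of "{s. (s, w) \<in> A} \<inter> {0..T}" "{0..T}" "path_measure (\<lambda>t. V t w)"]
          emeasure_path_measure_Icc[OF inc[OF w] T] by (auto simp: top_unique)
      ultimately show ?thesis using sec[OF A] emeasure_path_measure_Icc[OF inc[OF w] T]
        by (simp only:, subst emeasure_Diff) auto
    qed
    then show ?case using compl(2) V[of T] T by (simp cong: measurable_cong)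
  next
    case (union A)
    have A: "A i \<in> sets (borel \<Otimes>\<^sub>M S)" for i using union(2) unfolding sets_pair_measure by auto
    have "emeasure (path_measure (\<lambda>t. V t w)) ({s. (s, w) \<in> \<Union> (range A)} \<inter> {0..T}) =
        (\<Sum>i. emeasure (path_measure (\<lambda>t. V t w)) ({s. (s, w) \<in> A i} \<inter> {0..T}))" for w
    proof -
      have "{s. (s, w) \<in> \<Union> (range A)} \<inter> {0..T} = (\<Union>i. {s. (s, w) \<in> A i} \<inter> {0..T})" by auto
      moreover have "disjoint_family (\<lambda>i. {s. (s, w) \<in> A i} \<inter> {0..T})"
        using union(1) unfolding disjoint_family_on_def by blast
      ultimately show ?thesis using sec[OF A] by (subst suminf_emeasure) auto
    qed
    then show ?case using union(3) by simp
  qed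
qed

lemma path_kernel_measurable:
  assumes inc: "\<And>w. w \<in> space S \<Longrightarrow> increasing_path (\<lambda>t. V t w)"
    and V: "\<And>t. 0 \<le> t \<Longrightarrow> t \<le> T \<Longrightarrow> V t \<in> borel_measurable S" and T: "0 \<le> T"
    and H: "H \<in> borel_measurable (borel \<Otimes>\<^sub>M S)"
  shows "(\<lambda>w. \<integral>\<^sup>+s. H (s, w) * indicator {0..T} s \<partial>path_measure (\<lambda>t. V t w)) \<in> borel_measurable S"
  using H
proof (induction rule: borel_measurable_induct)
  case (cong f g)
  have "(\<integral>\<^sup>+s. f (s, w) * indicator {0..T} s \<partial>path_measure (\<lambda>t. V t w)) =
     (\<integral>\<^sup>+s. g (s, w) * indicator {0..T} s \<partial>path_measure (\<lambda>t. V t w))" if "w \<in> space S" for w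
    using cong(3)[of "(_, w)"] that by (intro nn_integral_cong) (simp add: space_pair_measure)
  then show ?case using cong(4) by (simp cong: measurable_cong)
next
  case (set A)
  have sec: "{s. (s, w) \<in> A} \<in> sets borel" for w
    using sets_Pair2[OF set, of w] by (simp add: vimage_def)
  have "(\<integral>\<^sup>+s. indicator A (s, w) * indicator {0..T} s \<partial>path_measure (\<lambda>t. V t w)) =
     emeasure (path_measure (\<lambda>t. V t w)) ({s. (s, w) \<in> A} \<inter> {0..T})" for w
  proof -
    have "(\<integral>\<^sup>+s. indicator A (s, w) * indicator {0..T} s \<partial>path_measure (\<lambda>t. V t w)) =
      (\<integral>\<^sup>+s. indicator ({s. (s, w) \<in> A} \<inter> {0..T}) s \<partial>path_measure (\<lambda>t. V t w))"
      by (intro nn_integral_cong) (auto simp: indicator_def)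
    then show ?thesis using sec[of w] by simp
  qed
  then show ?case using path_kernel_measurable_pair_set[OF inc V T set] by simp
next
  case (mult u c)
  have [measurable]: "(\<lambda>s. u (s, w)) \<in> borel_measurable borel" if "w \<in> space S" for w
    using measurable_compose[OF measurable_Pair2'[OF that] mult(2)] by simp
  have "(\<integral>\<^sup>+s. c * u (s, w) * indicator {0..T} s \<partial>path_measure (\<lambda>t. V t w)) =
    c * (\<integral>\<^sup>+s. u (s, w) * indicator {0..T} s \<partial>path_measure (\<lambda>t. V t w))" if "w \<in> space S" for w
    unfolding mult.assoc using that by (subst nn_integral_cmult) auto
  then show ?case using mult(4) by (simp cong: measurable_cong)
next
  case (add u v)
  have [measurable]: "(\<lambda>s. u (s, w)) \<in> borel_measurable borel" "(\<lambda>s. v (s, w)) \<in> borel_measurable borel" if "w \<in> space S" for w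
    using measurable_compose[OF measurable_Pair2'[OF that] add(1)] measurable_compose[OF measurable_Pair2'[OF that] add(3)] by simp_all
  have "(\<integral>\<^sup>+s. (v (s, w) + u (s, w)) * indicator {0..T} s \<partial>path_measure (\<lambda>t. V t w)) =
    (\<integral>\<^sup>+s. v (s, w) * indicator {0..T} s \<partial>path_measure (\<lambda>t. V t w)) +
    (\<integral>\<^sup>+s. u (s, w) * indicator {0..T} s \<partial>path_measure (\<lambda>t. V t w))" if "w \<in> space S" for w
    unfolding distrib_right using that by (subst nn_integral_add) auto
  then show ?case using add(6,7) by (simp cong: measurable_cong)
next
  case (seq U)
  have [measurable]: "(\<lambda>s. U i (s, w)) \<in> borel_measurable borel" if "w \<in> space S" for i w
    using measurable_compose[OF measurable_Pair2'[OF that] seq(1)] by simp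
  have "(\<integral>\<^sup>+s. (SUP i. U i) (s, w) * indicator {0..T} s \<partial>path_measure (\<lambda>t. V t w)) =
    (SUP i. \<integral>\<^sup>+s. U i (s, w) * indicator {0..T} s \<partial>path_measure (\<lambda>t. V t w))" if "w \<in> space S" for w
  proof -
    have "(\<integral>\<^sup>+s. (SUP i. U i) (s, w) * indicator {0..T} s \<partial>path_measure (\<lambda>t. V t w)) =
       (\<integral>\<^sup>+s. (SUP i. U i (s, w) * indicator {0..T} s) \<partial>path_measure (\<lambda>t. V t w))"
      by (intro nn_integral_cong) (auto simp: indicator_def image_comp)
    also have "\<dots> = (SUP i. \<integral>\<^sup>+s. U i (s, w) * indicator {0..T} s \<partial>path_measure (\<lambda>t. V t w))"
      using that seq(3) by (intro nn_integral_monotone_convergence_SUP)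
        (auto simp: incseq_def le_fun_def intro!: mult_right_mono)
    finally show ?thesis .
  qed
  then show ?case using seq(5) by (simp cong: measurable_cong)
qed

lemma nn_integral_SUP_Icc:
  assumes "(\<lambda>s. f s * indicator {0..} s) \<in> borel_measurable \<kappa>" "sets \<kappa> = sets borel"
  shows "(\<integral>\<^sup>+s. f s * indicator {0..} s \<partial>\<kappa>) = (SUP n. \<integral>\<^sup>+s. f s * indicator {0..real n} s \<partial>\<kappa>)"
proof -
  have e: "f s * indicator {0..real n} s = (f s * indicator {0..} s) * indicator {0..real n} s" for s n
    by (auto simp: indicator_def)
  have "(SUP n. \<integral>\<^sup>+s. f s * indicator {0..real n} s \<partial>\<kappa>) = (\<integral>\<^sup>+s. (SUP n. f s * indicator {0..real n} s) \<partial>\<kappa>)"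
  proof (rule nn_integral_monotone_convergence_SUP[symmetric])
    show "incseq (\<lambda>n s. f s * indicator {0..real n} s)"
      by (auto simp: incseq_def le_fun_def indicator_def)
    show "(\<lambda>s. f s * indicator {0..real n} s) \<in> borel_measurable \<kappa>" for n
      unfolding e using assms by measurable
  qed
  also have "\<dots> = (\<integral>\<^sup>+s. f s * indicator {0..} s \<partial>\<kappa>)"
  proof (rule nn_integral_cong)
    fix s :: real
    obtain n where n: "s \<le> real n" using real_arch_simple by blast
    show "(SUP n. f s * indicator {0..real n} s) = f s * indicator {0..} s"
    proof (rule antisym)
      show "(SUP n. f s * indicator {0..real n} s) \<le> f s * indicator {0..} s"
        by (intro SUP_least) (auto simp: indicator_def)
      have "f s * indicator {0..} s = f s * indicator {0..real n} s" using n by (auto simp: indicator_def)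
      also have "\<dots> \<le> (SUP n. f s * indicator {0..real n} s)" by (intro SUP_upper) simp
      finally show "f s * indicator {0..} s \<le> (SUP n. f s * indicator {0..real n} s)" .
    qed
  qed
  finally show ?thesis by simp
qed

lemma path_kernel_measurable_Ici:
  assumes inc: "\<And>w. w \<in> space S \<Longrightarrow> increasing_path (\<lambda>t. V t w)"
    and V: "\<And>t. 0 \<le> t \<Longrightarrow> V t \<in> borel_measurable S"
    and H: "H \<in> borel_measurable (borel \<Otimes>\<^sub>M S)"
  shows "(\<lambda>w. \<integral>\<^sup>+s. H (s, w) * indicator {0..} s \<partial>path_measure (\<lambda>t. V t w)) \<in> borel_measurable S"
proof -
  have m: "(\<lambda>s. H (s, w) * indicator {0..} s) \<in> borel_measurable (path_measure (\<lambda>t. V t w))" if "w \<in> space S" for w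
    using measurable_compose[OF measurable_Pair2'[OF that] H] by simp
  have "(\<lambda>w. SUP n. \<integral>\<^sup>+s. H (s, w) * indicator {0..real n} s \<partial>path_measure (\<lambda>t. V t w)) \<in> borel_measurable S"
    using path_kernel_measurable[OF inc V _ H] by (intro borel_measurable_SUP) auto
  then show ?thesis by (subst measurable_cong[OF nn_integral_SUP_Icc[OF m]]) auto
qed

section \<open>Predictable and optional processes\<close>

text \<open>The sigma-algebras contain all null sets of the completion, so they are compared with
  \<open>completion M\<close> and not with \<open>M\<close>.\<close>

locale filtered_space = prob_space M for M :: "'a measure" +
  fixes F :: "ennreal \<Rightarrow> 'a measure"
  assumes filt: "filtration (space M) F"
    and F_sub: "\<And>t. sets (F t) \<subseteq> sets (completion M)"
    and F_null: "\<And>t. null_sets (completion M) \<subseteq> sets (F t)"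
begin

abbreviation "CM \<equiv> completion M"

sublocale C: prob_space CM by (rule prob_space_completion)

lemma space_F[simp]: "space (F t) = space M"
  using filt by (rule filtration.space_F)

lemma sets_F_mono: "s \<le> t \<Longrightarrow> sets (F s) \<subseteq> sets (F t)"
  using filt by (rule filtration.sets_F_mono)

lemma subalgebra_F: "subalgebra CM (F t)"
  using F_sub by (auto simp: subalgebra_def)

lemma F_measurable_CM: "f \<in> borel_measurable (F t) \<Longrightarrow> f \<in> borel_measurable CM"
  using subalgebra_F by (rule measurable_from_subalg)

lemma F_measurable_mono: "f \<in> borel_measurable (F s) \<Longrightarrow> s \<le> t \<Longrightarrow> f \<in> borel_measurable (F t)"
  by (erule measurable_from_subalg[rotated]) (simp add: subalgebra_def sets_F_mono)

lemma sigma_finite_F: "sigma_finite_subalgebra CM (F t)"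
  by (intro finite_measure_subalgebra_is_sigma_finite finite_measure_subalgebra.intro
      finite_measure_subalgebra_axioms.intro subalgebra_F C.finite_measure_axioms)

abbreviation "PA \<equiv> predictable_algebra M F"
abbreviation "OA \<equiv> optional_algebra M F"

lemma PA_gens: "{{0} \<times> B |B. B \<in> sets (F 0)} \<union>
        {{s<..t} \<times> B |s t B. 0 \<le> s \<and> s < t \<and> B \<in> sets (F (ennreal s))} \<subseteq> Pow ({0..} \<times> space M)"
  using sets.sets_into_space[of _ "F _"] by auto

lemma space_PA[simp]: "space PA = {0..} \<times> space M"
  unfolding predictable_algebra_def using PA_gens by (rule space_measure_of)

lemma sets_PA: "sets PA = sigma_sets ({0..} \<times> space M) ({{0} \<times> B |B. B \<in> sets (F 0)} \<union>
        {{s<..t} \<times> B |s t B. 0 \<le> s \<and> s < t \<and> B \<in> sets (F (ennreal s))})"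
  unfolding predictable_algebra_def using PA_gens by (rule sets_measure_of)

lemma space_OA[simp]: "space OA = {0..} \<times> space M"
  unfolding optional_algebra_def by (rule space_measure_of) auto

lemma sets_OA: "sets OA = sigma_sets ({0..} \<times> space M)
       {{(t, w) \<in> {0..} \<times> space M. X t w \<in> B} |X B.
          adapted F X \<and> (\<forall>w\<in>space M. cadlag (\<lambda>t. X t w)) \<and> B \<in> sets borel}"
  unfolding optional_algebra_def by (rule sets_measure_of) auto

lemma PA_zero: "B \<in> sets (F 0) \<Longrightarrow> {0} \<times> B \<in> sets PA"
  unfolding sets_PA by (auto intro!: sigma_sets.Basic)

lemma PA_Ioc: "0 \<le> s \<Longrightarrow> B \<in> sets (F (ennreal s)) \<Longrightarrow> {s<..t} \<times> B \<in> sets PA"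
  unfolding sets_PA by (cases "s < t") (auto intro!: sigma_sets.Basic sigma_sets.Empty)

lemma PA_Ioi: assumes "0 \<le> s" "B \<in> sets (F (ennreal s))" shows "{s<..} \<times> B \<in> sets PA"
proof -
  have "{s<..} \<times> B = (\<Union>n. {s<..real n} \<times> B)"
    using real_arch_simple by auto
  also have "\<dots> \<in> sets PA" using PA_Ioc[OF assms] by auto
  finally show ?thesis .
qed

text \<open>Predictable sets are progressive: up to time T a generator involves only events of F_T.
  This is why integrals of predictable processes up to T are adapted.\<close>

lemma PA_progressive:
  assumes "0 \<le> T" "E \<in> sets PA"
  shows "E \<inter> ({0..T} \<times> space M) \<in> sets (borel \<Otimes>\<^sub>M F (ennreal T))"
  using assms(2) unfolding sets_PA
proof (induction rule: sigma_sets.induct)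
  case (Basic a)
  then consider B where "a = {0} \<times> B" "B \<in> sets (F 0)"
    | s t B where "a = {s<..t} \<times> B" "0 \<le> s" "B \<in> sets (F (ennreal s))" by blast
  then show ?case
  proof cases
    case 1
    have "B \<in> sets (F (ennreal T))" using 1 sets_F_mono[of 0 "ennreal T"] by auto
    moreover have "a \<inter> ({0..T} \<times> space M) = {0} \<times> B" using 1 assms(1) sets.sets_into_space[OF 1(2)] by auto
    ultimately show ?thesis by simp
  next
    case 2
    show ?thesis
    proof (cases "s \<le> T")
      case True
      then have "B \<in> sets (F (ennreal T))" using 2 sets_F_mono[of "ennreal s" "ennreal T"] by (auto simp: ennreal_leI)
      moreover have "a \<inter> ({0..T} \<times> space M) = ({s<..t} \<inter> {0..T}) \<times> B" using 2 sets.sets_into_space[OF 2(3)] by auto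
      ultimately show ?thesis by (simp add: pair_measureI)
    next
      case False
      then have "a \<inter> ({0..T} \<times> space M) = {}" using 2 by auto
      then show ?thesis by simp
    qed
  qed
next
  case (Compl a)
  have "({0..} \<times> space M - a) \<inter> ({0..T} \<times> space M) = {0..T} \<times> space M - a \<inter> ({0..T} \<times> space M)" by auto
  moreover have "{0..T} \<times> space M \<in> sets (borel \<Otimes>\<^sub>M F (ennreal T))"
    using sets.top[of "F (ennreal T)"] by (intro pair_measureI) auto
  ultimately show ?case using Compl by auto
next
  case (Union a)
  have "\<Union> (range a) \<inter> ({0..T} \<times> space M) = (\<Union>i. a i \<inter> ({0..T} \<times> space M))" by auto
  also have "\<dots> \<in> sets (borel \<Otimes>\<^sub>M F (ennreal T))" using Union by blast
  finally show ?case .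
qed simp

lemma Omega_pair: "{0::real..} \<times> space M \<in> sets (borel \<Otimes>\<^sub>M CM)"
  using sets.top[of CM] by (intro pair_measureI) auto

lemma PA_subset_pair: "sets PA \<subseteq> sets (borel \<Otimes>\<^sub>M CM)"
proof
  fix E assume "E \<in> sets PA"
  then show "E \<in> sets (borel \<Otimes>\<^sub>M CM)" unfolding sets_PA
  proof (induction rule: sigma_sets.induct)
    case (Basic a)
    then consider B where "a = {0} \<times> B" "B \<in> sets (F 0)"
      | s t B where "a = {s<..t} \<times> B" "0 \<le> s" "B \<in> sets (F (ennreal s))" by blast
    then show ?case using F_sub by cases (auto intro!: pair_measureI)
  next
    case (Compl a) then show ?case using Omega_pair by auto
  qed auto
qed

lemma PA_section: "0 \<le> t \<Longrightarrow> (\<lambda>w. (t, w)) \<in> F (ennreal t) \<rightarrow>\<^sub>M PA"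
  unfolding predictable_algebra_def
proof (rule measurable_measure_of[OF PA_gens])
  show "(\<lambda>w. (t, w)) \<in> space (F (ennreal t)) \<rightarrow> {0..} \<times> space M" if "0 \<le> t" using that by auto
  fix y assume t: "0 \<le> t" and "y \<in> {{0} \<times> B |B. B \<in> sets (F 0)} \<union> {{s<..t} \<times> B |s t B. 0 \<le> s \<and> s < t \<and> B \<in> sets (F (ennreal s))}"
  then consider B where "y = {0} \<times> B" "B \<in> sets (F 0)"
    | s u B where "y = {s<..u} \<times> B" "0 \<le> s" "B \<in> sets (F (ennreal s))" by blast
  then show "(\<lambda>w. (t, w)) -` y \<inter> space (F (ennreal t)) \<in> sets (F (ennreal t))"
  proof cases
    case 1
    then show ?thesis using sets.sets_into_space[OF 1(2)] t by (cases "t = 0") (auto simp: vimage_def Int_absorb2)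
  next
    case 2
    show ?thesis
    proof (cases "s < t \<and> t \<le> u")
      case True
      then have "(\<lambda>w. (t, w)) -` y \<inter> space (F (ennreal t)) = B" using 2 sets.sets_into_space[OF 2(3)] by auto
      then show ?thesis using 2 True sets_F_mono[of "ennreal s" "ennreal t"] by (auto simp: ennreal_leI)
    next
      case False
      then have "(\<lambda>w. (t, w)) -` y \<inter> space (F (ennreal t)) = {}" using 2 by auto
      then show ?thesis by simp
    qed
  qed
qed

lemma OA_section: assumes "0 \<le> t" shows "(\<lambda>w. (t, w)) \<in> F (ennreal t) \<rightarrow>\<^sub>M OA"
  unfolding optional_algebra_def
proof (rule measurable_measure_of)
  show "(\<lambda>w. (t, w)) \<in> space (F (ennreal t)) \<rightarrow> {0..} \<times> space M" using assms by auto
  fix y assume "y \<in> {{(t, w) \<in> {0..} \<times> space M. X t w \<in> B} |X B.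
          adapted F X \<and> (\<forall>w\<in>space M. cadlag (\<lambda>t. X t w)) \<and> B \<in> sets borel}"
  then obtain X B where y: "y = {(t, w) \<in> {0..} \<times> space M. X t w \<in> B}" "adapted F X" "B \<in> sets borel" by auto
  have "(\<lambda>w. (t, w)) -` y \<inter> space (F (ennreal t)) = X t -` B \<inter> space (F (ennreal t))" using y(1) assms by auto
  also have "\<dots> \<in> sets (F (ennreal t))" using y assms unfolding adapted_def by (intro measurable_sets) auto
  finally show "(\<lambda>w. (t, w)) -` y \<inter> space (F (ennreal t)) \<in> sets (F (ennreal t))" .
qed auto

text \<open>By right-continuity, X t is the limit of the values at the next point of a grid of mesh
  1/(n+1), and every such approximation consists of countably many measurable pieces.\<close>

lemma cadlag_joint_measurable:
  assumes X: "adapted F X" "\<And>w. w \<in> space M \<Longrightarrow> cadlag (\<lambda>t. X t w)"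
  shows "(\<lambda>(t, w). if 0 \<le> t then X t w else 0) \<in> borel_measurable (borel \<Otimes>\<^sub>M CM)"
proof (rule borel_measurable_LIMSEQ_real)
  \<comment> \<open>Floor plus one gives a grid point strictly to the right of t even if t lies on
    the grid, as convergence along \<open>at_right t\<close> demands.\<close>
  let ?t = "\<lambda>n t. (of_int \<lfloor>real (Suc n) * t\<rfloor> + 1) / real (Suc n)"
  let ?f = "\<lambda>n (t, w). if 0 \<le> t then X (?t n t) w else 0"
  show "?f n \<in> borel_measurable (borel \<Otimes>\<^sub>M CM)" for n
  proof -
    have "(\<lambda>p. if 0 \<le> fst p then (\<lambda>i p. X ((of_int i + 1) / real (Suc n)) (snd p)) \<lfloor>real (Suc n) * fst p\<rfloor> p else 0) \<in> borel_measurable (borel \<Otimes>\<^sub>M CM)"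
    proof -
      have "(\<lambda>p. (\<lambda>i p. if 0 \<le> i then X ((of_int i + 1) / real (Suc n)) (snd p) else 0) \<lfloor>real (Suc n) * fst p\<rfloor> p) \<in> borel_measurable (borel \<Otimes>\<^sub>M CM)"
      proof (rule measurable_compose_countable[where g = "\<lambda>p. \<lfloor>real (Suc n) * fst p\<rfloor>"])
        fix i :: int
        show "(\<lambda>p. if 0 \<le> i then X ((of_int i + 1) / real (Suc n)) (snd p) else 0) \<in> borel_measurable (borel \<Otimes>\<^sub>M CM)"
        proof (cases "0 \<le> i")
          case True
          then have "X ((of_int i + 1) / real (Suc n)) \<in> borel_measurable CM"
            using X(1) unfolding adapted_def by (intro F_measurable_CM[of _ "ennreal ((of_int i + 1) / real (Suc n))"]) auto
          then show ?thesis using True by (auto intro: measurable_compose[OF measurable_snd])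
        qed auto
      qed measurable
      moreover have "0 \<le> \<lfloor>real (Suc n) * t\<rfloor> \<longleftrightarrow> 0 \<le> t" for t :: real by (simp add: zero_le_mult_iff)
      ultimately show ?thesis by (simp only:)
    qed
    then show ?thesis by (simp add: case_prod_beta')
  qed
  fix p :: "real \<times> 'a" assume p: "p \<in> space (borel \<Otimes>\<^sub>M CM)"
  obtain t w where [simp]: "p = (t, w)" by (cases p)
  show "(\<lambda>n. ?f n p) \<longlonglongrightarrow> (case p of (t, w) \<Rightarrow> if 0 \<le> t then X t w else 0)"
  proof (cases "0 \<le> t")
    case True
    have c: "((\<lambda>t. X t w) \<longlongrightarrow> X t w) (at_right t)"
      using X(2)[of w] p True by (auto simp: cadlag_def continuous_within space_pair_measure)
    have up: "?t n t \<le> t + 1 / real (Suc n)" and lo: "t < ?t n t" for n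
    proof -
      have "of_int \<lfloor>real (Suc n) * t\<rfloor> \<le> real (Suc n) * t" "real (Suc n) * t < of_int \<lfloor>real (Suc n) * t\<rfloor> + 1"
        by linarith+
      then show "?t n t \<le> t + 1 / real (Suc n)" "t < ?t n t" by (simp_all add: field_simps del: of_nat_Suc)
    qed
    have "(\<lambda>n. t + 1 / real (Suc n)) \<longlonglongrightarrow> t + 0"
      by (intro tendsto_add tendsto_const LIMSEQ_Suc[OF lim_const_over_n])
    then have u: "(\<lambda>n. t + 1 / real (Suc n)) \<longlonglongrightarrow> t" by simp
    have "(\<lambda>n. ?t n t) \<longlonglongrightarrow> t"
      by (rule tendsto_sandwich[OF _ _ tendsto_const u])
        (intro always_eventually allI less_imp_le[OF lo] up)+
    moreover have "?t n t \<noteq> t" for n using lo[of n] by simp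
    ultimately have "filterlim (\<lambda>n. ?t n t) (at_right t) sequentially"
      using lo by (simp add: filterlim_at del: of_nat_Suc)
    from filterlim_compose[OF c this] show ?thesis using True by simp
  qed simp
qed

lemma OA_subset_pair: "sets OA \<subseteq> sets (borel \<Otimes>\<^sub>M CM)"
proof
  fix E assume "E \<in> sets OA"
  then show "E \<in> sets (borel \<Otimes>\<^sub>M CM)" unfolding sets_OA
  proof (induction rule: sigma_sets.induct)
    case (Basic a)
    then obtain X B where a: "a = {(t, w) \<in> {0..} \<times> space M. X t w \<in> B}" "adapted F X"
      "\<forall>w\<in>space M. cadlag (\<lambda>t. X t w)" "B \<in> sets borel" by auto
    have "a = ((\<lambda>(t, w). if 0 \<le> t then X t w else 0) -` B \<inter> space (borel \<Otimes>\<^sub>M CM)) \<inter> ({0..} \<times> space M)"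
      using a(1) by (auto simp: space_pair_measure)
    also have "\<dots> \<in> sets (borel \<Otimes>\<^sub>M CM)"
      using cadlag_joint_measurable[OF a(2)] a(3,4) Omega_pair by (intro sets.Int measurable_sets) auto
    finally show ?case .
  next
    case (Compl a) then show ?case using Omega_pair by auto
  qed auto
qed

text \<open>The indicator of this set is itself an adapted process with right-continuous paths and
  left limits, so the set is a generator.\<close>

lemma OA_Ico: assumes "0 \<le> s" "B \<in> sets (F (ennreal s))" "s < t" shows "{s..<t} \<times> B \<in> sets OA"
proof -
  let ?X = "\<lambda>u w. indicator {s..<t} u * indicator B w :: real"
  have ad: "adapted F ?X" unfolding adapted_def
  proof (intro allI impI)
    fix u :: real assume "0 \<le> u"
    show "?X u \<in> borel_measurable (F (ennreal u))"
    proof (cases "s \<le> u")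
      case True
      then have "B \<in> sets (F (ennreal u))" using assms sets_F_mono[of "ennreal s" "ennreal u"] by (auto simp: ennreal_leI)
      then show ?thesis by measurable
    qed simp
  qed
  have cad: "cadlag (\<lambda>u. ?X u w)" for w
  proof -
    have ri: "continuous (at_right u) (indicator {s..<t} :: real \<Rightarrow> real)" for u
    proof -
      have "\<exists>v>u. \<forall>y>u. y < v \<longrightarrow> indicator {s..<t} y = (indicator {s..<t} u :: real)"
        using assms(3) by (cases "u < s"; cases "u < t") (auto simp: indicator_def intro: exI[of _ s] exI[of _ t] exI[of _ "u + 1"])
      then have "eventually (\<lambda>y. indicator {s..<t} y = (indicator {s..<t} u :: real)) (at_right u)"
        by (auto simp: eventually_at_right_field)
      then show ?thesis unfolding continuous_within by (rule tendsto_eventually)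
    qed
    have le: "\<exists>l. ((indicator {s..<t} :: real \<Rightarrow> real) \<longlongrightarrow> l) (at_left u)" for u
    proof -
      have "\<exists>l. \<exists>v<u. \<forall>y>v. y < u \<longrightarrow> indicator {s..<t} y = (l :: real)"
      proof -
        consider "u \<le> s" | "s < u" "u \<le> t" | "t < u" by linarith
        then show ?thesis
        proof cases
          case 1 then show ?thesis by (intro exI[of _ 0] exI[of _ "u - 1"]) (auto simp: indicator_def)
        next
          case 2 then show ?thesis by (intro exI[of _ 1] exI[of _ s]) (auto simp: indicator_def)
        next
          case 3 then show ?thesis by (intro exI[of _ 0] exI[of _ t]) (auto simp: indicator_def)
        qed
      qed
      then obtain l where "eventually (\<lambda>y. indicator {s..<t} y = (l :: real)) (at_left u)"
        by (auto simp: eventually_at_left_field)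
      then show ?thesis by (intro exI tendsto_eventually)
    qed
    show ?thesis unfolding cadlag_def
    proof (intro conjI allI impI)
      show "continuous (at_right u) (\<lambda>u. ?X u w)" for u by (intro continuous_intros ri)
      fix u :: real
      obtain l where "((indicator {s..<t} :: real \<Rightarrow> real) \<longlongrightarrow> l) (at_left u)" using le by blast
      then have "((\<lambda>u. ?X u w) \<longlongrightarrow> l * indicator B w) (at_left u)" by (intro tendsto_intros)
      then show "\<exists>l. ((\<lambda>u. ?X u w) \<longlongrightarrow> l) (at_left u)" by blast
    qed
  qed
  have "{s..<t} \<times> B = {(u, w) \<in> {0..} \<times> space M. ?X u w \<in> {1}}"
    using assms(1) sets.sets_into_space[OF assms(2)] by (auto simp: indicator_def split: if_splits)
  then show ?thesis unfolding sets_OA using ad cad by (intro sigma_sets.Basic) (auto intro!: exI[of _ ?X] exI[of _ "{1}"])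
qed

text \<open>The optional side supplies intervals closed on the left. A half-line (u,\<infinity>) is
  a countable union of intervals starting at u + 1/(n+1), (s,t] is the difference of two half-lines,
  and {0} is the intersection of the intervals [0,1/(n+1)).\<close>

lemma PA_subset_OA: "sets PA \<subseteq> sets OA"
proof
  fix E assume "E \<in> sets PA"
  then show "E \<in> sets OA" unfolding sets_PA
  proof (induction rule: sigma_sets.induct)
    case (Basic a)
    then consider B where "a = {0} \<times> B" "B \<in> sets (F 0)"
      | s t B where "a = {s<..t} \<times> B" "0 \<le> s" "s < t" "B \<in> sets (F (ennreal s))" by blast
    then show ?case
    proof cases
      case 1
      have "{0} = (\<Inter>n. {0::real..<inverse (real (Suc n))})"
      proof -
        have "x = 0" if "0 \<le> x" "\<And>n. x < inverse (real (Suc n))" for x :: real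
          using that reals_Archimedean[of x] by (metis less_asym order_le_less)
        then show ?thesis by (auto simp del: of_nat_Suc)
      qed
      then have "a = (\<Inter>n. {0..<inverse (real (Suc n))} \<times> B)" using 1 by (simp only:) auto
      also have "\<dots> \<in> sets OA" using OA_Ico[of 0 B] 1 by (intro sets.countable_INT) auto
      finally show ?thesis .
    next
      case 2
      have "{s<..t} = {s<..} - {t<..}" by auto
      have Ioi: "{u<..} \<times> B \<in> sets OA" if "s \<le> u" for u
      proof -
        have u: "0 \<le> u" "B \<in> sets (F (ennreal v))" if "u \<le> v" for v
          using \<open>s \<le> u\<close> that 2 sets_F_mono[of "ennreal s" "ennreal v"] by (auto simp: ennreal_leI)
        have "{u<..} \<times> B = (\<Union>n. \<Union>m. {u + inverse (real (Suc n))..<u + inverse (real (Suc n)) + real (Suc m)} \<times> B)"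
        proof -
          have "\<exists>n m. u + inverse (real (Suc n)) \<le> x \<and> x < u + inverse (real (Suc n)) + real (Suc m)" if x: "u < x" for x
          proof -
            obtain n where n: "inverse (real (Suc n)) < x - u" using reals_Archimedean[of "x - u"] x by auto
            obtain m where "x - u < real m" using reals_Archimedean2 by blast
            moreover have "0 < inverse (real (Suc n))" by simp
            ultimately have "x < u + inverse (real (Suc n)) + real (Suc m)" unfolding of_nat_Suc[of m] by linarith
            then show ?thesis using n by (intro exI[of _ n] exI[of _ m]) simp
          qed
          moreover have "u < x" if "u + inverse (real (Suc n)) \<le> x" for x n
          proof -
            have "0 < inverse (real (Suc n))" by simp
            then show ?thesis using that by linarith
          qed
          ultimately show ?thesis by (auto simp del: of_nat_Suc)
        qed
        also have "\<dots> \<in> sets OA"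
        proof (intro sets.countable_UN'' OA_Ico)
          fix n m :: nat
          have "0 < inverse (real (Suc n))" by simp
          then have "u \<le> u + inverse (real (Suc n))" by linarith
          then show "0 \<le> u + inverse (real (Suc n))" "B \<in> sets (F (ennreal (u + inverse (real (Suc n)))))"
            using u(1)[of u] u(2)[of "u + inverse (real (Suc n))"] by (simp_all del: of_nat_Suc)
        qed (auto)
        finally show ?thesis .
      qed
      have "a = {s<..} \<times> B - {t<..} \<times> B" using 2 by auto
      then show ?thesis using Ioi[of s] Ioi[of t] 2 by auto
    qed
  next
    case (Compl a)
    have "{0..} \<times> space M \<in> sets OA" using sets.top[of OA] by simp
    then show ?case using Compl by auto
  qed auto
qed

end

section \<open>Measurability of pathwise integrals; the measure of the occurrence path\<close>

lemma increasing_path_mono: "increasing_path f \<Longrightarrow> 0 \<le> x \<Longrightarrow> x \<le> y \<Longrightarrow> f x \<le> f y"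
  by (rule mono_onD[of "{0..}" f]) (auto simp: increasing_path_def)

text \<open>The formula includes the value 0 that the Bochner integral takes for non-integrable f.
  Measurability in a parameter then reduces to that of nonnegative integrals.\<close>

lemma set_lebesgue_integral_cases:
  fixes f :: "real \<Rightarrow> real"
  assumes "(\<lambda>s. f s * indicator A s) \<in> borel_measurable \<kappa>"
  shows "(LINT s:A|\<kappa>. f s) = (if (\<integral>\<^sup>+s. ennreal \<bar>f s\<bar> * indicator A s \<partial>\<kappa>) < \<infinity>
     then enn2real (\<integral>\<^sup>+s. ennreal (f s) * indicator A s \<partial>\<kappa>) - enn2real (\<integral>\<^sup>+s. ennreal (- f s) * indicator A s \<partial>\<kappa>) else 0)"
proof -
  let ?g = "\<lambda>s. indicator A s *\<^sub>R f s"
  have m: "?g \<in> borel_measurable \<kappa>" using assms by (simp add: mult.commute)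
  have e: "ennreal (norm (?g s)) = ennreal \<bar>f s\<bar> * indicator A s" "ennreal (?g s) = ennreal (f s) * indicator A s"
    "ennreal (- ?g s) = ennreal (- f s) * indicator A s" for s by (auto simp: indicator_def)
  have i: "integrable \<kappa> ?g \<longleftrightarrow> (\<integral>\<^sup>+s. ennreal \<bar>f s\<bar> * indicator A s \<partial>\<kappa>) < \<infinity>"
    unfolding integrable_iff_bounded e using m by blast
  show ?thesis
  proof (cases "integrable \<kappa> ?g")
    case True
    then show ?thesis unfolding set_lebesgue_integral_def real_lebesgue_integral_def[OF True] e using i by simp
  next
    case False
    then show ?thesis using i by (simp add: set_lebesgue_integral_def not_integrable_integral_eq)
  qed
qed

lemma path_integral_measurable:
  fixes g :: "real \<times> 'a \<Rightarrow> real"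
  assumes inc: "\<And>w. w \<in> space S \<Longrightarrow> increasing_path (\<lambda>t. V t w)"
    and V: "\<And>t. 0 \<le> t \<Longrightarrow> t \<le> T \<Longrightarrow> V t \<in> borel_measurable S" and T: "0 \<le> T"
    and g: "g \<in> borel_measurable (borel \<Otimes>\<^sub>M S)"
  shows "(\<lambda>w. LINT s:{0..T}|path_measure (\<lambda>t. V t w). g (s, w)) \<in> borel_measurable S"
proof -
  have m: "(\<lambda>s. g (s, w) * indicator {0..T} s) \<in> borel_measurable (path_measure (\<lambda>t. V t w))" if "w \<in> space S" for w
    using measurable_compose[OF measurable_Pair2'[OF that] g] by simp
  note k = path_kernel_measurable[OF inc V T]
  have [measurable]: "(\<lambda>w. \<integral>\<^sup>+s. ennreal \<bar>g (s, w)\<bar> * indicator {0..T} s \<partial>path_measure (\<lambda>t. V t w)) \<in> borel_measurable S"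
    "(\<lambda>w. \<integral>\<^sup>+s. ennreal (g (s, w)) * indicator {0..T} s \<partial>path_measure (\<lambda>t. V t w)) \<in> borel_measurable S"
    "(\<lambda>w. \<integral>\<^sup>+s. ennreal (- g (s, w)) * indicator {0..T} s \<partial>path_measure (\<lambda>t. V t w)) \<in> borel_measurable S"
    using k[of "\<lambda>p. ennreal \<bar>g p\<bar>"] k[of "\<lambda>p. ennreal (g p)"] k[of "\<lambda>p. ennreal (- g p)"] g by simp_all
  show ?thesis
    by (subst measurable_cong[OF set_lebesgue_integral_cases[OF m]]) (assumption, measurable)
qed

lemma path_integral_measurable_Ici:
  fixes g :: "real \<times> 'a \<Rightarrow> real"
  assumes inc: "\<And>w. w \<in> space S \<Longrightarrow> increasing_path (\<lambda>t. V t w)"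
    and V: "\<And>t. 0 \<le> t \<Longrightarrow> V t \<in> borel_measurable S"
    and g: "g \<in> borel_measurable (borel \<Otimes>\<^sub>M S)"
  shows "(\<lambda>w. LINT s:{0..}|path_measure (\<lambda>t. V t w). g (s, w)) \<in> borel_measurable S"
proof -
  have m: "(\<lambda>s. g (s, w) * indicator {0..} s) \<in> borel_measurable (path_measure (\<lambda>t. V t w))" if "w \<in> space S" for w
    using measurable_compose[OF measurable_Pair2'[OF that] g] by simp
  note k = path_kernel_measurable_Ici[OF inc V]
  have [measurable]: "(\<lambda>w. \<integral>\<^sup>+s. ennreal \<bar>g (s, w)\<bar> * indicator {0..} s \<partial>path_measure (\<lambda>t. V t w)) \<in> borel_measurable S"
    "(\<lambda>w. \<integral>\<^sup>+s. ennreal (g (s, w)) * indicator {0..} s \<partial>path_measure (\<lambda>t. V t w)) \<in> borel_measurable S"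
    "(\<lambda>w. \<integral>\<^sup>+s. ennreal (- g (s, w)) * indicator {0..} s \<partial>path_measure (\<lambda>t. V t w)) \<in> borel_measurable S"
    using k[of "\<lambda>p. ennreal \<bar>g p\<bar>"] k[of "\<lambda>p. ennreal (g p)"] k[of "\<lambda>p. ennreal (- g p)"] g by simp_all
  show ?thesis
    by (subst measurable_cong[OF set_lebesgue_integral_cases[OF m]]) (assumption, measurable)
qed

lemma occurrence_path: "increasing_path (\<lambda>t. occurrence \<tau> t w)"
proof -
  have rc: "continuous (at_right t) (\<lambda>t. occurrence \<tau> t w)" if "0 \<le> t" for t
  proof -
    have "\<exists>v>t. \<forall>y>t. y < v \<longrightarrow> occurrence \<tau> y w = occurrence \<tau> t w"
    proof (cases "\<tau> w \<le> ennreal t")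
      case True
      then have "\<tau> w \<le> ennreal y" if "t < y" for y using that by (meson ennreal_leI less_imp_le order_trans)
      then show ?thesis using True \<open>0 \<le> t\<close> by (intro exI[of _ "t + 1"]) (auto simp: occurrence_def)
    next
      case False
      show ?thesis
      proof (cases "\<tau> w = \<infinity>")
        case True
        then show ?thesis by (intro exI[of _ "t + 1"]) (auto simp: occurrence_def top_unique)
      next
        case fin: False
        then obtain r where r: "\<tau> w = ennreal r" "0 \<le> r" by (cases "\<tau> w") auto
        then show ?thesis using False \<open>0 \<le> t\<close> by (intro exI[of _ r]) (auto simp: occurrence_def)
      qed
    qed
    then have "eventually (\<lambda>y. occurrence \<tau> y w = occurrence \<tau> t w) (at_right t)"
      by (auto simp: eventually_at_right_field)
    then show ?thesis unfolding continuous_within by (rule tendsto_eventually)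
  qed
  have "mono_on {0..} (\<lambda>t. occurrence \<tau> t w)"
    by (auto simp: mono_on_def occurrence_def intro: order_trans ennreal_leI)
  then show ?thesis using rc unfolding increasing_path_def by (auto simp: occurrence_def)
qed

lemma path_measure_occurrence:
  "path_measure (\<lambda>t. occurrence \<tau> t w) = (if \<tau> w = \<infinity> then null_measure borel else return borel (enn2real (\<tau> w)))"
proof -
  have "rcmono (\<lambda>s. if s < 0 then 0 else occurrence \<tau> s w)" by (rule rcmono_path[OF occurrence_path])
  note u = interval_measure_unique[OF _ this, symmetric]
  show ?thesis
  proof (cases "\<tau> w = \<infinity>")
    case True
    then show ?thesis unfolding path_measure_def
      by (subst u[of "null_measure borel"]) (auto simp: occurrence_def top_unique)
  next
    case False
    then obtain r where r: "\<tau> w = ennreal r" "0 \<le> r" by (cases "\<tau> w") auto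
    then show ?thesis unfolding path_measure_def
      by (subst u[of "return borel r"]) (auto simp: occurrence_def indicator_def ennreal_le_iff)
  qed
qed

lemma nn_integral_occurrence:
  assumes "(\<lambda>s. H s * indicator {0..} s) \<in> borel_measurable borel"
  shows "(\<integral>\<^sup>+s. H s * indicator {0..} s \<partial>path_measure (\<lambda>t. occurrence \<tau> t w)) =
    (if \<tau> w = \<infinity> then 0 else H (enn2real (\<tau> w)))"
  unfolding path_measure_occurrence using assms by (auto simp: nn_integral_return)

section \<open>Predictability of left limits; hitting times and their graphs\<close>

context filtered_space begin

text \<open>The left limit is the limit of the values at the last grid point before t. On (i/(n+1),
  (i+1)/(n+1)] this approximation equals X at time i/(n+1), known at the left end of the interval,
  so it is predictable. The value 0 at t = 0 is a convention.\<close>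

lemma left_limit_predictable:
  assumes X: "adapted F X" "\<And>w. w \<in> space M \<Longrightarrow> cadlag (\<lambda>t. X t w)"
  shows "(\<lambda>(t, w). if t = 0 then 0 else left_limit (\<lambda>u. X u w) t) \<in> borel_measurable PA"
proof (rule borel_measurable_LIMSEQ_real)
  \<comment> \<open>Ceiling minus one gives the largest grid point strictly below t.\<close>
  let ?t = "\<lambda>n t. (of_int \<lceil>real (Suc n) * t\<rceil> - 1) / real (Suc n)"
  let ?f = "\<lambda>n (t, w). if t = 0 then 0 else X (?t n t) w"
  show "?f n \<in> borel_measurable PA" for n
  proof (rule measurableI)
    fix B :: "real set" assume B: "B \<in> sets borel"
    let ?R = "\<lambda>i::nat. {real i / real (Suc n)<..real (Suc i) / real (Suc n)} \<times> (X (real i / real (Suc n)) -` B \<inter> space M)"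
    let ?Z = "if 0 \<in> B then {0} \<times> space M else {}"
    have R: "?R i \<in> sets PA" for i
    proof (rule PA_Ioc)
      have "X (real i / real (Suc n)) \<in> borel_measurable (F (ennreal (real i / real (Suc n))))"
        using X(1) by (simp add: adapted_def)
      from measurable_sets[OF this B] show "X (real i / real (Suc n)) -` B \<inter> space M \<in> sets (F (ennreal (real i / real (Suc n))))"
        by simp
    qed simp
    have Z: "?Z \<in> sets PA" using PA_zero[of "space M"] sets.top[of "F 0"] by auto
    have eq: "\<lceil>real (Suc n) * t\<rceil> = int (Suc i) \<longleftrightarrow> t \<in> {real i / real (Suc n)<..real (Suc i) / real (Suc n)}" for t i
    proof -
      have "\<lceil>real (Suc n) * t\<rceil> = int (Suc i) \<longleftrightarrow> real i < real (Suc n) * t \<and> real (Suc n) * t \<le> real (Suc i)"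
        by (simp add: ceiling_eq_iff)
      then show ?thesis by (simp add: field_simps del: of_nat_Suc)
    qed
    have "?f n -` B \<inter> space PA = ?Z \<union> (\<Union>i. ?R i)"
    proof (intro set_eqI iffI)
      fix p assume p: "p \<in> ?f n -` B \<inter> space PA"
      obtain t w where [simp]: "p = (t, w)" by (cases p)
      have t: "0 \<le> t" "w \<in> space M" using p by auto
      show "p \<in> ?Z \<union> (\<Union>i. ?R i)"
      proof (cases "t = 0")
        case True then show ?thesis using p by auto
      next
        case False
        then have "0 < real (Suc n) * t" using t by simp
        then have "0 < \<lceil>real (Suc n) * t\<rceil>" by (simp del: of_nat_Suc)
        then obtain i where i: "\<lceil>real (Suc n) * t\<rceil> = int (Suc i)" by (metis gr0_implies_Suc pos_int_cases)
        then have "?t n t = real i / real (Suc n)" by simp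
        then have "X (real i / real (Suc n)) w \<in> B" using p False by auto
        then have "p \<in> ?R i" using i eq[of t i] t by (simp del: of_nat_Suc)
        then show ?thesis by blast
      qed
    next
      fix p assume "p \<in> ?Z \<union> (\<Union>i. ?R i)"
      then consider "p \<in> ?Z" | i where "p \<in> ?R i" by blast
      then show "p \<in> ?f n -` B \<inter> space PA"
      proof cases
        case 1 then show ?thesis by (auto split: if_splits)
      next
        case 2
        obtain t w where [simp]: "p = (t, w)" by (cases p)
        have c: "\<lceil>real (Suc n) * t\<rceil> = int (Suc i)" using 2 eq[of t i] by (simp del: of_nat_Suc)
        then have e: "?t n t = real i / real (Suc n)" by simp
        have "0 \<le> real i / real (Suc n)" by simp
        moreover have "real i / real (Suc n) < t" using 2 by (simp del: of_nat_Suc)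
        ultimately have "0 < t" by linarith
        then show ?thesis using 2 unfolding vimage_def by (simp add: e del: of_nat_Suc)
      qed
    qed
    also have "\<dots> \<in> sets PA" using R Z by (intro sets.Un sets.countable_UN) auto
    finally show "?f n -` B \<inter> space PA \<in> sets PA" .
  qed simp
  fix p assume p: "p \<in> space PA"
  obtain t w where [simp]: "p = (t, w)" by (cases p)
  show "(\<lambda>n. ?f n p) \<longlonglongrightarrow> (case p of (t, w) \<Rightarrow> if t = 0 then 0 else left_limit (\<lambda>u. X u w) t)"
  proof (cases "t = 0")
    case False
    then have t: "0 < t" using p by auto
    then obtain l where c: "((\<lambda>t. X t w) \<longlongrightarrow> l) (at_left t)"
      using X(2)[of w] p by (auto simp: cadlag_def)
    have lo: "t - 1 / real (Suc n) \<le> ?t n t" and up: "?t n t < t" for n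
    proof -
      have "real (Suc n) * t \<le> of_int \<lceil>real (Suc n) * t\<rceil>" "of_int \<lceil>real (Suc n) * t\<rceil> - 1 < real (Suc n) * t"
        by linarith+
      then show "t - 1 / real (Suc n) \<le> ?t n t" "?t n t < t" by (simp_all add: field_simps del: of_nat_Suc)
    qed
    have "(\<lambda>n. t - 1 / real (Suc n)) \<longlonglongrightarrow> t - 0"
      by (intro tendsto_diff tendsto_const LIMSEQ_Suc[OF lim_const_over_n])
    then have u: "(\<lambda>n. t - 1 / real (Suc n)) \<longlonglongrightarrow> t" by simp
    have "(\<lambda>n. ?t n t) \<longlonglongrightarrow> t"
      by (rule tendsto_sandwich[OF _ _ u tendsto_const])
        (intro always_eventually allI less_imp_le[OF up] lo)+
    moreover have "?t n t \<noteq> t" for n using up[of n] by simp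
    ultimately have "filterlim (\<lambda>n. ?t n t) (at_left t) sequentially"
      using up by (simp add: filterlim_at del: of_nat_Suc)
    from filterlim_compose[OF c this] show ?thesis using False left_limit_eqI[OF c] by simp
  qed simp
qed

text \<open>What the predictable and the optional sigma-algebra have in common and what the
  arguments about dual projections rest on; both projections are then treated at once.\<close>

definition good :: "(real \<times> 'a) measure \<Rightarrow> bool" where
  "good S \<longleftrightarrow> space S = {0..} \<times> space M \<and> sets PA \<subseteq> sets S \<and> sets S \<subseteq> sets (borel \<Otimes>\<^sub>M CM) \<and>
     (\<forall>t\<ge>0. (\<lambda>w. (t, w)) \<in> F (ennreal t) \<rightarrow>\<^sub>M S)"

lemma good_PA: "good PA" and good_OA: "good OA"
  by (auto simp: good_def PA_section OA_section PA_subset_pair OA_subset_pair PA_subset_OA)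

lemma goodD:
  assumes "good S"
  shows "space S = {0..} \<times> space M" "\<And>E. E \<in> sets PA \<Longrightarrow> E \<in> sets S" "\<And>E. E \<in> sets S \<Longrightarrow> E \<in> sets (borel \<Otimes>\<^sub>M CM)"
    "\<And>t. 0 \<le> t \<Longrightarrow> (\<lambda>w. (t, w)) \<in> F (ennreal t) \<rightarrow>\<^sub>M S"
  using assms by (auto simp: good_def)

lemma good_extend:
  fixes f :: "real \<times> 'a \<Rightarrow> 'b::topological_space"
  assumes S: "good S" and f: "f \<in> borel_measurable S"
  shows "(\<lambda>p. if p \<in> {0..} \<times> space M then f p else c) \<in> borel_measurable (borel \<Otimes>\<^sub>M CM)"
proof (rule measurableI)
  fix B :: "'b set" assume B: "B \<in> sets borel"
  have "(\<lambda>p. if p \<in> {0..} \<times> space M then f p else c) -` B \<inter> space (borel \<Otimes>\<^sub>M CM) =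
     (f -` B \<inter> space S) \<union> (if c \<in> B then space (borel \<Otimes>\<^sub>M CM) - {0..} \<times> space M else {})"
    using goodD(1)[OF S] by (auto simp: space_pair_measure split: if_splits)
  also have "\<dots> \<in> sets (borel \<Otimes>\<^sub>M CM)"
    using goodD(3)[OF S measurable_sets[OF f B]] sets.compl_sets[OF Omega_pair] by (cases "c \<in> B") simp_all
  finally show "(\<lambda>p. if p \<in> {0..} \<times> space M then f p else c) -` B \<inter> space (borel \<Otimes>\<^sub>M CM) \<in> sets (borel \<Otimes>\<^sub>M CM)" .
qed simp

lemma good_adapted:
  assumes "good S" "(\<lambda>(t, w). B t w) \<in> borel_measurable S" shows "adapted F B"
  unfolding adapted_def using measurable_compose[OF goodD(4)[OF assms(1)] assms(2)] by simp

lemma adapted_CM: "adapted F X \<Longrightarrow> 0 \<le> t \<Longrightarrow> X t \<in> borel_measurable CM"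
  unfolding adapted_def using F_measurable_CM by blast

lemma good_section_borel:
  fixes f :: "real \<times> 'a \<Rightarrow> 'b::topological_space"
  assumes S: "good S" and f: "f \<in> borel_measurable S" and w: "w \<in> space M"
  shows "(\<lambda>s. if 0 \<le> s then f (s, w) else c) \<in> borel_measurable borel"
proof -
  have "(\<lambda>s. (s, w)) \<in> borel \<rightarrow>\<^sub>M borel \<Otimes>\<^sub>M CM" using w by (intro measurable_Pair2') simp
  from measurable_compose[OF this good_extend[OF S f, of c]] show ?thesis using w by simp
qed

text \<open>An increasing right-continuous path attains the level c at the first time it reaches it.
  The hitting time is therefore at most r exactly when c \<le> V r, an event of F_r.\<close>

lemma hitting_stopping_time:
  fixes V :: "real \<Rightarrow> 'a \<Rightarrow> real"
  assumes ad: "adapted F V" and inc: "\<And>w. w \<in> space M \<Longrightarrow> increasing_path (\<lambda>t. V t w)"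
  shows "stopping_time F (\<lambda>w. Inf (ennreal ` {t. 0 \<le> t \<and> c \<le> V t w}))"
proof (rule stopping_timeI)
  fix t :: ennreal
  show "Measurable.pred (F t) (\<lambda>w. Inf (ennreal ` {t. 0 \<le> t \<and> c \<le> V t w}) \<le> t)"
  proof (cases t)
    case (real r)
    have "Inf (ennreal ` {t. 0 \<le> t \<and> c \<le> V t w}) \<le> t \<longleftrightarrow> c \<le> V r w" if w: "w \<in> space M" for w
    proof
      assume "c \<le> V r w"
      then show "Inf (ennreal ` {t. 0 \<le> t \<and> c \<le> V t w}) \<le> t" unfolding real(2) using real(1) by (intro Inf_lower) auto
    next
      assume le: "Inf (ennreal ` {t. 0 \<le> t \<and> c \<le> V t w}) \<le> t"
      have mono: "V x w \<le> V y w" if "0 \<le> x" "x \<le> y" for x y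
        using increasing_path_mono[OF inc[OF w], of x y] that by simp
      have gt: "c \<le> V u w" if "r < u" for u
      proof -
        have "Inf (ennreal ` {t. 0 \<le> t \<and> c \<le> V t w}) < ennreal u"
          using le real that by (auto intro!: le_less_trans[OF le] simp: ennreal_lessI)
        then obtain v where "0 \<le> v" "c \<le> V v w" "ennreal v < ennreal u" unfolding Inf_less_iff by auto
        then show ?thesis using mono[of v u] by (simp add: ennreal_less_iff)
      qed
      have "((\<lambda>t. V t w) \<longlongrightarrow> V r w) (at_right r)"
        using inc[OF w] real by (auto simp: increasing_path_def continuous_within)
      moreover have "\<forall>\<^sub>F u in at_right r. c \<le> V u w" using gt by (intro eventually_at_rightI[of _ "r + 1"]) auto
      ultimately show "c \<le> V r w" by (intro tendsto_lowerbound[where f = "\<lambda>t. V t w" and F = "at_right r"]) auto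
    qed
    moreover have "Measurable.pred (F t) (\<lambda>w. c \<le> V r w)"
    proof -
      have [measurable]: "V r \<in> borel_measurable (F t)" using ad real by (simp add: adapted_def)
      show ?thesis by measurable
    qed
    ultimately show ?thesis by (subst measurable_cong[where g = "\<lambda>w. c \<le> V r w"]) auto
  qed simp
qed

text \<open>The graph of the time at which V reaches the level c. Earlier times are tested at
  rationals only; this suffices for monotone paths and keeps the set measurable.\<close>

definition graph :: "(real \<Rightarrow> 'a \<Rightarrow> real) \<Rightarrow> real \<Rightarrow> (real \<times> 'a) set" where
  "graph V c = {(s, w) \<in> {0..} \<times> space M. c \<le> V s w \<and> (\<forall>q\<in>\<rat>. 0 \<le> q \<and> q < s \<longrightarrow> V q w < c)}"

lemma graph_measurable:
  assumes S: "good S" and V: "(\<lambda>(t, w). V t w) \<in> borel_measurable S"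
  shows "graph V c \<in> sets S"
proof -
  have ad: "adapted F V" by (rule good_adapted[OF S V])
  have "graph V c = ((\<lambda>(t, w). V t w) -` {c..} \<inter> space S) - (\<Union>q\<in>\<rat> \<inter> {0..}. {q<..} \<times> (V q -` {c..} \<inter> space M))"
    unfolding graph_def goodD(1)[OF S] by (auto simp: not_le not_less)
  also have "\<dots> \<in> sets S"
  proof (intro sets.Diff measurable_sets[OF V] sets.countable_UN')
    show "countable (\<rat> \<inter> {0::real..})" by (rule countable_Int1) (rule countable_rat)
    show "(\<lambda>q. {q<..} \<times> (V q -` {c..} \<inter> space M)) ` (\<rat> \<inter> {0..}) \<subseteq> sets S"
    proof (safe intro!: goodD(2)[OF S] PA_Ioi)
      fix q :: real assume "0 \<le> q"
      then have "V q \<in> borel_measurable (F (ennreal q))" using ad by (simp add: adapted_def)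
      from measurable_sets[OF this, of "{c..}"] show "V q -` {c..} \<inter> space M \<in> sets (F (ennreal q))" by simp
    qed
  qed simp
  finally show ?thesis .
qed

lemma graph_hitting:
  assumes inc: "increasing_path (\<lambda>t. V t w)" and g: "(s, w) \<in> graph V c"
  shows "Inf (ennreal ` {t. 0 \<le> t \<and> c \<le> V t w}) = ennreal s"
proof (rule antisym)
  have s: "0 \<le> s" "c \<le> V s w" and lt: "\<And>q. q \<in> \<rat> \<Longrightarrow> 0 \<le> q \<Longrightarrow> q < s \<Longrightarrow> V q w < c"
    using g by (auto simp: graph_def)
  then show "Inf (ennreal ` {t. 0 \<le> t \<and> c \<le> V t w}) \<le> ennreal s" by (intro Inf_lower) auto
  show "ennreal s \<le> Inf (ennreal ` {t. 0 \<le> t \<and> c \<le> V t w})"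
  proof (safe intro!: Inf_greatest ennreal_leI)
    fix t assume t: "0 \<le> t" "c \<le> V t w"
    show "s \<le> t"
    proof (rule ccontr)
      assume "\<not> s \<le> t"
      then obtain q where q: "q \<in> \<rat>" "t < q" "q < s" using Rats_dense_in_real[of t s] by auto
      then have "V t w \<le> V q w" using increasing_path_mono[OF inc, of t q] t by simp
      then show False using lt[of q] q t by auto
    qed
  qed
qed

text \<open>An atom at s leaves a gap in the values just below V s, and a rational level inside this
  gap is reached exactly at s.\<close>

lemma graph_covers_atoms:
  assumes inc: "increasing_path (\<lambda>t. V t w)" and w: "w \<in> space M" and s: "0 \<le> s"
    and pos: "emeasure (path_measure (\<lambda>t. V t w)) {s} \<noteq> 0"
  shows "\<exists>c\<in>\<rat>. (s, w) \<in> graph V c"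
proof -
  let ?\<kappa> = "path_measure (\<lambda>t. V t w)"
  obtain d where d: "emeasure ?\<kappa> {s} = ennreal d" "0 < d"
    using emeasure_path_singleton_finite[OF inc s] pos by (cases "emeasure ?\<kappa> {s}") auto
  have mono: "V x w \<le> V y w" if "0 \<le> x" "x \<le> y" for x y
    using increasing_path_mono[OF inc, of x y] that by simp
  obtain c where c: "c \<in> \<rat>" "V s w - d < c" "c < V s w" using Rats_dense_in_real[of "V s w - d" "V s w"] d by auto
  have "V q w < c" if q: "0 \<le> q" "q < s" for q
  proof -
    have "ennreal d \<le> emeasure ?\<kappa> {q<..s}" unfolding d(1)[symmetric] using q by (intro emeasure_mono) auto
    also have "\<dots> = ennreal (V s w - V q w)" using q by (intro emeasure_path_measure_Ioc[OF inc]) auto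
    finally have "d \<le> V s w - V q w" using mono[of q s] q by (subst (asm) ennreal_le_iff) auto
    then show ?thesis using c by linarith
  qed
  then have "(s, w) \<in> graph V c" using c s w by (auto simp: graph_def)
  then show ?thesis using c by blast
qed

end

section \<open>Dual projections\<close>

text \<open>Identifies \<open>at_infinity_value\<close> of an increasing path of finite mass with
  the total mass of its measure.\<close>

lemma tendsto_increasing_path_at_top:
  assumes f: "increasing_path f" and fin: "emeasure (path_measure f) {0..} < \<infinity>"
  shows "(f \<longlongrightarrow> measure (path_measure f) {0..}) at_top"
proof (rule tendsto_at_topI_sequentially)
  fix X :: "nat \<Rightarrow> real" assume X: "filterlim X at_top sequentially"
  have 1: "(\<lambda>n. measure (path_measure f) {0..real n}) \<longlonglongrightarrow> measure (path_measure f) (\<Union>n. {0..real n})"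
  proof (rule Lim_measure_incseq)
    have "(\<Union>n. {0..real n}) = {0..}" using real_arch_simple by auto
    then show "emeasure (path_measure f) (\<Union>n. {0..real n}) \<noteq> \<infinity>" using fin by simp
  qed (auto simp: incseq_def)
  have m: "measure (path_measure f) {0..t} = f t" if "0 \<le> t" for t
    using emeasure_path_measure_Icc[OF f that] increasing_path_mono[OF f order_refl that] f
    by (simp add: measure_def increasing_path_def)
  have U: "(\<Union>n. {0..real n}) = {0..}" using real_arch_simple by auto
  have fn: "(\<lambda>n. f (real n)) \<longlonglongrightarrow> measure (path_measure f) {0..}" using 1 U m by simp
  let ?L = "measure (path_measure f) {0..}"
  have le: "f t \<le> ?L" if "0 \<le> t" for t
    unfolding m[OF that, symmetric] using fin by (intro measure_mono_fmeasurable) (auto simp: fmeasurable_def)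
  show "(\<lambda>n. f (X n)) \<longlonglongrightarrow> ?L"
  proof (rule order_tendstoI)
    fix a assume "a < ?L"
    then obtain k where k: "a < f (real k)" using order_tendstoD(1)[OF fn] by (auto simp: eventually_sequentially)
    have "\<forall>\<^sub>F n in sequentially. real k \<le> X n" using X by (simp add: filterlim_at_top)
    then show "\<forall>\<^sub>F n in sequentially. a < f (X n)"
      by eventually_elim (use k increasing_path_mono[OF f] in \<open>auto intro: less_le_trans\<close>)
  next
    fix a assume a: "?L < a"
    have "\<forall>\<^sub>F n in sequentially. 0 \<le> X n" using X by (simp add: filterlim_at_top)
    then show "\<forall>\<^sub>F n in sequentially. f (X n) < a"
      by eventually_elim (use le a in \<open>auto intro: le_less_trans\<close>)
  qed
qed

lemma measure_path_Ioi:
  assumes f: "increasing_path f" and fin: "emeasure (path_measure f) {0..} < \<infinity>" and t: "0 \<le> t"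
  shows "measure (path_measure f) {t<..} = Lim at_top f - f t"
proof -
  have L: "Lim at_top f = measure (path_measure f) {0..}"
    using tendsto_increasing_path_at_top[OF f fin] by (intro tendsto_Lim) auto
  have m: "measure (path_measure f) {0..t} = f t"
    using emeasure_path_measure_Icc[OF f t] increasing_path_mono[OF f order_refl t] f
    by (simp add: measure_def increasing_path_def)
  have e: "{t<..} = {0..} - {0..t}" using t by auto
  show ?thesis unfolding e L m[symmetric] using fin by (intro measure_Diff) auto
qed

text \<open>Versions of each other are indistinguishable when right-continuous: one null set serves
  all rational times, and limits from the right reach the others.\<close>

lemma AE_right_continuous_eq:
  fixes X Y :: "real \<Rightarrow> 'a \<Rightarrow> real"
  assumes eq: "\<And>t. 0 \<le> t \<Longrightarrow> AE w in M. X t w = Y t w"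
    and X: "AE w in M. \<forall>t\<ge>0. continuous (at_right t) (\<lambda>t. X t w)"
    and Y: "AE w in M. \<forall>t\<ge>0. continuous (at_right t) (\<lambda>t. Y t w)"
  shows "AE w in M. \<forall>t\<ge>0. X t w = Y t w"
proof -
  have "AE w in M. \<forall>q\<in>\<rat> \<inter> {0..}. X q w = Y q w"
    by (subst AE_ball_countable) (auto intro!: countable_Int1 countable_rat eq)
  then show ?thesis using X Y
  proof eventually_elim
    case (elim w)
    show ?case
    proof (intro allI impI)
      fix t :: real assume t: "0 \<le> t"
      have "\<exists>q. q \<in> \<rat> \<and> t < q \<and> q < t + inverse (real (Suc n))" for n
        using Rats_dense_in_real[of t "t + inverse (real (Suc n))"] by (auto simp del: of_nat_Suc)
      then obtain q where q: "\<And>n. q n \<in> \<rat>" "\<And>n. t < q n" "\<And>n. q n < t + inverse (real (Suc n))" by metis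
      have u: "(\<lambda>n. t + inverse (real (Suc n))) \<longlonglongrightarrow> t" using LIMSEQ_inverse_real_of_nat_add[of t] by simp
      have "q \<longlonglongrightarrow> t"
        by (rule tendsto_sandwich[OF _ _ tendsto_const u]) (intro always_eventually allI less_imp_le[OF q(2)] less_imp_le[OF q(3)])+
      moreover have "q n \<noteq> t" for n using q(2)[of n] by simp
      ultimately have f: "filterlim q (at_right t) sequentially"
        using q(2) by (simp add: filterlim_at)
      have "(\<lambda>n. X (q n) w) \<longlonglongrightarrow> X t w" "(\<lambda>n. Y (q n) w) \<longlonglongrightarrow> Y t w"
        using elim t by (auto simp: continuous_within intro: filterlim_compose[OF _ f])
      moreover have "X (q n) w = Y (q n) w" for n using elim q[of n] t by (auto intro: less_imp_le)
      ultimately show "X t w = Y t w" by (simp add: LIMSEQ_unique)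
    qed
  qed
qed

locale random_time = filtered_space M F for M :: "'a measure" and F +
  fixes \<tau> :: "'a \<Rightarrow> ennreal"
  assumes \<tau>_meas: "\<tau> \<in> borel_measurable M" and avoids: "avoids_stopping_times M F \<tau>"
begin

lemma \<tau>_CM[measurable]: "\<tau> \<in> borel_measurable CM"
  using \<tau>_meas by (rule measurable_completion)

text \<open>\<open>measure\<close> is 0 by default on sets that are not measurable; measurability of
  the event is what turns avoidance into an almost sure statement.\<close>

lemma avoids_AE:
  assumes \<sigma>: "stopping_time F \<sigma>" shows "AE w in CM. \<not> (\<tau> w = \<sigma> w \<and> \<sigma> w < \<infinity>)"
proof -
  have [measurable]: "\<sigma> \<in> borel_measurable CM" using \<sigma> F_sub by (rule measurable_stopping_time) simp
  have S: "{w \<in> space CM. \<tau> w = \<sigma> w \<and> \<sigma> w < \<infinity>} \<in> sets CM" by measurable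
  have "measure CM {w \<in> space CM. \<tau> w = \<sigma> w \<and> \<sigma> w < \<infinity>} = 0"
    using avoids \<sigma> by (simp add: avoids_stopping_times_def)
  then show ?thesis using S by (subst AE_iff_measurable[OF _ refl]) (auto simp: C.emeasure_eq_measure)
qed

lemma \<tau>_pos: "AE w in CM. 0 < \<tau> w"
  using avoids_AE[OF stopping_time_const, of 0] by eventually_elim (auto simp: zero_less_iff_neq_zero)

lemma at_\<tau>_measurable:
  fixes f :: "real \<times> 'a \<Rightarrow> 'b::topological_space"
  assumes S: "good S" and f: "f \<in> borel_measurable S"
  shows "(\<lambda>w. if \<tau> w = \<infinity> then c else f (enn2real (\<tau> w), w)) \<in> borel_measurable CM"
proof -
  have p: "(\<lambda>w. (enn2real (\<tau> w), w)) \<in> CM \<rightarrow>\<^sub>M borel \<Otimes>\<^sub>M CM" by measurable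
  have m: "(\<lambda>w. if (enn2real (\<tau> w), w) \<in> {0..} \<times> space M then f (enn2real (\<tau> w), w) else c) \<in> borel_measurable CM"
    by (rule measurable_compose[OF p good_extend[OF S f, of c]])
  have "(\<lambda>w. if \<tau> w = \<infinity> then c else (if (enn2real (\<tau> w), w) \<in> {0..} \<times> space M then f (enn2real (\<tau> w), w) else c)) \<in> borel_measurable CM"
  proof (rule measurable_If[OF measurable_const m])
    show "{w \<in> space CM. \<tau> w = \<infinity>} \<in> sets CM" by measurable
  qed simp
  then show ?thesis by (subst measurable_cong) auto
qed

text \<open>The occurrence path has a single jump of size 1 at \<tau>, so integrating against it is
  evaluation at \<tau>.\<close>

lemma dual_nn_integral:
  assumes S: "good S" and D: "dual_projection M S (occurrence \<tau>) B"
    and H: "H \<in> borel_measurable S"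
  shows "(\<integral>\<^sup>+w. (\<integral>\<^sup>+s. H (s, w) * indicator {0..} s \<partial>path_measure (\<lambda>t. B t w)) \<partial>CM) =
     (\<integral>\<^sup>+w. (if \<tau> w = \<infinity> then 0 else H (enn2real (\<tau> w), w)) \<partial>CM)"
proof -
  have "(\<integral>\<^sup>+w. (\<integral>\<^sup>+s. H (s, w) * indicator {0..} s \<partial>path_measure (\<lambda>t. B t w)) \<partial>CM) =
    (\<integral>\<^sup>+w. (\<integral>\<^sup>+s. H (s, w) * indicator {0..} s \<partial>path_measure (\<lambda>t. occurrence \<tau> t w)) \<partial>CM)"
    using D H unfolding dual_projection_def by simp
  also have "\<dots> = (\<integral>\<^sup>+w. (if \<tau> w = \<infinity> then 0 else H (enn2real (\<tau> w), w)) \<partial>CM)"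
  proof (rule nn_integral_cong)
    fix w assume w: "w \<in> space CM"
    have "(\<lambda>s. H (s, w) * indicator {0..} s) = (\<lambda>s. if 0 \<le> s then H (s, w) else 0)" by (auto simp: indicator_def fun_eq_iff)
    also have "\<dots> \<in> borel_measurable borel" using good_section_borel[OF S H, of w 0] w by simp
    finally show "(\<integral>\<^sup>+s. H (s, w) * indicator {0..} s \<partial>path_measure (\<lambda>t. occurrence \<tau> t w)) =
      (if \<tau> w = \<infinity> then 0 else H (enn2real (\<tau> w), w))" by (rule nn_integral_occurrence)
  qed
  finally show ?thesis .
qed

lemma dualD:
  assumes S: "good S" and D: "dual_projection M S (occurrence \<tau>) B"
  shows "\<And>w. w \<in> space M \<Longrightarrow> increasing_path (\<lambda>t. B t w)" "(\<lambda>(t, w). B t w) \<in> borel_measurable S"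
    "adapted F B" "\<And>t. 0 \<le> t \<Longrightarrow> B t \<in> borel_measurable CM"
  using D good_adapted[OF S] adapted_CM unfolding dual_projection_def by auto

lemma dual_kernel_measurable:
  fixes H :: "real \<times> 'a \<Rightarrow> ennreal"
  assumes S: "good S" and D: "dual_projection M S (occurrence \<tau>) B" and H: "H \<in> borel_measurable S"
  shows "(\<lambda>w. \<integral>\<^sup>+s. H (s, w) * indicator {0..} s \<partial>path_measure (\<lambda>t. B t w)) \<in> borel_measurable CM"
proof -
  have "(\<lambda>w. \<integral>\<^sup>+s. (if (s, w) \<in> {0..} \<times> space M then H (s, w) else 0) * indicator {0..} s \<partial>path_measure (\<lambda>t. B t w)) \<in> borel_measurable CM"
    using dualD[OF S D] by (intro path_kernel_measurable_Ici good_extend[OF S H]) auto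
  then show ?thesis
    by (rule measurable_cong[THEN iffD1, rotated]) (auto intro!: nn_integral_cong simp: indicator_def)
qed

text \<open>Tested on the graph of a hitting time \<sigma> of B, duality gives the expected dB-mass
  of the graph as P(\<tau> = \<sigma> < \<infinity>), which is 0 by avoidance. The graphs for
  rational levels cover all atoms.\<close>

lemma dual_atomless:
  assumes S: "good S" and D: "dual_projection M S (occurrence \<tau>) B"
  shows "AE w in CM. \<forall>s\<ge>0. emeasure (path_measure (\<lambda>t. B t w)) {s} = 0"
proof -
  note B = dualD[OF S D]
  have "AE w in CM. (\<integral>\<^sup>+s. indicator (graph B c) (s, w) * indicator {0..} s \<partial>path_measure (\<lambda>t. B t w)) = 0" for c
  proof -
    have H: "indicator (graph B c) \<in> borel_measurable S"
      using graph_measurable[OF S B(2)] by (rule borel_measurable_indicator)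
    have st: "stopping_time F (\<lambda>w. Inf (ennreal ` {t. 0 \<le> t \<and> c \<le> B t w}))"
      by (rule hitting_stopping_time[OF B(3) B(1)])
    have "AE w in CM. (if \<tau> w = \<infinity> then 0 else indicator (graph B c) (enn2real (\<tau> w), w)) = (0::ennreal)"
      using avoids_AE[OF st] AE_space[where M = CM]
    proof eventually_elim
      case (elim w)
      have False if "\<tau> w \<noteq> \<infinity>" "(enn2real (\<tau> w), w) \<in> graph B c"
        using graph_hitting[where V = B, OF B(1) that(2)] elim that(1) by (simp add: less_top)
      then show ?case by (auto simp: indicator_def)
    qed
    then have "(\<integral>\<^sup>+w. (if \<tau> w = \<infinity> then 0 else indicator (graph B c) (enn2real (\<tau> w), w)) \<partial>CM) = 0"
      by (subst nn_integral_cong_AE[of _ "\<lambda>_. 0"]) auto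
    then show ?thesis unfolding dual_nn_integral[OF S D H, symmetric]
      by (subst (asm) nn_integral_0_iff_AE) (auto intro: dual_kernel_measurable[OF S D H])
  qed
  then have "AE w in CM. \<forall>c\<in>\<rat>. (\<integral>\<^sup>+s. indicator (graph B c) (s, w) * indicator {0..} s \<partial>path_measure (\<lambda>t. B t w)) = 0"
    by (subst AE_ball_countable) (auto simp: countable_rat)
  then show ?thesis using AE_space[where M = CM]
  proof eventually_elim
    case (elim w)
    then have w: "w \<in> space M" by simp
    show ?case
    proof (intro allI impI, rule ccontr)
      fix s :: real assume s: "0 \<le> s" "emeasure (path_measure (\<lambda>t. B t w)) {s} \<noteq> 0"
      then obtain c where c: "c \<in> \<rat>" "(s, w) \<in> graph B c" using graph_covers_atoms[where V = B, OF B(1)[OF w] w] by blast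
      have "emeasure (path_measure (\<lambda>t. B t w)) {s} = (\<integral>\<^sup>+u. indicator {s} u \<partial>path_measure (\<lambda>t. B t w))" by simp
      also have "\<dots> \<le> (\<integral>\<^sup>+u. indicator (graph B c) (u, w) * indicator {0..} u \<partial>path_measure (\<lambda>t. B t w))"
        using c s by (intro nn_integral_mono) (auto simp: indicator_def)
      also have "\<dots> = 0" using elim(1) c by blast
      finally show False using s by simp
    qed
  qed
qed

lemma dual_finite:
  assumes S: "good S" and D: "dual_projection M S (occurrence \<tau>) B"
  shows "AE w in CM. emeasure (path_measure (\<lambda>t. B t w)) {0..} < \<infinity>"
proof -
  have "(\<integral>\<^sup>+w. (\<integral>\<^sup>+s. 1 * indicator {0..} s \<partial>path_measure (\<lambda>t. B t w)) \<partial>CM) =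
     (\<integral>\<^sup>+w. (if \<tau> w = \<infinity> then 0 else 1) \<partial>CM)"
    using dual_nn_integral[OF S D, of "\<lambda>_. 1"] by simp
  also have "\<dots> \<le> (\<integral>\<^sup>+w. 1 \<partial>CM)" by (intro nn_integral_mono) auto
  also have "\<dots> = 1" by (simp add: emeasure_space_1)
  finally have "(\<integral>\<^sup>+w. (\<integral>\<^sup>+s. 1 * indicator {0..} s \<partial>path_measure (\<lambda>t. B t w)) \<partial>CM) \<noteq> \<infinity>"
    by (auto simp: top_unique)
  then have "AE w in CM. (\<integral>\<^sup>+s. 1 * indicator {0..} s \<partial>path_measure (\<lambda>t. B t w)) \<noteq> \<infinity>"
    using dual_kernel_measurable[OF S D, of "\<lambda>_. 1"] by (intro nn_integral_PInf_AE) auto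
  then show ?thesis by eventually_elim (simp add: less_top)
qed

text \<open>Duality for bounded signed integrands: it holds for the positive and the negative part
  separately, and both have expectation at most |C|, so the difference is meaningful.\<close>

lemma dual_integral:
  fixes g :: "real \<times> 'a \<Rightarrow> real"
  assumes S: "good S" and D: "dual_projection M S (occurrence \<tau>) B"
    and g: "g \<in> borel_measurable S" and C: "\<And>p. p \<in> {0..} \<times> space M \<Longrightarrow> \<bar>g p\<bar> \<le> C"
  shows "AE w in CM. set_integrable (path_measure (\<lambda>t. B t w)) {0..} (\<lambda>s. g (s, w))"
    and "integrable CM (\<lambda>w. LINT s:{0..}|path_measure (\<lambda>t. B t w). g (s, w))"
    and "(\<integral>w. (LINT s:{0..}|path_measure (\<lambda>t. B t w). g (s, w)) \<partial>CM) =
      (\<integral>w. (if \<tau> w = \<infinity> then 0 else g (enn2real (\<tau> w), w)) \<partial>CM)"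
proof -
  note B = dualD[OF S D]
  have m: "(\<lambda>s. g (s, w) * indicator {0..} s) \<in> borel_measurable borel" if "w \<in> space M" for w
  proof -
    have "(\<lambda>s. g (s, w) * indicator {0..} s) = (\<lambda>s. if 0 \<le> s then g (s, w) else 0)" by (auto simp: indicator_def fun_eq_iff)
    then show ?thesis using good_section_borel[OF S g that, of 0] by simp
  qed
  show si: "AE w in CM. set_integrable (path_measure (\<lambda>t. B t w)) {0..} (\<lambda>s. g (s, w))"
    using dual_finite[OF S D] AE_space[where M = CM]
  proof eventually_elim
    case (elim w)
    then have w: "w \<in> space M" by simp
    have "integrable (path_measure (\<lambda>t. B t w)) (\<lambda>s. C * indicator {0..} s)"
      using elim by (intro integrable_mult_right integrable_real_indicator) auto
    then show ?case unfolding set_integrable_def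
    proof (rule Bochner_Integration.integrable_bound)
      show "(\<lambda>s. indicator {0..} s *\<^sub>R g (s, w)) \<in> borel_measurable (path_measure (\<lambda>t. B t w))"
        using m[OF w] by (simp add: mult.commute)
      have "\<bar>g (s, w)\<bar> \<le> \<bar>C\<bar>" if "0 \<le> s" for s using C[of "(s, w)"] w that by simp
      then show "AE s in path_measure (\<lambda>t. B t w). norm (indicator {0..} s *\<^sub>R g (s, w)) \<le> norm (C * indicator {0..} s)"
        by (intro AE_I2) (simp add: indicator_def)
    qed
  qed
  define I where "I = (\<lambda>f w. \<integral>\<^sup>+s. ennreal (f (s, w)) * indicator {0..} s \<partial>path_measure (\<lambda>t. B t w))"
  define J where "J = (\<lambda>f w. if \<tau> w = \<infinity> then 0 else ennreal (f (enn2real (\<tau> w), w)))"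
  let ?n = "\<lambda>p. - g p"
  have IJ: "(\<integral>\<^sup>+w. I f w \<partial>CM) = (\<integral>\<^sup>+w. J f w \<partial>CM)" and Im: "I f \<in> borel_measurable CM"
    if f: "f \<in> borel_measurable S" for f :: "real \<times> 'a \<Rightarrow> real"
    unfolding I_def J_def using dual_nn_integral[OF S D, of "\<lambda>p. ennreal (f p)"] dual_kernel_measurable[OF S D, of "\<lambda>p. ennreal (f p)"] f
    by auto
  have Jfin: "(\<integral>\<^sup>+w. J f w \<partial>CM) < \<infinity>" if f: "\<And>p. p \<in> {0..} \<times> space M \<Longrightarrow> \<bar>f p\<bar> \<le> C" for f :: "real \<times> 'a \<Rightarrow> real"
  proof -
    have "(\<integral>\<^sup>+w. J f w \<partial>CM) \<le> (\<integral>\<^sup>+w. ennreal \<bar>C\<bar> \<partial>CM)"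
    proof (rule nn_integral_mono)
      fix w assume "w \<in> space CM"
      then have "f (enn2real (\<tau> w), w) \<le> \<bar>C\<bar>" using f[of "(enn2real (\<tau> w), w)"] by simp
      then show "J f w \<le> ennreal \<bar>C\<bar>" by (simp add: J_def ennreal_leI)
    qed
    also have "\<dots> < \<infinity>" by (simp add: emeasure_space_1)
    finally show ?thesis .
  qed
  have gS: "?n \<in> borel_measurable S" using g by simp
  have nC: "\<And>p. p \<in> {0..} \<times> space M \<Longrightarrow> \<bar>?n p\<bar> \<le> C" using C by simp
  have fin: "AE w in CM. I f w \<noteq> \<infinity>" if "f \<in> borel_measurable S" "\<And>p. p \<in> {0..} \<times> space M \<Longrightarrow> \<bar>f p\<bar> \<le> C" for f
  proof (rule nn_integral_PInf_AE[OF Im[OF that(1)]])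
    have "(\<integral>\<^sup>+w. J f w \<partial>CM) < \<infinity>" by (rule Jfin) (rule that(2))
    then show "(\<integral>\<^sup>+w. I f w \<partial>CM) \<noteq> \<infinity>" using IJ[OF that(1)] by simp
  qed
  have eI: "integrable CM (\<lambda>w. enn2real (I f w)) \<and> (\<integral>w. enn2real (I f w) \<partial>CM) = enn2real (\<integral>\<^sup>+w. J f w \<partial>CM)"
    if "f \<in> borel_measurable S" "\<And>p. p \<in> {0..} \<times> space M \<Longrightarrow> \<bar>f p\<bar> \<le> C" for f
  proof -
    have e: "(\<integral>\<^sup>+w. ennreal (enn2real (I f w)) \<partial>CM) = (\<integral>\<^sup>+w. I f w \<partial>CM)"
    proof (rule nn_integral_cong_AE)
      have "AE w in CM. I f w \<noteq> \<infinity>" by (rule fin) (rule that(1), rule that(2))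
      then show "AE w in CM. ennreal (enn2real (I f w)) = I f w" by eventually_elim (simp add: less_top)
    qed
    have Jf: "(\<integral>\<^sup>+w. J f w \<partial>CM) < \<infinity>" by (rule Jfin) (rule that(2))
    have "integrable CM (\<lambda>w. enn2real (I f w))"
      using Im[OF that(1)] e IJ[OF that(1)] Jf by (intro integrableI_bounded) auto
    moreover have "(\<integral>w. enn2real (I f w) \<partial>CM) = enn2real (\<integral>\<^sup>+w. J f w \<partial>CM)"
      using Im[OF that(1)] e IJ[OF that(1)] by (subst integral_eq_nn_integral) auto
    ultimately show ?thesis by simp
  qed
  have ig: "integrable CM (\<lambda>w. enn2real (I g w)) \<and> (\<integral>w. enn2real (I g w) \<partial>CM) = enn2real (\<integral>\<^sup>+w. J g w \<partial>CM)"
    by (rule eI) (rule g, rule C)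
  have ign: "integrable CM (\<lambda>w. enn2real (I ?n w)) \<and> (\<integral>w. enn2real (I ?n w) \<partial>CM) = enn2real (\<integral>\<^sup>+w. J ?n w \<partial>CM)"
    by (rule eI) (rule gS, rule nC)
  have ae: "AE w in CM. (LINT s:{0..}|path_measure (\<lambda>t. B t w). g (s, w)) = enn2real (I g w) - enn2real (I ?n w)"
    using si AE_space[where M = CM]
  proof eventually_elim
    case (elim w)
    then have w: "w \<in> space M" by simp
    have "ennreal (norm (indicator {0..} s *\<^sub>R g (s, w))) = ennreal \<bar>g (s, w)\<bar> * indicator {0..} s" for s by (auto simp: indicator_def)
    then have "(\<integral>\<^sup>+s. ennreal \<bar>g (s, w)\<bar> * indicator {0..} s \<partial>path_measure (\<lambda>t. B t w)) < \<infinity>"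
      using elim(1) unfolding set_integrable_def integrable_iff_bounded by simp
    then show ?case using m[OF w] by (subst set_lebesgue_integral_cases) (auto simp: I_def)
  qed
  have lm: "(\<lambda>w. LINT s:{0..}|path_measure (\<lambda>t. B t w). g (s, w)) \<in> borel_measurable CM"
  proof -
    have "(\<lambda>w. LINT s:{0..}|path_measure (\<lambda>t. B t w). (if (s, w) \<in> {0..} \<times> space M then g (s, w) else 0)) \<in> borel_measurable CM"
      using B by (intro path_integral_measurable_Ici good_extend[OF S g]) auto
    then show ?thesis
      by (rule measurable_cong[THEN iffD1, rotated])
        (auto intro!: set_lebesgue_integral_cong)
  qed
  have di: "integrable CM (\<lambda>w. enn2real (I g w) - enn2real (I ?n w))"
    using ig ign by auto
  show "integrable CM (\<lambda>w. LINT s:{0..}|path_measure (\<lambda>t. B t w). g (s, w))"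
    using di lm ae by (intro integrable_cong_AE_imp[OF di]) (auto elim!: eventually_mono)
  have "(\<integral>w. (LINT s:{0..}|path_measure (\<lambda>t. B t w). g (s, w)) \<partial>CM) = (\<integral>w. enn2real (I g w) - enn2real (I ?n w) \<partial>CM)"
    using di lm ae by (intro integral_cong_AE) auto
  also have "\<dots> = enn2real (\<integral>\<^sup>+w. J g w \<partial>CM) - enn2real (\<integral>\<^sup>+w. J ?n w \<partial>CM)"
    using ig ign by simp
  also have "\<dots> = (\<integral>w. (if \<tau> w = \<infinity> then 0 else g (enn2real (\<tau> w), w)) \<partial>CM)"
  proof -
    let ?h = "\<lambda>w. if \<tau> w = \<infinity> then 0 else g (enn2real (\<tau> w), w)"
    have "integrable CM ?h"
    proof (rule C.integrable_const_bound[of _ "\<bar>C\<bar>"])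
      show "AE w in CM. norm (?h w) \<le> \<bar>C\<bar>"
      proof (rule AE_I2)
        fix w assume "w \<in> space CM"
        then show "norm (?h w) \<le> \<bar>C\<bar>" using C[of "(enn2real (\<tau> w), w)"] by auto
      qed
    qed (rule at_\<tau>_measurable[OF S g])
    then show ?thesis by (subst real_lebesgue_integral_def) (auto simp: J_def intro!: arg_cong2[where f="\<lambda>a b. enn2real a - enn2real b"] nn_integral_cong)
  qed
  finally show "(\<integral>w. (LINT s:{0..}|path_measure (\<lambda>t. B t w). g (s, w)) \<partial>CM) =
      (\<integral>w. (if \<tau> w = \<infinity> then 0 else g (enn2real (\<tau> w), w)) \<partial>CM)" .
qed

end

lemma AE_eq_measurable_completion:
  fixes f g :: "'a \<Rightarrow> 'b::topological_space"
  assumes f: "f \<in> borel_measurable (completion M)" and eq: "AE x in completion M. f x = g x"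
  shows "g \<in> borel_measurable (completion M)"
proof (rule measurableI)
  fix B :: "'b set" assume B: "B \<in> sets borel"
  obtain N where N: "{x \<in> space (completion M). f x \<noteq> g x} \<subseteq> N" "N \<in> null_sets (completion M)"
    using eq by (auto elim!: AE_E simp: null_sets_def)
  have S: "g -` B \<inter> N \<inter> space (completion M) \<in> null_sets (completion M)"
    using N(2) by (rule completion.complete2[rotated]) auto
  have "g -` B \<inter> space (completion M) = (f -` B \<inter> space (completion M) - N) \<union> (g -` B \<inter> N \<inter> space (completion M))"
    using N(1) by auto
  also have "\<dots> \<in> sets (completion M)"
    using measurable_sets[OF f B] N(2) S by auto
  finally show "g -` B \<inter> space (completion M) \<in> sets (completion M)" .
qed simp

lemma countable_exhaust:
  assumes "countable S" "S \<noteq> {}"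
  shows "\<exists>Q :: nat \<Rightarrow> 'b set. (\<forall>n. finite (Q n)) \<and> (\<forall>n. Q n \<subseteq> S) \<and> incseq Q \<and> (\<Union>n. Q n) = S"
proof (intro exI[of _ "\<lambda>n. from_nat_into S ` {..n}"] conjI allI)
  have "(\<Union>n. from_nat_into S ` {..n}) = range (from_nat_into S)" by auto
  then show "(\<Union>n. from_nat_into S ` {..n}) = S" using range_from_nat_into[OF assms(2,1)] by simp
qed (use from_nat_into[OF assms(2)] in \<open>auto simp: incseq_def\<close>)

section \<open>First occurrence among finitely many times\<close>

context filtered_space begin

lemma sets_F_CM: "E \<in> sets (F t) \<Longrightarrow> E \<in> sets CM"
  using F_sub by auto

text \<open>With \<open>B q\<close> read as an event observed at time q, this says that q is the
  first time in Q at which it occurs: a discrete stopping time, split into disjoint pieces.\<close>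

definition first_event :: "real set \<Rightarrow> (real \<Rightarrow> 'a set) \<Rightarrow> real \<Rightarrow> 'a set" where
  "first_event Q B q = B q - (\<Union>p\<in>{p\<in>Q. p < q}. B p)"

lemma first_event_sets:
  assumes Q: "finite Q" and B: "\<And>q. q \<in> Q \<Longrightarrow> B q \<in> sets (F (ennreal q))" and q: "q \<in> Q"
  shows "first_event Q B q \<in> sets (F (ennreal q))"
proof -
  have "B p \<in> sets (F (ennreal q))" if "p \<in> {p\<in>Q. p < q}" for p
    using B[of p] that sets_F_mono[of "ennreal p" "ennreal q"] by (auto simp: ennreal_leI)
  then show ?thesis unfolding first_event_def using Q B[OF q] by (intro sets.Diff sets.finite_UN) auto
qed

lemma first_event_disjoint: "disjoint_family_on (first_event Q B) Q"
  unfolding disjoint_family_on_def first_event_def by (auto simp: set_eq_iff) (meson linorder_neqE_linordered_idom)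

lemma first_event_ex:
  assumes Q: "finite Q" and q: "q \<in> Q" "w \<in> B q"
  shows "\<exists>p\<in>Q. p \<le> q \<and> w \<in> first_event Q B p"
proof -
  let ?P = "{p\<in>Q. p \<le> q \<and> w \<in> B p}"
  have "finite ?P" "?P \<noteq> {}" using Q q by auto
  then have m: "Min ?P \<in> ?P" "\<And>p. p \<in> ?P \<Longrightarrow> Min ?P \<le> p" using Min_in[of ?P] Min_le[of ?P] by blast+
  have "w \<in> first_event Q B (Min ?P)"
    unfolding first_event_def
  proof (safe)
    show "w \<in> B (Min ?P)" using m(1) by simp
    fix p assume p: "p \<in> Q" "p < Min ?P" "w \<in> B p"
    then have "p \<in> ?P" using m(1) by auto
    then show False using m(2)[of p] p by auto
  qed
  then show ?thesis using m(1) by auto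
qed

end

section \<open>Conditional expectations on survival; the lower bound of Z before \<tau>\<close>

context random_time begin

abbreviation alive :: "real \<Rightarrow> 'a \<Rightarrow> real" where "alive t w \<equiv> of_bool (\<tau> w > ennreal t)"

lemma alive_sets[measurable]: "{w \<in> space M. ennreal t < \<tau> w} \<in> sets CM"
proof -
  have "\<tau> -` {ennreal t<..} \<inter> space CM \<in> sets CM" by (rule measurable_sets[OF \<tau>_CM]) simp
  then show ?thesis by (simp add: vimage_def Int_def conj_commute)
qed

lemma alive_measurable[measurable]: "alive t \<in> borel_measurable CM"
proof -
  have "indicator {w \<in> space M. ennreal t < \<tau> w} \<in> borel_measurable CM"
    using alive_sets by (rule borel_measurable_indicator)
  then show ?thesis by (rule measurable_cong[THEN iffD1, rotated]) (simp add: indicator_def)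
qed

text \<open>X t is a version of E(\<xi> 1_{t < \<tau>} | F_t). The two instances are Z, with \<xi> =
  1, and X, with \<xi> the value of h at \<tau> (see \<open>X_rep\<close>).\<close>

definition rep :: "('a \<Rightarrow> real) \<Rightarrow> (real \<Rightarrow> 'a \<Rightarrow> real) \<Rightarrow> bool" where
  "rep \<xi> X \<longleftrightarrow> cadlag_cond_exp M F (\<lambda>t w. \<xi> w * alive t w) X"

lemma bounded_integrable:
  fixes f :: "'a \<Rightarrow> real"
  assumes "f \<in> borel_measurable CM" "AE w in CM. \<bar>f w\<bar> \<le> c" shows "integrable CM f"
  using assms by (intro C.integrable_const_bound[of _ c]) auto

lemma repD:
  assumes "rep \<xi> X"
  shows "adapted F X" "\<And>w. w \<in> space M \<Longrightarrow> cadlag (\<lambda>t. X t w)"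
    "\<And>t. 0 \<le> t \<Longrightarrow> X t \<in> borel_measurable (F (ennreal t))"
    "\<And>t. 0 \<le> t \<Longrightarrow> X t \<in> borel_measurable CM"
    "\<And>t. 0 \<le> t \<Longrightarrow> AE w in CM. X t w = real_cond_exp CM (F (ennreal t)) (\<lambda>w. \<xi> w * alive t w) w"
proof -
  note r = assms[unfolded rep_def cadlag_cond_exp_def]
  show ad: "adapted F X" using r by (rule conjunct1)
  show "cadlag (\<lambda>t. X t w)" if "w \<in> space M" for w
    using r[THEN conjunct2, THEN conjunct1] that by (rule bspec)
  show "X t \<in> borel_measurable (F (ennreal t))" if "0 \<le> t" for t
    using ad that unfolding adapted_def by blast
  show "X t \<in> borel_measurable CM" if "0 \<le> t" for t
    using ad that by (rule adapted_CM)
  show "AE w in CM. X t w = real_cond_exp CM (F (ennreal t)) (\<lambda>w. \<xi> w * alive t w) w" if "0 \<le> t" for t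
    using r[THEN conjunct2, THEN conjunct2] that by (elim allE impE)
qed

lemma rep_integral:
  assumes r: "rep \<xi> X" and \<xi>: "\<xi> \<in> borel_measurable CM" "\<And>w. w \<in> space M \<Longrightarrow> \<bar>\<xi> w\<bar> \<le> C"
    and t: "0 \<le> t" and f: "f \<in> borel_measurable (F (ennreal t))" "AE w in CM. \<bar>f w\<bar> \<le> c"
  shows "integrable CM (\<lambda>w. f w * X t w)"
    and "(\<integral>w. f w * X t w \<partial>CM) = (\<integral>w. f w * (\<xi> w * alive t w) \<partial>CM)"
proof -
  interpret S: sigma_finite_subalgebra CM "F (ennreal t)" by (rule sigma_finite_F)
  note [measurable] = F_measurable_CM[OF f(1)] \<xi>(1) repD(4)[OF r t]
  have i: "integrable CM (\<lambda>w. f w * (\<xi> w * alive t w))"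
  proof (rule bounded_integrable)
    show "AE w in CM. \<bar>f w * (\<xi> w * alive t w)\<bar> \<le> \<bar>c\<bar> * \<bar>C\<bar>"
      using f(2) AE_space[where M = CM]
    proof eventually_elim
      case (elim w)
      then have "\<bar>f w\<bar> * (\<bar>\<xi> w\<bar> * of_bool (\<tau> w > ennreal t)) \<le> \<bar>c\<bar> * (\<bar>C\<bar> * 1)"
        using \<xi>(2)[of w] by (intro mult_mono) auto
      then show ?case by (simp add: abs_mult)
    qed
  qed measurable
  note R = S.real_cond_exp_intg[OF i f(1)]
  have m: "(\<lambda>w. \<xi> w * alive t w) \<in> borel_measurable CM" by measurable
  have ae: "AE w in CM. f w * real_cond_exp CM (F (ennreal t)) (\<lambda>w. \<xi> w * alive t w) w = f w * X t w"
    using repD(5)[OF r t] by eventually_elim simp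
  show "integrable CM (\<lambda>w. f w * X t w)"
    by (rule integrable_cong_AE_imp[OF R(1)[OF m] _ ae]) measurable
  have "(\<integral>w. f w * X t w \<partial>CM) = (\<integral>w. f w * real_cond_exp CM (F (ennreal t)) (\<lambda>w. \<xi> w * alive t w) w \<partial>CM)"
    using ae by (intro integral_cong_AE) auto
  then show "(\<integral>w. f w * X t w \<partial>CM) = (\<integral>w. f w * (\<xi> w * alive t w) \<partial>CM)"
    using R(2)[OF m] by simp
qed

text \<open>Monotonicity of conditional expectation for \<xi> and for -\<xi>; the survival indicator
  turns the constant C into C Z.\<close>

lemma rep_AE_le:
  assumes r: "rep \<xi> X" and \<xi>: "\<xi> \<in> borel_measurable CM" "\<And>w. w \<in> space M \<Longrightarrow> \<bar>\<xi> w\<bar> \<le> C"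
    and rZ: "rep (\<lambda>_. 1) Z" and t: "0 \<le> t"
  shows "AE w in CM. \<bar>X t w\<bar> \<le> C * Z t w"
proof -
  interpret S: sigma_finite_subalgebra CM "F (ennreal t)" by (rule sigma_finite_F)
  note [measurable] = \<xi>(1)
  have iX: "integrable CM (\<lambda>w. \<xi> w * alive t w)"
    using \<xi>(2) by (intro bounded_integrable[where c = "\<bar>C\<bar>"] AE_I2) (auto simp: abs_mult intro: order_trans[OF _ abs_ge_self])
  have iZ: "integrable CM (alive t)" by (intro bounded_integrable[where c = 1] AE_I2) auto
  have nX: "integrable CM (\<lambda>w. - 1 * (\<xi> w * alive t w))" and CZ: "integrable CM (\<lambda>w. C * alive t w)" using iX iZ by auto
  have le: "\<xi> w * alive t w \<le> C * alive t w" "- 1 * (\<xi> w * alive t w) \<le> C * alive t w" if "w \<in> space CM" for w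
    using \<xi>(2)[of w] that by (auto simp: of_bool_def)
  have "AE w in CM. real_cond_exp CM (F (ennreal t)) (\<lambda>w. \<xi> w * alive t w) w \<le> real_cond_exp CM (F (ennreal t)) (\<lambda>w. C * alive t w) w"
    using le by (intro S.real_cond_exp_mono iX CZ AE_I2)
  moreover have "AE w in CM. real_cond_exp CM (F (ennreal t)) (\<lambda>w. - 1 * (\<xi> w * alive t w)) w \<le> real_cond_exp CM (F (ennreal t)) (\<lambda>w. C * alive t w) w"
    using le by (intro S.real_cond_exp_mono nX CZ AE_I2)
  moreover have "AE w in CM. Z t w = real_cond_exp CM (F (ennreal t)) (alive t) w"
    using repD(5)[OF rZ t] by simp
  moreover note repD(5)[OF r t] S.real_cond_exp_cmult[OF iX, of "-1"] S.real_cond_exp_cmult[OF iZ, of C]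
  ultimately show ?thesis by eventually_elim auto
qed

lemma rep_Z_bounds:
  assumes rZ: "rep (\<lambda>_. 1) Z" and t: "0 \<le> t"
  shows "AE w in CM. 0 \<le> Z t w \<and> Z t w \<le> 1"
proof -
  interpret S: sigma_finite_subalgebra CM "F (ennreal t)" by (rule sigma_finite_F)
  have iZ: "integrable CM (alive t)" by (intro bounded_integrable[where c = 1] AE_I2) auto
  have "AE w in CM. Z t w = real_cond_exp CM (F (ennreal t)) (alive t) w"
    using repD(5)[OF rZ t] by simp
  moreover have "AE w in CM. 0 \<le> real_cond_exp CM (F (ennreal t)) (alive t) w"
    by (intro S.real_cond_exp_pos AE_I2) auto
  moreover have "AE w in CM. real_cond_exp CM (F (ennreal t)) (alive t) w \<le> 1"
    using iZ by (intro S.real_cond_exp_le_c) auto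
  ultimately show ?thesis by eventually_elim auto
qed

lemma rep_Z_event:
  assumes rZ: "rep (\<lambda>_. 1) Z" and t: "0 \<le> t" and D: "D \<in> sets (F (ennreal t))"
  shows "(\<integral>w. indicator D w * Z t w \<partial>CM) = C.prob {w \<in> D. ennreal t < \<tau> w}"
proof -
  have D': "D \<in> sets CM" "D \<subseteq> space M" using sets_F_CM[OF D] sets.sets_into_space[OF D] by auto
  have "(\<integral>w. indicator D w * Z t w \<partial>CM) = (\<integral>w. indicator D w * (1 * alive t w) \<partial>CM)"
    using D by (intro rep_integral(2)[OF rZ, of 1 t _ 1] t AE_I2) (auto simp: indicator_def)
  also have "\<dots> = (\<integral>w. indicator {w \<in> D. ennreal t < \<tau> w} w \<partial>CM)"
    by (intro Bochner_Integration.integral_cong) (auto simp: indicator_def)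
  also have "\<dots> = C.prob {w \<in> D. ennreal t < \<tau> w}"
  proof -
    have "{w \<in> D. ennreal t < \<tau> w} = D \<inter> {w \<in> space CM. ennreal t < \<tau> w}" using D' by auto
    also have "\<dots> \<in> sets CM" using D' alive_sets[of t] by simp
    finally have "{w \<in> D. ennreal t < \<tau> w} \<inter> space CM = {w \<in> D. ennreal t < \<tau> w}" using D' by auto
    then show ?thesis by simp
  qed
  finally show ?thesis .
qed

text \<open>A maximal inequality. If q < \<tau> and Z_q < \<epsilon>, then the first p in Q with Z_p
  < \<epsilon> satisfies p < \<tau> as well. On the event E_p in F_p that p is first, P(E_p, p <
  \<tau>) = E(1_{E_p} Z_p) \<le> \<epsilon> P(E_p), and the events E_p are disjoint.\<close>

lemma Z_event_finite:
  assumes rZ: "rep (\<lambda>_. 1) Z" and Q: "finite Q" "Q \<subseteq> {0..}" and \<epsilon>: "0 \<le> \<epsilon>"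
  shows "C.prob {w \<in> space M. \<exists>q\<in>Q. ennreal q < \<tau> w \<and> Z q w < \<epsilon>} \<le> \<epsilon>"
proof -
  define B where "B = (\<lambda>q. {w \<in> space M. Z q w < \<epsilon>})"
  have B: "B q \<in> sets (F (ennreal q))" if "q \<in> Q" for q
  proof -
    have "Z q \<in> borel_measurable (F (ennreal q))" using repD(3)[OF rZ] Q that by auto
    from measurable_sets[OF this, of "{..<\<epsilon>}"] show ?thesis by (simp add: B_def vimage_def Int_def conj_commute)
  qed
  let ?E = "first_event Q B"
  have E: "?E q \<in> sets (F (ennreal q))" if "q \<in> Q" for q using first_event_sets[OF Q(1) B that] .
  have ES: "{w \<in> ?E q. ennreal q < \<tau> w} \<in> sets CM" if "q \<in> Q" for q
  proof -
    have "{w \<in> ?E q. ennreal q < \<tau> w} = ?E q \<inter> {w \<in> space CM. ennreal q < \<tau> w}"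
      using sets.sets_into_space[OF E[OF that]] by auto
    also have "\<dots> \<in> sets CM" using sets_F_CM[OF E[OF that]] alive_sets[of q] by simp
    finally show ?thesis .
  qed
  have "{w \<in> space M. \<exists>q\<in>Q. ennreal q < \<tau> w \<and> Z q w < \<epsilon>} \<subseteq> (\<Union>q\<in>Q. {w \<in> ?E q. ennreal q < \<tau> w})"
  proof safe
    fix w q assume w: "w \<in> space M" "q \<in> Q" "ennreal q < \<tau> w" "Z q w < \<epsilon>"
    then obtain p where "p \<in> Q" "p \<le> q" "w \<in> ?E p" using first_event_ex[OF Q(1) w(2), of w B] by (auto simp: B_def)
    moreover have "ennreal p < \<tau> w" using \<open>p \<le> q\<close> w(3) by (meson ennreal_leI le_less_trans)
    ultimately show "w \<in> (\<Union>q\<in>Q. {w \<in> ?E q. ennreal q < \<tau> w})" by auto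
  qed
  then have "C.prob {w \<in> space M. \<exists>q\<in>Q. ennreal q < \<tau> w \<and> Z q w < \<epsilon>} \<le> C.prob (\<Union>q\<in>Q. {w \<in> ?E q. ennreal q < \<tau> w})"
    using ES Q by (intro C.finite_measure_mono sets.finite_UN) auto
  also have "\<dots> \<le> (\<Sum>q\<in>Q. C.prob {w \<in> ?E q. ennreal q < \<tau> w})"
    using ES Q by (intro C.finite_measure_subadditive_finite) auto
  also have "\<dots> \<le> (\<Sum>q\<in>Q. \<epsilon> * C.prob (?E q))"
  proof (rule sum_mono)
    fix q assume q: "q \<in> Q"
    then have q0: "0 \<le> q" using Q by auto
    have "C.prob {w \<in> ?E q. ennreal q < \<tau> w} = (\<integral>w. indicator (?E q) w * Z q w \<partial>CM)"
      by (rule rep_Z_event[OF rZ q0 E[OF q], symmetric])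
    also have "\<dots> \<le> (\<integral>w. \<epsilon> * indicator (?E q) w \<partial>CM)"
    proof (rule integral_mono)
      show "integrable CM (\<lambda>w. indicator (?E q) w * Z q w)"
        using E[OF q] by (intro rep_integral(1)[OF rZ, of 1 q _ 1] q0 AE_I2) (auto simp: indicator_def)
      show "integrable CM (\<lambda>w. \<epsilon> * indicator (?E q) w)"
        using sets_F_CM[OF E[OF q]] by (intro integrable_mult_right integrable_real_indicator) (auto simp: C.emeasure_eq_measure)
      show "indicator (?E q) w * Z q w \<le> \<epsilon> * indicator (?E q) w" for w
        by (auto simp: indicator_def first_event_def B_def)
    qed
    also have "\<dots> = \<epsilon> * C.prob (?E q)"
      using sets_F_CM[OF E[OF q]] sets.sets_into_space[OF E[OF q]] by (simp add: Int_absorb2)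
    finally show "C.prob {w \<in> ?E q. ennreal q < \<tau> w} \<le> \<epsilon> * C.prob (?E q)" .
  qed
  also have "\<dots> = \<epsilon> * C.prob (\<Union>q\<in>Q. ?E q)"
    using Q sets_F_CM[OF E] first_event_disjoint by (subst C.finite_measure_finite_Union) (auto simp: sum_distrib_left)
  also have "\<dots> \<le> \<epsilon> * 1" using \<epsilon> by (intro mult_left_mono) auto
  finally show ?thesis by simp
qed

lemma Z_event_countable:
  assumes rZ: "rep (\<lambda>_. 1) Z" and \<epsilon>: "0 \<le> \<epsilon>"
  defines "S \<equiv> {w \<in> space M. \<exists>q\<in>\<rat> \<inter> {0..}. ennreal q < \<tau> w \<and> Z q w < \<epsilon>}"
  shows "S \<in> sets CM" "C.prob S \<le> \<epsilon>"
proof -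
  have c: "countable (\<rat> \<inter> {0::real..})" by (rule countable_Int1) (rule countable_rat)
  have ne: "\<rat> \<inter> {0::real..} \<noteq> {}" using Rats_0 by (auto simp: ex_in_conv[symmetric] intro!: exI[of _ 0])
  obtain Q :: "nat \<Rightarrow> real set" where Q: "\<And>n. finite (Q n)" "\<And>n. Q n \<subseteq> \<rat> \<inter> {0..}" "incseq Q" "(\<Union>n. Q n) = \<rat> \<inter> {0..}"
    using countable_exhaust[OF c ne] by auto
  let ?A = "\<lambda>n. {w \<in> space M. \<exists>q\<in>Q n. ennreal q < \<tau> w \<and> Z q w < \<epsilon>}"
  have A: "?A n \<in> sets CM" for n
  proof -
    have "?A n = (\<Union>q\<in>Q n. {w \<in> space CM. ennreal q < \<tau> w \<and> Z q w < \<epsilon>})" by auto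
    also have "\<dots> \<in> sets CM"
    proof (intro sets.finite_UN Q)
      fix q assume "q \<in> Q n"
      then have [measurable]: "Z q \<in> borel_measurable CM" using repD(4)[OF rZ] Q(2) by auto
      show "{w \<in> space CM. ennreal q < \<tau> w \<and> Z q w < \<epsilon>} \<in> sets CM" by measurable
    qed
    finally show ?thesis .
  qed
  have S: "S = (\<Union>n. ?A n)" unfolding S_def Q(4)[symmetric] by auto
  then show "S \<in> sets CM" using A by auto
  have "(\<lambda>n. C.prob (?A n)) \<longlonglongrightarrow> C.prob (\<Union>n. ?A n)"
  proof (rule C.finite_Lim_measure_incseq)
    show "range ?A \<subseteq> sets CM" using A by auto
    show "incseq ?A" unfolding incseq_def using incseqD[OF Q(3)] by blast
  qed
  then show "C.prob S \<le> \<epsilon>" unfolding S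
    by (rule LIMSEQ_le_const2) (use Z_event_finite[OF rZ Q(1) _ \<epsilon>] Q(2) in blast)
qed

text \<open>With probability at most 1/(n+1), Z falls below 1/(n+1) at a rational time before
  \<tau>; so almost no path does so for every n. Right-continuity extends the bound from rational
  times to all times before \<tau>.\<close>

lemma Z_bounded_below:
  assumes rZ: "rep (\<lambda>_. 1) Z"
  shows "AE w in CM. \<exists>\<epsilon>>0. \<forall>t\<ge>0. ennreal t < \<tau> w \<longrightarrow> \<epsilon> \<le> Z t w"
proof -
  let ?S = "\<lambda>\<epsilon>. {w \<in> space M. \<exists>q\<in>\<rat> \<inter> {0..}. ennreal q < \<tau> w \<and> Z q w < \<epsilon>}"
  let ?I = "\<Inter>n. ?S (inverse (real (Suc n)))"
  have S: "?S \<epsilon> \<in> sets CM" "C.prob (?S \<epsilon>) \<le> \<epsilon>" if "0 \<le> \<epsilon>" for \<epsilon> using Z_event_countable[OF rZ that] by auto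
  have I: "?I \<in> sets CM" by (intro sets.countable_INT) (auto intro!: S(1) simp del: of_nat_Suc)
  have "C.prob ?I \<le> inverse (real (Suc n))" for n
    by (rule order_trans[OF C.finite_measure_mono S(2)]) (auto intro!: S(1) simp del: of_nat_Suc)
  then have "C.prob ?I \<le> 0" using LIMSEQ_inverse_real_of_nat by (intro LIMSEQ_le_const) auto
  then have "?I \<in> null_sets CM" using I by (intro null_setsI) (auto simp: C.emeasure_eq_measure measure_le_0_iff)
  then have "AE w in CM. w \<notin> ?I" by (rule AE_not_in)
  then show ?thesis using AE_space[where M = CM]
  proof eventually_elim
    case (elim w)
    then obtain n where n: "w \<notin> ?S (inverse (real (Suc n)))" by blast
    have w: "w \<in> space M" using elim by simp
    let ?e = "inverse (real (Suc n))"
    have q: "?e \<le> Z q w" if "q \<in> \<rat>" "0 \<le> q" "ennreal q < \<tau> w" for q using n w that by (force simp del: of_nat_Suc)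
    have "?e \<le> Z t w" if t: "0 \<le> t" "ennreal t < \<tau> w" for t
    proof (rule ccontr)
      assume "\<not> ?e \<le> Z t w"
      moreover have "((\<lambda>t. Z t w) \<longlongrightarrow> Z t w) (at_right t)"
        using repD(2)[OF rZ w] t by (auto simp: cadlag_def continuous_within)
      ultimately have "\<forall>\<^sub>F s in at_right t. Z s w < ?e" by (intro order_tendstoD(2)) auto
      then obtain b where b: "t < b" "\<And>s. t < s \<Longrightarrow> s < b \<Longrightarrow> Z s w < ?e" by (auto simp: eventually_at_right_field)
      obtain c where c: "t < c" "c \<le> b" "\<And>s. t < s \<Longrightarrow> s < c \<Longrightarrow> ennreal s < \<tau> w"
      proof (cases "\<tau> w")
        case (real r)
        then have "t < r" using t by (simp add: ennreal_less_iff)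
        show ?thesis by (rule that[of "min r b"]) (use \<open>t < r\<close> b t real in \<open>auto simp: ennreal_less_iff\<close>)
      next
        case top then show ?thesis using b by (intro that[of b]) (auto simp: less_top[symmetric])
      qed
      obtain s where s: "s \<in> \<rat>" "t < s" "s < c" using Rats_dense_in_real[OF c(1)] by auto
      have "?e \<le> Z s w" using c s t by (intro q) auto
      moreover have "Z s w < ?e" using b s c by (intro b(2)) auto
      ultimately show False by simp
    qed
    then show ?case by (intro exI[of _ ?e]) auto
  qed
qed

end

section \<open>Convergence of Z at infinity\<close>

context random_time begin

text \<open>For s \<le> t this is the indicator of {s < \<tau> \<le> t}.\<close>

definition dies :: "real \<Rightarrow> real \<Rightarrow> 'a \<Rightarrow> real" where "dies s t w = alive s w - alive t w"

lemma dies_bounds: "s \<le> t \<Longrightarrow> 0 \<le> dies s t w" "s \<le> t \<Longrightarrow> dies s t w \<le> 1"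
  unfolding dies_def by (auto simp: of_bool_def dest: ennreal_leI intro: le_less_trans)

lemma dies_measurable[measurable]: "dies s t \<in> borel_measurable CM"
  unfolding dies_def by simp

lemma dies_mono: "s \<le> u \<Longrightarrow> u \<le> t \<Longrightarrow> dies u t w \<le> dies s t w"
  using dies_bounds(1)[of s u w] by (simp add: dies_def)

lemma integrable_times_dies:
  assumes "f \<in> borel_measurable CM" "AE w in CM. \<bar>f w\<bar> \<le> c" "s \<le> t" shows "integrable CM (\<lambda>w. f w * dies s t w)"
proof (rule bounded_integrable)
  show "AE w in CM. \<bar>f w * dies s t w\<bar> \<le> \<bar>c\<bar> * 1"
    using assms(2)
  proof eventually_elim
    case (elim w)
    then have "\<bar>f w\<bar> * \<bar>dies s t w\<bar> \<le> \<bar>c\<bar> * 1" using dies_bounds[OF assms(3), of w] by (intro mult_mono) auto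
    then show ?case by (simp add: abs_mult)
  qed
  show "(\<lambda>w. f w * dies s t w) \<in> borel_measurable CM" using assms(1) by simp
qed

lemma integrable_dies: "s \<le> t \<Longrightarrow> integrable CM (dies s t)"
  using integrable_times_dies[of "\<lambda>_. 1" 1 s t] by simp

context
  fixes Z :: "real \<Rightarrow> 'a \<Rightarrow> real"
  assumes rZ: "rep (\<lambda>_. 1) Z"
begin

text \<open>The supermartingale defect of Z in exact form: what is lost from s to t is the mass of
  {s < \<tau> \<le> t}.\<close>

lemma Z_increment:
  assumes st: "0 \<le> s" "s \<le> t" and f: "f \<in> borel_measurable (F (ennreal s))" "AE w in CM. \<bar>f w\<bar> \<le> c"
  shows "(\<integral>w. f w * Z s w \<partial>CM) = (\<integral>w. f w * Z t w \<partial>CM) + (\<integral>w. f w * dies s t w \<partial>CM)"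
proof -
  have ft: "f \<in> borel_measurable (F (ennreal t))" using f(1) st by (rule_tac F_measurable_mono) (auto simp: ennreal_leI)
  have t: "0 \<le> t" using st by simp
  have s: "(\<integral>w. f w * Z s w \<partial>CM) = (\<integral>w. f w * (1 * alive s w) \<partial>CM)"
    by (rule rep_integral(2)[OF rZ _ _ st(1) f]) auto
  have t': "(\<integral>w. f w * Z t w \<partial>CM) = (\<integral>w. f w * (1 * alive t w) \<partial>CM)"
    by (rule rep_integral(2)[OF rZ _ _ t ft f(2)]) auto
  have "integrable CM (\<lambda>w. f w * alive u w)" for u
  proof (rule bounded_integrable)
    show "AE w in CM. \<bar>f w * alive u w\<bar> \<le> \<bar>c\<bar>" using f(2) by eventually_elim (auto simp: abs_mult of_bool_def)
    show "(\<lambda>w. f w * alive u w) \<in> borel_measurable CM" using F_measurable_CM[OF f(1)] by simp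
  qed
  then have "(\<integral>w. f w * dies s t w \<partial>CM) = (\<integral>w. f w * alive s w \<partial>CM) - (\<integral>w. f w * alive t w \<partial>CM)"
    unfolding dies_def right_diff_distrib by (subst Bochner_Integration.integral_diff) auto
  then show ?thesis using s t' by simp
qed

lemma Z_abs_le_1: "0 \<le> t \<Longrightarrow> AE w in CM. \<bar>Z t w\<bar> \<le> 1"
proof -
  assume "0 \<le> t"
  from rep_Z_bounds[OF rZ this] show ?thesis by eventually_elim auto
qed

lemma Z_measurable: "0 \<le> t \<Longrightarrow> Z t \<in> borel_measurable CM"
  using repD(4)[OF rZ] .

lemma integrable_ZZ: "0 \<le> s \<Longrightarrow> 0 \<le> t \<Longrightarrow> integrable CM (\<lambda>w. Z s w * Z t w)"
proof (rule bounded_integrable)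
  assume st: "0 \<le> s" "0 \<le> t"
  show "(\<lambda>w. Z s w * Z t w) \<in> borel_measurable CM" using Z_measurable st by simp
  show "AE w in CM. \<bar>Z s w * Z t w\<bar> \<le> 1 * 1"
    using Z_abs_le_1[OF st(1)] Z_abs_le_1[OF st(2)] by eventually_elim (simp only: abs_mult, intro mult_mono, auto)
qed

lemma integrable_Z: "0 \<le> t \<Longrightarrow> integrable CM (Z t)"
  using bounded_integrable[OF Z_measurable Z_abs_le_1] .

text \<open>A bounded increasing function that controls squared increments. Expanding (Z_t - Z_s)^2
  gives E Z_t^2 - E Z_s^2 + 2 E(Z_s; s < \<tau> \<le> t). Two copies of P(\<tau> \<le> t) absorb the
  last term, and the third pays for the extra summand P(s < \<tau> \<le> t) in
  \<open>Z_square\<close>.\<close>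

definition energy :: "real \<Rightarrow> real" where
  "energy t = (\<integral>w. Z t w * Z t w \<partial>CM) + 3 * (\<integral>w. 1 - alive t w \<partial>CM)"

lemma Z_square:
  assumes st: "0 \<le> s" "s \<le> t"
  shows "(\<integral>w. (Z t w - Z s w)\<^sup>2 \<partial>CM) + (\<integral>w. dies s t w \<partial>CM) \<le> energy t - energy s"
proof -
  have t: "0 \<le> t" using st by simp
  note zz = integrable_ZZ[OF t t] integrable_ZZ[OF st(1) t] integrable_ZZ[OF st(1) st(1)]
  have al: "integrable CM (alive u)" for u by (rule bounded_integrable[where c = 1]) auto
  have "(\<integral>w. (Z t w - Z s w)\<^sup>2 \<partial>CM) = (\<integral>w. Z t w * Z t w - 2 * (Z s w * Z t w) + Z s w * Z s w \<partial>CM)"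
    by (intro Bochner_Integration.integral_cong) (auto simp: power2_eq_square algebra_simps)
  also have "\<dots> = (\<integral>w. Z t w * Z t w \<partial>CM) - 2 * (\<integral>w. Z s w * Z t w \<partial>CM) + (\<integral>w. Z s w * Z s w \<partial>CM)"
    using zz by simp
  also have "(\<integral>w. Z s w * Z t w \<partial>CM) = (\<integral>w. Z s w * Z s w \<partial>CM) - (\<integral>w. Z s w * dies s t w \<partial>CM)"
    using Z_increment[OF st repD(3)[OF rZ st(1)] Z_abs_le_1[OF st(1)]] by simp
  finally have 1: "(\<integral>w. (Z t w - Z s w)\<^sup>2 \<partial>CM) =
     (\<integral>w. Z t w * Z t w \<partial>CM) - (\<integral>w. Z s w * Z s w \<partial>CM) + 2 * (\<integral>w. Z s w * dies s t w \<partial>CM)" by simp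
  have "(\<integral>w. Z s w * dies s t w \<partial>CM) \<le> (\<integral>w. dies s t w \<partial>CM)"
  proof (rule integral_mono_AE)
    show "integrable CM (\<lambda>w. Z s w * dies s t w)"
      by (rule integrable_times_dies[OF Z_measurable[OF st(1)] Z_abs_le_1[OF st(1)] st(2)])
    show "integrable CM (dies s t)" by (rule integrable_dies[OF st(2)])
    show "AE w in CM. Z s w * dies s t w \<le> dies s t w"
      using Z_abs_le_1[OF st(1)]
    proof eventually_elim
      case (elim w)
      then have "Z s w * dies s t w \<le> 1 * dies s t w" using dies_bounds(1)[OF st(2)] by (intro mult_right_mono) auto
      then show ?case by simp
    qed
  qed
  moreover have "(\<integral>w. dies s t w \<partial>CM) = (\<integral>w. 1 - alive t w \<partial>CM) - (\<integral>w. 1 - alive s w \<partial>CM)"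
    unfolding dies_def using al by simp
  ultimately show ?thesis using 1 by (simp add: energy_def)
qed

lemma energy_mono: "0 \<le> s \<Longrightarrow> s \<le> t \<Longrightarrow> energy s \<le> energy t"
proof -
  assume st: "0 \<le> s" "s \<le> t"
  have "0 \<le> (\<integral>w. (Z t w - Z s w)\<^sup>2 \<partial>CM)" "0 \<le> (\<integral>w. dies s t w \<partial>CM)"
    using dies_bounds(1)[OF st(2)] by auto
  then show ?thesis using Z_square[OF st] by linarith
qed

lemma energy_bound: "0 \<le> t \<Longrightarrow> energy t \<le> 4"
proof -
  assume t: "0 \<le> t"
  have al: "integrable CM (alive u)" for u by (rule bounded_integrable[where c = 1]) auto
  have "(\<integral>w. Z t w * Z t w \<partial>CM) \<le> (\<integral>w. 1 \<partial>CM)"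
  proof (rule integral_mono_AE[OF integrable_ZZ[OF t t]])
    show "AE w in CM. Z t w * Z t w \<le> 1"
      using rep_Z_bounds[OF rZ t] by eventually_elim (auto intro: mult_le_one)
  qed simp
  moreover have "(\<integral>w. 1 - alive t w \<partial>CM) \<le> (\<integral>w. 1 \<partial>CM)"
    using al by (intro integral_mono) auto
  ultimately show ?thesis by (simp add: energy_def prob_space)
qed

lemma energy_small:
  assumes "0 < \<delta>" shows "\<exists>n::nat. \<forall>K::nat\<ge>n. energy (real K) - energy (real n) < \<delta>"
proof -
  let ?g = "\<lambda>n::nat. energy (real n)"
  have "incseq ?g" by (auto simp: incseq_def intro!: energy_mono)
  then obtain L where L: "?g \<longlonglongrightarrow> L" "\<forall>i. ?g i \<le> L"
    using incseq_convergent[of ?g 4] energy_bound by (metis of_nat_0_le_iff)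
  then have "\<forall>\<^sub>F n in sequentially. L - \<delta> < ?g n" using assms by (intro order_tendstoD) auto
  then obtain n where "L - \<delta> < ?g n" by (auto simp: eventually_sequentially)
  then show ?thesis using L(2) by (intro exI[of _ n]) (smt (verit))
qed

text \<open>A Doob inequality through first events. On the piece where q is the first time with |Z_q
  - Z_n| > \<epsilon>, \<open>f\<close> is the sign of that difference. \<open>Z_increment\<close>
  replaces Z_q by Z_K at the price of the mass of {q < \<tau> \<le> K}, and summing over the
  disjoint pieces leaves a single copy of the bound.\<close>

lemma Z_max_event:
  assumes Q: "finite Q" "Q \<subseteq> {real n..real K}" and \<epsilon>: "0 < \<epsilon>"
  defines "A \<equiv> {w \<in> space M. \<exists>q\<in>Q. \<epsilon> < \<bar>Z q w - Z (real n) w\<bar>}"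
  shows "A \<in> sets CM"
    and "\<epsilon> * C.prob A \<le> (\<integral>w. \<bar>Z (real K) w - Z (real n) w\<bar> \<partial>CM) + (\<integral>w. dies (real n) (real K) w \<partial>CM)"
proof -
  let ?n = "real n" and ?K = "real K"
  define B where "B = (\<lambda>q. {w \<in> space M. \<epsilon> < \<bar>Z q w - Z ?n w\<bar>})"
  have q0: "0 \<le> q" "?n \<le> q" "q \<le> ?K" if "q \<in> Q" for q using Q that by (auto intro: order_trans[of 0 ?n])
  have ZF: "Z q \<in> borel_measurable (F (ennreal q))" "Z ?n \<in> borel_measurable (F (ennreal q))" if "q \<in> Q" for q
    using repD(3)[OF rZ q0(1)[OF that]] F_measurable_mono[OF repD(3)[OF rZ, of ?n], of "ennreal q"] q0[OF that]
    by (auto simp: ennreal_leI)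
  have B: "B q \<in> sets (F (ennreal q))" if "q \<in> Q" for q
  proof -
    have "(\<lambda>w. \<bar>Z q w - Z ?n w\<bar>) \<in> borel_measurable (F (ennreal q))" using ZF[OF that] by simp
    from measurable_sets[OF this, of "{\<epsilon><..}"] show ?thesis by (simp add: B_def vimage_def Int_def conj_commute)
  qed
  have "A = (\<Union>q\<in>Q. B q)" by (auto simp: A_def B_def)
  then show "A \<in> sets CM" using B sets_F_CM Q by auto
  let ?E = "first_event Q B"
  have E: "?E q \<in> sets (F (ennreal q))" if "q \<in> Q" for q using first_event_sets[OF Q(1) B that] .
  define Y where "Y = (\<lambda>w. \<bar>Z ?K w - Z ?n w\<bar> + dies ?n ?K w)"
  have nK: "?n \<le> ?K" if "q \<in> Q" for q using q0[OF that] by simp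
  have "\<epsilon> * C.prob (?E q) \<le> (\<integral>w. indicator (?E q) w * Y w \<partial>CM)" if q: "q \<in> Q" for q
  proof -
    define f where "f = (\<lambda>w. indicator (?E q) w * sgn (Z q w - Z ?n w))"
    have fF: "f \<in> borel_measurable (F (ennreal q))"
      unfolding f_def using E[OF q] ZF[OF q] by measurable
    have f1: "AE w in CM. \<bar>f w\<bar> \<le> 1" by (rule AE_I2) (auto simp: f_def indicator_def sgn_if)
    have fZ: "integrable CM (\<lambda>w. f w * Z u w)" if "0 \<le> u" for u
    proof (rule bounded_integrable)
      show "(\<lambda>w. f w * Z u w) \<in> borel_measurable CM" using F_measurable_CM[OF fF] Z_measurable[OF that] by simp
      show "AE w in CM. \<bar>f w * Z u w\<bar> \<le> 1 * 1"
        using f1 Z_abs_le_1[OF that] by eventually_elim (simp only: abs_mult, intro mult_mono, auto)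
    qed
    have fd: "integrable CM (\<lambda>w. f w * dies q ?K w)"
      by (rule integrable_times_dies[OF F_measurable_CM[OF fF] f1 q0(3)[OF q]])
    have Es: "?E q \<in> sets CM" by (rule sets_F_CM[OF E[OF q]])
    have iY: "integrable CM Y" unfolding Y_def
      using integrable_Z[of ?K] integrable_Z[of ?n] integrable_dies[OF nK[OF q]] by auto
    have "\<epsilon> * C.prob (?E q) = (\<integral>w. \<epsilon> * indicator (?E q) w \<partial>CM)"
      using Es sets.sets_into_space[OF Es] by (simp add: Int_absorb2)
    also have "\<dots> \<le> (\<integral>w. f w * Z q w - f w * Z ?n w \<partial>CM)"
    proof (rule integral_mono)
      show "integrable CM (\<lambda>w. \<epsilon> * indicator (?E q) w)"
        using Es by (intro integrable_mult_right integrable_real_indicator) (auto simp: C.emeasure_eq_measure)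
      show "integrable CM (\<lambda>w. f w * Z q w - f w * Z ?n w)" using fZ q0(1)[OF q] by auto
      show "\<epsilon> * indicator (?E q) w \<le> f w * Z q w - f w * Z ?n w" for w
        by (auto simp: f_def indicator_def first_event_def B_def sgn_if)
    qed
    also have "\<dots> = (\<integral>w. f w * Z q w \<partial>CM) - (\<integral>w. f w * Z ?n w \<partial>CM)" using fZ q0(1)[OF q] by simp
    also have "\<dots> = (\<integral>w. f w * Z ?K w + f w * dies q ?K w - f w * Z ?n w \<partial>CM)"
      using Z_increment[OF q0(1)[OF q] q0(3)[OF q] fF f1] fZ fd by simp
    also have "\<dots> \<le> (\<integral>w. indicator (?E q) w * Y w \<partial>CM)"
    proof (rule integral_mono)
      show "integrable CM (\<lambda>w. f w * Z ?K w + f w * dies q ?K w - f w * Z ?n w)" using fZ fd by auto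
      show "integrable CM (\<lambda>w. indicator (?E q) w * Y w)"
        using integrable_mult_indicator[OF Es iY] by simp
      fix w
      have "f w * (Z ?K w - Z ?n w) \<le> \<bar>f w\<bar> * \<bar>Z ?K w - Z ?n w\<bar>" by (metis abs_ge_self abs_mult)
      also have "\<dots> \<le> indicator (?E q) w * \<bar>Z ?K w - Z ?n w\<bar>"
        by (intro mult_right_mono) (auto simp: f_def indicator_def sgn_if)
      finally have 1: "f w * (Z ?K w - Z ?n w) \<le> indicator (?E q) w * \<bar>Z ?K w - Z ?n w\<bar>" .
      have "f w * dies q ?K w \<le> indicator (?E q) w * dies q ?K w"
        using dies_bounds(1)[OF q0(3)[OF q]] by (intro mult_right_mono) (auto simp: f_def indicator_def sgn_if)
      also have "\<dots> \<le> indicator (?E q) w * dies ?n ?K w"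
        using dies_mono[OF q0(2,3)[OF q]] by (intro mult_left_mono) auto
      finally show "f w * Z ?K w + f w * dies q ?K w - f w * Z ?n w \<le> indicator (?E q) w * Y w"
        using 1 by (simp add: Y_def algebra_simps)
    qed
    finally show ?thesis .
  qed note each = this
  show "\<epsilon> * C.prob A \<le> (\<integral>w. \<bar>Z ?K w - Z ?n w\<bar> \<partial>CM) + (\<integral>w. dies ?n ?K w \<partial>CM)"
  proof (cases "Q = {}")
    \<comment> \<open>Here A is empty, so nonnegativity of the right side is to be shown, and K < n
      is possible. In that case the second integral is minus the mean of Z_K - Z_n, which the first
      integral dominates.\<close>
    case True
    have "0 \<le> (\<integral>w. dies ?n ?K w \<partial>CM)" if "?n \<le> ?K" using dies_bounds(1)[OF that] by simp
    show ?thesis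
    proof (cases "?n \<le> ?K")
      case True
      then show ?thesis using \<open>Q = {}\<close> \<open>?n \<le> ?K \<Longrightarrow> 0 \<le> (\<integral>w. dies ?n ?K w \<partial>CM)\<close>
        by (simp add: A_def)
    next
      case False
      have al: "integrable CM (alive u)" for u by (rule bounded_integrable[where c = 1]) auto
      have "(\<integral>w. dies ?n ?K w \<partial>CM) = - (\<integral>w. dies ?K ?n w \<partial>CM)" unfolding dies_def using al by simp
      also have "\<dots> = (\<integral>w. 1 * Z ?n w \<partial>CM) - (\<integral>w. 1 * Z ?K w \<partial>CM)"
        using Z_increment[of ?K ?n "\<lambda>_. 1" 1] False by simp
      also have "\<dots> = - (\<integral>w. Z ?K w - Z ?n w \<partial>CM)" using integrable_Z[of ?K] integrable_Z[of ?n] by simp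
      finally have "(\<integral>w. dies ?n ?K w \<partial>CM) = - (\<integral>w. Z ?K w - Z ?n w \<partial>CM)" .
      moreover have "(\<integral>w. Z ?K w - Z ?n w \<partial>CM) \<le> (\<integral>w. \<bar>Z ?K w - Z ?n w\<bar> \<partial>CM)"
        using integrable_Z[of ?K] integrable_Z[of ?n] by (intro integral_mono) auto
      ultimately show ?thesis using \<open>Q = {}\<close> by (simp add: A_def)
    qed
  next
    case False
    then obtain q0' where "q0' \<in> Q" by auto
    note nK' = nK[OF this]
    have iY: "integrable CM Y" unfolding Y_def
      using integrable_Z[of ?K] integrable_Z[of ?n] integrable_dies[OF nK'] by auto
    have Y0: "0 \<le> Y w" for w unfolding Y_def using dies_bounds(1)[OF nK'] by (intro add_nonneg_nonneg) auto
    have A: "A = (\<Union>q\<in>Q. ?E q)"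
    proof (intro set_eqI iffI)
      fix w assume "w \<in> A"
      then obtain q where "q \<in> Q" "w \<in> B q" by (auto simp: A_def B_def)
      then show "w \<in> (\<Union>q\<in>Q. ?E q)" using first_event_ex[OF Q(1)] by blast
    qed (auto simp: first_event_def A_def B_def)
    have "\<epsilon> * C.prob A = (\<Sum>q\<in>Q. \<epsilon> * C.prob (?E q))"
      unfolding A using Q sets_F_CM[OF E] first_event_disjoint
      by (subst C.finite_measure_finite_Union) (auto simp: sum_distrib_left)
    also have "\<dots> \<le> (\<Sum>q\<in>Q. \<integral>w. indicator (?E q) w * Y w \<partial>CM)" by (intro sum_mono each)
    also have "\<dots> = (\<integral>w. (\<Sum>q\<in>Q. indicator (?E q) w * Y w) \<partial>CM)"
      using integrable_mult_indicator[OF sets_F_CM[OF E] iY] by (subst Bochner_Integration.integral_sum) auto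
    also have "\<dots> \<le> (\<integral>w. Y w \<partial>CM)"
    proof (rule integral_mono)
      show "integrable CM (\<lambda>w. \<Sum>q\<in>Q. indicator (?E q) w * Y w)"
        using integrable_mult_indicator[OF sets_F_CM[OF E] iY] by (intro Bochner_Integration.integrable_sum) auto
      fix w
      have "(\<Sum>q\<in>Q. indicator (?E q) w * Y w) = indicator (\<Union>q\<in>Q. ?E q) w * Y w"
        using Q(1) first_event_disjoint[of Q B] by (simp add: sum_distrib_right[symmetric] indicator_UN_disjoint)
      also have "\<dots> \<le> 1 * Y w" using Y0 by (intro mult_right_mono) (auto simp: indicator_def)
      finally show "(\<Sum>q\<in>Q. indicator (?E q) w * Y w) \<le> Y w" by simp
    qed (rule iY)
    also have "\<dots> = (\<integral>w. \<bar>Z ?K w - Z ?n w\<bar> \<partial>CM) + (\<integral>w. dies ?n ?K w \<partial>CM)"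
      unfolding Y_def using integrable_Z[of ?K] integrable_Z[of ?n] integrable_dies[OF nK'] by simp
    finally show ?thesis .
  qed
qed

text \<open>The inequality |x| \<le> \<delta>/2 + x^2/(2 \<delta>) turns the squared bound
  \<delta>^2 into an L1 bound \<delta>; the second integral is at most \<delta>^2 \<le>
  \<delta>.\<close>

lemma Z_L1_small:
  assumes \<delta>: "0 < \<delta>" "\<delta> \<le> 1" and e: "energy (real K) - energy (real n) < \<delta>\<^sup>2" and nK: "n \<le> K"
  shows "(\<integral>w. \<bar>Z (real K) w - Z (real n) w\<bar> \<partial>CM) + (\<integral>w. dies (real n) (real K) w \<partial>CM) \<le> 2 * \<delta>"
proof -
  let ?d = "\<lambda>w. Z (real K) w - Z (real n) w"
  have sq: "(\<integral>w. (?d w)\<^sup>2 \<partial>CM) + (\<integral>w. dies (real n) (real K) w \<partial>CM) < \<delta>\<^sup>2"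
    using Z_square[of "real n" "real K"] nK e by simp
  have "0 \<le> (\<integral>w. dies (real n) (real K) w \<partial>CM)" "0 \<le> (\<integral>w. (?d w)\<^sup>2 \<partial>CM)"
    using dies_bounds(1)[of "real n" "real K"] nK by auto
  then have 1: "(\<integral>w. (?d w)\<^sup>2 \<partial>CM) \<le> \<delta>\<^sup>2" and 2: "(\<integral>w. dies (real n) (real K) w \<partial>CM) \<le> \<delta>\<^sup>2" using sq by linarith+
  have "\<delta>\<^sup>2 \<le> \<delta>" using \<delta> by (simp add: power2_eq_square mult_left_le)
  have isq: "integrable CM (\<lambda>w. (?d w)\<^sup>2)"
  proof -
    have "integrable CM (\<lambda>w. Z (real K) w * Z (real K) w - 2 * (Z (real n) w * Z (real K) w) + Z (real n) w * Z (real n) w)"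
      using integrable_ZZ by auto
    then show ?thesis by (rule Bochner_Integration.integrable_cong[THEN iffD1, rotated 2]) (auto simp: power2_eq_square algebra_simps)
  qed
  have "(\<integral>w. \<bar>?d w\<bar> \<partial>CM) \<le> (\<integral>w. \<delta> / 2 + (?d w)\<^sup>2 / (2 * \<delta>) \<partial>CM)"
  proof (rule integral_mono)
    show "integrable CM (\<lambda>w. \<bar>?d w\<bar>)" using integrable_Z[of "real K"] integrable_Z[of "real n"] by auto
    show "integrable CM (\<lambda>w. \<delta> / 2 + (?d w)\<^sup>2 / (2 * \<delta>))" using isq by auto
    fix w
    have "0 \<le> (\<bar>?d w\<bar> - \<delta>)\<^sup>2" by simp
    then have "2 * \<delta> * \<bar>?d w\<bar> \<le> \<delta>\<^sup>2 + (?d w)\<^sup>2" by (simp add: power2_diff algebra_simps)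
    then have "2 * \<delta> * \<bar>?d w\<bar> / (2 * \<delta>) \<le> (\<delta>\<^sup>2 + (?d w)\<^sup>2) / (2 * \<delta>)" using \<delta> by (intro divide_right_mono) auto
    then show "\<bar>?d w\<bar> \<le> \<delta> / 2 + (?d w)\<^sup>2 / (2 * \<delta>)" using \<delta> by (simp add: add_divide_distrib power2_eq_square)
  qed
  also have "\<dots> = \<delta> / 2 + (\<integral>w. (?d w)\<^sup>2 \<partial>CM) / (2 * \<delta>)" using isq by (simp add: prob_space)
  also have "\<dots> \<le> \<delta> / 2 + \<delta>\<^sup>2 / (2 * \<delta>)" using 1 \<delta> by (intro add_left_mono divide_right_mono) auto
  also have "\<dots> = \<delta>" using \<delta> by (simp add: power2_eq_square)
  finally show ?thesis using 2 \<open>\<delta>\<^sup>2 \<le> \<delta>\<close> by linarith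
qed

text \<open>Beyond a suitable n the bound of \<open>Z_max_event\<close> is uniform in K, so it
  survives the exhaustion of all rational times after n by finite sets.\<close>

lemma Z_tail_event:
  assumes \<epsilon>: "0 < \<epsilon>" and \<eta>: "0 < \<eta>"
  shows "\<exists>n::nat. {w \<in> space M. \<exists>q\<in>\<rat> \<inter> {real n..}. \<epsilon> < \<bar>Z q w - Z (real n) w\<bar>} \<in> sets CM \<and>
     C.prob {w \<in> space M. \<exists>q\<in>\<rat> \<inter> {real n..}. \<epsilon> < \<bar>Z q w - Z (real n) w\<bar>} \<le> \<eta>"
proof -
  \<comment> \<open>Chosen such that the bound 2 \<delta> of \<open>Z_L1_small\<close>, divided by
    \<epsilon>, is at most \<eta>.\<close>
  define \<delta> where "\<delta> = min 1 (\<epsilon> * \<eta> / 2)"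
  have \<delta>: "0 < \<delta>" "\<delta> \<le> 1" "2 * \<delta> \<le> \<epsilon> * \<eta>" using \<epsilon> \<eta> by (auto simp: \<delta>_def)
  obtain n where n: "\<And>K. n \<le> K \<Longrightarrow> energy (real K) - energy (real n) < \<delta>\<^sup>2"
    using energy_small[of "\<delta>\<^sup>2"] \<delta>(1) by auto
  have c: "countable (\<rat> \<inter> {real n..})" by (rule countable_Int1) (rule countable_rat)
  have ne: "\<rat> \<inter> {real n..} \<noteq> {}" proof -
    have "real n \<in> \<rat> \<inter> {real n..}" using Rats_of_nat by simp
    then show ?thesis by blast
  qed
  obtain Q :: "nat \<Rightarrow> real set" where Q: "\<And>k. finite (Q k)" "\<And>k. Q k \<subseteq> \<rat> \<inter> {real n..}" "incseq Q" "(\<Union>k. Q k) = \<rat> \<inter> {real n..}"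
    using countable_exhaust[OF c ne] by auto
  let ?A = "\<lambda>k. {w \<in> space M. \<exists>q\<in>Q k. \<epsilon> < \<bar>Z q w - Z (real n) w\<bar>}"
  have A: "?A k \<in> sets CM \<and> C.prob (?A k) \<le> \<eta>" for k
  proof -
    obtain K where K: "\<And>q. q \<in> Q k \<Longrightarrow> q \<le> real K"
    proof -
      obtain b where "\<And>q. q \<in> Q k \<Longrightarrow> q \<le> b" using Q(1)[of k] by (meson bdd_above.E bdd_above_finite)
      moreover obtain K where "b \<le> real K" using real_arch_simple by blast
      ultimately show ?thesis using that by (meson order_trans)
    qed
    let ?K = "max n K"
    have QK: "Q k \<subseteq> {real n..real ?K}"     proof
      fix x assume x: "x \<in> Q k"
      have "real n \<le> x" using Q(2)[of k] x by blast
      moreover have "x \<le> real ?K" using K[OF x] by (auto intro: order_trans)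
      ultimately show "x \<in> {real n..real ?K}" by simp
    qed
    have "\<epsilon> * C.prob (?A k) \<le> 2 * \<delta>"
      using Z_max_event(2)[OF Q(1) QK \<epsilon>] Z_L1_small[OF \<delta>(1,2) n[of ?K]] by linarith
    then have "\<epsilon> * C.prob (?A k) \<le> \<epsilon> * \<eta>" using \<delta>(3) by linarith
    then show ?thesis using \<epsilon> Z_max_event(1)[OF Q(1) QK \<epsilon>] by simp
  qed
  have S: "{w \<in> space M. \<exists>q\<in>\<rat> \<inter> {real n..}. \<epsilon> < \<bar>Z q w - Z (real n) w\<bar>} = (\<Union>k. ?A k)"
    unfolding Q(4)[symmetric] by auto
  have "(\<lambda>k. C.prob (?A k)) \<longlonglongrightarrow> C.prob (\<Union>k. ?A k)"
  proof (rule C.finite_Lim_measure_incseq)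
    show "range ?A \<subseteq> sets CM" using A by auto
    show "incseq ?A" unfolding incseq_def using incseqD[OF Q(3)] by blast
  qed
  then have "C.prob (\<Union>k. ?A k) \<le> \<eta>" by (rule LIMSEQ_le_const2) (use A in blast)
  then show ?thesis using A S by (intro exI[of _ n]) auto
qed

text \<open>Choose starting times n_k after which a large oscillation has probability at most
  1/(k+1); almost no path oscillates after every one of them.\<close>

lemma Z_oscillation:
  assumes \<epsilon>: "0 < \<epsilon>"
  shows "AE w in CM. \<exists>n::nat. \<forall>q\<in>\<rat> \<inter> {real n..}. \<bar>Z q w - Z (real n) w\<bar> \<le> \<epsilon>"
proof -
  let ?T = "\<lambda>n::nat. {w \<in> space M. \<exists>q\<in>\<rat> \<inter> {real n..}. \<epsilon> < \<bar>Z q w - Z (real n) w\<bar>}"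
  have "\<exists>n. ?T n \<in> sets CM \<and> C.prob (?T n) \<le> inverse (real (Suc k))" for k
    using Z_tail_event[OF \<epsilon>, of "inverse (real (Suc k))"] by (simp del: of_nat_Suc)
  then have "\<exists>n. \<forall>k. ?T (n k) \<in> sets CM \<and> C.prob (?T (n k)) \<le> inverse (real (Suc k))" by (intro choice allI)
  then obtain n where nn: "\<forall>k. ?T (n k) \<in> sets CM \<and> C.prob (?T (n k)) \<le> inverse (real (Suc k))" ..
  have n: "?T (n k) \<in> sets CM" "C.prob (?T (n k)) \<le> inverse (real (Suc k))" for k
    using nn[THEN spec, of k] by (rule conjunct1, rule conjunct2)
  let ?I = "\<Inter>k. ?T (n k)"
  have I: "?I \<in> sets CM" using n(1) by (intro sets.countable_INT) auto
  have "C.prob ?I \<le> inverse (real (Suc k))" for k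
    by (rule order_trans[OF C.finite_measure_mono n(2)]) (use n(1) in auto)
  then have "C.prob ?I \<le> 0" using LIMSEQ_inverse_real_of_nat by (intro LIMSEQ_le_const) auto
  then have "?I \<in> null_sets CM" using I by (intro null_setsI) (auto simp: C.emeasure_eq_measure measure_le_0_iff)
  then have "AE w in CM. w \<notin> ?I" by (rule AE_not_in)
  then show ?thesis using AE_space[where M = CM]
  proof eventually_elim
    case (elim w)
    then obtain k where "w \<notin> ?T (n k)" by blast
    then show ?case using elim(2) by (intro exI[of _ "n k"]) (auto simp: not_less)
  qed
qed

text \<open>\<open>at_infinity_value\<close> is an unspecified number when the limit does not exist,
  so this is what gives meaning to Z at infinity. The small oscillation at rational times extends to
  all times by right-continuity and yields the Cauchy property.\<close>

lemma Z_converges: "AE w in CM. ((\<lambda>t. Z t w) \<longlongrightarrow> at_infinity_value Z w) at_top"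
proof -
  have "AE w in CM. \<forall>k. \<exists>n::nat. \<forall>q\<in>\<rat> \<inter> {real n..}. \<bar>Z q w - Z (real n) w\<bar> \<le> inverse (real (Suc k))"
    using Z_oscillation by (subst AE_all_countable) (auto simp del: of_nat_Suc)
  then show ?thesis using AE_space[where M = CM]
  proof eventually_elim
    case (elim w)
    then have w: "w \<in> space M" by simp
    have osc: "\<exists>n::nat. \<forall>t\<ge>real n. \<bar>Z t w - Z (real n) w\<bar> \<le> \<epsilon>" if \<epsilon>: "0 < \<epsilon>" for \<epsilon>
    proof -
      obtain k where k: "inverse (real (Suc k)) < \<epsilon>" using reals_Archimedean[OF \<epsilon>] by auto
      obtain n :: nat where n: "\<And>q. q \<in> \<rat> \<Longrightarrow> real n \<le> q \<Longrightarrow> \<bar>Z q w - Z (real n) w\<bar> \<le> inverse (real (Suc k))"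
        using elim(1) by (metis IntI atLeast_iff)
      have "\<bar>Z t w - Z (real n) w\<bar> \<le> \<epsilon>" if t: "real n \<le> t" for t
      proof (rule ccontr)
        assume c: "\<not> ?thesis"
        have "((\<lambda>t. Z t w) \<longlongrightarrow> Z t w) (at_right t)"
          using repD(2)[OF rZ w] t by (auto simp: cadlag_def continuous_within intro: order_trans[of 0 "real n"])
        then have "((\<lambda>t. \<bar>Z t w - Z (real n) w\<bar>) \<longlongrightarrow> \<bar>Z t w - Z (real n) w\<bar>) (at_right t)" by (intro tendsto_intros)
        then have "\<forall>\<^sub>F s in at_right t. \<epsilon> < \<bar>Z s w - Z (real n) w\<bar>" using c by (intro order_tendstoD(1)) auto
        then obtain b where b: "t < b" "\<And>s. t < s \<Longrightarrow> s < b \<Longrightarrow> \<epsilon> < \<bar>Z s w - Z (real n) w\<bar>" by (auto simp: eventually_at_right_field)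
        obtain q where q: "q \<in> \<rat>" "t < q" "q < b" using Rats_dense_in_real[OF b(1)] by auto
        show False using b(2)[OF q(2,3)] n[OF q(1)] q(2) t k by linarith
      qed
      then show ?thesis by blast
    qed
    have "Cauchy (\<lambda>n. Z (real n) w)"
    proof (rule CauchyI')
      fix e :: real assume "0 < e"
      then obtain n :: nat where n: "\<And>t. real n \<le> t \<Longrightarrow> \<bar>Z t w - Z (real n) w\<bar> \<le> e / 3" using osc[of "e / 3"] by auto
      show "\<exists>M. \<forall>m\<ge>M. \<forall>k>m. dist (Z (real m) w) (Z (real k) w) < e"
      proof (intro exI[of _ n] allI impI)
        fix m k assume "n \<le> m" "m < k"
        then show "dist (Z (real m) w) (Z (real k) w) < e" using n[of "real m"] n[of "real k"] \<open>0 < e\<close> unfolding dist_real_def by linarith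
      qed
    qed
    then obtain l where l: "(\<lambda>n. Z (real n) w) \<longlonglongrightarrow> l" by (auto simp: Cauchy_convergent_iff convergent_def)
    have "((\<lambda>t. Z t w) \<longlongrightarrow> l) at_top"
    proof (rule tendstoI)
      fix e :: real assume "0 < e"
      then obtain n :: nat where n: "\<And>t. real n \<le> t \<Longrightarrow> \<bar>Z t w - Z (real n) w\<bar> \<le> e / 3" using osc[of "e / 3"] by auto
      have "\<bar>l - Z (real n) w\<bar> \<le> e / 3"
      proof (rule tendsto_upperbound)
        show "(\<lambda>m. \<bar>Z (real m) w - Z (real n) w\<bar>) \<longlonglongrightarrow> \<bar>l - Z (real n) w\<bar>" by (intro tendsto_intros l)
        show "\<forall>\<^sub>F m in sequentially. \<bar>Z (real m) w - Z (real n) w\<bar> \<le> e / 3"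
          using n by (auto simp: eventually_sequentially intro!: exI[of _ n])
      qed simp
      then have "dist (Z t w) l < e" if "real n \<le> t" for t using n[OF that] \<open>0 < e\<close> unfolding dist_real_def by linarith
      then show "\<forall>\<^sub>F t in at_top. dist (Z t w) l < e" by (auto simp: eventually_at_top_linorder)
    qed
    then show ?case unfolding at_infinity_value_def by (subst tendsto_Lim) auto
  qed
qed

end

end

lemma integral_right_continuous:
  fixes f :: "real \<Rightarrow> real"
  assumes \<kappa>: "sets \<kappa> = sets borel" and f: "set_integrable \<kappa> {0<..T} f" and s: "0 \<le> s" "s < T"
  shows "continuous (at_right s) (\<lambda>r. LINT u:{0<..r}|\<kappa>. f u)"
  unfolding continuous_within
proof (rule tendsto_at_right_sequentially[OF s(2)])
  fix S :: "nat \<Rightarrow> real" assume S: "\<And>n. s < S n" "\<And>n. S n < T" "decseq S" "S \<longlonglongrightarrow> s"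
  show "(\<lambda>n. LINT u:{0<..S n}|\<kappa>. f u) \<longlonglongrightarrow> (LINT u:{0<..s}|\<kappa>. f u)"
  proof (rule tendsto_set_integral_shrink[OF \<kappa> f])
    fix u
    show "\<forall>\<^sub>F n in sequentially. (u \<in> {0<..S n}) = (u \<in> {0<..s})"
    proof (cases "s < u")
      case True
      then have "\<forall>\<^sub>F n in sequentially. S n < u" using S(4) by (rule order_tendstoD(2)[rotated])
      then show ?thesis by eventually_elim (use True in auto)
    next
      case False
      then have "u \<le> S n" for n using S(1)[of n] by linarith
      then show ?thesis using False by (intro always_eventually) auto
    qed
    show "{0<..S n} \<subseteq> {0<..T}" for n using S(2)[of n] by auto
  qed (use s in auto)
qed

lemma (in filtered_space) PA_progressive_fun:
  fixes f :: "real \<times> 'a \<Rightarrow> real"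
  assumes T: "0 \<le> T" and f: "f \<in> borel_measurable PA"
  shows "(\<lambda>p. if p \<in> {0..T} \<times> space M then f p else 0) \<in> borel_measurable (borel \<Otimes>\<^sub>M F (ennreal T))"
proof (rule measurableI)
  fix B :: "real set" assume B: "B \<in> sets borel"
  have R: "{0..T} \<times> space M \<in> sets (borel \<Otimes>\<^sub>M F (ennreal T))"
    using sets.top[of "F (ennreal T)"] by (intro pair_measureI) auto
  have "(\<lambda>p. if p \<in> {0..T} \<times> space M then f p else 0) -` B \<inter> space (borel \<Otimes>\<^sub>M F (ennreal T)) =
    ((f -` B \<inter> space PA) \<inter> ({0..T} \<times> space M)) \<union> (if 0 \<in> B then space (borel \<Otimes>\<^sub>M F (ennreal T)) - {0..T} \<times> space M else {})"
    by (auto simp: space_pair_measure split: if_splits)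
  also have "\<dots> \<in> sets (borel \<Otimes>\<^sub>M F (ennreal T))"
    using PA_progressive[OF T measurable_sets[OF f B]] sets.compl_sets[OF R] by (cases "0 \<in> B") simp_all
  finally show "(\<lambda>p. if p \<in> {0..T} \<times> space M then f p else 0) -` B \<inter> space (borel \<Otimes>\<^sub>M F (ennreal T)) \<in> sets (borel \<Otimes>\<^sub>M F (ennreal T))" .
qed simp

section \<open>Additive decompositions by dual projections\<close>

context random_time begin

lemma cond_exp_eqI:
  assumes f: "integrable CM f" and g: "integrable CM g"
    and eq: "\<And>D. D \<in> sets (F t) \<Longrightarrow> (\<integral>w. indicator D w * f w \<partial>CM) = (\<integral>w. indicator D w * g w \<partial>CM)"
  shows "AE w in CM. real_cond_exp CM (F t) f w = real_cond_exp CM (F t) g w"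
proof -
  interpret S: sigma_finite_subalgebra CM "F t" by (rule sigma_finite_F)
  show ?thesis
  proof (rule S.real_cond_exp_charact)
    fix D assume D: "D \<in> sets (F t)"
    have "(LINT w:D|CM. f w) = (LINT w:D|CM. g w)"
      using eq[OF D] by (simp add: set_lebesgue_integral_def)
    then show "(LINT w:D|CM. f w) = (LINT w:D|CM. real_cond_exp CM (F t) g w)"
      using S.real_cond_exp_intA[OF g D] by simp
  qed (use f g in auto)
qed

text \<open>Common source of the decompositions of Z and X. Since \<xi> t and \<xi>0 differ by the
  adapted I t, conditioning on F_t gives the identity at each fixed time; right-continuity makes it
  hold for all times at once.\<close>

lemma cond_exp_drift:
  assumes X: "\<And>t. 0 \<le> t \<Longrightarrow> AE w in CM. X t w = real_cond_exp CM (F (ennreal t)) (\<xi> t) w"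
    and mu: "\<And>t. 0 \<le> t \<Longrightarrow> AE w in CM. \<mu> t w = real_cond_exp CM (F (ennreal t)) \<xi>0 w"
    and i: "integrable CM \<xi>0" "\<And>t. 0 \<le> t \<Longrightarrow> integrable CM (\<xi> t)"
    and I: "\<And>t. 0 \<le> t \<Longrightarrow> I t \<in> borel_measurable (F (ennreal t))" "\<And>t. 0 \<le> t \<Longrightarrow> integrable CM (I t)"
    and eq: "\<And>t. 0 \<le> t \<Longrightarrow> AE w in CM. \<xi> t w = \<xi>0 w - I t w"
    and rc: "AE w in CM. \<forall>t\<ge>0. continuous (at_right t) (\<lambda>t. X t w)"
      "AE w in CM. \<forall>t\<ge>0. continuous (at_right t) (\<lambda>t. \<mu> t w)" "AE w in CM. \<forall>t\<ge>0. continuous (at_right t) (\<lambda>t. I t w)"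
  shows "AE w in CM. \<forall>t\<ge>0. X t w = \<mu> t w - I t w"
proof (rule AE_right_continuous_eq)
  fix t :: real assume t: "0 \<le> t"
  interpret S: sigma_finite_subalgebra CM "F (ennreal t)" by (rule sigma_finite_F)
  have "AE w in CM. real_cond_exp CM (F (ennreal t)) (\<xi> t) w = real_cond_exp CM (F (ennreal t)) (\<lambda>w. \<xi>0 w - I t w) w"
    using i(1) i(2)[OF t] I(2)[OF t] eq[OF t] by (intro S.real_cond_exp_cong) auto
  moreover have "AE w in CM. real_cond_exp CM (F (ennreal t)) (\<lambda>w. \<xi>0 w - I t w) w = real_cond_exp CM (F (ennreal t)) \<xi>0 w - real_cond_exp CM (F (ennreal t)) (I t) w"
    by (rule S.real_cond_exp_diff[OF i(1) I(2)[OF t]])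
  moreover have "AE w in CM. real_cond_exp CM (F (ennreal t)) (I t) w = I t w"
    by (rule S.real_cond_exp_F_meas[OF I(2)[OF t] I(1)[OF t]])
  ultimately show "AE w in CM. X t w = \<mu> t w - I t w" using X[OF t] mu[OF t] by eventually_elim simp
next
  show "AE w in CM. \<forall>t\<ge>0. continuous (at_right t) (\<lambda>t. \<mu> t w - I t w)"
    using rc(2,3) by eventually_elim (auto intro!: continuous_intros)
qed (rule rc(1))

lemma cadlag_cond_expD:
  assumes "cadlag_cond_exp M F \<xi> X"
  shows "adapted F X" "\<And>w. w \<in> space M \<Longrightarrow> cadlag (\<lambda>t. X t w)"
    "\<And>t. 0 \<le> t \<Longrightarrow> AE w in CM. X t w = real_cond_exp CM (F (ennreal t)) (\<xi> t) w"
    "AE w in CM. \<forall>t\<ge>0. continuous (at_right t) (\<lambda>t. X t w)"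
proof -
  note r = assms[unfolded cadlag_cond_exp_def]
  show "adapted F X" using r by (rule conjunct1)
  show c: "cadlag (\<lambda>t. X t w)" if "w \<in> space M" for w
    using r[THEN conjunct2, THEN conjunct1] that by (rule bspec)
  show "AE w in CM. X t w = real_cond_exp CM (F (ennreal t)) (\<xi> t) w" if "0 \<le> t" for t
    using r[THEN conjunct2, THEN conjunct2] that by (elim allE impE)
  show "AE w in CM. \<forall>t\<ge>0. continuous (at_right t) (\<lambda>t. X t w)"
  proof (rule AE_I2)
    fix w assume "w \<in> space CM"
    then have "cadlag (\<lambda>t. X t w)" using c by simp
    then show "\<forall>t\<ge>0. continuous (at_right t) (\<lambda>t. X t w)" by (simp add: cadlag_def)
  qed
qed

lemma alive_enn2real: "\<tau> w \<noteq> \<infinity> \<Longrightarrow> 0 \<le> t \<Longrightarrow> t < enn2real (\<tau> w) \<longleftrightarrow> ennreal t < \<tau> w"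
  by (cases "\<tau> w") (auto simp: ennreal_less_iff)

context
  fixes S B
  assumes S: "good S" and D: "dual_projection M S (occurrence \<tau>) B"
begin

lemma dual_at_infinity:
  "AE w in CM. emeasure (path_measure (\<lambda>t. B t w)) {0..} < \<infinity> \<and>
     at_infinity_value B w = measure (path_measure (\<lambda>t. B t w)) {0..} \<and>
     (\<forall>t\<ge>0. at_infinity_value B w - B t w = measure (path_measure (\<lambda>t. B t w)) {t<..})"
  using dual_finite[OF S D] AE_space[where M = CM]
proof eventually_elim
  case (elim w)
  have inc: "increasing_path (\<lambda>t. B t w)" using dualD(1)[OF S D] elim by simp
  show ?case using elim(1) measure_path_Ioi[OF inc elim(1)] tendsto_increasing_path_at_top[OF inc elim(1)]
    by (auto simp: at_infinity_value_def intro!: tendsto_Lim)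
qed

lemma dual_infinity_integrable: "integrable CM (at_infinity_value B)"
proof -
  have m: "(\<lambda>_. 1::real) \<in> borel_measurable S" by simp
  have i: "integrable CM (\<lambda>w. LINT s:{0..}|path_measure (\<lambda>t. B t w). (1::real))"
    by (rule dual_integral(2)[where g = "\<lambda>_. 1", OF S D m, of 1]) simp
  have e: "AE w in CM. (LINT s:{0..}|path_measure (\<lambda>t. B t w). (1::real)) = at_infinity_value B w"
    using dual_at_infinity by eventually_elim (simp add: set_lebesgue_integral_def)
  show ?thesis
    by (rule integrable_cong_AE_imp[OF i AE_eq_measurable_completion[OF borel_measurable_integrable[OF i] e] e])
qed

lemma dual_path_integrable: assumes t: "0 \<le> t" shows "integrable CM (B t)"
proof (rule Bochner_Integration.integrable_bound[OF dual_infinity_integrable])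
  show "B t \<in> borel_measurable CM" by (rule dualD(4)[OF S D t])
  show "AE w in CM. norm (B t w) \<le> norm (at_infinity_value B w)"
    using dual_at_infinity AE_space[where M = CM]
  proof eventually_elim
    case (elim w)
    have inc: "increasing_path (\<lambda>t. B t w)" using dualD(1)[OF S D] elim by simp
    have "0 \<le> B t w" using increasing_path_mono[OF inc order_refl t] inc by (simp add: increasing_path_def)
    moreover have "at_infinity_value B w - B t w = measure (path_measure (\<lambda>t. B t w)) {t<..}" using elim(1) t by blast
    then have "0 \<le> at_infinity_value B w - B t w" by (simp only: measure_nonneg)
    ultimately have "\<bar>B t w\<bar> \<le> \<bar>at_infinity_value B w\<bar>" by linarith
    then show ?case by simp
  qed
qed

text \<open>Duality tested on (t,\<infinity>) x E, a predictable set because E belongs to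
  F_t.\<close>

lemma dual_tail:
  assumes t: "0 \<le> t" and E: "E \<in> sets (F (ennreal t))"
  shows "(\<integral>w. indicator E w * (at_infinity_value B w - B t w) \<partial>CM) = (\<integral>w. indicator E w * (alive t w - of_bool (\<tau> w = \<infinity>)) \<partial>CM)"
proof -
  let ?g = "indicator ({t<..} \<times> E) :: real \<times> 'a \<Rightarrow> real"
  have g: "?g \<in> borel_measurable S" using goodD(2)[OF S PA_Ioi[OF t E]] by (rule borel_measurable_indicator)
  have gi: "integrable CM (\<lambda>w. LINT s:{0..}|path_measure (\<lambda>t. B t w). ?g (s, w))"
    by (rule dual_integral(2)[where g = ?g, OF S D g, of 1]) (simp add: indicator_def)
  have "(\<integral>w. indicator E w * (at_infinity_value B w - B t w) \<partial>CM) = (\<integral>w. (LINT s:{0..}|path_measure (\<lambda>t. B t w). ?g (s, w)) \<partial>CM)"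
  proof (rule integral_cong_AE)
    show "(\<lambda>w. indicator E w * (at_infinity_value B w - B t w)) \<in> borel_measurable CM"
      by (intro borel_measurable_times borel_measurable_diff borel_measurable_integrable[OF dual_infinity_integrable]
          dualD(4)[OF S D t] borel_measurable_indicator sets_F_CM[OF E])
    show "AE w in CM. indicator E w * (at_infinity_value B w - B t w) = (LINT s:{0..}|path_measure (\<lambda>t. B t w). ?g (s, w))"
      using dual_at_infinity
    proof eventually_elim
      case (elim w)
      have "(LINT s:{0..}|path_measure (\<lambda>t. B t w). ?g (s, w)) = (\<integral>s. indicator E w * indicator {t<..} s \<partial>path_measure (\<lambda>t. B t w))"
        unfolding set_lebesgue_integral_def using t by (intro Bochner_Integration.integral_cong) (auto simp: indicator_def)
      moreover have "at_infinity_value B w - B t w = measure (path_measure (\<lambda>t. B t w)) {t<..}" using elim t by blast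
      ultimately show ?case by simp
    qed
  qed (use gi in auto)
  also have "\<dots> = (\<integral>w. (if \<tau> w = \<infinity> then 0 else ?g (enn2real (\<tau> w), w)) \<partial>CM)"
    by (rule dual_integral(3)[where g = ?g, OF S D g, of 1]) (simp add: indicator_def)
  also have "\<dots> = (\<integral>w. indicator E w * (alive t w - of_bool (\<tau> w = \<infinity>)) \<partial>CM)"
    using alive_enn2real[OF _ t] by (intro Bochner_Integration.integral_cong) (auto simp: indicator_def)
  finally show ?thesis .
qed

lemma never_measurable[measurable]: "(\<lambda>w. of_bool (\<tau> w = \<infinity>) :: real) \<in> borel_measurable CM"
proof -
  have "{w \<in> space CM. \<tau> w = \<infinity>} \<in> sets CM" by measurable
  then have "indicator {w \<in> space CM. \<tau> w = \<infinity>} \<in> borel_measurable CM" by (rule borel_measurable_indicator)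
  then show ?thesis by (rule measurable_cong[THEN iffD1, rotated]) (simp add: indicator_def)
qed

text \<open>By \<open>dual_tail\<close>, the conditional mean of the mass of B after t is P(t <
  \<tau> < \<infinity> | F_t); adding the event \<tau> = \<infinity> gives Z t. The argument covers
  the predictable and the optional projection alike.\<close>

lemma doob_meyer:
  assumes rZ: "rep (\<lambda>_. 1) Z" and mu: "cadlag_cond_exp M F (\<lambda>_ w. at_infinity_value B w + of_bool (\<tau> w = \<infinity>)) \<mu>"
  shows "AE w in CM. \<forall>t\<ge>0. Z t w = \<mu> t w - B t w"
proof (rule cond_exp_drift)
  have n: "integrable CM (\<lambda>w. of_bool (\<tau> w = \<infinity>) :: real)" by (rule bounded_integrable[of _ 1]) auto
  show x0: "integrable CM (\<lambda>w. at_infinity_value B w + of_bool (\<tau> w = \<infinity>))" using dual_infinity_integrable n by auto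
  show xt: "integrable CM (\<lambda>w. at_infinity_value B w + of_bool (\<tau> w = \<infinity>) - B t w)" if t: "0 \<le> t" for t
    using x0 dual_path_integrable[OF t] by auto
  show "AE w in CM. Z t w = real_cond_exp CM (F (ennreal t)) (\<lambda>w. at_infinity_value B w + of_bool (\<tau> w = \<infinity>) - B t w) w" if t: "0 \<le> t" for t
  proof -
    have ai: "integrable CM (alive t)" by (rule bounded_integrable[of _ 1]) auto
    have "AE w in CM. real_cond_exp CM (F (ennreal t)) (\<lambda>w. 1 * alive t w) w =
       real_cond_exp CM (F (ennreal t)) (\<lambda>w. at_infinity_value B w + of_bool (\<tau> w = \<infinity>) - B t w) w"
    proof (rule cond_exp_eqI)
      fix E assume E: "E \<in> sets (F (ennreal t))"
      have iE: "integrable CM (\<lambda>w. indicator E w * f w)" if "integrable CM f" for f :: "'a \<Rightarrow> real"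
        using integrable_mult_indicator[OF sets_F_CM[OF E] that] by simp
      have d: "integrable CM (\<lambda>w. at_infinity_value B w - B t w)" using dual_infinity_integrable dual_path_integrable[OF t] by auto
      have an: "integrable CM (\<lambda>w. alive t w - of_bool (\<tau> w = \<infinity>))" using ai n by auto
      have "(\<integral>w. indicator E w * (at_infinity_value B w + of_bool (\<tau> w = \<infinity>) - B t w) \<partial>CM) =
        (\<integral>w. indicator E w * (at_infinity_value B w - B t w) + indicator E w * of_bool (\<tau> w = \<infinity>) \<partial>CM)"
        by (intro Bochner_Integration.integral_cong) (auto simp: algebra_simps)
      also have "\<dots> = (\<integral>w. indicator E w * (alive t w - of_bool (\<tau> w = \<infinity>)) \<partial>CM) + (\<integral>w. indicator E w * of_bool (\<tau> w = \<infinity>) \<partial>CM)"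
        using iE[OF d] iE[OF n] dual_tail[OF t E] by simp
      also have "\<dots> = (\<integral>w. indicator E w * (alive t w - of_bool (\<tau> w = \<infinity>)) + indicator E w * of_bool (\<tau> w = \<infinity>) \<partial>CM)"
        using iE[OF an] iE[OF n] by simp
      also have "\<dots> = (\<integral>w. indicator E w * (1 * alive t w) \<partial>CM)"
        by (intro Bochner_Integration.integral_cong) (auto simp: algebra_simps)
      finally show "(\<integral>w. indicator E w * (1 * alive t w) \<partial>CM) =
        (\<integral>w. indicator E w * (at_infinity_value B w + of_bool (\<tau> w = \<infinity>) - B t w) \<partial>CM)" by simp
    qed (use ai xt[OF t] in auto)
    then show ?thesis using repD(5)[OF rZ t] by eventually_elim simp
  qed
  show "AE w in CM. \<mu> t w = real_cond_exp CM (F (ennreal t)) (\<lambda>w. at_infinity_value B w + of_bool (\<tau> w = \<infinity>)) w" if "0 \<le> t" for t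
    by (rule cadlag_cond_expD(3)[OF mu that])
  show "B t \<in> borel_measurable (F (ennreal t))" if "0 \<le> t" for t using dualD(3)[OF S D] that by (simp add: adapted_def)
  show "integrable CM (B t)" if "0 \<le> t" for t by (rule dual_path_integrable[OF that])
  show "AE w in CM. \<forall>t\<ge>0. continuous (at_right t) (\<lambda>t. Z t w)"
    using rZ unfolding rep_def by (rule cadlag_cond_expD(4))
  show "AE w in CM. \<forall>t\<ge>0. continuous (at_right t) (\<lambda>t. \<mu> t w)" by (rule cadlag_cond_expD(4)[OF mu])
  show "AE w in CM. \<forall>t\<ge>0. continuous (at_right t) (\<lambda>t. B t w)"
  proof (rule AE_I2)
    fix w assume "w \<in> space CM"
    then have "increasing_path (\<lambda>t. B t w)" using dualD(1)[OF S D] by simp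
    then show "\<forall>t\<ge>0. continuous (at_right t) (\<lambda>t. B t w)" by (simp add: increasing_path_def)
  qed
qed auto

end

section \<open>The process X of a bounded predictable h\<close>

context
  fixes Z h A :: "real \<Rightarrow> 'a \<Rightarrow> real" and C :: real
  assumes rZ: "rep (\<lambda>_. 1) Z" and DA: "dual_projection M PA (occurrence \<tau>) A"
    and hp: "predictable M F h" and hC: "\<And>t w. 0 \<le> t \<Longrightarrow> w \<in> space M \<Longrightarrow> \<bar>h t w\<bar> \<le> C"
    and hlim: "\<And>w. w \<in> space M \<Longrightarrow> \<exists>l. ((\<lambda>t. h t w) \<longlongrightarrow> l) at_top"
begin

lemma h_PA: "(\<lambda>(t, w). h t w) \<in> borel_measurable PA"
  using hp by (simp add: predictable_def)

lemma h_adapted: "adapted F h" by (rule good_adapted[OF good_PA h_PA])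

lemma h_infinity: "w \<in> space M \<Longrightarrow> ((\<lambda>t. h t w) \<longlongrightarrow> at_infinity_value h w) at_top"
  using hlim[of w] unfolding at_infinity_value_def by (auto simp: tendsto_Lim)

lemma h_infinity_seq: "w \<in> space M \<Longrightarrow> (\<lambda>n. h (real n) w) \<longlonglongrightarrow> at_infinity_value h w"
  by (rule filterlim_compose[OF h_infinity filterlim_real_sequentially])

lemma h_infinity_measurable: "at_infinity_value h \<in> borel_measurable CM"
  by (rule borel_measurable_LIMSEQ_real[where u = "\<lambda>n. h (real n)"])
     (use h_infinity_seq adapted_CM[OF h_adapted] in auto)

lemma h_infinity_bound: assumes "w \<in> space M" shows "\<bar>at_infinity_value h w\<bar> \<le> C"
proof (rule LIMSEQ_le_const2)
  show "(\<lambda>n. \<bar>h (real n) w\<bar>) \<longlonglongrightarrow> \<bar>at_infinity_value h w\<bar>" by (intro tendsto_rabs h_infinity_seq assms)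
qed (use hC assms in auto)

lemma C_nonneg: "0 \<le> C"
proof -
  obtain w where "w \<in> space M" using not_empty by blast
  then show ?thesis using hC[of 0 w] by simp
qed

lemma Z_infinity_bounds: "AE w in CM. \<bar>at_infinity_value Z w\<bar> \<le> 1"
proof -
  have "AE w in CM. \<forall>n. \<bar>Z (real n) w\<bar> \<le> 1" by (subst AE_all_countable) (auto intro: Z_abs_le_1[OF rZ])
  then show ?thesis using Z_converges[OF rZ]
  proof eventually_elim
    case (elim w)
    have "(\<lambda>n. \<bar>Z (real n) w\<bar>) \<longlonglongrightarrow> \<bar>at_infinity_value Z w\<bar>"
      by (intro tendsto_rabs filterlim_compose[OF elim(2) filterlim_real_sequentially])
    then show ?case by (rule LIMSEQ_le_const2) (use elim(1) in auto)
  qed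
qed

lemma Z_infinity_measurable: "at_infinity_value Z \<in> borel_measurable CM"
proof -
  have m: "(\<lambda>w. lim (\<lambda>n. Z (real n) w)) \<in> borel_measurable CM"
    using repD(4)[OF rZ] by (intro borel_measurable_lim_metric) auto
  have e: "AE w in CM. lim (\<lambda>n. Z (real n) w) = at_infinity_value Z w"
    using Z_converges[OF rZ]
  proof eventually_elim
    case (elim w)
    show ?case by (rule limI[OF filterlim_compose[OF elim filterlim_real_sequentially]])
  qed
  show ?thesis by (rule AE_eq_measurable_completion[OF m e])
qed

text \<open>In substance, Z at infinity is the conditional probability of {\<tau> = \<infinity>}.
  For n \<ge> t one has E(1_E h_n Z_n) = E(1_E h_n; n < \<tau>), and both sides converge under the
  bound C.\<close>

lemma Z_infinity_integral:
  assumes t: "0 \<le> t" and E: "E \<in> sets (F (ennreal t))"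
  shows "(\<integral>w. indicator E w * (at_infinity_value h w * at_infinity_value Z w) \<partial>CM) =
    (\<integral>w. indicator E w * (at_infinity_value h w * of_bool (\<tau> w = \<infinity>)) \<partial>CM)"
proof -
  note [measurable] = h_infinity_measurable Z_infinity_measurable sets_F_CM[OF E] repD(4)[OF rZ] adapted_CM[OF h_adapted]
    never_measurable[OF good_PA DA]
  have [measurable]: "h (real n) \<in> borel_measurable CM" "Z (real n) \<in> borel_measurable CM" for n by auto
  have hb: "\<bar>h (real n) w\<bar> \<le> C" if "w \<in> space CM" for n w using hC[of "real n" w] that by simp
  have l1: "(\<lambda>n. \<integral>w. indicator E w * (h (real n) w * Z (real n) w) \<partial>CM) \<longlonglongrightarrow>
     (\<integral>w. indicator E w * (at_infinity_value h w * at_infinity_value Z w) \<partial>CM)"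
  proof (rule integral_dominated_convergence[where w = "\<lambda>_. C"])
    show "AE w in CM. (\<lambda>n. indicator E w * (h (real n) w * Z (real n) w)) \<longlonglongrightarrow> indicator E w * (at_infinity_value h w * at_infinity_value Z w)"
      using Z_converges[OF rZ] AE_space[where M = CM]
    proof eventually_elim
      case (elim w)
      then show ?case
        by (intro tendsto_mult tendsto_const h_infinity_seq filterlim_compose[OF elim(1) filterlim_real_sequentially]) simp
    qed
    show "AE w in CM. norm (indicator E w * (h (real n) w * Z (real n) w)) \<le> C" for n
      using Z_abs_le_1[OF rZ, of "real n", OF of_nat_0_le_iff] AE_space[where M = CM]
    proof eventually_elim
      case (elim w)
      then have "\<bar>h (real n) w\<bar> * \<bar>Z (real n) w\<bar> \<le> C * 1" using hb C_nonneg by (intro mult_mono) auto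
      then show ?case using C_nonneg by (auto simp: indicator_def abs_mult)
    qed
  qed auto
  have l2: "(\<lambda>n. \<integral>w. indicator E w * (h (real n) w * alive (real n) w) \<partial>CM) \<longlonglongrightarrow>
     (\<integral>w. indicator E w * (at_infinity_value h w * of_bool (\<tau> w = \<infinity>)) \<partial>CM)"
  proof (rule integral_dominated_convergence[where w = "\<lambda>_. C"])
    have al: "(\<lambda>n. alive (real n) w) \<longlonglongrightarrow> of_bool (\<tau> w = \<infinity>)" for w
    proof (cases "\<tau> w")
      case (real r)
      obtain k where "r \<le> real k" using real_arch_simple by blast
      then have "\<forall>\<^sub>F n in sequentially. alive (real n) w = of_bool (\<tau> w = \<infinity>)"
        using real by (auto simp: eventually_sequentially ennreal_less_iff intro!: exI[of _ k])
      then show ?thesis by (rule tendsto_eventually)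
    qed (simp add: less_top[symmetric])
    show "AE w in CM. (\<lambda>n. indicator E w * (h (real n) w * alive (real n) w)) \<longlonglongrightarrow> indicator E w * (at_infinity_value h w * of_bool (\<tau> w = \<infinity>))"
      by (intro AE_I2 tendsto_mult tendsto_const h_infinity_seq al) simp
    show "AE w in CM. norm (indicator E w * (h (real n) w * alive (real n) w)) \<le> C" for n
    proof (rule AE_I2)
      fix w assume "w \<in> space CM"
      then show "norm (indicator E w * (h (real n) w * alive (real n) w)) \<le> C"
        using hb[of w n] C_nonneg by (auto simp: indicator_def abs_mult of_bool_def)
    qed
  qed auto
  have eq: "(\<integral>w. indicator E w * (h (real n) w * Z (real n) w) \<partial>CM) = (\<integral>w. indicator E w * (h (real n) w * alive (real n) w) \<partial>CM)"
    if n: "t \<le> real n" for n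
  proof -
    have En: "E \<in> sets (F (ennreal (real n)))" using E sets_F_mono[of "ennreal t" "ennreal (real n)"] n by (auto simp: ennreal_leI)
    have hn: "h (real n) \<in> borel_measurable (F (ennreal (real n)))" using h_adapted unfolding adapted_def by simp
    have fm: "(\<lambda>w. indicator E w * h (real n) w) \<in> borel_measurable (F (ennreal (real n)))" using En hn by measurable
    have fb: "AE w in CM. \<bar>indicator E w * h (real n) w\<bar> \<le> C"
      using hb C_nonneg by (intro AE_I2) (auto simp: indicator_def)
    have "(\<integral>w. (indicator E w * h (real n) w) * Z (real n) w \<partial>CM) = (\<integral>w. (indicator E w * h (real n) w) * (1 * alive (real n) w) \<partial>CM)"
      by (rule rep_integral(2)[OF rZ, of 1, OF _ _ _ fm fb]) auto
    then show ?thesis by (simp add: mult.assoc)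
  qed
  obtain k where k: "t \<le> real k" using real_arch_simple by blast
  have "(\<lambda>n. \<integral>w. indicator E w * (h (real n) w * Z (real n) w) \<partial>CM) \<longlonglongrightarrow>
     (\<integral>w. indicator E w * (at_infinity_value h w * of_bool (\<tau> w = \<infinity>)) \<partial>CM)"
  proof (rule Lim_transform_eventually[OF l2])
    show "\<forall>\<^sub>F n in sequentially. (\<integral>w. indicator E w * (h (real n) w * alive (real n) w) \<partial>CM) = (\<integral>w. indicator E w * (h (real n) w * Z (real n) w) \<partial>CM)"
      using k eq by (auto simp: eventually_sequentially intro!: exI[of _ k] eq[symmetric])
  qed
  with l1 show ?thesis by (rule LIMSEQ_unique)
qed

lemma h_at_\<tau>_measurable: "at_random_time \<tau> h \<in> borel_measurable CM"
proof -
  have 1: "(\<lambda>w. if \<tau> w = \<infinity> then 0 else h (enn2real (\<tau> w)) w) \<in> borel_measurable CM"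
    using at_\<tau>_measurable[OF good_PA h_PA, of 0] unfolding case_prod_conv .
  have "(\<lambda>w. if \<tau> w = \<infinity> then at_infinity_value h w else (if \<tau> w = \<infinity> then 0 else h (enn2real (\<tau> w)) w)) \<in> borel_measurable CM"
  proof (rule measurable_If[OF h_infinity_measurable 1])
    show "{w \<in> space CM. \<tau> w = \<infinity>} \<in> sets CM" by measurable
  qed
  then show ?thesis by (rule measurable_cong[THEN iffD1, rotated]) (simp add: at_random_time_def)
qed

lemma h_at_\<tau>_bound: "w \<in> space M \<Longrightarrow> \<bar>at_random_time \<tau> h w\<bar> \<le> C"
  unfolding at_random_time_def using h_infinity_bound hC by simp

abbreviation "tail t w \<equiv> (LINT s:{t<..}|path_measure (\<lambda>u. A u w). h s w)"

lemma h_integrable_paths: "AE w in CM. set_integrable (path_measure (\<lambda>t. A t w)) {0..} (\<lambda>s. h s w)"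
  using dual_integral(1)[where g = "\<lambda>(t, w). h t w", OF good_PA DA h_PA, of C] hC by auto

text \<open>Duality tested with h on (t,\<infinity>) x E, which sees only finite \<tau>.
  \<open>at_random_time\<close> takes the limit of h when \<tau> = \<infinity>, and the subtracted
  term removes that contribution.\<close>

lemma tail_integral:
  assumes t: "0 \<le> t" and E: "E \<in> sets (F (ennreal t))"
  shows "integrable CM (\<lambda>w. indicator E w * tail t w)"
    and "(\<integral>w. indicator E w * tail t w \<partial>CM) =
      (\<integral>w. indicator E w * (at_random_time \<tau> h w * alive t w - at_infinity_value h w * of_bool (\<tau> w = \<infinity>)) \<partial>CM)"
proof -
  let ?g = "\<lambda>p. indicator ({t<..} \<times> E) p * (case p of (s, w) \<Rightarrow> h s w)"
  have g: "?g \<in> borel_measurable PA"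
    using PA_Ioi[OF t E] h_PA by (intro borel_measurable_times borel_measurable_indicator)
  have gC: "\<bar>?g p\<bar> \<le> C" if "p \<in> {0..} \<times> space M" for p
    using that hC C_nonneg by (auto simp: indicator_def)
  have e: "(LINT s:{0..}|path_measure (\<lambda>t. A t w). ?g (s, w)) = indicator E w * tail t w" for w
  proof -
    have "(LINT s:{0..}|path_measure (\<lambda>t. A t w). ?g (s, w)) = (\<integral>s. indicator E w * (indicator {t<..} s *\<^sub>R h s w) \<partial>path_measure (\<lambda>t. A t w))"
      unfolding set_lebesgue_integral_def using t by (intro Bochner_Integration.integral_cong) (auto simp: indicator_def)
    then show ?thesis by (simp add: set_lebesgue_integral_def)
  qed
  show "integrable CM (\<lambda>w. indicator E w * tail t w)"
    using dual_integral(2)[where g = ?g, OF good_PA DA g gC] unfolding e .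
  have "(\<integral>w. indicator E w * tail t w \<partial>CM) = (\<integral>w. (if \<tau> w = \<infinity> then 0 else ?g (enn2real (\<tau> w), w)) \<partial>CM)"
    using dual_integral(3)[where g = ?g, OF good_PA DA g gC] unfolding e .
  also have "\<dots> = (\<integral>w. indicator E w * (at_random_time \<tau> h w * alive t w - at_infinity_value h w * of_bool (\<tau> w = \<infinity>)) \<partial>CM)"
    using alive_enn2real[OF _ t] by (intro Bochner_Integration.integral_cong) (auto simp: indicator_def at_random_time_def)
  finally show "(\<integral>w. indicator E w * tail t w \<partial>CM) =
      (\<integral>w. indicator E w * (at_random_time \<tau> h w * alive t w - at_infinity_value h w * of_bool (\<tau> w = \<infinity>)) \<partial>CM)" .
qed

lemma tail_integrable: assumes "0 \<le> t" shows "integrable CM (tail t)"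
proof -
  have "space M \<in> sets (F (ennreal t))" using sets.top[of "F (ennreal t)"] by simp
  from tail_integral(1)[OF assms this] show ?thesis
    by (rule Bochner_Integration.integrable_cong[THEN iffD1, rotated 2]) auto
qed

lemma residual_integrable: "integrable CM (\<lambda>w. at_infinity_value h w * at_infinity_value Z w)"
proof (rule bounded_integrable)
  show "(\<lambda>w. at_infinity_value h w * at_infinity_value Z w) \<in> borel_measurable CM"
    by (rule borel_measurable_times[OF h_infinity_measurable Z_infinity_measurable])
  show "AE w in CM. \<bar>at_infinity_value h w * at_infinity_value Z w\<bar> \<le> C * 1"
    using Z_infinity_bounds AE_space[where M = CM]
  proof eventually_elim
    case (elim w)
    then show ?case unfolding abs_mult using h_infinity_bound[of w] C_nonneg by (intro mult_mono) auto
  qed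
qed

text \<open>The integral over (t,\<infinity>) accounts for h at \<tau> on {t < \<tau> <
  \<infinity>}, and the product of the limits of h and Z accounts for {\<tau> =
  \<infinity>}.\<close>

lemma X_rep:
  assumes X: "cadlag_cond_exp M F (\<lambda>t w. tail t w + at_infinity_value h w * at_infinity_value Z w) X"
  shows "rep (at_random_time \<tau> h) X"
  unfolding rep_def cadlag_cond_exp_def
proof (intro conjI ballI allI impI)
  show "adapted F X" by (rule cadlag_cond_expD(1)[OF X])
  show "cadlag (\<lambda>t. X t w)" if "w \<in> space M" for w by (rule cadlag_cond_expD(2)[OF X that])
  fix t :: real assume t: "0 \<le> t"
  note [measurable] = h_at_\<tau>_measurable h_infinity_measurable never_measurable[OF good_PA DA]
  have ia: "integrable CM (\<lambda>w. at_random_time \<tau> h w * alive t w)"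
    by (rule bounded_integrable[of _ C]) (use h_at_\<tau>_bound C_nonneg in \<open>auto intro!: AE_I2 simp: abs_mult of_bool_def\<close>)
  have ih: "integrable CM (\<lambda>w. at_infinity_value h w * of_bool (\<tau> w = \<infinity>))"
    by (rule bounded_integrable[of _ C]) (use h_infinity_bound C_nonneg in \<open>auto intro!: AE_I2 simp: abs_mult of_bool_def\<close>)
  have id: "integrable CM (\<lambda>w. at_random_time \<tau> h w * alive t w - at_infinity_value h w * of_bool (\<tau> w = \<infinity>))"
    using ia ih by auto
  have "AE w in CM. real_cond_exp CM (F (ennreal t)) (\<lambda>w. tail t w + at_infinity_value h w * at_infinity_value Z w) w =
    real_cond_exp CM (F (ennreal t)) (\<lambda>w. at_random_time \<tau> h w * alive t w) w"
  proof (rule cond_exp_eqI)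
    show "integrable CM (\<lambda>w. tail t w + at_infinity_value h w * at_infinity_value Z w)"
      using tail_integrable[OF t] residual_integrable by auto
    fix E assume E: "E \<in> sets (F (ennreal t))"
    have iE: "integrable CM (\<lambda>w. indicator E w * f w)" if "integrable CM f" for f :: "'a \<Rightarrow> real"
      using integrable_mult_indicator[OF sets_F_CM[OF E] that] by simp
    have "(\<integral>w. indicator E w * (tail t w + at_infinity_value h w * at_infinity_value Z w) \<partial>CM) =
      (\<integral>w. indicator E w * tail t w \<partial>CM) + (\<integral>w. indicator E w * (at_infinity_value h w * at_infinity_value Z w) \<partial>CM)"
      unfolding distrib_left by (rule Bochner_Integration.integral_add[OF tail_integral(1)[OF t E] iE[OF residual_integrable]])
    also have "\<dots> = (\<integral>w. indicator E w * (at_random_time \<tau> h w * alive t w - at_infinity_value h w * of_bool (\<tau> w = \<infinity>)) \<partial>CM) +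
      (\<integral>w. indicator E w * (at_infinity_value h w * of_bool (\<tau> w = \<infinity>)) \<partial>CM)"
      unfolding tail_integral(2)[OF t E] Z_infinity_integral[OF t E] ..
    also have "\<dots> = (\<integral>w. indicator E w * (at_random_time \<tau> h w * alive t w - at_infinity_value h w * of_bool (\<tau> w = \<infinity>)) +
        indicator E w * (at_infinity_value h w * of_bool (\<tau> w = \<infinity>)) \<partial>CM)"
      by (rule Bochner_Integration.integral_add[OF iE[OF id] iE[OF ih], symmetric])
    also have "\<dots> = (\<integral>w. indicator E w * (at_random_time \<tau> h w * alive t w) \<partial>CM)"
      by (intro Bochner_Integration.integral_cong) (auto simp: algebra_simps)
    finally show "(\<integral>w. indicator E w * (tail t w + at_infinity_value h w * at_infinity_value Z w) \<partial>CM) =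
      (\<integral>w. indicator E w * (at_random_time \<tau> h w * alive t w) \<partial>CM)" .
  qed (rule ia)
  with cadlag_cond_expD(3)[OF X t] show "AE w in CM. X t w = real_cond_exp CM (F (ennreal t)) (\<lambda>w. at_random_time \<tau> h w * alive t w) w"
    by eventually_elim simp
qed

text \<open>Up to time t the integrand is jointly measurable over F_t by progressive measurability,
  and the random measure on [0,t] depends on A only up to t.\<close>

lemma drift_measurable:
  assumes t: "0 \<le> t"
  shows "(\<lambda>w. LINT s:{0<..t}|path_measure (\<lambda>u. A u w). h s w) \<in> borel_measurable (F (ennreal t))"
proof -
  let ?f = "\<lambda>p. indicator ({0<..} \<times> space M) p * (case p of (s, w) \<Rightarrow> h s w)"
  have f: "?f \<in> borel_measurable PA"
    using PA_Ioi[of 0 "space M"] sets.top[of "F (ennreal 0)"] h_PA by (intro borel_measurable_times borel_measurable_indicator) auto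
  note B = dualD[OF good_PA DA]
  have Au: "A u \<in> borel_measurable (F (ennreal t))" if "0 \<le> u" "u \<le> t" for u
    using B(3) that F_measurable_mono[of "A u" "ennreal u" "ennreal t"] by (auto simp: adapted_def ennreal_leI)
  have "(\<lambda>w. LINT s:{0..t}|path_measure (\<lambda>u. A u w). (if (s, w) \<in> {0..t} \<times> space M then ?f (s, w) else 0)) \<in> borel_measurable (F (ennreal t))"
    using B(1) by (intro path_integral_measurable[OF _ Au t PA_progressive_fun[OF t f]]) auto
  then show ?thesis
  proof (rule measurable_cong[THEN iffD1, rotated])
    fix w assume "w \<in> space (F (ennreal t))"
    then show "(LINT s:{0..t}|path_measure (\<lambda>u. A u w). (if (s, w) \<in> {0..t} \<times> space M then ?f (s, w) else 0)) =
       (LINT s:{0<..t}|path_measure (\<lambda>u. A u w). h s w)"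
      unfolding set_lebesgue_integral_def by (intro Bochner_Integration.integral_cong) (auto simp: indicator_def)
  qed
qed

lemma X_drift:
  assumes X: "cadlag_cond_exp M F (\<lambda>t w. tail t w + at_infinity_value h w * at_infinity_value Z w) X"
    and muh: "cadlag_cond_exp M F (\<lambda>_ w. tail 0 w + at_infinity_value h w * at_infinity_value Z w) \<mu>h"
  shows "AE w in CM. \<forall>t\<ge>0. X t w = \<mu>h t w - (LINT s:{0<..t}|path_measure (\<lambda>u. A u w). h s w)"
proof (rule cond_exp_drift[where \<xi> = "\<lambda>t w. tail t w + at_infinity_value h w * at_infinity_value Z w"])
  let ?I = "\<lambda>t w. LINT s:{0<..t}|path_measure (\<lambda>u. A u w). h s w"
  have split: "AE w in CM. tail 0 w - tail t w = ?I t w" if t: "0 \<le> t" for t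
    using h_integrable_paths
  proof eventually_elim
    case (elim w)
    have e: "{0<..} = {0<..t} \<union> {t<..}" using t by auto
    have "(LINT s:{0<..t} \<union> {t<..}|path_measure (\<lambda>u. A u w). h s w) = ?I t w + tail t w"
      using t by (intro set_integral_Un set_integrable_subset[OF elim]) auto
    then show ?case using e by simp
  qed
  show i: "integrable CM (\<lambda>w. tail t w + at_infinity_value h w * at_infinity_value Z w)" if "0 \<le> t" for t
    using tail_integrable[OF that] residual_integrable by auto
  then show "integrable CM (\<lambda>w. tail 0 w + at_infinity_value h w * at_infinity_value Z w)" by simp
  show m: "?I t \<in> borel_measurable (F (ennreal t))" if "0 \<le> t" for t by (rule drift_measurable[OF that])
  show "integrable CM (?I t)" if t: "0 \<le> t" for t
  proof (rule integrable_cong_AE_imp)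
    show "integrable CM (\<lambda>w. tail 0 w - tail t w)" using tail_integrable[OF t] tail_integrable[of 0] by auto
  qed (use split[OF t] F_measurable_CM[OF m[OF t]] in auto)
  show "AE w in CM. tail t w + at_infinity_value h w * at_infinity_value Z w =
      tail 0 w + at_infinity_value h w * at_infinity_value Z w - ?I t w" if "0 \<le> t" for t
    using split[OF that] by eventually_elim simp
  show "AE w in CM. \<forall>t\<ge>0. continuous (at_right t) (\<lambda>t. ?I t w)"
    using h_integrable_paths
  proof eventually_elim
    case (elim w)
    show ?case
    proof (intro allI impI)
      fix t :: real assume t: "0 \<le> t"
      have "set_integrable (path_measure (\<lambda>t. A t w)) {0<..t + 1} (\<lambda>s. h s w)"
        by (rule set_integrable_subset[OF elim]) auto
      then show "continuous (at_right t) (\<lambda>t. ?I t w)" using t by (intro integral_right_continuous[where T = "t + 1"]) auto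
    qed
  qed
qed (use cadlag_cond_expD[OF X] cadlag_cond_expD[OF muh] in auto)

end

end

lemma usual_filtration_space: "usual_filtration M H \<Longrightarrow> space (H t) = space M"
  unfolding usual_filtration_def by (rule filtration.space_F) (rule conjunct1)

context random_time begin

section \<open>The progressive enlargement\<close>

abbreviation "F_plus t \<equiv> (\<Inter>s\<in>{t<..}. sets (F s))"

text \<open>A concrete candidate that contains the enlargement: arbitrary information once \<tau>
  has occurred, but only F_{t+} before. F_{t+} instead of F_t makes the family
  right-continuous.\<close>

definition trace_sets :: "ennreal \<Rightarrow> 'a set set" where
  "trace_sets t = {E \<in> sets CM. \<exists>E'\<in>F_plus t. \<forall>w\<in>space M. t < \<tau> w \<longrightarrow> (w \<in> E \<longleftrightarrow> w \<in> E')}"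

lemma trace_sigma_algebra: "sigma_algebra (space M) (trace_sets t)"
  unfolding sigma_algebra_iff2
proof (intro conjI ballI allI impI)
  show "trace_sets t \<subseteq> Pow (space M)" using sets.sets_into_space[of _ CM] by (auto simp: trace_sets_def)
  have e: "{} \<in> F_plus t" by blast
  show "{} \<in> trace_sets t" unfolding trace_sets_def by (intro CollectI conjI bexI[OF _ e]) simp_all
next
  fix E assume "E \<in> trace_sets t"
  then obtain E' where E: "E \<in> sets CM" "E' \<in> F_plus t" "\<forall>w\<in>space M. t < \<tau> w \<longrightarrow> (w \<in> E \<longleftrightarrow> w \<in> E')"
    by (auto simp: trace_sets_def)
  have "space M - E' \<in> F_plus t"
  proof
    fix s assume "s \<in> {t<..}" then have "E' \<in> sets (F s)" using E(2) by blast
    from sets.compl_sets[OF this] show "space M - E' \<in> sets (F s)" by simp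
  qed
  moreover have "space M - E \<in> sets CM" using sets.compl_sets[OF E(1)] by simp
  ultimately show "space M - E \<in> trace_sets t"
    unfolding trace_sets_def by (intro CollectI conjI bexI[of _ "space M - E'"]) (use E(3) in auto)
next
  fix E :: "nat \<Rightarrow> 'a set" assume "range E \<subseteq> trace_sets t"
  then have ex: "\<forall>i. \<exists>E'. E' \<in> F_plus t \<and> (\<forall>w\<in>space M. t < \<tau> w \<longrightarrow> (w \<in> E i \<longleftrightarrow> w \<in> E'))" and CM: "range E \<subseteq> sets CM"
    unfolding trace_sets_def by blast+
  from choice[OF ex] obtain E' where E': "\<forall>i. E' i \<in> F_plus t \<and> (\<forall>w\<in>space M. t < \<tau> w \<longrightarrow> (w \<in> E i \<longleftrightarrow> w \<in> E' i))" ..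
  have "(\<Union>i. E' i) \<in> F_plus t"
  proof
    fix s assume "s \<in> {t<..}" then have "E' i \<in> sets (F s)" for i using E' by blast
    then show "(\<Union>i. E' i) \<in> sets (F s)" by blast
  qed
  moreover have "\<forall>w\<in>space M. t < \<tau> w \<longrightarrow> (w \<in> (\<Union>i. E i) \<longleftrightarrow> w \<in> (\<Union>i. E' i))" using E' by blast
  moreover have "(\<Union>i. E i) \<in> sets CM" using CM by blast
  ultimately show "(\<Union>i. E i) \<in> trace_sets t" unfolding trace_sets_def by blast
qed

definition trace_filtration :: "ennreal \<Rightarrow> 'a measure" where
  "trace_filtration t = sigma (space M) (trace_sets t)"

lemma trace_filtration[simp]: "sets (trace_filtration t) = trace_sets t" "space (trace_filtration t) = space M"
proof -
  interpret sigma_algebra "space M" "trace_sets t" by (rule trace_sigma_algebra)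
  show "sets (trace_filtration t) = trace_sets t" "space (trace_filtration t) = space M"
    unfolding trace_filtration_def using space_closed by (simp_all add: sigma_sets_eq)
qed

lemma trace_sets_mono: assumes "s \<le> t" shows "trace_sets s \<subseteq> trace_sets t"
proof
  fix E assume "E \<in> trace_sets s"
  then obtain E' where E: "E \<in> sets CM" "E' \<in> F_plus s" "\<forall>w\<in>space M. s < \<tau> w \<longrightarrow> (w \<in> E \<longleftrightarrow> w \<in> E')"
    by (auto simp: trace_sets_def)
  have "E' \<in> F_plus t" using E(2) assms by auto
  then show "E \<in> trace_sets t" using E assms unfolding trace_sets_def by (auto intro: le_less_trans)
qed

lemma ennreal_decreasing_seq:
  assumes "t < (\<infinity>::ennreal)"
  shows "\<exists>u :: nat \<Rightarrow> ennreal. (\<forall>n. t < u n) \<and> decseq u \<and> (\<forall>s. t < s \<longrightarrow> (\<exists>n. u n < s))"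
proof -
  obtain r where r: "t = ennreal r" "0 \<le> r" using assms by (cases t) auto
  show ?thesis
  proof (intro exI[of _ "\<lambda>n. ennreal (r + inverse (real (Suc n)))"] conjI allI impI)
    show "t < ennreal (r + inverse (real (Suc n)))" for n
      using r by (simp add: ennreal_less_iff del: of_nat_Suc)
    show "decseq (\<lambda>n. ennreal (r + inverse (real (Suc n))))"
      by (intro decseq_SucI ennreal_leI add_left_mono le_imp_inverse_le) auto
    show "\<exists>n. ennreal (r + inverse (real (Suc n))) < s" if "t < s" for s
    proof (cases s)
      case (real q)
      then have "r < q" using that r by (simp add: ennreal_less_iff)
      then obtain n where "inverse (real (Suc n)) < q - r" using reals_Archimedean[of "q - r"] by auto
      moreover have "0 < inverse (real (Suc n))" by simp
      ultimately have "ennreal (r + inverse (real (Suc n))) < s" using r real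
        by (subst real(2), subst ennreal_less_iff) linarith+
      then show ?thesis by blast
    qed auto
  qed
qed

text \<open>Along times u_n decreasing to t, choose E'_n in F_{u_n+} with the same trace as E on
  {u_n < \<tau>}. On {t < \<tau>} they agree with E for all late n, and so does their lower limit.
  The lower limit depends only on late n, hence lies in F_s for every s > t.\<close>

lemma trace_right_continuous:
  assumes t: "t < \<infinity>" shows "trace_sets t = (\<Inter>s\<in>{t<..}. trace_sets s)"
proof
  show "trace_sets t \<subseteq> (\<Inter>s\<in>{t<..}. trace_sets s)" using trace_sets_mono by (auto dest: less_imp_le)
  show "(\<Inter>s\<in>{t<..}. trace_sets s) \<subseteq> trace_sets t"
  proof
    fix E assume E: "E \<in> (\<Inter>s\<in>{t<..}. trace_sets s)"
    obtain u :: "nat \<Rightarrow> ennreal" where u: "\<And>n. t < u n" "decseq u" "\<And>s. t < s \<Longrightarrow> \<exists>n. u n < s"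
      using ennreal_decreasing_seq[OF t] by blast
    have ex: "\<forall>n. \<exists>E'. E' \<in> F_plus (u n) \<and> (\<forall>w\<in>space M. u n < \<tau> w \<longrightarrow> (w \<in> E \<longleftrightarrow> w \<in> E'))"
    proof
      fix n have "E \<in> trace_sets (u n)" using E u(1)[of n] by blast
      then show "\<exists>E'. E' \<in> F_plus (u n) \<and> (\<forall>w\<in>space M. u n < \<tau> w \<longrightarrow> (w \<in> E \<longleftrightarrow> w \<in> E'))"
        unfolding trace_sets_def by blast
    qed
    from choice[OF ex] obtain E' where E': "\<forall>n. E' n \<in> F_plus (u n) \<and> (\<forall>w\<in>space M. u n < \<tau> w \<longrightarrow> (w \<in> E \<longleftrightarrow> w \<in> E' n))" ..
    let ?L = "\<Union>m. \<Inter>n\<in>{m..}. E' n"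
    have L: "?L \<in> F_plus t"
    proof
      fix s assume "s \<in> {t<..}"
      then obtain k where k: "u k < s" using u(3) by auto
      have En: "E' n \<in> sets (F s)" if "k \<le> n" for n
      proof -
        have "u n < s" using decseqD[OF u(2) that] k by (rule le_less_trans)
        then show ?thesis using E' by blast
      qed
      have "?L = (\<Union>m\<in>{k..}. \<Inter>n\<in>{m..}. E' n)"
      proof (intro set_eqI iffI)
        fix w assume "w \<in> ?L"
        then obtain m where "\<And>n. m \<le> n \<Longrightarrow> w \<in> E' n" by auto
        then show "w \<in> (\<Union>m\<in>{k..}. \<Inter>n\<in>{m..}. E' n)" by (intro UN_I[of "max m k"]) auto
      qed auto
      also have "\<dots> \<in> sets (F s)"
      proof (rule sets.countable_UN')
        have "(\<Inter>n\<in>{m..}. E' n) \<in> sets (F s)" if "k \<le> m" for m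
          by (rule sets.countable_INT') (use En that in auto)
        then show "(\<lambda>m. \<Inter>n\<in>{m..}. E' n) ` {k..} \<subseteq> sets (F s)" by auto
      qed simp
      finally show "?L \<in> sets (F s)" .
    qed
    have EL: "w \<in> E \<longleftrightarrow> w \<in> ?L" if w: "w \<in> space M" "t < \<tau> w" for w
    proof -
      obtain k where k: "u k < \<tau> w" using u(3)[OF w(2)] by blast
      have iff: "w \<in> E \<longleftrightarrow> w \<in> E' n" if "k \<le> n" for n
      proof -
        have "u n < \<tau> w" using decseqD[OF u(2) that] k by (rule le_less_trans)
        then show ?thesis using E' w by blast
      qed
      show ?thesis
      proof
        assume "w \<in> E"
        then show "w \<in> ?L" using iff by (intro UN_I[of k]) auto
      next
        assume "w \<in> ?L"
        then obtain m where "\<And>n. m \<le> n \<Longrightarrow> w \<in> E' n" by auto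
        then show "w \<in> E" using iff[of "max m k"] by auto
      qed
    qed
    have "E \<in> trace_sets (u 0)" using E u(1)[of 0] by blast
    then have "E \<in> sets CM" unfolding trace_sets_def by blast
    then show "E \<in> trace_sets t"
      unfolding trace_sets_def by (intro CollectI conjI bexI[OF _ L] ballI impI EL)
  qed
qed

lemma usual_trace_filtration:
  "usual_filtration M trace_filtration" "\<And>s. sets (F s) \<subseteq> sets (trace_filtration s)" "stopping_time trace_filtration \<tau>"
proof -
  show sub: "sets (F s) \<subseteq> sets (trace_filtration s)" for s
  proof
    fix E assume E: "E \<in> sets (F s)"
    then have "E \<in> F_plus s" using sets_F_mono[of s] by (auto dest: less_imp_le)
    then show "E \<in> sets (trace_filtration s)" using sets_F_CM[OF E] by (auto simp: trace_sets_def)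
  qed
  show "usual_filtration M trace_filtration"
    unfolding usual_filtration_def
  proof (intro conjI allI impI)
    show "filtration (space M) trace_filtration" by (rule filtration.intro) (simp_all add: trace_sets_mono)
    show "null_sets CM \<subseteq> sets (trace_filtration t)" for t using F_null[of t] sub[of t] by blast
    show "sets (trace_filtration t) = (\<Inter>s\<in>{t<..}. sets (trace_filtration s))" if "t < \<infinity>" for t
      using trace_right_continuous[OF that] by simp
  qed
  show "stopping_time trace_filtration \<tau>"
  proof (rule stopping_timeI)
    fix t
    have "{w \<in> space CM. \<tau> w \<le> t} \<in> sets CM" by measurable
    then have C: "{w \<in> space M. \<tau> w \<le> t} \<in> sets CM" by simp
    \<comment> \<open>On {t < \<tau>} the event {\<tau> \<le> t} is empty, so the empty set serves
      as its trace.\<close>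
    have e: "{} \<in> F_plus t" by blast
    have "{w \<in> space M. \<tau> w \<le> t} \<in> trace_sets t" unfolding trace_sets_def
      by (intro CollectI conjI bexI[OF _ e] C ballI impI) (simp add: not_le)
    then show "Measurable.pred (trace_filtration t) (\<lambda>w. \<tau> w \<le> t)" by (simp add: pred_def)
  qed
qed

abbreviation "GF \<equiv> progressive_enlargement M F \<tau>"

text \<open>The intersection is closed under \<open>sigma_sets\<close>, as every candidate is. The
  trace filtration shows that the family of candidates is nonempty, so that the intersection
  consists of subsets of the space.\<close>

lemma enlargement_sets:
  "sets (GF t) = (\<Inter>H\<in>{H. usual_filtration M H \<and> (\<forall>s. sets (F s) \<subseteq> sets (H s)) \<and> stopping_time H \<tau>}. sets (H t))"
  (is "_ = ?I") and enlargement_space[simp]: "space (GF t) = space M"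
proof -
  let ?\<H> = "{H. usual_filtration M H \<and> (\<forall>s. sets (F s) \<subseteq> sets (H s)) \<and> stopping_time H \<tau>}"
  have T: "trace_filtration \<in> ?\<H>" using usual_trace_filtration by blast
  have "?I \<subseteq> sets (trace_filtration t)" by (rule INT_lower[OF T])
  also have "\<dots> = trace_sets t" by simp
  also have "\<dots> \<subseteq> Pow (space M)" using sigma_algebra.axioms(1)[OF trace_sigma_algebra] by (rule algebra.axioms(1)[THEN ring_of_sets.axioms(1), THEN semiring_of_sets.axioms(1), THEN subset_class.space_closed])
  finally have P: "?I \<subseteq> Pow (space M)" .
  then show "space (GF t) = space M" unfolding progressive_enlargement_def by (rule space_measure_of)
  have "sigma_sets (space M) ?I \<subseteq> sets (H t)" if H: "H \<in> ?\<H>" for H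
  proof -
    have "space (H t) = space M" using H usual_filtration_space by auto
    then show ?thesis using sets.sigma_sets_subset[of ?I "H t"] H by auto
  qed
  then have "sigma_sets (space M) ?I = ?I" by (intro antisym INT_greatest sigma_sets_superset_generator)
  then show "sets (GF t) = ?I" unfolding progressive_enlargement_def using P by (simp add: sets_measure_of)
qed

lemma enlargement_trace: "sets (GF t) \<subseteq> trace_sets t"
proof -
  have "sets (GF t) \<subseteq> sets (trace_filtration t)"
    unfolding enlargement_sets using usual_trace_filtration by (intro INT_lower) blast
  then show ?thesis by simp
qed

lemma enlargement_CM: "sets (GF t) \<subseteq> sets CM"
  using enlargement_trace[of t] by (auto simp: trace_sets_def)

lemma enlargement_F: "sets (F t) \<subseteq> sets (GF t)"
  unfolding enlargement_sets by auto

lemma enlargement_mono: "s \<le> t \<Longrightarrow> sets (GF s) \<subseteq> sets (GF t)"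
proof -
  assume st: "s \<le> t"
  have "sets (H s) \<subseteq> sets (H t)" if "usual_filtration M H" for H
    using that[unfolded usual_filtration_def, THEN conjunct1] by (rule filtration.sets_F_mono[OF _ st])
  then show ?thesis unfolding enlargement_sets by (intro INT_anti_mono[OF subset_refl]) simp
qed

lemma enlargement_stopping: "{w \<in> space M. \<tau> w \<le> t} \<in> sets (GF t)"
  unfolding enlargement_sets
proof
  fix H assume H: "H \<in> {H. usual_filtration M H \<and> (\<forall>s. sets (F s) \<subseteq> sets (H s)) \<and> stopping_time H \<tau>}"
  then have sp: "space (H t) = space M" and st: "stopping_time H \<tau>" using usual_filtration_space by auto
  show "{w \<in> space M. \<tau> w \<le> t} \<in> sets (H t)" using stopping_timeD[OF st, of t] by (simp add: pred_def sp)
qed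

section \<open>Conditional expectations in the enlarged filtration\<close>

lemma rep_AE_bound:
  assumes r: "rep \<xi> X" and \<xi>: "\<xi> \<in> borel_measurable CM" "\<And>w. w \<in> space M \<Longrightarrow> \<bar>\<xi> w\<bar> \<le> C"
    and rZ: "rep (\<lambda>_. 1) Z" and t: "0 \<le> t"
  shows "AE w in CM. \<bar>X t w\<bar> \<le> \<bar>C\<bar>"
proof -
  have "AE w in CM. \<bar>X t w\<bar> \<le> C * Z t w" by (rule rep_AE_le[OF r \<xi>(1) _ rZ t]) (rule \<xi>(2))
  then show ?thesis using rep_Z_bounds[OF rZ t]
  proof eventually_elim
    case (elim w)
    have "\<bar>X t w\<bar> \<le> C * Z t w" using elim by simp
    also have "\<dots> \<le> \<bar>C\<bar> * 1" using elim by (intro mult_mono) auto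
    finally show ?case by simp
  qed
qed

text \<open>Traces of the enlargement lie in F_{t+}, while \<open>rep_integral\<close> tests with
  F_t. It is applied at t + 1/(n+1); right-continuity of X and of the survival indicator lets n tend
  to infinity under a constant bound.\<close>

lemma rep_integral_plus:
  assumes r: "rep \<xi> X" and \<xi>: "\<xi> \<in> borel_measurable CM" "\<And>w. w \<in> space M \<Longrightarrow> \<bar>\<xi> w\<bar> \<le> C"
    and rZ: "rep (\<lambda>_. 1) Z" and t: "0 \<le> t" and fF: "\<And>s. ennreal t < s \<Longrightarrow> f \<in> borel_measurable (F s)"
    and fc: "AE w in CM. \<bar>f w\<bar> \<le> c"
  shows "(\<integral>w. f w * X t w \<partial>CM) = (\<integral>w. f w * (\<xi> w * alive t w) \<partial>CM)"
proof -
  have fCM[measurable]: "f \<in> borel_measurable CM" using F_measurable_CM[OF fF[of \<infinity>]] by simp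
  note [measurable] = \<xi>(1)
  let ?t = "\<lambda>n. t + inverse (real (Suc n))"
  have t0: "t < ?t n" "0 \<le> ?t n" for n
  proof -
    have "0 < inverse (real (Suc n))" by simp
    then show "t < ?t n" "0 \<le> ?t n" using t by linarith+
  qed
  have tl: "?t \<longlonglongrightarrow> t" using LIMSEQ_inverse_real_of_nat_add[of t] by simp
  have tr: "filterlim ?t (at_right t) sequentially"
    unfolding filterlim_at using tl t0(1) by (auto simp: less_imp_neq[symmetric] simp del: of_nat_Suc intro!: always_eventually)
  have Xm: "X u \<in> borel_measurable CM" if "0 \<le> u" for u by (rule repD(4)[OF r that])
  have l1: "(\<lambda>n. \<integral>w. f w * X (?t n) w \<partial>CM) \<longlonglongrightarrow> (\<integral>w. f w * X t w \<partial>CM)"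
  proof (rule integral_dominated_convergence[where w = "\<lambda>_. \<bar>c\<bar> * \<bar>C\<bar>"])
    show "AE w in CM. (\<lambda>n. f w * X (?t n) w) \<longlonglongrightarrow> f w * X t w"
    proof (rule AE_I2)
      fix w assume "w \<in> space CM"
      then have "((\<lambda>t. X t w) \<longlongrightarrow> X t w) (at_right t)"
        using repD(2)[OF r, of w] t by (auto simp: cadlag_def continuous_within)
      from filterlim_compose[OF this tr] show "(\<lambda>n. f w * X (?t n) w) \<longlonglongrightarrow> f w * X t w"
        by (intro tendsto_mult tendsto_const)
    qed
    show "AE w in CM. norm (f w * X (?t n) w) \<le> \<bar>c\<bar> * \<bar>C\<bar>" for n
    proof -
      have "AE w in CM. \<bar>X (?t n) w\<bar> \<le> \<bar>C\<bar>" by (rule rep_AE_bound[OF r \<xi>(1) _ rZ t0(2)]) (rule \<xi>(2))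
      with fc show ?thesis
    proof eventually_elim
      case (elim w)
      have "\<bar>f w\<bar> * \<bar>X (?t n) w\<bar> \<le> \<bar>c\<bar> * \<bar>C\<bar>" using elim by (intro mult_mono) auto
      then show ?case by (simp add: abs_mult)
    qed
    qed
    show "(\<lambda>w. f w * X t w) \<in> borel_measurable CM" "(\<lambda>w. f w * X (?t n) w) \<in> borel_measurable CM" for n
      by (intro borel_measurable_times fCM Xm t t0(2))+
  qed simp
  have l2: "(\<lambda>n. \<integral>w. f w * (\<xi> w * alive (?t n) w) \<partial>CM) \<longlonglongrightarrow> (\<integral>w. f w * (\<xi> w * alive t w) \<partial>CM)"
  proof (rule integral_dominated_convergence[where w = "\<lambda>_. \<bar>c\<bar> * \<bar>C\<bar>"])
    have al: "(\<lambda>n. alive (?t n) w) \<longlonglongrightarrow> alive t w" for w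
    proof (rule tendsto_eventually)
      show "\<forall>\<^sub>F n in sequentially. alive (?t n) w = alive t w"
      proof (cases "ennreal t < \<tau> w")
        case True
        show ?thesis
        proof (cases "\<tau> w")
          case (real q)
          then have "t < q" using True t by (simp add: ennreal_less_iff)
          then have "\<forall>\<^sub>F n in sequentially. ?t n < q" using tl by (intro order_tendstoD(2)) auto
          then show ?thesis
          proof eventually_elim
            case (elim n)
            then show ?case using True real t0(2)[of n] by (simp add: ennreal_less_iff del: of_nat_Suc)
          qed
        qed (simp add: less_top[symmetric])
      next
        case False
        then have "\<not> ennreal (?t n) < \<tau> w" for n
          using t0(1)[of n] by (meson ennreal_leI less_imp_le le_less_trans)
        then show ?thesis using False by simp
      qed
    qed
    show "AE w in CM. (\<lambda>n. f w * (\<xi> w * alive (?t n) w)) \<longlonglongrightarrow> f w * (\<xi> w * alive t w)"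
      by (intro AE_I2 tendsto_mult tendsto_const al)
    show "AE w in CM. norm (f w * (\<xi> w * alive (?t n) w)) \<le> \<bar>c\<bar> * \<bar>C\<bar>" for n
      using fc AE_space[where M = CM]
    proof eventually_elim
      case (elim w)
      have "\<bar>f w\<bar> * (\<bar>\<xi> w\<bar> * of_bool (ennreal (?t n) < \<tau> w)) \<le> \<bar>c\<bar> * (\<bar>C\<bar> * 1)"
        using elim \<xi>(2)[of w] by (intro mult_mono) auto
      then show ?case by (simp add: abs_mult)
    qed
    show "(\<lambda>w. f w * (\<xi> w * alive t w)) \<in> borel_measurable CM" "(\<lambda>w. f w * (\<xi> w * alive (?t n) w)) \<in> borel_measurable CM" for n
      by (intro borel_measurable_times fCM \<xi>(1) alive_measurable)+
  qed simp
  have "(\<integral>w. f w * X (?t n) w \<partial>CM) = (\<integral>w. f w * (\<xi> w * alive (?t n) w) \<partial>CM)" for n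
  proof (rule rep_integral(2)[OF r \<xi> t0(2) fF fc])
    show "ennreal t < ennreal (?t n)" using t0(1)[of n] t by (simp add: ennreal_less_iff del: of_nat_Suc)
  qed
  with l1 l2 show ?thesis by (simp add: LIMSEQ_unique)
qed

text \<open>Makes the value of h at \<tau> known at time t on {\<tau> \<le> t}. The variable min
  \<tau> t is measurable for the enlargement at t, and the pair with the sample point is then
  measurable into the predictable sigma-algebra, generator by generator.\<close>

lemma stopped_value_measurable:
  fixes f :: "real \<times> 'a \<Rightarrow> real"
  assumes t: "0 \<le> t" and f: "f \<in> borel_measurable PA"
  shows "(\<lambda>w. f (enn2real (min (\<tau> w) (ennreal t)), w)) \<in> borel_measurable (GF (ennreal t))"
proof -
  let ?m = "\<lambda>w. enn2real (min (\<tau> w) (ennreal t))"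
  have mm: "?m \<in> borel_measurable (GF (ennreal t))"
  proof (rule borel_measurable_iff_le[THEN iffD2], intro allI)
    fix a :: real
    show "{w \<in> space (GF (ennreal t)). ?m w \<le> a} \<in> sets (GF (ennreal t))"
    proof (cases "a < 0")
      case True
      then have "{w \<in> space (GF (ennreal t)). ?m w \<le> a} = {}" by (auto simp: not_le intro: less_le_trans)
      then show ?thesis by (simp only: sets.empty_sets)
    next
      case a: False
      show ?thesis
      proof (cases "t \<le> a")
        case True
        have "?m w \<le> a" for w
          using enn2real_mono[of "min (\<tau> w) (ennreal t)" "ennreal t"] t True by simp
        then show ?thesis using sets.top[of "GF (ennreal t)"] by simp
      next
        case False
        have "?m w \<le> a \<longleftrightarrow> \<tau> w \<le> ennreal a" for w
        proof (cases "\<tau> w")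
          case (real q)
          then show ?thesis using False a t by (auto simp: ennreal_le_iff min_def)
        next
          case top
          then show ?thesis using False a t by (simp add: top_unique)
        qed
        moreover have "{w \<in> space M. \<tau> w \<le> ennreal a} \<in> sets (GF (ennreal t))"
          using enlargement_stopping[of "ennreal a"] enlargement_mono[of "ennreal a" "ennreal t"] False by (auto simp: ennreal_leI)
        ultimately show ?thesis by simp
      qed
    qed
  qed
  have "(\<lambda>w. (?m w, w)) \<in> GF (ennreal t) \<rightarrow>\<^sub>M PA"
    unfolding predictable_algebra_def
  proof (rule measurable_measure_of[OF PA_gens])
    show "(\<lambda>w. (?m w, w)) \<in> space (GF (ennreal t)) \<rightarrow> {0..} \<times> space M" by auto
    fix y assume "y \<in> {{0} \<times> B |B. B \<in> sets (F 0)} \<union> {{s<..t} \<times> B |s t B. 0 \<le> s \<and> s < t \<and> B \<in> sets (F (ennreal s))}"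
    then consider B where "y = {0} \<times> B" "B \<in> sets (F 0)"
      | s u B where "y = {s<..u} \<times> B" "0 \<le> s" "B \<in> sets (F (ennreal s))" by blast
    then show "(\<lambda>w. (?m w, w)) -` y \<inter> space (GF (ennreal t)) \<in> sets (GF (ennreal t))"
    proof cases
      case 1
      have "B \<in> sets (GF (ennreal t))" using 1 enlargement_F[of 0] enlargement_mono[of 0 "ennreal t"] by auto
      moreover have "(\<lambda>w. (?m w, w)) -` y \<inter> space (GF (ennreal t)) = (?m -` {0} \<inter> space (GF (ennreal t))) \<inter> B" using 1 by auto
      ultimately show ?thesis using measurable_sets[OF mm, of "{0}"] by auto
    next
      case 2
      show ?thesis
      proof (cases "s < t")
        case True
        have "B \<in> sets (GF (ennreal t))"
          using 2 True enlargement_F[of "ennreal s"] enlargement_mono[of "ennreal s" "ennreal t"] by (auto simp: ennreal_leI)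
        moreover have "(\<lambda>w. (?m w, w)) -` y \<inter> space (GF (ennreal t)) = (?m -` {s<..u} \<inter> space (GF (ennreal t))) \<inter> B" using 2 by auto
        ultimately show ?thesis using measurable_sets[OF mm, of "{s<..u}"] by auto
      next
        case False
        have "\<not> s < ?m w" for w
          using enn2real_mono[of "min (\<tau> w) (ennreal t)" "ennreal t"] t False by simp
        then have "(\<lambda>w. (?m w, w)) -` y \<inter> space (GF (ennreal t)) = {}" using 2 by auto
        then show ?thesis by simp
      qed
    qed
  qed
  from measurable_compose[OF this f] show ?thesis .
qed

lemma enlargement_measurable: "f \<in> borel_measurable (F t) \<Longrightarrow> f \<in> borel_measurable (GF t)"
  by (erule measurable_from_subalg[rotated]) (simp add: subalgebra_def enlargement_F)

lemma enlargement_subalgebra: "sigma_finite_subalgebra CM (GF t)"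
  by (intro finite_measure_subalgebra_is_sigma_finite finite_measure_subalgebra.intro
      finite_measure_subalgebra_axioms.intro C.finite_measure_axioms) (simp add: subalgebra_def enlargement_CM)

context
  fixes Z X h :: "real \<Rightarrow> 'a \<Rightarrow> real" and C :: real
  assumes rZ: "rep (\<lambda>_. 1) Z" and rX: "rep (at_random_time \<tau> h) X"
    and \<xi>: "at_random_time \<tau> h \<in> borel_measurable CM" "\<And>w. w \<in> space M \<Longrightarrow> \<bar>at_random_time \<tau> h w\<bar> \<le> C"
    and h_PA: "(\<lambda>(t, w). h t w) \<in> borel_measurable PA"
begin

definition W :: "real \<Rightarrow> 'a \<Rightarrow> real" where
  "W t w = (if \<tau> w \<le> ennreal t then at_random_time \<tau> h w else X t w / Z t w)"

lemma W_measurable: assumes t: "0 \<le> t" shows "W t \<in> borel_measurable (GF (ennreal t))"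
proof -
  have 1: "(\<lambda>w. h (enn2real (min (\<tau> w) (ennreal t))) w) \<in> borel_measurable (GF (ennreal t))"
    using stopped_value_measurable[OF t h_PA] unfolding case_prod_conv .
  have 2: "(\<lambda>w. X t w / Z t w) \<in> borel_measurable (GF (ennreal t))"
    using repD(3)[OF rX t] repD(3)[OF rZ t] by (intro enlargement_measurable borel_measurable_divide)
  have "(\<lambda>w. if \<tau> w \<le> ennreal t then h (enn2real (min (\<tau> w) (ennreal t))) w else X t w / Z t w) \<in> borel_measurable (GF (ennreal t))"
    by (rule measurable_If[OF 1 2]) (use enlargement_stopping in simp)
  moreover have "(\<lambda>w. if \<tau> w \<le> ennreal t then h (enn2real (min (\<tau> w) (ennreal t))) w else X t w / Z t w) = W t"
    by (auto simp: fun_eq_iff W_def at_random_time_def min_def top_unique)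
  ultimately show ?thesis by simp
qed

lemma X_le_Z: "0 \<le> t \<Longrightarrow> AE w in CM. \<bar>X t w\<bar> \<le> C * Z t w"
  by (rule rep_AE_le[OF rX \<xi>(1) _ rZ]) (rule \<xi>(2))

lemma ratio_bound: assumes t: "0 \<le> t" shows "AE w in CM. \<bar>X t w / Z t w\<bar> \<le> \<bar>C\<bar>"
  using X_le_Z[OF t] rep_Z_bounds[OF rZ t]
proof eventually_elim
  case (elim w)
  show ?case
  proof (cases "Z t w = 0")
    case False
    then have "\<bar>X t w\<bar> / Z t w \<le> C" using elim by (simp add: divide_le_eq)
    then show ?thesis using elim by (simp add: abs_divide)
  qed simp
qed

lemma W_bound: assumes t: "0 \<le> t" shows "AE w in CM. \<bar>W t w\<bar> \<le> \<bar>C\<bar>"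
  using ratio_bound[OF t] AE_space[where M = CM]
proof eventually_elim
  case (elim w) then show ?case using \<xi>(2)[of w] by (simp add: W_def)
qed

text \<open>On {t < \<tau>} the event E may be replaced by an event E' of F_{t+}. With \<xi> the
  value of h at \<tau>, E(\<xi>; E', t < \<tau>) = E(X_t; E') = E((X_t / Z_t) Z_t; E') = E(X_t /
  Z_t; E', t < \<tau>). Where Z_t = 0, the bound |X_t| \<le> C Z_t gives X_t = 0, so the default
  value of the quotient does no harm.\<close>

lemma W_integral:
  assumes t: "0 \<le> t" and E: "E \<in> sets (GF (ennreal t))"
  shows "(\<integral>w. indicator E w * at_random_time \<tau> h w \<partial>CM) = (\<integral>w. indicator E w * W t w \<partial>CM)"
proof -
  let ?\<xi> = "at_random_time \<tau> h"
  let ?R = "\<lambda>w. X t w / Z t w"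
  have ECM: "E \<in> sets CM" using E enlargement_CM by auto
  obtain E' where E': "E' \<in> F_plus (ennreal t)" "\<forall>w\<in>space M. ennreal t < \<tau> w \<longrightarrow> (w \<in> E \<longleftrightarrow> w \<in> E')"
    using E enlargement_trace[of "ennreal t"] unfolding trace_sets_def by blast
  have E'F: "E' \<in> sets (F s)" if "ennreal t < s" for s using E'(1) that by blast
  have E'CM: "E' \<in> sets CM" using sets_F_CM[OF E'F[of \<infinity>]] by simp
  have RF: "?R \<in> borel_measurable (F s)" if "ennreal t < s" for s
    using repD(3)[OF rX t] repD(3)[OF rZ t] that by (intro F_measurable_mono[of ?R "ennreal t" s] borel_measurable_divide) auto
  have Rm: "?R \<in> borel_measurable CM" using repD(4)[OF rX t] repD(4)[OF rZ t] by (rule borel_measurable_divide)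
  have Wm: "W t \<in> borel_measurable CM"
    using W_measurable[OF t] by (rule measurable_from_subalg[rotated]) (simp add: subalgebra_def enlargement_CM)
  note [measurable] = Rm Wm \<xi>(1) ECM E'CM
  have ind: "(\<integral>w. indicator E w * (g w * alive t w) \<partial>CM) = (\<integral>w. indicator E' w * (g w * alive t w) \<partial>CM)" for g :: "'a \<Rightarrow> real"
    using E'(2) by (intro Bochner_Integration.integral_cong) (auto simp: indicator_def)
  have A: "(\<integral>w. indicator E' w * X t w \<partial>CM) = (\<integral>w. indicator E' w * (?\<xi> w * alive t w) \<partial>CM)"
  proof (rule rep_integral_plus[OF rX \<xi> rZ t, of _ 1])
    show "indicator E' \<in> borel_measurable (F s)" if "ennreal t < s" for s
      using E'F[OF that] by (rule borel_measurable_indicator)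
  qed (auto simp: indicator_def)
  have B: "(\<integral>w. (indicator E' w * ?R w) * Z t w \<partial>CM) = (\<integral>w. (indicator E' w * ?R w) * (1 * alive t w) \<partial>CM)"
  proof (rule rep_integral_plus[OF rZ _ _ rZ t, of 1 _ "\<bar>C\<bar>"])
    show "(\<lambda>w. indicator E' w * ?R w) \<in> borel_measurable (F s)" if "ennreal t < s" for s
      using E'F[OF that] RF[OF that] by (intro borel_measurable_times borel_measurable_indicator)
    show "AE w in CM. \<bar>indicator E' w * ?R w\<bar> \<le> \<bar>C\<bar>" using ratio_bound[OF t]
      by eventually_elim (simp add: indicator_def)
  qed auto
  have "(\<integral>w. indicator E' w * X t w \<partial>CM) = (\<integral>w. (indicator E' w * ?R w) * Z t w \<partial>CM)"
  proof (rule integral_cong_AE)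
    show "AE w in CM. indicator E' w * X t w = (indicator E' w * ?R w) * Z t w"
      using X_le_Z[OF t]
    proof eventually_elim
      case (elim w) then show ?case by (cases "Z t w = 0") auto
    qed
    show "(\<lambda>w. indicator E' w * X t w) \<in> borel_measurable CM" "(\<lambda>w. (indicator E' w * ?R w) * Z t w) \<in> borel_measurable CM"
      using repD(4)[OF rX t] repD(4)[OF rZ t] Rm E'CM by (auto intro!: borel_measurable_times borel_measurable_indicator)
  qed
  then have key: "(\<integral>w. indicator E w * (?\<xi> w * alive t w) \<partial>CM) = (\<integral>w. indicator E w * (?R w * alive t w) \<partial>CM)"
    unfolding ind using A B by (simp add: mult.assoc)
  let ?d = "\<lambda>g w. indicator E w * (g w * (1 - alive t w))"
  have i\<xi>: "integrable CM (\<lambda>w. indicator E w * (?\<xi> w * (1 - alive t w)))" "integrable CM (\<lambda>w. indicator E w * (?\<xi> w * alive t w))"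
    by (rule bounded_integrable[of _ "\<bar>C\<bar>"], use \<xi>(2) in \<open>auto intro!: AE_I2 simp: indicator_def of_bool_def intro: order_trans[OF _ abs_ge_self]\<close>)+
  have iR: "integrable CM (\<lambda>w. indicator E w * (?R w * alive t w))"
  proof (rule bounded_integrable)
    show "AE w in CM. \<bar>indicator E w * (?R w * alive t w)\<bar> \<le> \<bar>C\<bar>"
      using ratio_bound[OF t] by eventually_elim (simp add: indicator_def of_bool_def)
  qed (intro borel_measurable_times borel_measurable_indicator ECM Rm alive_measurable)
  have "(\<integral>w. indicator E w * ?\<xi> w \<partial>CM) = (\<integral>w. indicator E w * (?\<xi> w * (1 - alive t w)) + indicator E w * (?\<xi> w * alive t w) \<partial>CM)"
    by (intro Bochner_Integration.integral_cong) (auto simp: algebra_simps)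
  also have "\<dots> = (\<integral>w. indicator E w * (?\<xi> w * (1 - alive t w)) \<partial>CM) + (\<integral>w. indicator E w * (?R w * alive t w) \<partial>CM)"
    using i\<xi> key by simp
  also have "\<dots> = (\<integral>w. indicator E w * (?\<xi> w * (1 - alive t w)) + indicator E w * (?R w * alive t w) \<partial>CM)"
    by (rule Bochner_Integration.integral_add[OF i\<xi>(1) iR, symmetric])
  also have "\<dots> = (\<integral>w. indicator E w * W t w \<partial>CM)"
    by (intro Bochner_Integration.integral_cong) (auto simp: W_def of_bool_def not_less)
  finally show ?thesis .
qed

text \<open>Before \<tau> the quotient inherits right-continuity because Z is positive there; from
  \<tau> on the process is constant.\<close>

lemma W_right_continuous: "AE w in CM. \<forall>t\<ge>0. continuous (at_right t) (\<lambda>t. W t w)"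
  using Z_bounded_below[OF rZ] AE_space[where M = CM]
proof eventually_elim
  case (elim w)
  then obtain \<epsilon> where \<epsilon>: "0 < \<epsilon>" "\<And>t. 0 \<le> t \<Longrightarrow> ennreal t < \<tau> w \<Longrightarrow> \<epsilon> \<le> Z t w" by auto
  have w: "w \<in> space M" using elim by simp
  show ?case
  proof (intro allI impI)
    fix t :: real assume t: "0 \<le> t"
    show "continuous (at_right t) (\<lambda>t. W t w)"
    proof (cases "ennreal t < \<tau> w")
      case True
      have "((\<lambda>t. X t w / Z t w) \<longlongrightarrow> X t w / Z t w) (at_right t)"
        using repD(2)[OF rX w] repD(2)[OF rZ w] t \<epsilon>(2)[OF t True] \<epsilon>(1)
        by (intro tendsto_divide) (auto simp: cadlag_def continuous_within)
      moreover have "\<forall>\<^sub>F s in at_right t. W s w = X s w / Z s w"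
      proof -
        obtain b where b: "t < b" "\<And>s. t < s \<Longrightarrow> s < b \<Longrightarrow> ennreal s < \<tau> w"
        proof (cases "\<tau> w")
          case (real r)
          then have "t < r" using t True by (simp add: ennreal_less_iff)
          then show ?thesis using t real that[of r] by (auto simp: ennreal_less_iff)
        next
          case top then show ?thesis using that[of "t + 1"] by (auto simp: less_top[symmetric])
        qed
        then show ?thesis by (intro eventually_at_rightI[of t b]) (auto simp: W_def not_le[symmetric])
      qed
      then have "\<forall>\<^sub>F s in at_right t. X s w / Z s w = W s w" by eventually_elim simp
      ultimately have "((\<lambda>t. W t w) \<longlongrightarrow> X t w / Z t w) (at_right t)" by (rule Lim_transform_eventually)
      moreover have "W t w = X t w / Z t w" using True by (simp add: W_def not_le[symmetric])
      ultimately show ?thesis unfolding continuous_within by (simp only:)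
    next
      case False
      have "\<forall>\<^sub>F s in at_right t. W s w = W t w"
      proof (intro eventually_at_rightI[of t "t + 1"])
        fix s assume "s \<in> {t<..<t + 1}"
        then have "ennreal t \<le> ennreal s" by (intro ennreal_leI) simp
        then show "W s w = W t w" using False by (simp add: W_def not_less order_trans)
      qed simp
      then show ?thesis unfolding continuous_within by (rule tendsto_eventually)
    qed
  qed
qed

lemma enlargement_Y:
  assumes Y: "cadlag_cond_exp M GF (\<lambda>_. at_random_time \<tau> h) Y"
  shows "AE w in CM. \<forall>t\<ge>0. Y t w = W t w"
proof (rule AE_right_continuous_eq)
  note YD = Y[unfolded cadlag_cond_exp_def]
  have Yc: "cadlag (\<lambda>t. Y t w)" if "w \<in> space M" for w
    using YD[THEN conjunct2, THEN conjunct1] that by (rule bspec)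
  show "AE w in CM. \<forall>t\<ge>0. continuous (at_right t) (\<lambda>t. Y t w)"
    using AE_space[where M = CM]
  proof eventually_elim
    case (elim w) then show ?case using Yc[of w] by (simp add: cadlag_def)
  qed
  show "AE w in CM. \<forall>t\<ge>0. continuous (at_right t) (\<lambda>t. W t w)" by (rule W_right_continuous)
  fix t :: real assume t: "0 \<le> t"
  interpret S: sigma_finite_subalgebra CM "GF (ennreal t)" by (rule enlargement_subalgebra)
  have Wm: "W t \<in> borel_measurable CM"
    using W_measurable[OF t] by (rule measurable_from_subalg[rotated]) (simp add: subalgebra_def enlargement_CM)
  have "AE w in CM. real_cond_exp CM (GF (ennreal t)) (at_random_time \<tau> h) w = W t w"
  proof (rule S.real_cond_exp_charact)
    show "(LINT w:E|CM. at_random_time \<tau> h w) = (LINT w:E|CM. W t w)" if "E \<in> sets (GF (ennreal t))" for E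
      using W_integral[OF t that] by (simp add: set_lebesgue_integral_def)
    show "integrable CM (at_random_time \<tau> h)" by (rule bounded_integrable[OF \<xi>(1), of C]) (use \<xi>(2) in auto)
    show "integrable CM (W t)" by (rule bounded_integrable[OF Wm W_bound[OF t]])
  qed (rule W_measurable[OF t])
  moreover have "AE w in CM. Y t w = real_cond_exp CM (GF (ennreal t)) (at_random_time \<tau> h) w"
    using YD[THEN conjunct2, THEN conjunct2] t by (elim allE impE)
  ultimately show "AE w in CM. Y t w = W t w" by eventually_elim simp
qed

end

end

section \<open>The Poisson filtration\<close>

text \<open>The weighted series is r times the exponential series shifted by one index.\<close>

lemma poisson_mean:
  assumes "0 < r" shows "(\<integral>\<^sup>+k. of_nat k \<partial>measure_pmf (poisson_pmf r)) = ennreal r"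
proof -
  have s: "(\<lambda>k. r ^ k / fact k * exp (- r) * real k) sums r"
  proof -
    have "(\<lambda>k. r ^ k /\<^sub>R fact k) sums exp r" by (rule exp_converges)
    then have "(\<lambda>k. r * exp (- r) * (r ^ k /\<^sub>R fact k)) sums (r * exp (- r) * exp r)" by (rule sums_mult)
    moreover have "r * exp (- r) * exp r = r" by (simp add: exp_minus)
    ultimately have "(\<lambda>k. r * exp (- r) * (r ^ k /\<^sub>R fact k)) sums r" by metis
    moreover have "r * exp (- r) * (r ^ k /\<^sub>R fact k) = r ^ Suc k / fact (Suc k) * exp (- r) * real (Suc k)" for k
      by (simp add: field_simps del: of_nat_Suc)
    ultimately have "(\<lambda>k. r ^ Suc k / fact (Suc k) * exp (- r) * real (Suc k)) sums r" by simp
    then show ?thesis by (subst (asm) sums_Suc_iff) simp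
  qed
  have "(\<integral>\<^sup>+k. of_nat k \<partial>measure_pmf (poisson_pmf r)) = (\<integral>\<^sup>+k. ennreal (pmf (poisson_pmf r) k) * of_nat k \<partial>count_space UNIV)"
    by (rule nn_integral_measure_pmf)
  also have "\<dots> = (\<integral>\<^sup>+k. ennreal (r ^ k / fact k * exp (- r) * real k) \<partial>count_space UNIV)"
    using assms by (intro nn_integral_cong) (simp add: ennreal_mult''[symmetric] ennreal_of_nat_eq_real_of_nat)
  also have "\<dots> = (\<Sum>k. ennreal (r ^ k / fact k * exp (- r) * real k))" by (rule nn_integral_count_space_nat)
  also have "\<dots> = ennreal r" using s assms by (intro suminf_ennreal_eq) (auto simp: divide_nonneg_nonneg)
  finally show ?thesis .
qed

text \<open>The mass of {0, 1} is exp(-r) (1 + r), which is at least (1 - r) (1 + r) = 1 -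
  r^2.\<close>

lemma poisson_tail:
  assumes "0 < r" shows "measure (measure_pmf (poisson_pmf r)) {2..} \<le> r\<^sup>2"
proof -
  have "measure (measure_pmf (poisson_pmf r)) {..<2} = (\<Sum>k<2. pmf (poisson_pmf r) k)"
    by (rule measure_measure_pmf_finite) simp
  also have "\<dots> = exp (- r) * (1 + r)" using assms by (simp add: eval_nat_numeral algebra_simps)
  finally have "measure (measure_pmf (poisson_pmf r)) {..<2} = exp (- r) * (1 + r)" .
  moreover have "{2..} = UNIV - {..<2::nat}" by auto
  then have "measure (measure_pmf (poisson_pmf r)) {2..} = 1 - measure (measure_pmf (poisson_pmf r)) {..<2}"
    using measure_pmf.prob_compl[of "{..<2}" "poisson_pmf r"] by simp
  moreover have "(1 - r) * (1 + r) \<le> exp (- r) * (1 + r)"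
    using exp_ge_add_one_self[of "- r"] assms by (intro mult_right_mono) auto
  ultimately show ?thesis by (simp add: power2_eq_square algebra_simps)
qed

locale poisson_setting = prob_space M for M :: "'a measure" +
  fixes lam :: real and N :: "real \<Rightarrow> 'a \<Rightarrow> nat"
  assumes lam: "0 < lam" and poisson: "poisson_process M lam N"
begin

abbreviation "PF \<equiv> completed_filtration M N"

lemma N_meas: "0 \<le> t \<Longrightarrow> N t \<in> M \<rightarrow>\<^sub>M count_space UNIV"
  and N_zero: "w \<in> space M \<Longrightarrow> N 0 w = 0"
  and N_mono_on: "w \<in> space M \<Longrightarrow> mono_on {0..} (\<lambda>t. N t w)"
  and N_cadlag: "w \<in> space M \<Longrightarrow> cadlag (\<lambda>t. real (N t w))"
  and N_distr: "0 \<le> s \<Longrightarrow> s < t \<Longrightarrow> distr M (count_space UNIV) (\<lambda>w. N t w - N s w) = measure_pmf (poisson_pmf (lam * (t - s)))"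
  and N_indep: "0 \<le> ts 0 \<Longrightarrow> (\<forall>i<n. ts i < ts (Suc i)) \<Longrightarrow>
     indep_vars (\<lambda>_. count_space UNIV) (\<lambda>i w. N (ts (Suc i)) w - N (ts i) w) {..<n}"
  using poisson unfolding poisson_process_def by blast+

lemma N_mono: "w \<in> space M \<Longrightarrow> 0 \<le> s \<Longrightarrow> s \<le> t \<Longrightarrow> N s w \<le> N t w"
  using mono_onD[OF N_mono_on, of w s t] by simp

lemma N_path: assumes w: "w \<in> space M" shows "increasing_path (\<lambda>t. real (N t w))"
  unfolding increasing_path_def
proof (intro conjI allI impI)
  show "mono_on {0..} (\<lambda>t. real (N t w))" using N_mono[OF w] by (auto simp: mono_on_def)
  show "continuous (at_right t) (\<lambda>t. real (N t w))" if "0 \<le> t" for t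
    using N_cadlag[OF w] that by (simp add: cadlag_def)
qed simp

lemma PF_gens: "{N s -` B \<inter> space M |s B. 0 \<le> s \<and> ennreal s \<le> t} \<union> null_sets (completion M) \<subseteq> Pow (space M)"
  using sets.sets_into_space[of _ "completion M"] by auto

lemma space_PF: "space (PF t) = space M"
  unfolding completed_filtration_def using PF_gens by (rule space_measure_of)

lemma sets_PF: "sets (PF t) = sigma_sets (space M) ({N s -` B \<inter> space M |s B. 0 \<le> s \<and> ennreal s \<le> t} \<union> null_sets (completion M))"
  unfolding completed_filtration_def using PF_gens by (rule sets_measure_of)

lemma filtered: "filtered_space M PF"
proof (unfold_locales)
  show "space (PF t) = space M" for t by (rule space_PF)
  show "sets (PF s) \<subseteq> sets (PF t)" if "s \<le> t" for s t
    unfolding sets_PF using that by (intro sigma_sets_mono') (auto intro: order_trans)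
  show "sets (PF t) \<subseteq> sets (completion M)" for t
  proof -
    have "N s -` B \<inter> space M \<in> sets M" if "0 \<le> s" for s B using measurable_sets[OF N_meas[OF that], of B] by simp
    then have "{N s -` B \<inter> space M |s B. 0 \<le> s \<and> ennreal s \<le> t} \<union> null_sets (completion M) \<subseteq> sets (completion M)"
      by auto
    then have "sigma_sets (space (completion M)) ({N s -` B \<inter> space M |s B. 0 \<le> s \<and> ennreal s \<le> t} \<union> null_sets (completion M)) \<subseteq> sets (completion M)"
      by (rule sets.sigma_sets_subset)
    then show ?thesis unfolding sets_PF by simp
  qed
  show "null_sets (completion M) \<subseteq> sets (PF t)" for t unfolding sets_PF by auto
qed

sublocale FS: filtered_space M PF by (rule filtered)

abbreviation "CM \<equiv> completion M"

lemma N_PF: assumes "0 \<le> t" shows "N t \<in> PF (ennreal t) \<rightarrow>\<^sub>M count_space UNIV"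
proof (rule measurableI)
  fix B :: "nat set"
  show "N t -` B \<inter> space (PF (ennreal t)) \<in> sets (PF (ennreal t))"
    unfolding sets_PF space_PF using assms by (intro sigma_sets.Basic) auto
qed simp

lemma N_adapted: "adapted PF (\<lambda>t w. real (N t w))"
  unfolding adapted_def using N_PF by (auto intro!: measurable_compose[OF N_PF])

text \<open>Together with the null sets, an intersection-stable generator of F_s.\<close>

definition cylinders :: "real \<Rightarrow> 'a set set" where
  "cylinders s = {{w \<in> space M. \<forall>u\<in>U. N u w \<in> B u} |U B. finite U \<and> U \<subseteq> {0..s}}"

lemma cylinders_Int_stable: "Int_stable (cylinders s \<union> null_sets CM)"
proof (rule Int_stableI)
  fix a b assume a: "a \<in> cylinders s \<union> null_sets CM" and b: "b \<in> cylinders s \<union> null_sets CM"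
  have null: "a \<inter> b \<in> null_sets CM" if "a \<in> null_sets CM \<or> b \<in> null_sets CM"
    using that by (auto intro: completion.complete2[of "a \<inter> b" a] completion.complete2[of "a \<inter> b" b])
  show "a \<inter> b \<in> cylinders s \<union> null_sets CM"
  proof (cases "a \<in> null_sets CM \<or> b \<in> null_sets CM")
    case False
    then obtain U B U' B' where 1: "a = {w \<in> space M. \<forall>u\<in>U. N u w \<in> B u}" "finite U" "U \<subseteq> {0..s}"
      and 2: "b = {w \<in> space M. \<forall>u\<in>U'. N u w \<in> B' u}" "finite U'" "U' \<subseteq> {0..s}"
      using a b unfolding cylinders_def by auto
    have "a \<inter> b = {w \<in> space M. \<forall>u\<in>U \<union> U'. N u w \<in> (if u \<in> U then B u else UNIV) \<inter> (if u \<in> U' then B' u else UNIV)}"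
      unfolding 1 2 by (auto split: if_splits)
    then show ?thesis unfolding cylinders_def using 1 2
      by (intro UnI1 CollectI exI[of _ "U \<union> U'"] exI[of _ "\<lambda>u. (if u \<in> U then B u else UNIV) \<inter> (if u \<in> U' then B' u else UNIV)"]) auto
  qed (use null in blast)
qed

text \<open>The times in \<open>U\<close>, together with \<open>0\<close> and \<open>s\<close>, cut \<open>[0, s]\<close> into increments that determine \<open>N u\<close> for \<open>u \<in> U\<close>.\<close>

lemma cylinder_indep:
  assumes st: "0 \<le> s" "s < t" and U: "finite U" "U \<subseteq> {0..s}"
  shows "prob ({w \<in> space M. \<forall>u\<in>U. N u w \<in> B u} \<inter> {w \<in> space M. N t w - N s w \<in> K}) =
    prob {w \<in> space M. \<forall>u\<in>U. N u w \<in> B u} * prob {w \<in> space M. N t w - N s w \<in> K}"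
proof -
  define xs where "xs = sorted_list_of_set (U \<union> {0, s})"
  have fin: "finite (U \<union> {0, s})" using U by simp
  have set: "set xs = U \<union> {0, s}" and sorted: "sorted_wrt (<) xs"
    unfolding xs_def using set_sorted_list_of_set[OF fin] strict_sorted_list_of_set[of "U \<union> {0, s}"] by blast+
  define n where "n = length xs - 1"
  have "xs \<noteq> []" using set by auto
  then have len: "length xs = Suc n" by (simp add: n_def)
  define ts where "ts = (\<lambda>i. if i \<le> n then xs ! i else t)"
  have lt: "xs ! i < xs ! j" if "i < j" "j \<le> n" for i j using sorted_wrt_nth_less[OF sorted that(1)] that len by simp
  have le: "xs ! i \<le> xs ! j" if "i \<le> j" "j \<le> n" for i j using lt[of i j] that by (cases "i = j") auto
  have bounds: "0 \<le> xs ! i" "xs ! i \<le> s" if "i \<le> n" for i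
  proof -
    have "xs ! i \<in> set xs" using that len by simp
    then show "0 \<le> xs ! i" "xs ! i \<le> s" using set U st by auto
  qed
  obtain i0 where i0: "i0 \<le> n" "xs ! i0 = 0" using set len by (metis Un_iff in_set_conv_nth insertI1 less_Suc_eq_le)
  have x0: "xs ! 0 = 0" using le[of 0 i0] i0 bounds(1)[of 0] by simp
  obtain i1 where i1: "i1 \<le> n" "xs ! i1 = s" using set len by (metis Un_iff in_set_conv_nth insertI1 insert_commute less_Suc_eq_le)
  have xn: "xs ! n = s" using le[of i1 n] i1 bounds(2)[of n] by simp
  have ts: "0 \<le> ts 0" "\<forall>i<Suc n. ts i < ts (Suc i)"
  proof -
    show "0 \<le> ts 0" using x0 by (simp add: ts_def)
    show "\<forall>i<Suc n. ts i < ts (Suc i)"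
    proof (intro allI impI)
      fix i assume "i < Suc n"
      then consider "Suc i \<le> n" | "i = n" by linarith
      then show "ts i < ts (Suc i)" by cases (use lt[of i "Suc i"] xn st in \<open>auto simp: ts_def\<close>)
    qed
  qed
  let ?X = "\<lambda>i w. N (ts (Suc i)) w - N (ts i) w"
  note ind = N_indep[OF ts]
  have iv: "indep_var (PiM {..<n} (\<lambda>_. count_space UNIV)) (\<lambda>w. restrict (\<lambda>i. ?X i w) {..<n})
     (PiM {n} (\<lambda>_. count_space UNIV)) (\<lambda>w. restrict (\<lambda>i. ?X i w) {n})"
    by (rule indep_var_restrict[OF ind]) auto
  have Nsum: "N (xs ! j) w = (\<Sum>i<j. ?X i w)" if "j \<le> n" "w \<in> space M" for j w
    using that(1)
  proof (induction j)
    case 0 then show ?case using x0 N_zero[OF that(2)] by simp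
  next
    case (Suc j)
    have "N (xs ! j) w \<le> N (xs ! Suc j) w" using bounds[of j] le[of j "Suc j"] Suc(2) by (intro N_mono[OF that(2)]) auto
    then show ?case using Suc by (simp add: ts_def)
  qed
  \<comment> \<open>The position of u in the sorted list: N u is the sum of the first
    \<open>pos u\<close> increments.\<close>
  define pos where "pos = (\<lambda>u. SOME j. j \<le> n \<and> xs ! j = u)"
  have pos: "pos u \<le> n \<and> xs ! pos u = u" if "u \<in> U" for u
  proof -
    have "\<exists>j. j \<le> n \<and> xs ! j = u" using that set len by (metis Un_iff in_set_conv_nth less_Suc_eq_le)
    then show ?thesis unfolding pos_def by (rule someI_ex)
  qed
  let ?A = "{f \<in> PiE {..<n} (\<lambda>_. UNIV). \<forall>u\<in>U. (\<Sum>i<pos u. f i) \<in> B u}"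
  let ?B = "{f \<in> PiE {n} (\<lambda>_. UNIV). f n \<in> K}"
  \<comment> \<open>A finite product of countable discrete spaces is discrete, which makes both
    events measurable.\<close>
  have cs: "PiM I (\<lambda>_. count_space (UNIV :: nat set)) = count_space (PiE I (\<lambda>_. UNIV))" if "finite I" for I :: "nat set"
    using that by (intro count_space_PiM_finite) auto
  have AB: "?A \<in> sets (PiM {..<n} (\<lambda>_. count_space (UNIV :: nat set)))" "?B \<in> sets (PiM {n} (\<lambda>_. count_space (UNIV :: nat set)))"
    by (subst cs, simp, auto)+
  have eA: "(\<lambda>w. restrict (\<lambda>i. ?X i w) {..<n}) -` ?A \<inter> space M = {w \<in> space M. \<forall>u\<in>U. N u w \<in> B u}"
  proof -
    have "(\<Sum>i<pos u. restrict (\<lambda>i. ?X i w) {..<n} i) = N u w" if "u \<in> U" "w \<in> space M" for u w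
    proof -
      have "(\<Sum>i<pos u. restrict (\<lambda>i. ?X i w) {..<n} i) = (\<Sum>i<pos u. ?X i w)"
        using pos[OF that(1)] by (intro sum.cong) auto
      then show ?thesis using Nsum[of "pos u" w] pos[OF that(1)] that(2) by simp
    qed
    then show ?thesis by auto
  qed
  have Xn: "?X n w = N t w - N s w" for w using xn by (simp add: ts_def)
  have eB: "(\<lambda>w. restrict (\<lambda>i. ?X i w) {n}) -` ?B \<inter> space M = {w \<in> space M. N t w - N s w \<in> K}"
    using Xn by auto
  have "(\<lambda>x. (restrict (\<lambda>i. ?X i x) {..<n}, restrict (\<lambda>i. ?X i x) {n})) -` (?A \<times> ?B) \<inter> space M =
     ((\<lambda>w. restrict (\<lambda>i. ?X i w) {..<n}) -` ?A \<inter> space M) \<inter> ((\<lambda>w. restrict (\<lambda>i. ?X i w) {n}) -` ?B \<inter> space M)"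
    by auto
  then show ?thesis using indep_varD[OF iv AB] unfolding eA eB by simp
qed

lemma increment_event: assumes "0 \<le> s" "s < t" shows "{w \<in> space M. N t w - N s w \<in> K} \<in> sets M"
proof -
  have "N s \<in> M \<rightarrow>\<^sub>M count_space UNIV" "N t \<in> M \<rightarrow>\<^sub>M count_space UNIV" using N_meas assms by auto
  then have "(\<lambda>w. N t w - N s w) \<in> M \<rightarrow>\<^sub>M count_space UNIV" by measurable
  from measurable_sets[OF this, of K] show ?thesis by (simp add: vimage_def Int_def conj_commute)
qed

text \<open>Independence of the increment from finite-dimensional events and from null sets extends
  to the generated sigma-algebra by the pi-lambda theorem.\<close>

lemma increment_indep:
  assumes st: "0 \<le> s" "s < t" and D: "D \<in> sets (PF (ennreal s))"
  shows "FS.C.prob (D \<inter> {w \<in> space M. N t w - N s w \<in> K}) = FS.C.prob D * FS.C.prob {w \<in> space M. N t w - N s w \<in> K}"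
proof -
  let ?E = "{w \<in> space M. N t w - N s w \<in> K}"
  have E: "?E \<in> sets M" by (rule increment_event[OF st])
  have cylM: "c \<in> sets M" if c: "c \<in> cylinders s" for c
  proof -
    obtain U B where U: "c = {w \<in> space M. \<forall>u\<in>U. N u w \<in> B u}" "finite U" "U \<subseteq> {0..s}" using c by (auto simp: cylinders_def)
    have "N u -` B u \<inter> space M \<in> sets M" if "u \<in> U" for u using measurable_sets[OF N_meas, of u "B u"] U that by auto
    then have "{w \<in> space M. N u w \<in> B u} \<in> sets M" if "u \<in> U" for u using that by (simp add: vimage_def Int_def conj_commute)
    then show ?thesis unfolding U(1) using U(2) by (intro sets.sets_Collect_finite_All) auto
  qed
  have "FS.C.indep_set (cylinders s \<union> null_sets CM) {?E}"
  proof (rule FS.C.indep_setI)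
    show "cylinders s \<union> null_sets CM \<subseteq> sets CM" using cylM by auto
    show "{?E} \<subseteq> sets CM" using E by auto
    fix a b assume a: "a \<in> cylinders s \<union> null_sets CM" and "b \<in> {?E}"
    then have b: "b = ?E" by simp
    show "FS.C.prob (a \<inter> b) = FS.C.prob a * FS.C.prob b"
    proof (cases "a \<in> null_sets CM")
      case True
      then have "a \<inter> b \<in> null_sets CM" by (rule completion.complete2[rotated]) auto
      then show ?thesis using True by (simp add: measure_def null_sets_def)
    next
      case False
      then have ac: "a \<in> cylinders s" using a by blast
      then obtain U B where U: "a = {w \<in> space M. \<forall>u\<in>U. N u w \<in> B u}" "finite U" "U \<subseteq> {0..s}" by (auto simp: cylinders_def)
      have "a \<in> sets M" by (rule cylM[OF ac])
      then have "FS.C.prob (a \<inter> b) = prob (a \<inter> ?E)" "FS.C.prob a = prob a" "FS.C.prob b = prob ?E"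
        using E b by (auto intro!: measure_completion)
      then show ?thesis using cylinder_indep[OF st U(2,3), of B K] U(1) by simp
    qed
  qed
  then have "FS.C.indep_set (sigma_sets (space CM) (cylinders s \<union> null_sets CM)) (sigma_sets (space CM) {?E})"
    by (rule FS.C.indep_set_sigma_sets[OF _ cylinders_Int_stable]) (auto simp: Int_stable_def)
  moreover have "D \<in> sigma_sets (space CM) (cylinders s \<union> null_sets CM)"
  proof -
    have "N u -` B \<inter> space M \<in> cylinders s" if "0 \<le> u" "ennreal u \<le> ennreal s" for u B
      unfolding cylinders_def using that st
      by (intro CollectI exI[of _ "{u}"] exI[of _ "\<lambda>_. B"]) (auto simp: ennreal_le_iff)
    then have "{N u -` B \<inter> space M |u B. 0 \<le> u \<and> ennreal u \<le> ennreal s} \<union> null_sets CM \<subseteq> cylinders s \<union> null_sets CM" by auto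
    then have "sigma_sets (space M) ({N u -` B \<inter> space M |u B. 0 \<le> u \<and> ennreal u \<le> ennreal s} \<union> null_sets CM) \<subseteq>
        sigma_sets (space M) (cylinders s \<union> null_sets CM)" by (rule sigma_sets_mono')
    then show ?thesis using D unfolding sets_PF space_completion by blast
  qed
  moreover have "?E \<in> sigma_sets (space CM) {?E}" by auto
  ultimately show ?thesis by (rule FS.C.indep_setD)
qed

text \<open>The mean of a variable with values in the natural numbers is the sum over k of the
  probabilities that it exceeds k; independence from D factors every term.\<close>

lemma increment_mean:
  assumes st: "0 \<le> s" "s < t" and D: "D \<in> sets (PF (ennreal s))"
  shows "(\<integral>\<^sup>+w. indicator D w * ennreal (real (N t w) - real (N s w)) \<partial>CM) = ennreal (lam * (t - s)) * emeasure CM D"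
proof -
  let ?d = "\<lambda>w. N t w - N s w"
  have DC: "D \<in> sets CM" by (rule FS.sets_F_CM[OF D])
  have Ns: "N s \<in> M \<rightarrow>\<^sub>M count_space UNIV" "N t \<in> M \<rightarrow>\<^sub>M count_space UNIV" using N_meas st by auto
  then have dm: "?d \<in> M \<rightarrow>\<^sub>M count_space UNIV" by measurable
  then have dC: "?d \<in> CM \<rightarrow>\<^sub>M count_space UNIV" by (rule measurable_completion)
  have "{w \<in> space CM. w \<in> D} = D" using sets.sets_into_space[OF DC] by blast
  then have "{w \<in> space CM. w \<in> D} \<in> sets CM" using DC by metis
  then have fm: "(\<lambda>w. if w \<in> D then ?d w else 0) \<in> CM \<rightarrow>\<^sub>M count_space UNIV"
    using dC by (intro measurable_If) auto
  have em: "emeasure CM {w \<in> space CM. k < (if w \<in> D then ?d w else 0)} = emeasure CM D * emeasure CM {w \<in> space CM. k < ?d w}" for k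
  proof -
    have "{w \<in> space CM. k < (if w \<in> D then ?d w else 0)} = D \<inter> {w \<in> space M. ?d w \<in> {k<..}}"
      using sets.sets_into_space[OF DC] by auto
    moreover have "{w \<in> space CM. k < ?d w} = {w \<in> space M. ?d w \<in> {k<..}}" by auto
    ultimately show ?thesis using increment_indep[OF st D, of "{k<..}"]
      by (simp add: FS.C.emeasure_eq_measure ennreal_mult)
  qed
  have "(\<integral>\<^sup>+w. indicator D w * ennreal (real (N t w) - real (N s w)) \<partial>CM) = (\<integral>\<^sup>+w. of_nat (if w \<in> D then ?d w else 0) \<partial>CM)"
    using N_mono[of _ s t] st
    by (intro nn_integral_cong) (auto simp: indicator_def ennreal_of_nat_eq_real_of_nat of_nat_diff)
  also have "\<dots> = (\<Sum>k. emeasure CM {w \<in> space CM. k < (if w \<in> D then ?d w else 0)})"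
    by (rule nn_integral_nat_function[OF fm])
  also have "\<dots> = emeasure CM D * (\<Sum>k. emeasure CM {w \<in> space CM. k < ?d w})" unfolding em by simp
  also have "(\<Sum>k. emeasure CM {w \<in> space CM. k < ?d w}) = (\<integral>\<^sup>+w. of_nat (?d w) \<partial>CM)"
    by (rule nn_integral_nat_function[OF dC, symmetric])
  also have "\<dots> = (\<integral>\<^sup>+w. of_nat (?d w) \<partial>M)" by (rule nn_integral_completion)
  also have "\<dots> = (\<integral>\<^sup>+k. of_nat k \<partial>distr M (count_space UNIV) ?d)"
    by (subst nn_integral_distr[OF dm]) auto
  also have "\<dots> = ennreal (lam * (t - s))"
    unfolding N_distr[OF st] using lam st by (intro poisson_mean) simp
  finally show ?thesis by (simp add: mult.commute)
qed

end

section \<open>Compensator and jumps of the Poisson process\<close>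

text \<open>Equal mean increments on the events of F_s say that both random measures give the
  generators (s,t] x D the same expected mass; {0} x D has none, because the paths start at 0.
  Finite expected mass on [0,T] permits complements, so the equality extends to all predictable
  sets.\<close>

lemma (in filtered_space) equal_compensators:
  fixes V :: "bool \<Rightarrow> real \<Rightarrow> 'a \<Rightarrow> real"
  assumes inc: "\<And>i w. w \<in> space M \<Longrightarrow> increasing_path (\<lambda>t. V i t w)"
    and V0: "\<And>i w. w \<in> space M \<Longrightarrow> V i 0 w = 0"
    and Vm: "\<And>i t. 0 \<le> t \<Longrightarrow> V i t \<in> borel_measurable CM"
    and eq: "\<And>s t D. 0 \<le> s \<Longrightarrow> s < t \<Longrightarrow> D \<in> sets (F (ennreal s)) \<Longrightarrow>
      (\<integral>\<^sup>+w. indicator D w * ennreal (V True t w - V True s w) \<partial>CM) = (\<integral>\<^sup>+w. indicator D w * ennreal (V False t w - V False s w) \<partial>CM)"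
    and T: "0 < T" and fin: "(\<integral>\<^sup>+w. ennreal (V False T w) \<partial>CM) < \<infinity>"
    and E: "E \<in> sets PA"
  shows "(\<integral>\<^sup>+w. emeasure (path_measure (\<lambda>t. V True t w)) ({s. (s, w) \<in> E} \<inter> {0..T}) \<partial>CM) =
    (\<integral>\<^sup>+w. emeasure (path_measure (\<lambda>t. V False t w)) ({s. (s, w) \<in> E} \<inter> {0..T}) \<partial>CM)"
proof -
  let ?k = "\<lambda>i w. path_measure (\<lambda>t. V i t w)"
  let ?a = "\<lambda>i E. \<integral>\<^sup>+w. emeasure (?k i w) ({s. (s, w) \<in> E} \<inter> {0..T}) \<partial>CM"
  let ?S = "{0::real..} \<times> space M"
  let ?G = "{{0} \<times> B |B. B \<in> sets (F 0)} \<union> {{s<..t} \<times> B |s t B. 0 \<le> s \<and> s < t \<and> B \<in> sets (F (ennreal s))}"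
  have meas: "(\<lambda>w. emeasure (?k i w) ({s. (s, w) \<in> A} \<inter> {0..T})) \<in> borel_measurable CM" if "A \<in> sets PA" for A i
    using inc Vm T that PA_subset_pair by (intro path_kernel_measurable_pair_set) auto
  have sec: "{s. (s, w) \<in> A} \<in> sets borel" if "A \<in> sets PA" for A w
  proof -
    have "A \<in> sets (borel \<Otimes>\<^sub>M CM)" using that PA_subset_pair by blast
    from sets_Pair2[OF this, of w] show ?thesis by (simp add: vimage_def)
  qed
  have total: "emeasure (?k i w) {0..T} = ennreal (V i T w)" if "w \<in> space M" for i w
    using inc[OF that] T by (intro emeasure_path_measure_Icc) auto
  have tot: "(\<integral>\<^sup>+w. ennreal (V True T w) \<partial>CM) = (\<integral>\<^sup>+w. ennreal (V False T w) \<partial>CM)"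
  proof -
    have "space M \<in> sets (F (ennreal 0))" using sets.top[of "F (ennreal 0)"] by simp
    moreover have "(\<integral>\<^sup>+w. indicator (space M) w * ennreal (V i T w - V i 0 w) \<partial>CM) = (\<integral>\<^sup>+w. ennreal (V i T w) \<partial>CM)" for i
      using V0 by (intro nn_integral_cong) simp
    ultimately show ?thesis using eq[of 0 T "space M"] T by simp
  qed
  have int: "Int_stable ?G"
  proof (rule Int_stableI)
    fix a b assume a: "a \<in> ?G" and b: "b \<in> ?G"
    have emp: "{} \<in> ?G" by auto
    have cases: "(\<exists>B. c = {0} \<times> B \<and> B \<in> sets (F 0)) \<or> (\<exists>s t B. c = {s<..t} \<times> B \<and> 0 \<le> s \<and> s < t \<and> B \<in> sets (F (ennreal s)))"
      if "c \<in> ?G" for c using that by blast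
    have mixed: "({0} \<times> A) \<inter> ({s<..t} \<times> B) = {}" "({s<..t} \<times> B) \<inter> ({0} \<times> A) = {}" if "0 \<le> s" for A B and s t :: real
      using that by auto
    have Ioc: "({s<..t} \<times> A) \<inter> ({u<..v} \<times> B) \<in> ?G" if "0 \<le> s" "0 \<le> u" "A \<in> sets (F (ennreal s))" "B \<in> sets (F (ennreal u))" for s t u v A B
    proof -
      have e: "({s<..t} \<times> A) \<inter> ({u<..v} \<times> B) = {max s u<..min t v} \<times> (A \<inter> B)" by auto
      have "A \<inter> B \<in> sets (F (ennreal (max s u)))"
        using that sets_F_mono[of "ennreal s" "ennreal (max s u)"] sets_F_mono[of "ennreal u" "ennreal (max s u)"]
        by (intro sets.Int) (auto simp: ennreal_leI)
      moreover have "0 \<le> max s u" using that by simp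
      ultimately have lt: "max s u < min t v \<Longrightarrow> {max s u<..min t v} \<times> (A \<inter> B) \<in> ?G" by blast
      have ge: "{max s u<..min t v} \<times> (A \<inter> B) \<in> ?G" if "\<not> max s u < min t v"
      proof -
        have "{max s u<..min t v} = {}" using that by (intro greaterThanAtMost_empty) linarith
        then show ?thesis using emp by (simp only: Sigma_empty1)
      qed
      show ?thesis unfolding e by (cases "max s u < min t v") (erule lt, erule ge)
    qed
    have zero: "({0} \<times> A) \<inter> ({0} \<times> B) \<in> ?G" if "A \<in> sets (F 0)" "B \<in> sets (F 0)" for A B
    proof -
      have "({0::real} \<times> A) \<inter> ({0} \<times> B) = {0} \<times> (A \<inter> B)" by blast
      then show ?thesis using that by blast
    qed
    show "a \<inter> b \<in> ?G" using cases[OF a] cases[OF b]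
    proof (elim disjE exE conjE)
      show ?thesis if "a = {0} \<times> A" "b = {0} \<times> B" "A \<in> sets (F 0)" "B \<in> sets (F 0)" for A B using zero that by simp
      show ?thesis if "a = {0} \<times> A" "b = {s<..t} \<times> B" "0 \<le> s" for A B s t
      proof -
        have "a \<inter> b = {}" unfolding that(1,2) by (rule mixed(1)[OF that(3)])
        then show ?thesis using emp by (simp only:)
      qed
      show ?thesis if "a = {s<..t} \<times> A" "b = {0} \<times> B" "0 \<le> s" for A B s t
      proof -
        have "a \<inter> b = {}" unfolding that(1,2) by (rule mixed(2)[OF that(3)])
        then show ?thesis using emp by (simp only:)
      qed
      show ?thesis if "a = {s<..t} \<times> A" "b = {u<..v} \<times> B" "0 \<le> s" "0 \<le> u" "A \<in> sets (F (ennreal s))" "B \<in> sets (F (ennreal u))" for s t A u v B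
        using Ioc[OF that(3-6), of t v] that(1,2) by simp
    qed
  qed
  from int PA_gens E[unfolded sets_PA] show "?a True E = ?a False E"
  proof (induction rule: sigma_sets_induct_disjoint)
    case (basic A)
    then consider B where "A = {0} \<times> B" "B \<in> sets (F 0)"
      | s t B where "A = {s<..t} \<times> B" "0 \<le> s" "s < t" "B \<in> sets (F (ennreal s))" by blast
    then show ?case
    proof cases
      case 1
      have "emeasure (?k i w) ({s. (s, w) \<in> A} \<inter> {0..T}) = 0" if "w \<in> space M" for i w
      proof -
        have "emeasure (?k i w) ({s. (s, w) \<in> A} \<inter> {0..T}) \<le> emeasure (?k i w) {0..0}"
          unfolding 1 by (intro emeasure_mono) auto
        also have "\<dots> = 0" using V0[OF that] by (subst emeasure_path_measure_Icc[OF inc[OF that]]) auto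
        finally show ?thesis by simp
      qed
      then have "?a i A = (\<integral>\<^sup>+w. 0 \<partial>CM)" for i by (intro nn_integral_cong) simp
      then show ?thesis by simp
    next
      case 2
      show ?thesis
      proof (cases "s < min t T")
        case True
        have "?a i A = (\<integral>\<^sup>+w. indicator B w * ennreal (V i (min t T) w - V i s w) \<partial>CM)" for i
        proof (rule nn_integral_cong)
          fix w assume "w \<in> space CM"
          then have w: "w \<in> space M" by simp
          have "{s. (s, w) \<in> A} \<inter> {0..T} = (if w \<in> B then {s<..min t T} else {})" unfolding 2 using 2 by auto
          then show "emeasure (?k i w) ({s. (s, w) \<in> A} \<inter> {0..T}) = indicator B w * ennreal (V i (min t T) w - V i s w)"
            using emeasure_path_measure_Ioc[OF inc[OF w, of i] 2(2), of "min t T"] True by simp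
        qed
        then show ?thesis using eq[OF 2(2) True 2(4)] by simp
      next
        case False
        have "{s. (s, w) \<in> A} \<inter> {0..T} = {}" for w using False unfolding 2 by auto
        then show ?thesis by simp
      qed
    qed
  next
    case empty then show ?case by simp
  next
    case (compl A)
    then have A: "A \<in> sets PA" and Ac: "?S - A \<in> sets PA" unfolding sets_PA by (auto intro: sigma_sets.Compl)
    have sum: "?a i A + ?a i (?S - A) = (\<integral>\<^sup>+w. ennreal (V i T w) \<partial>CM)" for i
    proof -
      have "?a i A + ?a i (?S - A) = (\<integral>\<^sup>+w. emeasure (?k i w) ({s. (s, w) \<in> A} \<inter> {0..T}) + emeasure (?k i w) ({s. (s, w) \<in> ?S - A} \<inter> {0..T}) \<partial>CM)"
        by (rule nn_integral_add[OF meas[OF A] meas[OF Ac], symmetric])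
      also have "\<dots> = (\<integral>\<^sup>+w. ennreal (V i T w) \<partial>CM)"
      proof (rule nn_integral_cong)
        fix w assume "w \<in> space CM"
        then have w: "w \<in> space M" by simp
        have "emeasure (?k i w) ({s. (s, w) \<in> A} \<inter> {0..T}) + emeasure (?k i w) ({s. (s, w) \<in> ?S - A} \<inter> {0..T}) =
            emeasure (?k i w) (({s. (s, w) \<in> A} \<inter> {0..T}) \<union> ({s. (s, w) \<in> ?S - A} \<inter> {0..T}))"
          using sec[OF A, of w] sec[OF Ac, of w] by (intro plus_emeasure) auto
        also have "({s. (s, w) \<in> A} \<inter> {0..T}) \<union> ({s. (s, w) \<in> ?S - A} \<inter> {0..T}) = {0..T}" using w by auto
        finally show "emeasure (?k i w) ({s. (s, w) \<in> A} \<inter> {0..T}) + emeasure (?k i w) ({s. (s, w) \<in> ?S - A} \<inter> {0..T}) = ennreal (V i T w)"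
          using total[OF w, of i] by simp
      qed
      finally show ?thesis .
    qed
    have "?a False A \<le> (\<integral>\<^sup>+w. ennreal (V False T w) \<partial>CM)" unfolding sum[of False, symmetric] by simp
    then have f: "?a False A \<noteq> \<infinity>" using fin by auto
    have "?a False A + ?a True (?S - A) = ?a False A + ?a False (?S - A)"
      using sum[of True] sum[of False] tot compl.IH by metis
    then show ?case using f by (subst (asm) ennreal_add_left_cancel) auto
  next
    case (union A)
    have Am: "A j \<in> sets PA" for j using union(2) unfolding sets_PA by blast
    have "?a i (\<Union>j. A j) = (\<Sum>j. ?a i (A j))" for i
    proof -
      have "emeasure (?k i w) ({s. (s, w) \<in> (\<Union>j. A j)} \<inter> {0..T}) = (\<Sum>j. emeasure (?k i w) ({s. (s, w) \<in> A j} \<inter> {0..T}))" for w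
      proof -
        have "disjoint_family (\<lambda>j. {s. (s, w) \<in> A j} \<inter> {0..T})"
          using union(1) unfolding disjoint_family_on_def by blast
        moreover have "range (\<lambda>j. {s. (s, w) \<in> A j} \<inter> {0..T}) \<subseteq> sets (?k i w)" using sec[OF Am, of w] by auto
        ultimately have "(\<Sum>j. emeasure (?k i w) ({s. (s, w) \<in> A j} \<inter> {0..T})) = emeasure (?k i w) (\<Union>j. {s. (s, w) \<in> A j} \<inter> {0..T})"
          by (intro suminf_emeasure)
        moreover have "(\<Union>j. {s. (s, w) \<in> A j} \<inter> {0..T}) = {s. (s, w) \<in> (\<Union>j. A j)} \<inter> {0..T}" by blast
        ultimately show ?thesis by simp
      qed
      then show ?thesis by (simp only:) (rule nn_integral_suminf[OF meas[OF Am]])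
    qed
    then show ?case using union.IH by simp
  qed
qed

text \<open>\<open>path_measure\<close> cuts the path off before time 0; comparing clamped paths
  shows that this does not affect subsets of (0,t].\<close>

lemma path_measure_linear:
  assumes c: "0 \<le> c" and S: "S \<in> sets borel" "S \<subseteq> {0<..t}"
  shows "emeasure (path_measure (\<lambda>s. c * s)) S = ennreal c * emeasure lborel S"
proof -
  have inc: "increasing_path (\<lambda>s. c * s)"
    unfolding increasing_path_def using c by (auto simp: mono_on_def intro!: mult_left_mono continuous_intros)
  have restr: "emeasure (density \<kappa> (indicator {0<..t})) S = emeasure \<kappa> S" if "sets \<kappa> = sets borel" for \<kappa> :: "real measure"
  proof -
    have "(\<lambda>x. indicator {0<..t} x * indicator S x :: ennreal) = indicator S" using S(2) by (auto simp: indicator_def fun_eq_iff)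
    moreover have "indicator {0<..t} \<in> borel_measurable \<kappa>" using that by (intro borel_measurable_indicator) simp
    ultimately show ?thesis using S(1) that by (subst emeasure_density) (simp_all add: nn_integral_indicator)
  qed
  have "clamp_path t (\<lambda>s. if s < 0 then 0 else c * s) = clamp_path t (\<lambda>s. c * s)"
    by (auto simp: clamp_path_def fun_eq_iff)
  then have "density (path_measure (\<lambda>s. c * s)) (indicator {0<..t}) = density (interval_measure (\<lambda>s. c * s)) (indicator {0<..t})"
    unfolding path_measure_def interval_measure_clamp[OF rcmono_path[OF inc]] interval_measure_clamp[OF rcmono_scale[OF c]] by simp
  then have "emeasure (path_measure (\<lambda>s. c * s)) S = emeasure (interval_measure (\<lambda>s. c * s)) S"
    using restr[of "path_measure (\<lambda>s. c * s)"] restr[of "interval_measure (\<lambda>s. c * s)"] by simp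
  also have "\<dots> = ennreal c * emeasure lborel S"
    using S(1) by (simp add: interval_measure_scale[OF c] emeasure_density_const)
  finally show ?thesis .
qed

text \<open>The covering of atoms by hitting times as in \<open>dual_atomless\<close>, now read
  along a path at the time \<tau>. Applied to N it says that N does not jump at \<tau>.\<close>

lemma (in random_time) avoids_atoms:
  assumes ad: "adapted F V" and inc: "\<And>w. w \<in> space M \<Longrightarrow> increasing_path (\<lambda>t. V t w)"
  shows "AE w in CM. \<forall>s\<ge>0. \<tau> w = ennreal s \<longrightarrow> emeasure (path_measure (\<lambda>t. V t w)) {s} = 0"
proof -
  have "AE w in CM. \<forall>c\<in>\<rat>. \<not> (\<tau> w = Inf (ennreal ` {t. 0 \<le> t \<and> c \<le> V t w}) \<and> Inf (ennreal ` {t. 0 \<le> t \<and> c \<le> V t w}) < \<infinity>)"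
    by (subst AE_ball_countable[OF countable_rat]) (intro ballI avoids_AE[OF hitting_stopping_time[OF ad inc]])
  then show ?thesis using AE_space[where M = CM]
  proof eventually_elim
    case (elim w)
    then have w: "w \<in> space M" by simp
    show ?case
    proof (intro allI impI, rule ccontr)
      fix s :: real assume s: "0 \<le> s" "\<tau> w = ennreal s" "emeasure (path_measure (\<lambda>t. V t w)) {s} \<noteq> 0"
      obtain c where c: "c \<in> \<rat>" "(s, w) \<in> graph V c" using graph_covers_atoms[where V = V and w = w and s = s] inc[OF w] w s(1,3) by blast
      have "Inf (ennreal ` {t. 0 \<le> t \<and> c \<le> V t w}) = ennreal s" by (rule graph_hitting[where V = V, OF inc[OF w] c(2)])
      then show False using elim(1) c(1) s(2) ennreal_less_top[of s] by (metis infinity_ennreal_def)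
    qed
  qed
qed

context poisson_setting begin

text \<open>\<open>equal_compensators\<close> for N and the deterministic path lam t, with the index
  True standing for N.\<close>

lemma compensator:
  assumes E: "E \<in> sets FS.PA" and T: "0 < T"
  shows "(\<integral>\<^sup>+w. emeasure (path_measure (\<lambda>t. real (N t w))) ({s. (s, w) \<in> E} \<inter> {0..T}) \<partial>CM) =
    (\<integral>\<^sup>+w. emeasure (path_measure (\<lambda>t. lam * t)) ({s. (s, w) \<in> E} \<inter> {0..T}) \<partial>CM)"
proof -
  let ?V = "\<lambda>i t w. if i then real (N t w) else lam * t"
  have lin: "increasing_path (\<lambda>s. lam * s)"
    unfolding increasing_path_def using lam by (auto simp: mono_on_def intro!: continuous_intros)
  have "(\<integral>\<^sup>+w. emeasure (path_measure (\<lambda>t. ?V True t w)) ({s. (s, w) \<in> E} \<inter> {0..T}) \<partial>CM) =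
    (\<integral>\<^sup>+w. emeasure (path_measure (\<lambda>t. ?V False t w)) ({s. (s, w) \<in> E} \<inter> {0..T}) \<partial>CM)"
  proof (rule FS.equal_compensators[OF _ _ _ _ T _ E])
    show "increasing_path (\<lambda>t. ?V i t w)" if "w \<in> space M" for i w using N_path[OF that] lin by (cases i) auto
    show "?V i 0 w = 0" if "w \<in> space M" for i w using N_zero[OF that] by simp
    show "(\<lambda>w. ?V i t w) \<in> borel_measurable CM" if "0 \<le> t" for i t
      using N_adapted that by (cases i) (auto simp: adapted_def intro: FS.F_measurable_CM)
    show "(\<integral>\<^sup>+w. ennreal (?V False T w) \<partial>CM) < \<infinity>" by (simp add: FS.C.emeasure_space_1[simplified])
    fix s t D assume st: "0 \<le> s" "s < t" and D: "D \<in> sets (PF (ennreal s))"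
    have "(\<integral>\<^sup>+w. indicator D w * ennreal (?V False t w - ?V False s w) \<partial>CM) = (\<integral>\<^sup>+w. ennreal (lam * (t - s)) * indicator D w \<partial>CM)"
      by (simp add: algebra_simps)
    also have "\<dots> = ennreal (lam * (t - s)) * emeasure CM D" by (rule nn_integral_cmult_indicator[OF FS.sets_F_CM[OF D]])
    finally show "(\<integral>\<^sup>+w. indicator D w * ennreal (?V True t w - ?V True s w) \<partial>CM) = (\<integral>\<^sup>+w. indicator D w * ennreal (?V False t w - ?V False s w) \<partial>CM)"
      using increment_mean[OF st D] by simp
  qed
  then show ?thesis by simp
qed

text \<open>A predictable set that misses the jump times has expected dN-mass 0, hence expected lam
  dt-mass 0. This is how a relation between predictable processes moves from jump times to almost
  all times.\<close>

lemma off_jumps_null: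
  assumes E: "E \<in> sets FS.PA" and J: "AE w in CM. \<forall>s\<in>jump_times (\<lambda>t. N t w). (s, w) \<notin> E"
  shows "AE w in CM. AE s in lborel. 0 < s \<longrightarrow> (s, w) \<notin> E"
proof -
  have sec: "{s. (s, w) \<in> E} \<in> sets borel" for w
  proof -
    have "E \<in> sets (borel \<Otimes>\<^sub>M CM)" using E FS.PA_subset_pair by blast
    from sets_Pair2[OF this, of w] show ?thesis by (simp add: vimage_def)
  qed
  have lin: "increasing_path (\<lambda>s. lam * s)"
    unfolding increasing_path_def using lam by (auto simp: mono_on_def intro!: continuous_intros)
  have "AE w in CM. emeasure (path_measure (\<lambda>t. lam * t)) ({s. (s, w) \<in> E} \<inter> {0..real (Suc n)}) = 0" for n
  proof -
    have "AE w in CM. emeasure (path_measure (\<lambda>t. real (N t w))) ({s. (s, w) \<in> E} \<inter> {0..real (Suc n)}) = 0"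
      using J AE_space[where M = CM]
    proof eventually_elim
      case (elim w)
      then have w: "w \<in> space M" by simp
      let ?\<kappa> = "path_measure (\<lambda>t. real (N t w))"
      have "emeasure ?\<kappa> {0} = 0" using emeasure_path_measure_Icc[OF N_path[OF w], of 0] N_zero[OF w] by simp
      then have "{0} \<in> null_sets ?\<kappa>" by (intro null_setsI) auto
      then have "{0} \<union> ({0<..} - jump_times (\<lambda>t. N t w)) \<in> null_sets ?\<kappa>"
        using emeasure_off_jump_times[OF N_path[OF w]] by (rule null_sets.Un)
      moreover have "{s. (s, w) \<in> E} \<inter> {0..real (Suc n)} \<subseteq> {0} \<union> ({0<..} - jump_times (\<lambda>t. N t w))" using elim(1) by auto
      ultimately have "{s. (s, w) \<in> E} \<inter> {0..real (Suc n)} \<in> null_sets ?\<kappa>"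
        using null_sets_subset[of _ ?\<kappa> "{s. (s, w) \<in> E} \<inter> {0..real (Suc n)}"] sec[of w] by auto
      then show ?case by auto
    qed
    then have "(\<integral>\<^sup>+w. emeasure (path_measure (\<lambda>t. real (N t w))) ({s. (s, w) \<in> E} \<inter> {0..real (Suc n)}) \<partial>CM) = (\<integral>\<^sup>+w. 0 \<partial>CM)"
      by (rule nn_integral_cong_AE)
    then have 0: "(\<integral>\<^sup>+w. emeasure (path_measure (\<lambda>t. lam * t)) ({s. (s, w) \<in> E} \<inter> {0..real (Suc n)}) \<partial>CM) = 0"
      using compensator[OF E, of "real (Suc n)"] by simp
    have "(\<lambda>w. emeasure (path_measure (\<lambda>t. lam * t)) ({s. (s, w) \<in> E} \<inter> {0..real (Suc n)})) \<in> borel_measurable CM"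
      using E FS.PA_subset_pair lin by (intro path_kernel_measurable_pair_set) auto
    from nn_integral_0_iff_AE[OF this] 0 show ?thesis by simp
  qed
  then have "AE w in CM. \<forall>n. emeasure (path_measure (\<lambda>t. lam * t)) ({s. (s, w) \<in> E} \<inter> {0..real (Suc n)}) = 0"
    by (subst AE_all_countable) blast
  then show ?thesis
  proof eventually_elim
    case (elim w)
    have "{s. (s, w) \<in> E} \<inter> {0<..real (Suc n)} \<in> null_sets lborel" for n
    proof -
      let ?S = "{s. (s, w) \<in> E} \<inter> {0<..real (Suc n)}"
      have S: "?S \<in> sets borel" "?S \<subseteq> {0<..real (Suc n)}" using sec[of w] by auto
      have "emeasure (path_measure (\<lambda>t. lam * t)) ?S \<le> emeasure (path_measure (\<lambda>t. lam * t)) ({s. (s, w) \<in> E} \<inter> {0..real (Suc n)})"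
        using sec[of w] by (intro emeasure_mono) auto
      then have "emeasure (path_measure (\<lambda>t. lam * t)) ?S = 0" using elim by simp
      then have "emeasure lborel ?S = 0" using path_measure_linear[OF _ S, of lam] lam by simp
      then show ?thesis using S by (intro null_setsI) auto
    qed
    then have "(\<Union>n. {s. (s, w) \<in> E} \<inter> {0<..real (Suc n)}) \<in> null_sets lborel" by (rule null_sets_UN)
    then show ?case
    proof (rule AE_I')
      show "{s \<in> space lborel. \<not> (0 < s \<longrightarrow> (s, w) \<notin> E)} \<subseteq> (\<Union>n. {s. (s, w) \<in> E} \<inter> {0<..real (Suc n)})"
      proof
        fix s assume "s \<in> {s \<in> space lborel. \<not> (0 < s \<longrightarrow> (s, w) \<notin> E)}"
        moreover obtain n where "s < real n" using reals_Archimedean2 by blast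
        ultimately show "s \<in> (\<Union>n. {s. (s, w) \<in> E} \<inter> {0<..real (Suc n)})" by (intro UN_I[of n]) auto
      qed
    qed
  qed
qed

text \<open>A union bound over n + 1 cells of length T/(n+1), each containing two or more arrivals
  with probability at most (lam T/(n+1))^2.\<close>

lemma double_jump_bound:
  assumes T: "0 < T"
  shows "measure M (\<Union>i<Suc n. {w \<in> space M. N (T * real (Suc i) / real (Suc n)) w - N (T * real i / real (Suc n)) w \<in> {2..}}) \<le> (lam * T)\<^sup>2 / real (Suc n)"
proof -
  let ?t = "\<lambda>i. T * real i / real (Suc n)"
  have lt: "0 \<le> ?t i" "?t i < ?t (Suc i)" "?t (Suc i) - ?t i = T / real (Suc n)" for i
  proof -
    have "?t (Suc i) = ?t i + T / real (Suc n)" by (simp add: distrib_left add_divide_distrib)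
    moreover have "0 < T / real (Suc n)" using T by simp
    ultimately show "0 \<le> ?t i" "?t i < ?t (Suc i)" "?t (Suc i) - ?t i = T / real (Suc n)" using T by auto
  qed
  have one: "measure M {w \<in> space M. N (?t (Suc i)) w - N (?t i) w \<in> {2..}} \<le> (lam * (T / real (Suc n)))\<^sup>2" for i
  proof -
    have Ns: "N (?t i) \<in> M \<rightarrow>\<^sub>M count_space UNIV" "N (?t (Suc i)) \<in> M \<rightarrow>\<^sub>M count_space UNIV"
      using N_meas lt(1)[of i] lt(1)[of "Suc i"] by blast+
    have dm: "(\<lambda>w. N (?t (Suc i)) w - N (?t i) w) \<in> M \<rightarrow>\<^sub>M count_space UNIV" using Ns by measurable
    have "measure M {w \<in> space M. N (?t (Suc i)) w - N (?t i) w \<in> {2..}} = measure (distr M (count_space UNIV) (\<lambda>w. N (?t (Suc i)) w - N (?t i) w)) {2..}"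
      by (subst measure_distr[OF dm]) (auto simp: vimage_def Int_def conj_commute)
    also have "\<dots> = measure (measure_pmf (poisson_pmf (lam * (T / real (Suc n))))) {2..}"
      unfolding N_distr[OF lt(1,2)] lt(3) ..
    also have "\<dots> \<le> (lam * (T / real (Suc n)))\<^sup>2" using lam T by (intro poisson_tail) auto
    finally show ?thesis .
  qed
  have "measure M (\<Union>i<Suc n. {w \<in> space M. N (?t (Suc i)) w - N (?t i) w \<in> {2..}}) \<le> (\<Sum>i<Suc n. measure M {w \<in> space M. N (?t (Suc i)) w - N (?t i) w \<in> {2..}})"
    by (intro measure_UNION_le increment_event lt) auto
  also have "\<dots> \<le> (\<Sum>i<Suc n. (lam * (T / real (Suc n)))\<^sup>2)" by (rule sum_mono) (rule one)
  also have "\<dots> = (lam * T)\<^sup>2 / real (Suc n)" by (simp add: power2_eq_square del: of_nat_Suc)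
  finally show ?thesis .
qed

text \<open>Almost surely every horizon admits a subdivision without two arrivals in one cell. A
  jump lies in some cell, so its size is at most 1; it is at least 1 by integrality.\<close>

lemma unit_jumps: "AE w in CM. \<forall>s\<in>jump_times (\<lambda>t. N t w). emeasure (path_measure (\<lambda>t. real (N t w))) {s} = 1"
proof -
  define bad where "bad = (\<lambda>T n. \<Union>i<Suc n. {w \<in> space M. N (T * real (Suc i) / real (Suc n)) w - N (T * real i / real (Suc n)) w \<in> {2..}})"
  have badM: "bad T n \<in> sets M" if "0 < T" for T n
    unfolding bad_def using that by (intro sets.finite_UN increment_event) (auto simp: divide_strict_right_mono)
  have "AE w in M. \<exists>n. w \<notin> bad T n" if T: "0 < T" for T
  proof -
    have "measure M (\<Inter>n. bad T n) \<le> (lam * T)\<^sup>2 / real (Suc n)" for n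
    proof -
      have "measure M (\<Inter>n. bad T n) \<le> measure M (bad T n)" using badM[OF T] by (intro finite_measure_mono) auto
      then show ?thesis using double_jump_bound[OF T, of n] unfolding bad_def by linarith
    qed
    moreover have "(\<lambda>n. (lam * T)\<^sup>2 / real (Suc n)) \<longlonglongrightarrow> 0"
      using lim_const_over_n[of "(lam * T)\<^sup>2"] by (rule LIMSEQ_Suc)
    ultimately have "measure M (\<Inter>n. bad T n) \<le> 0" by (intro LIMSEQ_le_const[of _ 0]) auto
    then have "measure M (\<Inter>n. bad T n) = 0" using measure_nonneg[of M "\<Inter>n. bad T n"] by linarith
    then have "emeasure M (\<Inter>n. bad T n) = 0" by (simp add: emeasure_eq_measure)
    moreover have "(\<Inter>n. bad T n) \<in> sets M" using badM[OF T] by auto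
    ultimately show ?thesis by (intro AE_I[where N = "\<Inter>n. bad T n"]) auto
  qed
  then have "AE w in M. \<forall>k. \<exists>n. w \<notin> bad (real (Suc k)) n" by (subst AE_all_countable) simp
  then have "AE w in CM. \<forall>k. \<exists>n. w \<notin> bad (real (Suc k)) n" by (simp add: AE_completion_iff)
  then show ?thesis using AE_space[where M = CM]
  proof eventually_elim
    case (elim w)
    then have w: "w \<in> space M" by simp
    show ?case
    proof
      fix s assume s: "s \<in> jump_times (\<lambda>t. N t w)"
      then have s0: "0 < s" by (simp add: jump_times_def)
      obtain k where k: "s \<le> real (Suc k)" using real_arch_simple[of s] by (meson le_Suc_eq of_nat_le_iff order_refl order_trans)
      obtain n where n: "w \<notin> bad (real (Suc k)) n" using elim(1) by blast
      let ?t = "\<lambda>i. real (Suc k) * real i / real (Suc n)"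
      \<comment> \<open>Selects the cell (t_i, t_{i+1}] that contains s; ceiling minus one puts a
        grid point into the cell that it closes.\<close>
      define i where "i = nat (\<lceil>s * real (Suc n) / real (Suc k)\<rceil> - 1)"
      have pos: "0 < s * real (Suc n) / real (Suc k)" using s0 by (simp del: of_nat_Suc)
      have le: "s * real (Suc n) / real (Suc k) \<le> real (Suc n)" using k by (simp add: field_simps del: of_nat_Suc)
      have i: "real i < s * real (Suc n) / real (Suc k)" "s * real (Suc n) / real (Suc k) \<le> real (Suc i)"
        using pos unfolding i_def by linarith+
      then have "real i < real (Suc n)" using le by linarith
      then have iS: "i < Suc n" by (simp only: of_nat_less_iff)
      have ti: "?t i < s" "s \<le> ?t (Suc i)" using i by (simp_all add: field_simps del: of_nat_Suc)
      have "N (?t (Suc i)) w - N (?t i) w \<notin> {2..}" using n iS w unfolding bad_def by blast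
      then have N1: "N (?t (Suc i)) w - N (?t i) w \<le> 1" by simp
      have "0 \<le> ?t i" by simp
      have "emeasure (path_measure (\<lambda>t. real (N t w))) {s} \<le> emeasure (path_measure (\<lambda>t. real (N t w))) {?t i<..?t (Suc i)}"
        using ti by (intro emeasure_mono) auto
      also have "\<dots> = ennreal (real (N (?t (Suc i)) w) - real (N (?t i) w))"
        using ti by (intro emeasure_path_measure_Ioc[OF N_path[OF w]]) auto
      also have "\<dots> \<le> 1" using N1 by (simp add: ennreal_le_1)
      finally show "emeasure (path_measure (\<lambda>t. real (N t w))) {s} = 1"
        using emeasure_jump_ge_1[OF N_path[OF w] s] by (intro antisym)
    qed
  qed
qed

end

section \<open>Stieltjes integrals against the stopped martingales\<close>

lemma has_stieltjes_integralI:
  assumes "rcmono v1" "rcmono v2" "\<And>s. s \<in> {0..t} \<Longrightarrow> v s = v1 s - v2 s"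
    "set_integrable (interval_measure v1) {0<..t} f" "set_integrable (interval_measure v2) {0<..t} f"
    "I = (LINT s:{0<..t}|interval_measure v1. f s) - (LINT s:{0<..t}|interval_measure v2. f s)"
  shows "has_stieltjes_integral f v t I"
  using assms unfolding has_stieltjes_integral_def rcmono_def by (intro exI[of _ v1] exI[of _ v2]) simp

text \<open>The stopped integral v has the measure 1_{(0,T]} c d\<kappa>; nonnegativity of c almost
  everywhere makes v monotone and turns c into a density.\<close>

lemma stopped_integral:
  fixes c f :: "real \<Rightarrow> real"
  assumes \<kappa>: "sets \<kappa> = sets borel" and c: "set_integrable \<kappa> {0<..T} c"
    and nonneg: "AE s in \<kappa>. s \<in> {0<..T} \<longrightarrow> 0 \<le> c s" and T: "0 \<le> T" "T \<le> t"
    and f: "(\<lambda>s. indicator {0<..t} s *\<^sub>R f s) \<in> borel_measurable borel" and cf: "set_integrable \<kappa> {0<..T} (\<lambda>s. c s * f s)"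
  defines "v \<equiv> \<lambda>s. LINT r:{0<..min s T}|\<kappa>. c r"
  shows "rcmono v" and "set_integrable (interval_measure v) {0<..t} f"
    and "(LINT s:{0<..t}|interval_measure v. f s) = (LINT s:{0<..T}|\<kappa>. c s * f s)"
proof -
  have sub: "set_integrable \<kappa> {a<..b} c" if "0 \<le> a" "b \<le> T" for a b
    by (rule set_integrable_Ioc_subset[OF c \<kappa>]) (use that in auto)
  have inc: "v b - v a = (LINT r:{max 0 (min a T)<..min b T}|\<kappa>. c r)" if "a \<le> b" for a b
  proof (cases "0 \<le> min b T")
    case True
    have e: "{0<..min b T} = {0<..max 0 (min a T)} \<union> {max 0 (min a T)<..min b T}" using that True by auto
    have "(LINT r:{0<..max 0 (min a T)} \<union> {max 0 (min a T)<..min b T}|\<kappa>. c r) = (LINT r:{0<..max 0 (min a T)}|\<kappa>. c r) + (LINT r:{max 0 (min a T)<..min b T}|\<kappa>. c r)"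
      by (rule set_integral_Un[OF _ sub sub]) (use T in auto)
    then have "(LINT r:{0<..min b T}|\<kappa>. c r) = (LINT r:{0<..max 0 (min a T)}|\<kappa>. c r) + (LINT r:{max 0 (min a T)<..min b T}|\<kappa>. c r)"
      unfolding e[symmetric] .
    moreover have "{0<..max 0 (min a T)} = {0<..min a T}" by auto
    ultimately show ?thesis unfolding v_def by simp
  next
    case False
    have e: "{0<..min b T} = {}" "{0<..min a T} = {}" "{max 0 (min a T)<..min b T} = {}" using that False by auto
    show ?thesis unfolding v_def e by (simp add: set_lebesgue_integral_def)
  qed
  define d where "d = (\<lambda>s. indicator {0<..T} s * c s)"
  have dm[measurable]: "d \<in> borel_measurable \<kappa>"
    using c by (auto simp: d_def set_integrable_def dest!: borel_measurable_integrable)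
  have d0: "AE s in \<kappa>. 0 \<le> d s" using nonneg by eventually_elim (auto simp: d_def indicator_def)
  have em: "emeasure (density \<kappa> (\<lambda>s. ennreal (d s))) {a<..b} = ennreal (v b - v a)" and v_le: "v a \<le> v b" if "a \<le> b" for a b
  proof -
    have ab: "{a<..b} \<in> sets \<kappa>" using \<kappa> by simp
    have e: "indicator {max 0 (min a T)<..min b T} s *\<^sub>R c s = d s * indicator {a<..b} s" for s
      by (auto simp: d_def indicator_def)
    have i: "integrable \<kappa> (\<lambda>s. d s * indicator {a<..b} s)"
      using sub[of "max 0 (min a T)" "min b T"] unfolding set_integrable_def e by simp
    have "v b - v a = (\<integral>s. d s * indicator {a<..b} s \<partial>\<kappa>)" unfolding inc[OF that] set_lebesgue_integral_def e ..
    moreover have n: "AE s in \<kappa>. 0 \<le> d s * indicator {a<..b} s" using d0 by eventually_elim (auto simp: indicator_def)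
    ultimately show "v a \<le> v b" using integral_nonneg_AE[OF n] by linarith
    have "emeasure (density \<kappa> (\<lambda>s. ennreal (d s))) {a<..b} = (\<integral>\<^sup>+s. ennreal (d s) * indicator {a<..b} s \<partial>\<kappa>)"
      using ab by (subst emeasure_density) auto
    also have "\<dots> = (\<integral>\<^sup>+s. ennreal (d s * indicator {a<..b} s) \<partial>\<kappa>)" by (intro nn_integral_cong) (auto simp: indicator_def)
    also have "\<dots> = ennreal (v b - v a)" unfolding \<open>v b - v a = _\<close> by (rule nn_integral_eq_integral[OF i n])
    finally show "emeasure (density \<kappa> (\<lambda>s. ennreal (d s))) {a<..b} = ennreal (v b - v a)" .
  qed
  have cont: "continuous (at_right s) v" for s
  proof -
    consider "s < 0" | "0 \<le> s" "s < T" | "T \<le> s" by linarith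
    then show ?thesis
    proof cases
      case 1
      have "eventually (\<lambda>r. v r = v s) (at_right s)"
        using 1 by (intro eventually_at_rightI[of s 0]) (auto simp: v_def set_lebesgue_integral_def)
      then show ?thesis unfolding continuous_within by (subst filterlim_cong[OF refl refl]) auto
    next
      case 2
      have "eventually (\<lambda>r. v r = (LINT u:{0<..r}|\<kappa>. c u)) (at_right s)"
        using 2 by (intro eventually_at_rightI[of s T]) (auto simp: v_def)
      moreover have "v s = (LINT u:{0<..s}|\<kappa>. c u)" using 2 by (simp add: v_def)
      ultimately show ?thesis using integral_right_continuous[OF \<kappa> c 2] unfolding continuous_within
        by (subst filterlim_cong[OF refl refl]) auto
    next
      case 3
      have "eventually (\<lambda>r. v r = v s) (at_right s)"
        using 3 by (intro eventually_at_rightI[of s "s + 1"]) (auto simp: v_def)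
      then show ?thesis unfolding continuous_within by (subst filterlim_cong[OF refl refl]) auto
    qed
  qed
  show rc: "rcmono v" using cont v_le by (auto simp: rcmono_def mono_def)
  have iv: "interval_measure v = density \<kappa> (\<lambda>s. ennreal (d s))"
    by (rule interval_measure_unique[OF _ rc em, symmetric]) (simp_all add: \<kappa>)
  have fm: "(\<lambda>s. indicator {0<..t} s *\<^sub>R f s) \<in> borel_measurable \<kappa>" using f \<kappa> by (simp cong: measurable_cong_sets)
  have e: "d s *\<^sub>R (indicator {0<..t} s *\<^sub>R f s) = indicator {0<..T} s *\<^sub>R (c s * f s)" for s
    using T by (auto simp: d_def indicator_def)
  show "set_integrable (interval_measure v) {0<..t} f"
    unfolding iv set_integrable_def using cf d0
    by (subst integrable_density[OF fm dm]) (simp_all only: e set_integrable_def)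
  show "(LINT s:{0<..t}|interval_measure v. f s) = (LINT s:{0<..T}|\<kappa>. c s * f s)"
    unfolding iv set_lebesgue_integral_def using d0
    by (subst integral_density[OF fm dm]) (simp_all only: e)
qed

lemma occurrence_set_integral:
  fixes f :: "real \<Rightarrow> real"
  assumes f: "(\<lambda>s. indicator {0<..t} s *\<^sub>R f s) \<in> borel_measurable borel" and pos: "0 < \<tau> w" and t: "0 \<le> t"
  shows "set_integrable (path_measure (\<lambda>s. occurrence \<tau> s w)) {0<..t} f"
    and "(LINT s:{0<..t}|path_measure (\<lambda>s. occurrence \<tau> s w). f s) = (if \<tau> w \<le> ennreal t then f (enn2real (\<tau> w)) else 0)"
proof -
  have "set_integrable (path_measure (\<lambda>s. occurrence \<tau> s w)) {0<..t} f \<and>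
      (LINT s:{0<..t}|path_measure (\<lambda>s. occurrence \<tau> s w). f s) = (if \<tau> w \<le> ennreal t then f (enn2real (\<tau> w)) else 0)"
  proof (cases "\<tau> w = \<infinity>")
    case True
    have z: "AE s in null_measure borel. indicator {0<..t} s *\<^sub>R f s = 0" by (rule AE_I[where N = UNIV]) auto
    have "integrable (null_measure borel) (\<lambda>s. indicator {0<..t} s *\<^sub>R f s)"
      using f z by (subst integrable_cong_AE[where g = "\<lambda>_. 0"]) auto
    moreover have "(\<integral>s. indicator {0<..t} s *\<^sub>R f s \<partial>null_measure borel) = 0" using z by (rule integral_eq_zero_AE)
    ultimately show ?thesis unfolding path_measure_occurrence set_integrable_def set_lebesgue_integral_def
      using True by (simp add: top_unique)
  next
    case False
    then obtain r where r: "\<tau> w = ennreal r" "0 < r" using pos by (cases "\<tau> w") auto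
    have "integrable (return borel r) (\<lambda>s. indicator {0<..t} s *\<^sub>R f s)"
    proof -
      interpret p: prob_space "return borel r" by (rule prob_space_return) simp
      have "AE s in return borel r. norm (indicator {0<..t} s *\<^sub>R f s) \<le> \<bar>f r\<bar>"
        using f by (subst AE_return) (auto simp: indicator_def)
      then show ?thesis using f by (intro p.integrable_const_bound) auto
    qed
    moreover have "(\<integral>s. indicator {0<..t} s *\<^sub>R f s \<partial>return borel r) = indicator {0<..t} r *\<^sub>R f r" using f by (intro integral_return) auto
    moreover have "\<tau> w \<le> ennreal t \<longleftrightarrow> r \<le> t" using r t by (simp add: ennreal_le_iff)
    ultimately show ?thesis unfolding path_measure_occurrence set_integrable_def set_lebesgue_integral_def
      using r by (simp add: indicator_def)
  qed
  then show "set_integrable (path_measure (\<lambda>s. occurrence \<tau> s w)) {0<..t} f"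
    and "(LINT s:{0<..t}|path_measure (\<lambda>s. occurrence \<tau> s w). f s) = (if \<tau> w \<le> ennreal t then f (enn2real (\<tau> w)) else 0)"
    by (rule conjunct1, rule conjunct2)
qed

lemma stop_le: assumes "0 \<le> s" "s \<le> t" shows "stop \<tau> s w = min s (stop \<tau> t w)"
proof (cases "\<tau> w")
  case (real r)
  have "stop \<tau> u w = min u r" if "0 \<le> u" for u
    using that real by (auto simp: stop_def min_def ennreal_le_iff)
  then show ?thesis using assms by (simp add: min_def)
next
  case top
  then show ?thesis using assms by (simp add: stop_def)
qed

text \<open>The decomposition that defines \<open>M_tau\<close> is already one into monotone paths:
  the occurrence path, whose jump contributes f at \<tau>, and the stopped integral of dA /
  Z_-.\<close>

lemma M_tau_integral:
  fixes f :: "real \<Rightarrow> real"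
  assumes pos: "0 < \<tau> w" and t: "0 \<le> t" and T: "T = stop \<tau> t w"
    and Zpos: "\<And>s. s \<in> {0<..T} \<Longrightarrow> 0 < left_limit (\<lambda>u. Z u w) s"
    and c: "set_integrable (path_measure (\<lambda>u. A u w)) {0<..T} (\<lambda>s. 1 / left_limit (\<lambda>u. Z u w) s)"
    and f: "(\<lambda>s. indicator {0<..t} s *\<^sub>R f s) \<in> borel_measurable borel"
    and cf: "set_integrable (path_measure (\<lambda>u. A u w)) {0<..T} (\<lambda>s. f s / left_limit (\<lambda>u. Z u w) s)"
  shows "has_stieltjes_integral f (\<lambda>s. M_tau \<tau> Z A s w) t
    ((if \<tau> w \<le> ennreal t then f (enn2real (\<tau> w)) else 0) - (LINT s:{0<..T}|path_measure (\<lambda>u. A u w). f s / left_limit (\<lambda>u. Z u w) s))"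
proof -
  have T0: "0 \<le> T" "T \<le> t" using stop_le[OF t order_refl, of \<tau> w] T by (auto simp: stop_def)
  let ?c = "\<lambda>s. 1 / left_limit (\<lambda>u. Z u w) s"
  have n: "AE s in path_measure (\<lambda>u. A u w). s \<in> {0<..T} \<longrightarrow> 0 \<le> ?c s" using Zpos by (intro AE_I2) (auto intro: less_imp_le)
  have cf': "set_integrable (path_measure (\<lambda>u. A u w)) {0<..T} (\<lambda>s. ?c s * f s)" using cf by simp
  note st = stopped_integral[OF sets_path_measure c n T0 f cf']
  let ?v1 = "\<lambda>s. if s < 0 then 0 else occurrence \<tau> s w"
  let ?v2 = "\<lambda>s. LINT r:{0<..min s T}|path_measure (\<lambda>u. A u w). ?c r"
  have rc1: "rcmono ?v1" by (rule rcmono_path[OF occurrence_path])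
  have e1: "interval_measure ?v1 = path_measure (\<lambda>s. occurrence \<tau> s w)" by (simp add: path_measure_def)
  show ?thesis
  proof (rule has_stieltjes_integralI[OF rc1 st(1)])
    show "M_tau \<tau> Z A s w = ?v1 s - ?v2 s" if "s \<in> {0..t}" for s
      using that stop_le[of s t \<tau> w] T by (simp add: M_tau_def)
    show "set_integrable (interval_measure ?v1) {0<..t} f" unfolding e1 by (rule occurrence_set_integral(1)[where \<tau> = \<tau> and w = w, OF f pos t])
    show "set_integrable (interval_measure ?v2) {0<..t} f" by (rule st(2))
    show "(if \<tau> w \<le> ennreal t then f (enn2real (\<tau> w)) else 0) - (LINT s:{0<..T}|path_measure (\<lambda>u. A u w). f s / left_limit (\<lambda>u. Z u w) s) =
      (LINT s:{0<..t}|interval_measure ?v1. f s) - (LINT s:{0<..t}|interval_measure ?v2. f s)"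
      unfolding e1 occurrence_set_integral(2)[where \<tau> = \<tau> and w = w, OF f pos t] st(3) by simp
  qed
qed

text \<open>\<open>M_hat\<close> is stopped N minus the integral of lam (1 + \<gamma> / Zm) dt. With
  \<gamma> = \<phi> this density equals lam (Zm + \<phi>) / Zm; it is nonnegative, so both parts are
  monotone, and it cancels the denominator of K. At a zero of Zm + \<phi> both sides of the
  cancellation are 0, since g vanishes there.\<close>

lemma M_hat_integral:
  fixes K g \<phi> Zm :: "real \<Rightarrow> real" and \<gamma> :: "real \<Rightarrow> 'a \<Rightarrow> real"
  assumes P: "increasing_path (\<lambda>s. real (N s w))" and P0: "N 0 w = 0" and lam: "0 < lam"
    and t: "0 \<le> t" and T: "T = stop \<tau> t w" and Zm: "Zm = left_limit (\<lambda>u. Z u w)"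
    and Zpos: "\<And>s. s \<in> {0<..T} \<Longrightarrow> 0 < Zm s"
    and \<gamma>i: "set_integrable lborel {0<..T} (\<lambda>s. \<gamma> s w / Zm s)"
    and ae: "AE s in lborel. s \<in> {0<..T} \<longrightarrow> \<gamma> s w = \<phi> s \<and> 0 \<le> Zm s + \<phi> s \<and> (Zm s + \<phi> s = 0 \<longrightarrow> g s = 0)"
    and K: "(\<lambda>s. indicator {0<..t} s *\<^sub>R K s) \<in> borel_measurable borel" "\<And>s. s \<in> {0<..T} \<Longrightarrow> K s = g s / (Zm s + \<phi> s)"
    and i1: "set_integrable lborel {0<..T} (\<lambda>s. g s / Zm s)"
    and i2: "set_integrable (path_measure (\<lambda>s. real (N s w))) {0<..T} (\<lambda>s. g s / (Zm s + \<phi> s))"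
  shows "has_stieltjes_integral K (\<lambda>s. M_hat lam N \<tau> Z \<gamma> s w) t
    ((LINT s:{0<..T}|path_measure (\<lambda>s. real (N s w)). g s / (Zm s + \<phi> s)) - lam * (LINT s:{0<..T}|lborel. g s / Zm s))"
proof -
  have T0: "0 \<le> T" "T \<le> t" using stop_le[OF t order_refl, of \<tau> w] T by (auto simp: stop_def)
  let ?\<kappa> = "path_measure (\<lambda>s. real (N s w))"
  let ?d = "\<lambda>s. lam * (1 + \<gamma> s w / Zm s)"
  let ?v1 = "\<lambda>s. LINT r:{0<..min s T}|?\<kappa>. 1" and ?v2 = "\<lambda>s. LINT r:{0<..min s T}|lborel. ?d r"
  have one: "set_integrable ?\<kappa> {0<..T} (\<lambda>_. 1::real)"
    using emeasure_path_measure_Ioc[OF P order_refl T0(1)] by (simp add: set_integrable_def)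
  have one': "set_integrable lborel {0<..r} (\<lambda>_. 1::real)" for r :: real
    by (cases "0 \<le> r") (auto simp: set_integrable_def)
  have n1: "set_integrable ?\<kappa> {0<..T} (\<lambda>s. 1 * K s)"
    using i2 by (subst set_integrable_cong[OF refl refl, of _ _ "\<lambda>s. g s / (Zm s + \<phi> s)"]) (simp_all add: K(2))
  note s1 = stopped_integral[OF sets_path_measure one _ T0 K(1) n1]
  have d: "set_integrable lborel {0<..T} ?d" using one' \<gamma>i by (intro set_integrable_mult_right set_integral_add(1)) auto
  have eqK: "AE s in lborel. s \<in> {0<..T} \<longrightarrow> lam * (g s / Zm s) = ?d s * K s"
    using ae
  proof eventually_elim
    case (elim s)
    show ?case
    proof
      assume s: "s \<in> {0<..T}"
      have e: "1 + \<gamma> s w / Zm s = (Zm s + \<phi> s) / Zm s" using elim s Zpos[OF s] by (simp add: field_simps)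
      show "lam * (g s / Zm s) = ?d s * K s"
        unfolding K(2)[OF s] e using elim s Zpos[OF s] by (cases "Zm s + \<phi> s = 0") auto
    qed
  qed
  have dK: "(\<lambda>s. indicator {0<..T} s *\<^sub>R (?d s * K s)) \<in> borel_measurable lborel"
  proof -
    have "(\<lambda>s. (indicator {0<..T} s *\<^sub>R ?d s) * (indicator {0<..t} s *\<^sub>R K s)) \<in> borel_measurable lborel"
      using d K(1) by (intro borel_measurable_times) (auto simp: set_integrable_def)
    moreover have "(indicator {0<..T} s *\<^sub>R ?d s) * (indicator {0<..t} s *\<^sub>R K s) = indicator {0<..T} s *\<^sub>R (?d s * K s)" for s
      using T0 by (auto simp: indicator_def)
    ultimately show ?thesis by (simp only:)
  qed
  have i1': "set_integrable lborel {0<..T} (\<lambda>s. lam * (g s / Zm s))" using i1 by (intro set_integrable_mult_right)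
  note c2 = set_integral_cong_AE_on[OF i1' dK eqK]
  have d0: "AE s in lborel. s \<in> {0<..T} \<longrightarrow> 0 \<le> ?d s"
    using ae
  proof eventually_elim
    case (elim s)
    show ?case
    proof
      assume s: "s \<in> {0<..T}"
      have "1 + \<gamma> s w / Zm s = (Zm s + \<phi> s) / Zm s" using elim s Zpos[OF s] by (simp add: field_simps)
      moreover have "0 \<le> (Zm s + \<phi> s) / Zm s" using elim s Zpos[OF s] by (intro divide_nonneg_pos) auto
      ultimately have "0 \<le> 1 + \<gamma> s w / Zm s" by simp
      then show "0 \<le> ?d s" using lam by (intro mult_nonneg_nonneg) auto
    qed
  qed
  note s2 = stopped_integral[OF sets_lborel d d0 T0 K(1) c2(1)]
  have v1: "?v1 s = real (N (min s T) w)" if "0 \<le> s" for s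
    using emeasure_path_measure_Ioc[OF P order_refl, of "min s T"] that T0 P0
    by (simp add: set_lebesgue_integral_def measure_def)
  have v2: "?v2 s = lam * min s T + lam * (LINT r:{0<..min s T}|lborel. \<gamma> r w / Zm r)" if "0 \<le> s" for s
  proof -
    have "?v2 s = lam * (LINT r:{0<..min s T}|lborel. 1 + \<gamma> r w / Zm r)" by simp
    also have "(LINT r:{0<..min s T}|lborel. 1 + \<gamma> r w / Zm r) = (LINT r:{0<..min s T}|lborel. 1) + (LINT r:{0<..min s T}|lborel. \<gamma> r w / Zm r)"
      by (rule set_integral_add(2)[OF one' set_integrable_Ioc_subset[OF \<gamma>i]]) auto
    also have "(LINT r:{0<..min s T}|lborel. 1) = min s T"
      using that T0 by (simp add: set_lebesgue_integral_def)
    finally show ?thesis by (simp add: distrib_left)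
  qed
  have rc1: "rcmono ?v1" by (rule s1(1)) simp
  show ?thesis
  proof (rule has_stieltjes_integralI[OF rc1 s2(1)])
    show "M_hat lam N \<tau> Z \<gamma> s w = ?v1 s - ?v2 s" if "s \<in> {0..t}" for s
    proof -
      have st: "stop \<tau> s w = min s T" using stop_le[of s t \<tau> w] that T by simp
      have "0 \<le> s" using that by simp
      show ?thesis unfolding M_hat_def compensated_def st Zm[symmetric] v1[OF \<open>0 \<le> s\<close>] v2[OF \<open>0 \<le> s\<close>] by simp
    qed
    show "set_integrable (interval_measure ?v1) {0<..t} K" by (rule s1(2)) simp
    show "set_integrable (interval_measure ?v2) {0<..t} K" by (rule s2(2))
    have "(LINT s:{0<..t}|interval_measure ?v1. K s) = (LINT s:{0<..T}|?\<kappa>. 1 * K s)" by (rule s1(3)) simp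
    also have "\<dots> = (LINT s:{0<..T}|?\<kappa>. g s / (Zm s + \<phi> s))" by (intro set_lebesgue_integral_cong) (auto simp: K(2))
    finally have a: "(LINT s:{0<..t}|interval_measure ?v1. K s) = (LINT s:{0<..T}|?\<kappa>. g s / (Zm s + \<phi> s))" .
    have b: "(LINT s:{0<..t}|interval_measure ?v2. K s) = lam * (LINT s:{0<..T}|lborel. g s / Zm s)"
      unfolding s2(3) c2(2)[symmetric] by (rule set_integral_mult_right)
    show "(LINT s:{0<..T}|?\<kappa>. g s / (Zm s + \<phi> s)) - lam * (LINT s:{0<..T}|lborel. g s / Zm s) =
      (LINT s:{0<..t}|interval_measure ?v1. K s) - (LINT s:{0<..t}|interval_measure ?v2. K s)" unfolding a b ..
  qed
qed

lemma path_integral_one: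
  assumes A: "increasing_path A" and t: "0 \<le> t"
  shows "set_integrable (path_measure A) {0<..t} (\<lambda>_. 1::real)" "(LINT s:{0<..t}|path_measure A. (1::real)) = A t - A 0"
proof -
  have e: "emeasure (path_measure A) {0<..t} = ennreal (A t - A 0)" using emeasure_path_measure_Ioc[OF A order_refl t] .
  then show "set_integrable (path_measure A) {0<..t} (\<lambda>_. 1::real)" by (simp add: set_integrable_def)
  show "(LINT s:{0<..t}|path_measure A. (1::real)) = A t - A 0"
    using e increasing_path_mono[OF A order_refl t] by (simp add: set_lebesgue_integral_def measure_def)
qed

text \<open>At t = 0 the integral runs over the empty interval, so \<mu> 0 = c; the constants c and
  b are then absorbed into V 0.\<close>

lemma drift_pathI:
  assumes P: "increasing_path (\<lambda>t. real (P t))" and lam: "0 < lam"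
    and a: "\<And>t. 0 \<le> t \<Longrightarrow> set_integrable (path_measure A) {0<..t} a"
    and I: "\<And>t. 0 \<le> t \<Longrightarrow> has_stieltjes_integral \<phi> (\<lambda>s. real (P s) - lam * s) t (\<mu> t - c)"
    and V: "\<And>t. 0 \<le> t \<Longrightarrow> V t = \<mu> t - b - (LINT s:{0<..t}|path_measure A. a s)"
  shows "drift_path P lam A \<phi> a V"
  unfolding drift_path_def
proof (intro allI impI conjI)
  fix t :: real assume t: "0 \<le> t"
  note S = has_stieltjes_integral_compensated[OF P lam t I[OF t]]
  have S0: "\<mu> 0 = c" using has_stieltjes_integral_compensated(3)[OF P lam order_refl I[OF order_refl]]
    by (simp add: set_lebesgue_integral_def)
  show "set_integrable lborel {0<..t} \<phi>" "set_integrable (path_measure (\<lambda>t. real (P t))) {0<..t} \<phi>" by (rule S)+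
  show "set_integrable (path_measure A) {0<..t} a" by (rule a[OF t])
  have "V 0 = c - b" using V[of 0] S0 by (simp add: set_lebesgue_integral_def)
  then show "V t = V 0 + ((LINT s:{0<..t}|path_measure (\<lambda>t. real (P t)). \<phi> s) - lam * (LINT s:{0<..t}|lborel. \<phi> s))
       - (LINT s:{0<..t}|path_measure A. a s)" using V[OF t] S(3) by linarith
qed

lemma set_integrable_quotient:
  fixes g z :: "real \<Rightarrow> real"
  assumes \<kappa>: "sets \<kappa> = sets borel" and g: "set_integrable \<kappa> {0<..T} g"
    and z: "(\<lambda>s. indicator {0<..T} s * z s) \<in> borel_measurable borel" and \<epsilon>: "0 < \<epsilon>" "\<And>s. s \<in> {0<..T} \<Longrightarrow> \<epsilon> \<le> z s"
  shows "set_integrable \<kappa> {0<..T} (\<lambda>s. g s / z s)"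
  unfolding set_integrable_def
proof (rule Bochner_Integration.integrable_bound)
  show "integrable \<kappa> (\<lambda>s. (1 / \<epsilon>) * (indicator {0<..T} s *\<^sub>R g s))" using g unfolding set_integrable_def by (rule integrable_mult_right)
  have "(\<lambda>s. (indicator {0<..T} s *\<^sub>R g s) / (indicator {0<..T} s * z s)) \<in> borel_measurable \<kappa>"
    using g z \<kappa> by (intro borel_measurable_divide) (auto simp: set_integrable_def cong: measurable_cong_sets)
  moreover have "(indicator {0<..T} s *\<^sub>R g s) / (indicator {0<..T} s * z s) = indicator {0<..T} s *\<^sub>R (g s / z s)" for s
    by (auto simp: indicator_def)
  ultimately show "(\<lambda>s. indicator {0<..T} s *\<^sub>R (g s / z s)) \<in> borel_measurable \<kappa>" by (simp only:)
  show "AE s in \<kappa>. norm (indicator {0<..T} s *\<^sub>R (g s / z s)) \<le> norm ((1 / \<epsilon>) * (indicator {0<..T} s *\<^sub>R g s))"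
  proof (rule AE_I2)
    fix s
    show "norm (indicator {0<..T} s *\<^sub>R (g s / z s)) \<le> norm ((1 / \<epsilon>) * (indicator {0<..T} s *\<^sub>R g s))"
    proof (cases "s \<in> {0<..T}")
      case True
      have "\<bar>g s\<bar> / \<bar>z s\<bar> \<le> \<bar>g s\<bar> / \<epsilon>" using \<epsilon>(2)[OF True] \<epsilon>(1) by (intro divide_left_mono) auto
      then show ?thesis using True \<epsilon>(1) by (simp add: abs_divide)
    qed simp
  qed
qed

lemma occurrence_left_limit:
  assumes s: "0 < s" shows "left_limit (\<lambda>u. occurrence \<tau> u w) s = of_bool (\<tau> w < ennreal s)"
proof (rule left_limit_eqI)
  have "\<forall>\<^sub>F u in at_left s. occurrence \<tau> u w = of_bool (\<tau> w < ennreal s)"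
  proof (cases "\<tau> w < ennreal s")
    case True
    then obtain r where r: "\<tau> w = ennreal r" "0 \<le> r" by (cases "\<tau> w") auto
    then have "r < s" using True s by (simp add: ennreal_less_iff)
    then show ?thesis using r True
      by (intro eventually_at_leftI[of r]) (auto simp: occurrence_def ennreal_leI)
  next
    case False
    have "\<not> \<tau> w \<le> ennreal u" if "0 < u" "u < s" for u
      using False that by (metis ennreal_less_iff leD leI le_less_trans less_imp_le)
    then show ?thesis using False s by (intro eventually_at_leftI[of 0]) (auto simp: occurrence_def)
  qed
  then show "((\<lambda>u. occurrence \<tau> u w) \<longlongrightarrow> of_bool (\<tau> w < ennreal s)) (at_left s)" by (rule tendsto_eventually)
qed

section \<open>The decomposition along a path\<close>

text \<open>\<open>pathwise_quotient\<close> is used on [0,T] with T = min \<tau> t. No integrator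
  has an atom at \<tau>, so Z and X are left-continuous there and the lower bound of Z extends to
  the closed interval. If \<tau> \<le> t, the jump of \<open>M_tau\<close> contributes h - Xm / Zm
  at \<tau>, which turns the quotient at \<tau> into the value of h there.\<close>

lemma quotient_decomposition:
  fixes \<tau> :: "'a \<Rightarrow> ennreal" and N :: "real \<Rightarrow> 'a \<Rightarrow> nat" and Z A X h \<phi> \<phi>h \<gamma> :: "real \<Rightarrow> 'a \<Rightarrow> real"
  defines "Zm \<equiv> \<lambda>w. left_limit (\<lambda>u. Z u w)" and "Xm \<equiv> \<lambda>w. left_limit (\<lambda>u. X u w)"
  assumes P: "increasing_path (\<lambda>s. real (N s w))" and P0: "N 0 w = 0" and lam: "0 < lam"
    and A: "increasing_path (\<lambda>s. A s w)"
    and atomless: "\<And>s. 0 \<le> s \<Longrightarrow> emeasure (path_measure (\<lambda>u. A u w)) {s} = 0"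
    and unit: "\<And>s. s \<in> jump_times (\<lambda>t. N t w) \<Longrightarrow> emeasure (path_measure (\<lambda>s. real (N s w))) {s} = 1"
    and dZ: "drift_path (\<lambda>t. N t w) lam (\<lambda>t. A t w) (\<lambda>s. \<phi> s w) (\<lambda>_. 1) (\<lambda>t. Z t w)"
    and dX: "drift_path (\<lambda>t. N t w) lam (\<lambda>t. A t w) (\<lambda>s. \<phi>h s w) (\<lambda>s. h s w) (\<lambda>t. X t w)"
    and pos: "0 < \<tau> w"
    and nojump: "\<And>s. 0 \<le> s \<Longrightarrow> \<tau> w = ennreal s \<Longrightarrow> emeasure (path_measure (\<lambda>s. real (N s w))) {s} = 0"
    and \<epsilon>: "0 < \<epsilon>" "\<And>s. 0 \<le> s \<Longrightarrow> ennreal s < \<tau> w \<Longrightarrow> \<epsilon> \<le> Z s w"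
    and ae: "AE s in lborel. 0 < s \<longrightarrow> \<gamma> s w = \<phi> s w \<and> 0 \<le> Zm w s + \<phi> s w \<and> \<bar>Xm w s + \<phi>h s w\<bar> \<le> C * (Zm w s + \<phi> s w)"
    and \<gamma>i: "\<And>t. 0 \<le> t \<Longrightarrow> set_integrable lborel {0<..t} (\<lambda>s. \<gamma> s w)"
    and meas: "(\<lambda>s. if 0 \<le> s then h s w else 0) \<in> borel_measurable borel"
      "(\<lambda>s. if 0 \<le> s then \<phi> s w else 0) \<in> borel_measurable borel" "(\<lambda>s. if 0 \<le> s then \<phi>h s w else 0) \<in> borel_measurable borel"
      "(\<lambda>s. if 0 \<le> s then if s = 0 then 0 else Zm w s else 0) \<in> borel_measurable borel"
      "(\<lambda>s. if 0 \<le> s then if s = 0 then 0 else Xm w s else 0) \<in> borel_measurable borel"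
    and t: "0 \<le> t"
  shows "\<exists>I J. has_stieltjes_integral (\<lambda>s. h s w - Xm w s / Zm w s) (\<lambda>s. M_tau \<tau> Z A s w) t I \<and>
    has_stieltjes_integral (\<lambda>s. (1 - left_limit (\<lambda>u. occurrence \<tau> u w) s) / (Zm w s + \<phi> s w) * (\<phi>h s w - \<phi> s w * (Xm w s / Zm w s)))
      (\<lambda>s. M_hat lam N \<tau> Z \<gamma> s w) t J \<and>
    (if \<tau> w \<le> ennreal t then h (enn2real (\<tau> w)) w else X t w / Z t w) = X 0 w / Z 0 w + I + J"
proof -
  let ?\<kappa> = "path_measure (\<lambda>s. real (N s w))" and ?\<alpha> = "path_measure (\<lambda>u. A u w)"
  define T where "T = stop \<tau> t w"
  define U where "U = (\<lambda>s. Xm w s / Zm w s)"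
  define g where "g = (\<lambda>s. \<phi>h s w - \<phi> s w * U s)"
  have T0: "0 \<le> T" by (simp add: T_def stop_def)
  have before: "ennreal s < \<tau> w" if "0 \<le> s" "s < T" for s
  proof -
    have "min (ennreal t) (\<tau> w) < top" by (rule le_less_trans[OF min.cobounded1 ennreal_less_top])
    then have "ennreal T = min (ennreal t) (\<tau> w)" unfolding T_def stop_def by (rule ennreal_enn2real)
    then have "ennreal T \<le> \<tau> w" by simp
    moreover have "ennreal s < ennreal T" using that by (simp add: ennreal_less_iff)
    ultimately show ?thesis by order
  qed
  have not_after: "\<not> \<tau> w < ennreal s" if "s \<in> {0<..T}" for s
  proof
    assume a: "\<tau> w < ennreal s"
    then obtain r where r: "\<tau> w = ennreal r" "0 \<le> r" by (cases "\<tau> w") auto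
    then have "r < s" using a that by (simp add: ennreal_less_iff)
    then show False using before[of r] r that by simp
  qed
  have cont_\<tau>: "((\<lambda>t. Z t w) \<longlongrightarrow> Z s w) (at_left s)" "((\<lambda>t. X t w) \<longlongrightarrow> X s w) (at_left s)" if s: "0 < s" "\<tau> w = ennreal s" for s
    using drift_left_limit[OF dZ P s(1) atomless] drift_left_limit[OF dX P s(1) atomless] nojump[OF _ s(2)] s(1)
    by (simp_all add: measure_def)
  have Z_\<epsilon>: "\<epsilon> \<le> Z s w" if s: "0 \<le> s" "s \<le> T" for s
  proof (cases "ennreal s < \<tau> w")
    case True then show ?thesis using \<epsilon>(2) s by blast
  next
    case False
    have s0: "0 < s" using False pos s by (cases "s = 0") auto
    then have "\<tau> w = ennreal s" using False not_after[of s] s by auto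
    from cont_\<tau>(1)[OF s0 this] show ?thesis
    proof (rule tendsto_lowerbound)
      show "\<forall>\<^sub>F r in at_left s. \<epsilon> \<le> Z r w"
        using s0 before s by (intro eventually_at_leftI[of 0]) (auto intro!: \<epsilon>(2))
    qed simp
  qed
  have left_limits: "left_limit (\<lambda>u. Z u w) = Zm w" "left_limit (\<lambda>u. X u w) = Xm w" by (simp_all add: Zm_def Xm_def)
  note Q = pathwise_quotient[where A = "\<lambda>u. A u w" and P = "\<lambda>t. N t w" and \<phi> = "\<lambda>s. \<phi> s w" and \<phi>h = "\<lambda>s. \<phi>h s w" and h = "\<lambda>s. h s w"
      and X = "\<lambda>t. X t w" and Z = "\<lambda>t. Z t w" and T = T and lam = lam and \<epsilon> = \<epsilon>,
      OF A P lam T0 dX dZ \<epsilon>(1) Z_\<epsilon> atomless unit,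
      unfolded left_limits]
  have Q1: "set_integrable ?\<alpha> {0<..T} (\<lambda>s. (h s w - U s) / Zm w s)" unfolding U_def by (rule Q(1)) assumption+
  have Q2: "set_integrable lborel {0<..T} (\<lambda>s. g s / Zm w s)" unfolding g_def U_def by (rule Q(2)) assumption+
  have Q3: "set_integrable ?\<kappa> {0<..T} (\<lambda>s. g s / (Zm w s + \<phi> s w))" unfolding g_def U_def by (rule Q(3)) assumption+
  have Q4: "X T w / Z T w = X 0 w / Z 0 w + (LINT s:{0<..T}|?\<kappa>. g s / (Zm w s + \<phi> s w))
      - lam * (LINT s:{0<..T}|lborel. g s / Zm w s) - (LINT s:{0<..T}|?\<alpha>. (h s w - U s) / Zm w s)"
    unfolding g_def U_def by (rule Q(4)) assumption+
  have Q5: "(\<lambda>s. indicator {0<..T} s * Zm w s) \<in> borel_measurable borel" by (rule Q(5)) assumption+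
  have Zm\<epsilon>: "\<epsilon> \<le> Zm w s" if "s \<in> {0<..T}" for s by (rule Q(6)) (assumption | rule that)+
  have Zpos: "0 < Zm w s" if "s \<in> {0<..T}" for s using Zm\<epsilon>[OF that] \<epsilon>(1) by simp
  \<comment> \<open>Borel functions on the whole line that agree with the paths on (0,t]; the zeros
    outside are those produced by extending predictable processes.\<close>
  define h' \<phi>' \<phi>h' z' x' where "h' = (\<lambda>s. if 0 \<le> s then h s w else 0)" and "\<phi>' = (\<lambda>s. if 0 \<le> s then \<phi> s w else 0)"
    and "\<phi>h' = (\<lambda>s. if 0 \<le> s then \<phi>h s w else 0)" and "z' = (\<lambda>s. if 0 \<le> s then if s = 0 then 0 else Zm w s else 0)"
    and "x' = (\<lambda>s. if 0 \<le> s then if s = 0 then 0 else Xm w s else 0)"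
  have [measurable]: "h' \<in> borel_measurable borel" "\<phi>' \<in> borel_measurable borel" "\<phi>h' \<in> borel_measurable borel"
    "z' \<in> borel_measurable borel" "x' \<in> borel_measurable borel"
    unfolding h'_def \<phi>'_def \<phi>h'_def z'_def x'_def by (rule meas)+
  have eq': "h' s = h s w" "\<phi>' s = \<phi> s w" "\<phi>h' s = \<phi>h s w" "z' s = Zm w s" "x' s = Xm w s" if "s \<in> {0<..t}" for s
    using that by (auto simp: h'_def \<phi>'_def \<phi>h'_def z'_def x'_def)
  have fI: "(\<lambda>s. indicator {0<..t} s *\<^sub>R (h s w - U s)) \<in> borel_measurable borel"
  proof -
    have "(\<lambda>s. indicator {0<..t} s *\<^sub>R (h' s - x' s / z' s)) \<in> borel_measurable borel" by measurable
    moreover have "indicator {0<..t} s *\<^sub>R (h' s - x' s / z' s) = indicator {0<..t} s *\<^sub>R (h s w - U s)" for s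
      using eq'[of s] by (cases "s \<in> {0<..t}") (simp_all add: U_def)
    ultimately show ?thesis by (simp only:)
  qed
  let ?K = "\<lambda>s. (1 - left_limit (\<lambda>u. occurrence \<tau> u w) s) / (Zm w s + \<phi> s w) * g s"
  have fK: "(\<lambda>s. indicator {0<..t} s *\<^sub>R ?K s) \<in> borel_measurable borel"
  proof -
    have "(\<lambda>s. indicator {0<..t} s *\<^sub>R ((1 - of_bool (\<tau> w < ennreal s)) / (z' s + \<phi>' s) * (\<phi>h' s - \<phi>' s * (x' s / z' s)))) \<in> borel_measurable borel"
      by measurable
    moreover have "indicator {0<..t} s *\<^sub>R ((1 - of_bool (\<tau> w < ennreal s)) / (z' s + \<phi>' s) * (\<phi>h' s - \<phi>' s * (x' s / z' s))) = indicator {0<..t} s *\<^sub>R ?K s" for s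
      using eq'[of s] occurrence_left_limit[of s \<tau> w] by (cases "s \<in> {0<..t}") (simp_all add: U_def g_def)
    ultimately show ?thesis by (simp only:)
  qed
  have K: "?K s = g s / (Zm w s + \<phi> s w)" if "s \<in> {0<..T}" for s
    using occurrence_left_limit[of s \<tau> w] not_after[OF that] that by simp
  have c: "set_integrable ?\<alpha> {0<..T} (\<lambda>s. 1 / Zm w s)"
    using path_integral_one(1)[OF A T0] Q5 \<epsilon>(1) Zm\<epsilon> by (rule set_integrable_quotient[OF sets_path_measure])
  have \<gamma>q: "set_integrable lborel {0<..T} (\<lambda>s. \<gamma> s w / Zm w s)"
    using \<gamma>i[OF T0] Q5 \<epsilon>(1) Zm\<epsilon> by (rule set_integrable_quotient[OF sets_lborel])
  have ae': "AE s in lborel. s \<in> {0<..T} \<longrightarrow> \<gamma> s w = \<phi> s w \<and> 0 \<le> Zm w s + \<phi> s w \<and> (Zm w s + \<phi> s w = 0 \<longrightarrow> g s = 0)"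
    using ae
  proof eventually_elim
    case (elim s)
    show ?case
    proof
      assume s: "s \<in> {0<..T}"
      \<comment> \<open>At a zero of Zm + \<phi> the bound C (Zm + \<phi>) forces \<phi>h = - Xm,
        and \<phi> = - Zm; hence \<phi>h = \<phi> Xm / Zm.\<close>
      have "g s = 0" if z: "Zm w s + \<phi> s w = 0"
      proof -
        have "Xm w s + \<phi>h s w = 0" "\<phi> s w = - Zm w s" using elim s z by auto
        then show ?thesis using Zpos[OF s] by (simp add: g_def U_def)
      qed
      then show "\<gamma> s w = \<phi> s w \<and> 0 \<le> Zm w s + \<phi> s w \<and> (Zm w s + \<phi> s w = 0 \<longrightarrow> g s = 0)" using elim s by auto
    qed
  qed
  let ?I = "(if \<tau> w \<le> ennreal t then h (enn2real (\<tau> w)) w - U (enn2real (\<tau> w)) else 0) - (LINT s:{0<..T}|?\<alpha>. (h s w - U s) / Zm w s)"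
  let ?J = "(LINT s:{0<..T}|?\<kappa>. g s / (Zm w s + \<phi> s w)) - lam * (LINT s:{0<..T}|lborel. g s / Zm w s)"
  have I: "has_stieltjes_integral (\<lambda>s. h s w - U s) (\<lambda>s. M_tau \<tau> Z A s w) t ?I"
    using Zpos c fI Q1 unfolding Zm_def by (rule M_tau_integral[where \<tau> = \<tau> and w = w, OF pos t T_def])
  have J: "has_stieltjes_integral ?K (\<lambda>s. M_hat lam N \<tau> Z \<gamma> s w) t ?J"
    by (rule M_hat_integral[where N = N and w = w and Zm = "Zm w" and \<gamma> = \<gamma> and \<phi> = "\<lambda>s. \<phi> s w" and g = g,
        OF P P0 lam t T_def _ Zpos \<gamma>q ae' fK K Q2 Q3]) (simp_all add: Zm_def)
  have "(if \<tau> w \<le> ennreal t then h (enn2real (\<tau> w)) w else X t w / Z t w) = X 0 w / Z 0 w + ?I + ?J"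
  proof (cases "\<tau> w \<le> ennreal t")
    case True
    then obtain r where r: "\<tau> w = ennreal r" "0 < r" using pos by (cases "\<tau> w") (auto simp: top_unique)
    have "T = r" using True r by (simp add: T_def stop_def min_absorb2)
    moreover have "Zm w r = Z r w" "Xm w r = X r w"
      using cont_\<tau>[OF r(2,1)] unfolding Zm_def Xm_def by (auto intro: left_limit_eqI)
    ultimately show ?thesis using Q4 True r by (simp add: U_def)
  next
    case False
    then have "T = t" using t by (simp add: T_def stop_def min_absorb1)
    then show ?thesis using Q4 False by simp
  qed
  then show ?thesis using I J unfolding g_def U_def by blast
qed

section \<open>Identification of the integrands\<close>

lemma compatible_sets:
  fixes f g z x k :: "'b \<Rightarrow> real"
  assumes [measurable]: "g \<in> borel_measurable S" "f \<in> borel_measurable S" "z \<in> borel_measurable S"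
    "x \<in> borel_measurable S" "k \<in> borel_measurable S"
  shows "{p \<in> space S. \<not> (g p = f p \<and> 0 \<le> z p + f p \<and> \<bar>x p + k p\<bar> \<le> C * (z p + f p))} \<in> sets S"
  by measurable

text \<open>The hypotheses of the theorem with one fixed bound C for h, the constant in the
  comparison |X| \<le> C Z.\<close>

locale poisson_random_time = poisson_setting M lam N for M :: "'a measure" and lam N +
  fixes \<tau> :: "'a \<Rightarrow> ennreal" and Z Ap Ao \<mu> m h X \<mu>h \<phi> \<phi>h \<gamma> :: "real \<Rightarrow> 'a \<Rightarrow> real" and C :: real
  assumes \<tau>M: "\<tau> \<in> borel_measurable M" and avoid: "avoids_stopping_times M PF \<tau>"
    and Z: "cadlag_cond_exp M PF (\<lambda>t w. of_bool (\<tau> w > ennreal t)) Z"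
    and Ap: "dual_predictable_projection M PF (occurrence \<tau>) Ap"
    and Ao: "dual_optional_projection M PF (occurrence \<tau>) Ao"
    and \<mu>: "cadlag_cond_exp M PF (\<lambda>_ w. at_infinity_value Ap w + of_bool (\<tau> w = \<infinity>)) \<mu>"
    and m: "cadlag_cond_exp M PF (\<lambda>_ w. at_infinity_value Ao w + of_bool (\<tau> w = \<infinity>)) m"
    and h: "predictable M PF h" and hC: "\<And>t w. 0 \<le> t \<Longrightarrow> w \<in> space M \<Longrightarrow> \<bar>h t w\<bar> \<le> C"
    and hlim: "\<And>w. w \<in> space M \<Longrightarrow> \<exists>l. ((\<lambda>t. h t w) \<longlongrightarrow> l) at_top"
    and X: "cadlag_cond_exp M PF (\<lambda>t w. (LINT s:{t<..}|path_measure (\<lambda>u. Ap u w). h s w) + at_infinity_value h w * at_infinity_value Z w) X"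
    and \<mu>h: "cadlag_cond_exp M PF (\<lambda>_ w. (LINT s:{0<..}|path_measure (\<lambda>u. Ap u w). h s w) + at_infinity_value h w * at_infinity_value Z w) \<mu>h"
    and \<phi>: "predictable M PF \<phi>"
    and \<phi>I: "AE w in M. \<forall>t\<ge>0. has_stieltjes_integral (\<lambda>s. \<phi> s w) (\<lambda>s. compensated lam N s w) t (\<mu> t w - 1)"
    and \<phi>h: "predictable M PF \<phi>h"
    and \<phi>hI: "AE w in M. \<forall>t\<ge>0. has_stieltjes_integral (\<lambda>s. \<phi>h s w) (\<lambda>s. compensated lam N s w) t (\<mu>h t w - \<mu>h 0 w)"
    and \<gamma>: "predictable M PF \<gamma>"
    and \<gamma>I: "AE w in M. \<forall>t\<ge>0. has_stieltjes_integral (\<lambda>s. \<gamma> s w) (\<lambda>s. compensated lam N s w) t (m t w - 1)"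
begin

sublocale RT: random_time M PF \<tau>
  by unfold_locales (rule \<tau>M, rule avoid)

lemma rZ: "RT.rep (\<lambda>_. 1) Z"
  unfolding RT.rep_def using Z by simp

lemma rX: "RT.rep (at_random_time \<tau> h) X"
  by (rule RT.X_rep[where C = C, OF rZ Ap h _ _ X]) (use hC hlim in auto)

lemma h_\<tau>: "at_random_time \<tau> h \<in> borel_measurable CM" "w \<in> space M \<Longrightarrow> \<bar>at_random_time \<tau> h w\<bar> \<le> C"
  by (rule RT.h_at_\<tau>_measurable[where C = C, OF rZ Ap h], use hC hlim in auto)
     (rule RT.h_at_\<tau>_bound[where C = C, OF rZ Ap h], use hC hlim in auto)

text \<open>Applied with the predictable projection and \<phi>, and again with the optional
  projection and \<gamma>. Comparing the jumps in these two descriptions of the same path identifies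
  \<phi> with \<gamma>.\<close>

lemma Z_drift:
  assumes S: "FS.good S" and B: "dual_projection M S (occurrence \<tau>) B"
    and \<nu>: "cadlag_cond_exp M PF (\<lambda>_ w. at_infinity_value B w + of_bool (\<tau> w = \<infinity>)) \<nu>"
    and I: "AE w in M. \<forall>t\<ge>0. has_stieltjes_integral (\<lambda>s. \<psi> s w) (\<lambda>s. compensated lam N s w) t (\<nu> t w - 1)"
  shows "AE w in CM. drift_path (\<lambda>t. N t w) lam (\<lambda>t. B t w) (\<lambda>s. \<psi> s w) (\<lambda>_. 1) (\<lambda>t. Z t w)"
proof -
  have "AE w in CM. \<forall>t\<ge>0. has_stieltjes_integral (\<lambda>s. \<psi> s w) (\<lambda>s. compensated lam N s w) t (\<nu> t w - 1)"
    using I by (rule AE_completion)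
  then show ?thesis using RT.doob_meyer[OF S B rZ \<nu>] AE_space[where M = CM]
  proof eventually_elim
    case (elim w)
    then have w: "w \<in> space M" by simp
    have path: "increasing_path (\<lambda>t. B t w)" by (rule RT.dualD(1)[OF S B w])
    note one = path_integral_one[OF path]
    show ?case
    proof (rule drift_pathI[OF N_path[OF w] lam one(1)])
      show "has_stieltjes_integral (\<lambda>s. \<psi> s w) (\<lambda>s. real (N s w) - lam * s) t (\<nu> t w - 1)" if "0 \<le> t" for t
        using elim(1) that unfolding compensated_def by blast
      show "Z t w = \<nu> t w - B 0 w - (LINT s:{0<..t}|path_measure (\<lambda>t. B t w). 1)" if "0 \<le> t" for t
        unfolding one(2)[OF that] using elim(2) that by simp
    qed
  qed
qed

lemma X_drift: "AE w in CM. drift_path (\<lambda>t. N t w) lam (\<lambda>t. Ap t w) (\<lambda>s. \<phi>h s w) (\<lambda>s. h s w) (\<lambda>t. X t w)"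
proof -
  have 1: "AE w in CM. \<forall>t\<ge>0. X t w = \<mu>h t w - (LINT s:{0<..t}|path_measure (\<lambda>u. Ap u w). h s w)"
    by (rule RT.X_drift[where C = C, OF rZ Ap h _ _ X \<mu>h]) (use hC hlim in auto)
  have 2: "AE w in CM. set_integrable (path_measure (\<lambda>t. Ap t w)) {0..} (\<lambda>s. h s w)"
    by (rule RT.h_integrable_paths[where C = C, OF rZ Ap h]) (use hC hlim in auto)
  have 3: "AE w in CM. \<forall>t\<ge>0. has_stieltjes_integral (\<lambda>s. \<phi>h s w) (\<lambda>s. compensated lam N s w) t (\<mu>h t w - \<mu>h 0 w)"
    using \<phi>hI by (rule AE_completion)
  show ?thesis using 1 2 3 AE_space[where M = CM]
  proof eventually_elim
    case (elim w)
    then have w: "w \<in> space M" by simp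
    show ?case
    proof (rule drift_pathI[OF N_path[OF w] lam, where b = 0])
      show "set_integrable (path_measure (\<lambda>t. Ap t w)) {0<..t} (\<lambda>s. h s w)" if "0 \<le> t" for t
        by (rule set_integrable_subset[OF elim(2)]) auto
      show "has_stieltjes_integral (\<lambda>s. \<phi>h s w) (\<lambda>s. real (N s w) - lam * s) t (\<mu>h t w - \<mu>h 0 w)" if "0 \<le> t" for t
        using elim(3) that unfolding compensated_def by blast
      show "X t w = \<mu>h t w - 0 - (LINT s:{0<..t}|path_measure (\<lambda>t. Ap t w). h s w)" if "0 \<le> t" for t
        using elim(1) that by simp
    qed
  qed
qed

lemma right_continuous_paths: "w \<in> space M \<Longrightarrow> 0 \<le> t \<Longrightarrow> continuous (at_right t) (\<lambda>t. Z t w)"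
  "w \<in> space M \<Longrightarrow> 0 \<le> t \<Longrightarrow> continuous (at_right t) (\<lambda>t. X t w)"
  using RT.repD(2)[OF rZ] RT.repD(2)[OF rX] by (simp_all add: cadlag_def)

text \<open>The inequalities are written as equations of the form max(u, 0) = 0, so that
  \<open>AE_right_continuous_eq\<close> transfers them from fixed times to all times.\<close>

lemma X_bound: "AE w in CM. \<forall>t\<ge>0. 0 \<le> Z t w \<and> \<bar>X t w\<bar> \<le> C * Z t w"
proof -
  have le: "AE w in CM. \<bar>X t w\<bar> \<le> C * Z t w" if "0 \<le> t" for t
    by (rule RT.rep_AE_le[OF rX h_\<tau>(1) _ rZ that]) (rule h_\<tau>(2))
  have "AE w in CM. \<forall>t\<ge>0. max (\<bar>X t w\<bar> - C * Z t w) 0 = 0"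
  proof (rule AE_right_continuous_eq)
    show "AE w in CM. max (\<bar>X t w\<bar> - C * Z t w) 0 = 0" if "0 \<le> t" for t using le[OF that] by eventually_elim auto
    show "AE w in CM. \<forall>t\<ge>0. continuous (at_right t) (\<lambda>t. max (\<bar>X t w\<bar> - C * Z t w) 0)"
      using right_continuous_paths by (intro AE_I2) (auto intro!: continuous_intros)
  qed auto
  moreover have "AE w in CM. \<forall>t\<ge>0. max (- Z t w) 0 = 0"
  proof (rule AE_right_continuous_eq)
    show "AE w in CM. max (- Z t w) 0 = 0" if "0 \<le> t" for t using RT.rep_Z_bounds[OF rZ that] by eventually_elim auto
    show "AE w in CM. \<forall>t\<ge>0. continuous (at_right t) (\<lambda>t. max (- Z t w) 0)"
      using right_continuous_paths by (intro AE_I2) (auto intro!: continuous_intros)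
  qed auto
  ultimately show ?thesis by eventually_elim (force simp: max_def split: if_splits)
qed

text \<open>Here z and x stand for the left limits of Z and X. The two inequalities are what makes
  the compensator density nonnegative and the numerator vanish together with the
  denominator.\<close>

definition compatible :: "real \<Rightarrow> real \<Rightarrow> real \<Rightarrow> 'a \<Rightarrow> bool" where
  "compatible z x s w \<longleftrightarrow> \<gamma> s w = \<phi> s w \<and> 0 \<le> z + \<phi> s w \<and> \<bar>x + \<phi>h s w\<bar> \<le> C * (z + \<phi> s w)"

text \<open>At a jump time \<open>s\<close> of \<open>N\<close> both \<open>\<phi>\<close> and \<open>\<gamma>\<close> equal the jump of \<open>Z\<close>, and \<open>Z\<^sub>- + \<phi>\<close> and \<open>X\<^sub>- + \<phi>h\<close>
  are the values of \<open>Z\<close> and \<open>X\<close>, since the dual projections have no atoms.\<close>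

lemma compatible_at_jumps:
  "AE w in CM. \<forall>s\<in>jump_times (\<lambda>t. N t w). compatible (left_limit (\<lambda>u. Z u w) s) (left_limit (\<lambda>u. X u w) s) s w"
  using Z_drift[OF FS.good_PA Ap \<mu> \<phi>I] Z_drift[OF FS.good_OA Ao m \<gamma>I] X_drift X_bound unit_jumps
    RT.dual_atomless[OF FS.good_PA Ap] RT.dual_atomless[OF FS.good_OA Ao] AE_space[where M = CM]
proof eventually_elim
  case (elim w)
  then have w: "w \<in> space M" by simp
  show ?case
  proof
    fix s assume s: "s \<in> jump_times (\<lambda>t. N t w)"
    then have s0: "0 < s" by (simp add: jump_times_def)
    then have s0': "0 \<le> s" by simp
    have one: "measure (path_measure (\<lambda>t. real (N t w))) {s} = 1" using elim(5) s by (simp add: measure_def)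
    have a: "emeasure (path_measure (\<lambda>t. Ap t w)) {s} = 0" using elim(6) s0' by blast
    have b: "emeasure (path_measure (\<lambda>t. Ao t w)) {s} = 0" using elim(7) s0' by blast
    note l = drift_left_limit[OF elim(1) N_path[OF w] s0 a, unfolded one mult_1_right]
      drift_left_limit[OF elim(2) N_path[OF w] s0 b, unfolded one mult_1_right]
      drift_left_limit[OF elim(3) N_path[OF w] s0 a, unfolded one mult_1_right]
    have "Z s w - \<phi> s w = Z s w - \<gamma> s w" by (rule tendsto_unique[OF _ l(1,2)]) simp
    moreover have "left_limit (\<lambda>u. Z u w) s = Z s w - \<phi> s w" by (rule left_limit_eqI[OF l(1)])
    moreover have "left_limit (\<lambda>u. X u w) s = X s w - \<phi>h s w" by (rule left_limit_eqI[OF l(3)])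
    ultimately show "compatible (left_limit (\<lambda>u. Z u w) s) (left_limit (\<lambda>u. X u w) s) s w"
      using elim(4) s0' unfolding compatible_def by simp
  qed
qed

lemma left_limit_PA: "(\<lambda>(t, w). if t = 0 then 0 else left_limit (\<lambda>u. Z u w) t) \<in> borel_measurable FS.PA"
  "(\<lambda>(t, w). if t = 0 then 0 else left_limit (\<lambda>u. X u w) t) \<in> borel_measurable FS.PA"
  by (rule FS.left_limit_predictable[OF RT.repD(1)[OF rZ] RT.repD(2)[OF rZ]], assumption)
     (rule FS.left_limit_predictable[OF RT.repD(1)[OF rX] RT.repD(2)[OF rX]], assumption)

text \<open>Left limits and integrands are predictable, so the set where the relations fail is
  predictable and misses the jump times; \<open>off_jumps_null\<close> applies.\<close>

lemma compatible_AE: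
  "AE w in CM. AE s in lborel. 0 < s \<longrightarrow> compatible (left_limit (\<lambda>u. Z u w) s) (left_limit (\<lambda>u. X u w) s) s w"
proof -
  let ?z = "\<lambda>(t, w). if t = 0 then 0 else left_limit (\<lambda>u. Z u w) t" and ?x = "\<lambda>(t, w). if t = 0 then 0 else left_limit (\<lambda>u. X u w) t"
  let ?\<phi> = "\<lambda>(t, w). \<phi> t w" and ?\<phi>h = "\<lambda>(t, w). \<phi>h t w" and ?\<gamma> = "\<lambda>(t, w). \<gamma> t w"
  have "?z \<in> borel_measurable FS.PA" "?x \<in> borel_measurable FS.PA"
    "?\<phi> \<in> borel_measurable FS.PA" "?\<phi>h \<in> borel_measurable FS.PA" "?\<gamma> \<in> borel_measurable FS.PA"
    by (rule left_limit_PA \<phi>[unfolded predictable_def] \<phi>h[unfolded predictable_def] \<gamma>[unfolded predictable_def])+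
  define E where "E = {p \<in> space FS.PA. \<not> (?\<gamma> p = ?\<phi> p \<and> 0 \<le> ?z p + ?\<phi> p \<and> \<bar>?x p + ?\<phi>h p\<bar> \<le> C * (?z p + ?\<phi> p))}"
  have E: "E \<in> sets FS.PA" unfolding E_def by (rule compatible_sets) fact+
  have mem: "(s, w) \<notin> E \<longleftrightarrow> compatible (left_limit (\<lambda>u. Z u w) s) (left_limit (\<lambda>u. X u w) s) s w"
    if "0 < s" "w \<in> space M" for s w
    using that by (auto simp: E_def compatible_def)
  have "AE w in CM. \<forall>s\<in>jump_times (\<lambda>t. N t w). (s, w) \<notin> E"
    using compatible_at_jumps AE_space[where M = CM]
  proof eventually_elim
    case (elim w)
    show ?case
    proof
      fix s assume s: "s \<in> jump_times (\<lambda>t. N t w)"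
      then have "0 < s" by (simp add: jump_times_def)
      then show "(s, w) \<notin> E" using mem[of s w] elim s by simp
    qed
  qed
  from off_jumps_null[OF E this] show ?thesis using AE_space[where M = CM]
  proof eventually_elim
    case (elim w)
    from elim(1) show ?case by eventually_elim (use mem elim(2) in auto)
  qed
qed

lemma sections:
  assumes w: "w \<in> space M" and f: "(\<lambda>(t, w). f t w) \<in> borel_measurable FS.PA"
  shows "(\<lambda>s. if 0 \<le> s then f s w else (0::real)) \<in> borel_measurable borel"
  using FS.good_section_borel[OF FS.good_PA f w, of 0] unfolding case_prod_conv .

lemma decomposition:
  assumes Y: "cadlag_cond_exp M (progressive_enlargement M PF \<tau>) (\<lambda>_. at_random_time \<tau> h) Y"
  shows "AE w in CM. \<forall>t\<ge>0. \<exists>I J.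
    has_stieltjes_integral (\<lambda>s. h s w - left_limit (\<lambda>u. X u w) s / left_limit (\<lambda>u. Z u w) s) (\<lambda>s. M_tau \<tau> Z Ap s w) t I \<and>
    has_stieltjes_integral (\<lambda>s. (1 - left_limit (\<lambda>u. occurrence \<tau> u w) s) / (left_limit (\<lambda>u. Z u w) s + \<phi> s w)
        * (\<phi>h s w - \<phi> s w * (left_limit (\<lambda>u. X u w) s / left_limit (\<lambda>u. Z u w) s))) (\<lambda>s. M_hat lam N \<tau> Z \<gamma> s w) t J \<and>
    Y t w = Y 0 w + I + J"
proof -
  have PA: "(\<lambda>(t, w). h t w) \<in> borel_measurable FS.PA" "(\<lambda>(t, w). \<phi> t w) \<in> borel_measurable FS.PA"
    "(\<lambda>(t, w). \<phi>h t w) \<in> borel_measurable FS.PA"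
    using h \<phi> \<phi>h by (simp_all add: predictable_def)
  have YW: "AE w in CM. \<forall>t\<ge>0. Y t w = RT.W Z X h t w"
    by (rule RT.enlargement_Y[where C = C, OF rZ rX h_\<tau>(1) _ PA(1) Y]) (rule h_\<tau>(2))
  have W: "RT.W Z X h t w = (if \<tau> w \<le> ennreal t then at_random_time \<tau> h w else X t w / Z t w)" for t w
    by (rule RT.W_def[where C = C, OF rZ rX h_\<tau>(1) _ PA(1)]) (rule h_\<tau>(2))
  have nojump: "AE w in CM. \<forall>s\<ge>0. \<tau> w = ennreal s \<longrightarrow> emeasure (path_measure (\<lambda>t. real (N t w))) {s} = 0"
    by (rule RT.avoids_atoms[OF N_adapted]) (rule N_path)
  show ?thesis
    using YW nojump Z_drift[OF FS.good_PA Ap \<mu> \<phi>I] Z_drift[OF FS.good_OA Ao m \<gamma>I] X_drift unit_jumps RT.dual_atomless[OF FS.good_PA Ap]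
      RT.Z_bounded_below[OF rZ] compatible_AE RT.\<tau>_pos AE_space[where M = CM]
  proof eventually_elim
    case (elim w)
    then have w: "w \<in> space M" by simp
    obtain \<epsilon> where \<epsilon>: "0 < \<epsilon>" "\<And>s. 0 \<le> s \<Longrightarrow> ennreal s < \<tau> w \<Longrightarrow> \<epsilon> \<le> Z s w" using elim(8) by blast
    show ?case
    proof (intro allI impI)
      fix t :: real assume t: "0 \<le> t"
      have Yt: "Y t w = (if \<tau> w \<le> ennreal t then h (enn2real (\<tau> w)) w else X t w / Z t w)"
        using elim(1) t by (auto simp: W at_random_time_def top_unique)
      \<comment> \<open>Almost surely 0 < \<tau>, so at time 0 the quotient X / Z is the relevant
        branch.\<close>
      have Y0: "Y 0 w = X 0 w / Z 0 w" using elim(1)[rule_format, of 0] elim(10) by (auto simp: W)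
      show "\<exists>I J. has_stieltjes_integral (\<lambda>s. h s w - left_limit (\<lambda>u. X u w) s / left_limit (\<lambda>u. Z u w) s) (\<lambda>s. M_tau \<tau> Z Ap s w) t I \<and>
        has_stieltjes_integral (\<lambda>s. (1 - left_limit (\<lambda>u. occurrence \<tau> u w) s) / (left_limit (\<lambda>u. Z u w) s + \<phi> s w)
            * (\<phi>h s w - \<phi> s w * (left_limit (\<lambda>u. X u w) s / left_limit (\<lambda>u. Z u w) s))) (\<lambda>s. M_hat lam N \<tau> Z \<gamma> s w) t J \<and>
        Y t w = Y 0 w + I + J"
        unfolding Yt Y0
      proof (rule quotient_decomposition[where \<tau> = \<tau> and w = w and C = C and \<epsilon> = \<epsilon> and N = N and lam = lam and A = Ap
            and Z = Z and X = X and h = h and \<phi> = \<phi> and \<phi>h = \<phi>h and \<gamma> = \<gamma>,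
            OF N_path[OF w] N_zero[OF w] lam RT.dualD(1)[OF FS.good_PA Ap w] _ _ elim(3) elim(5) elim(10) _ \<epsilon>(1) _ _ _
              sections[OF w PA(1)] sections[OF w PA(2)] sections[OF w PA(3)] sections[OF w left_limit_PA(1)] sections[OF w left_limit_PA(2)] t])
        show "emeasure (path_measure (\<lambda>u. Ap u w)) {s} = 0" if "0 \<le> s" for s using elim(7) that by blast
        show "emeasure (path_measure (\<lambda>s. real (N s w))) {s} = 1" if "s \<in> jump_times (\<lambda>t. N t w)" for s using elim(6) that by blast
        show "emeasure (path_measure (\<lambda>s. real (N s w))) {s} = 0" if "0 \<le> s" "\<tau> w = ennreal s" for s using elim(2) that by blast
        show "\<epsilon> \<le> Z s w" if "0 \<le> s" "ennreal s < \<tau> w" for s by (rule \<epsilon>(2)[OF that])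
        show "AE s in lborel. 0 < s \<longrightarrow> \<gamma> s w = \<phi> s w \<and> 0 \<le> left_limit (\<lambda>u. Z u w) s + \<phi> s w \<and>
          \<bar>left_limit (\<lambda>u. X u w) s + \<phi>h s w\<bar> \<le> C * (left_limit (\<lambda>u. Z u w) s + \<phi> s w)"
          using elim(9) unfolding compatible_def .
        show "set_integrable lborel {0<..t} (\<lambda>s. \<gamma> s w)" if "0 \<le> t" for t by (rule drift_pathD(1)[OF elim(4) that])
      qed
    qed
  qed
qed

end

theorem corollary3p3:
  fixes M :: "'a measure" and lam :: real and N :: "real \<Rightarrow> 'a \<Rightarrow> nat" and \<tau> :: "'a \<Rightarrow> ennreal"
    and F G :: "ennreal \<Rightarrow> 'a measure"
    and Z Ap Ao \<mu> m h Xh \<mu>h \<phi> \<phi>h \<gamma> Y :: "real \<Rightarrow> 'a \<Rightarrow> real"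
  defines "F \<equiv> completed_filtration M N"
    and "G \<equiv> progressive_enlargement M F \<tau>"
  assumes "prob_space M"
    and "lam > 0" and "poisson_process M lam N"
    and "\<tau> \<in> borel_measurable M" and "avoids_stopping_times M F \<tau>"
    and "cadlag_cond_exp M F (\<lambda>t \<omega>. of_bool (\<tau> \<omega> > ennreal t)) Z"
    and "dual_predictable_projection M F (occurrence \<tau>) Ap"
    and "dual_optional_projection M F (occurrence \<tau>) Ao"
    and "cadlag_cond_exp M F (\<lambda>_ \<omega>. at_infinity_value Ap \<omega> + of_bool (\<tau> \<omega> = \<infinity>)) \<mu>"
    and "cadlag_cond_exp M F (\<lambda>_ \<omega>. at_infinity_value Ao \<omega> + of_bool (\<tau> \<omega> = \<infinity>)) m"
    and "predictable M F h"
    and "\<exists>C. \<forall>t\<ge>0. \<forall>\<omega>\<in>space M. \<bar>h t \<omega>\<bar> \<le> C"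
    and "\<forall>\<omega>\<in>space M. \<exists>l. ((\<lambda>t. h t \<omega>) \<longlongrightarrow> l) at_top"
    and "cadlag_cond_exp M F
           (\<lambda>t \<omega>. (LINT s:{t<..}|path_measure (\<lambda>u. Ap u \<omega>). h s \<omega>)
                  + at_infinity_value h \<omega> * at_infinity_value Z \<omega>) Xh"
    and "cadlag_cond_exp M F
           (\<lambda>_ \<omega>. (LINT s:{0<..}|path_measure (\<lambda>u. Ap u \<omega>). h s \<omega>)
                  + at_infinity_value h \<omega> * at_infinity_value Z \<omega>) \<mu>h"
    and "predictable M F \<phi>"
    and "AE \<omega> in M. \<forall>t\<ge>0. has_stieltjes_integral (\<lambda>s. \<phi> s \<omega>) (\<lambda>s. compensated lam N s \<omega>) t
                            (\<mu> t \<omega> - 1)"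
    and "predictable M F \<phi>h"
    and "AE \<omega> in M. \<forall>t\<ge>0. has_stieltjes_integral (\<lambda>s. \<phi>h s \<omega>) (\<lambda>s. compensated lam N s \<omega>) t
                            (\<mu>h t \<omega> - \<mu>h 0 \<omega>)"
    and "predictable M F \<gamma>"
    and "AE \<omega> in M. \<forall>t\<ge>0. has_stieltjes_integral (\<lambda>s. \<gamma> s \<omega>) (\<lambda>s. compensated lam N s \<omega>) t
                            (m t \<omega> - 1)"
    and "cadlag_cond_exp M G (\<lambda>_. at_random_time \<tau> h) Y"
  shows "AE \<omega> in M. \<forall>t\<ge>0. \<exists>I J.
           has_stieltjes_integral
             (\<lambda>s. h s \<omega> - left_limit (\<lambda>u. Xh u \<omega>) s / left_limit (\<lambda>u. Z u \<omega>) s)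
             (\<lambda>s. M_tau \<tau> Z Ap s \<omega>) t I \<and>
           has_stieltjes_integral
             (\<lambda>s. (1 - left_limit (\<lambda>u. occurrence \<tau> u \<omega>) s) / (left_limit (\<lambda>u. Z u \<omega>) s + \<phi> s \<omega>)
                  * (\<phi>h s \<omega> - \<phi> s \<omega> * (left_limit (\<lambda>u. Xh u \<omega>) s / left_limit (\<lambda>u. Z u \<omega>) s)))
             (\<lambda>s. M_hat lam N \<tau> Z \<gamma> s \<omega>) t J \<and>
           Y t \<omega> = Y 0 \<omega> + I + J"
proof -
  obtain C where C: "\<And>t w. 0 \<le> t \<Longrightarrow> w \<in> space M \<Longrightarrow> \<bar>h t w\<bar> \<le> C" using assms(14) by blast
  interpret prob_space M by (rule assms(3))
  interpret poisson_random_time M lam N \<tau> Z Ap Ao \<mu> m h Xh \<mu>h \<phi> \<phi>h \<gamma> C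
    by unfold_locales (use assms C in \<open>simp_all add: F_def\<close>)
  show ?thesis
    using decomposition[of Y] assms(24) unfolding AE_completion_iff F_def G_def by blast
qed

end
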